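(* For any non-negative integer $g$, the category $\mathcal{G}_g^{\mathrm{op}}$ (the opposite of the category of graphs of genus $g$ with contractions) is quasi-Gröbner, and therefore the category $\mathrm{Rep}_k(\mathcal{G}_g^{\mathrm{op}})$ is locally Noetherian for any Noetherian commutative ring $k$.
   Context: Graphs. A graph is a finite CW complex of dimension at most 1; 0-cells are vertices, 1-cells are edges (loops and multiple edges are allowed). The genus of a non-empty connected graph is the rank of its first homology group; a "graph of genus $g$" is always non-empty and connected. A map of CW complexes between graphs is very cellular if it takes every vertex to a vertex and every edge to either a vertex or an edge. A graph morphism is an equivalence class of very cellular maps, two being equivalent if they are homotopic through very cellular maps. A smooshing is a surjective graph morphism with connected fibers; a contraction is a smooshing with contractible fibers (so a contraction amounts to collapsing a set of edges forming a forest, followed by a graph isomorphism). $\mathcal{G}_g$ is the category whose objects are graphs of genus $g$ and whose morphisms are contractions. Modules. For a category $\mathcal{C}$ and commutative ring $k$, $\mathrm{Rep}_k(\mathcal{C})$ is the category of functors from $\mathcal{C}$ to $k$-modules. $M\in \mathrm{Rep}_k(\mathcal{C})$ is finitely generated if there are finitely many objects $x_1,\dots,x_r$ and elements $v_i\in M(x_i)$ such that for every object $x$, $M(x)$ is spanned over $k$ by the images of the $v_i$ under the maps induced by all morphisms $x_i\to x$. $\mathrm{Rep}_k(\mathcal{C})$ is locally Noetherian if every submodule of a finitely generated module is finitely generated. Gröbner theory. Let $\mathcal{C}$ be essentially small and $x$ an object. $\mathcal{C}_x$ is the set of equivalence classes of morphisms out of $x$, where $f:x\to y$ is equivalent to $g:x\to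 y'$ if there is an isomorphism $h:y\to y'$ with $h\circ f=g$. It has the quasi-order $f\le g$ iff there is a morphism $h$ with $h\circ f=g$. An infinite sequence $f_0,f_1,\dots$ in $\mathcal{C}_x$ is bad if there is no pair $i<j$ with $f_i\le f_j$. (G2): for every $x$, $\mathcal{C}_x$ admits no bad sequences. (G1): for every $x$, $\mathcal{C}_x$ admits a linear order $\preceq$ such that if $f,g:x\to y$, $h:y\to z$ and $f\preceq g$, then $h\circ f\preceq h\circ g$. $\mathcal{C}$ is Gröbner if it satisfies (G1) and (G2) and has no endomorphisms other than identities. A functor $\Phi:\mathcal{C}'\to\mathcal{C}$ has property (F) if for every object $x$ of $\mathcal{C}$ there are finitely many objects $y_1,\dots,y_r$ of $\mathcal{C}'$ and morphisms $f_i:x\to\Phi(y_i)$ such that for any object $y$ of $\mathcal{C}'$ and any morphism $f:x\to\Phi(y)$ there are an index $i$ and a morphism $g:y_i\to y$ with $f=\Phi(g)\circ f_i$. $\mathcal{C}$ is quasi-Gröbner if there exist a Gröbner category $\mathcal{C}'$ and an essentially surjective functor $\Phi:\mathcal{C}'\to\mathcal{C}$ with property (F). *)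

theory Defs
  imports "HOL-Homology.Homology" "HOL-Algebra.Algebra"
begin

section \<open>Categories\<close>

record ('o, 'm) cat =
  Obj :: "'o set"
  Arr :: "'m set"
  Dom :: "'m \<Rightarrow> 'o"
  Cod :: "'m \<Rightarrow> 'o"
  Idn :: "'o \<Rightarrow> 'm"
  Cmp :: "'m \<Rightarrow> 'm \<Rightarrow> 'm"

text \<open>\<open>Cmp C g f\<close> is the composite \<open>g \<circ> f\<close>; it is only meaningful if \<open>Cod C f = Dom C g\<close>.\<close>

definition hom_set :: "('o, 'm) cat \<Rightarrow> 'o \<Rightarrow> 'o \<Rightarrow> 'm set" where
  "hom_set C x y = {f \<in> Arr C. Dom C f = x \<and> Cod C f = y}"

locale category =
  fixes C :: "('o, 'm) cat"
  assumes Dom_in: "f \<in> Arr C \<Longrightarrow> Dom C f \<in> Obj C"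
    and Cod_in: "f \<in> Arr C \<Longrightarrow> Cod C f \<in> Obj C"
    and Idn_in: "x \<in> Obj C \<Longrightarrow> Idn C x \<in> hom_set C x x"
    and Cmp_in: "\<lbrakk>f \<in> hom_set C x y; g \<in> hom_set C y z\<rbrakk> \<Longrightarrow> Cmp C g f \<in> hom_set C x z"
    and Cmp_assoc: "\<lbrakk>f \<in> hom_set C w x; g \<in> hom_set C x y; h \<in> hom_set C y z\<rbrakk>
      \<Longrightarrow> Cmp C h (Cmp C g f) = Cmp C (Cmp C h g) f"
    and Cmp_Idn_right: "f \<in> hom_set C x y \<Longrightarrow> Cmp C f (Idn C x) = f"
    and Cmp_Idn_left: "f \<in> hom_set C x y \<Longrightarrow> Cmp C (Idn C y) f = f"

definition op_cat :: "('o, 'm) cat \<Rightarrow> ('o, 'm) cat" where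
  "op_cat C = \<lparr>Obj = Obj C, Arr = Arr C, Dom = Cod C, Cod = Dom C, Idn = Idn C,
    Cmp = (\<lambda>g f. Cmp C f g)\<rparr>"

definition iso_set :: "('o, 'm) cat \<Rightarrow> 'o \<Rightarrow> 'o \<Rightarrow> 'm set" where
  "iso_set C x y = {f \<in> hom_set C x y. \<exists>g \<in> hom_set C y x.
    Cmp C g f = Idn C x \<and> Cmp C f g = Idn C y}"

definition is_functor ::
  "('o, 'm) cat \<Rightarrow> ('p, 'n) cat \<Rightarrow> ('o \<Rightarrow> 'p) \<Rightarrow> ('m \<Rightarrow> 'n) \<Rightarrow> bool" where
  "is_functor C D F0 F1 \<longleftrightarrow>
    (\<forall>x \<in> Obj C. F0 x \<in> Obj D) \<and>
    (\<forall>x \<in> Obj C. \<forall>y \<in> Obj C. \<forall>f \<in> hom_set C x y. F1 f \<in> hom_set D (F0 x) (F0 y)) \<and>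
    (\<forall>x \<in> Obj C. F1 (Idn C x) = Idn D (F0 x)) \<and>
    (\<forall>x \<in> Obj C. \<forall>y \<in> Obj C. \<forall>z \<in> Obj C. \<forall>f \<in> hom_set C x y. \<forall>g \<in> hom_set C y z.
      F1 (Cmp C g f) = Cmp D (F1 g) (F1 f))"

definition essentially_surjective ::
  "('o, 'm) cat \<Rightarrow> ('p, 'n) cat \<Rightarrow> ('o \<Rightarrow> 'p) \<Rightarrow> bool" where
  "essentially_surjective C D F0 \<longleftrightarrow> (\<forall>x \<in> Obj D. \<exists>y \<in> Obj C. iso_set D x (F0 y) \<noteq> {})"


section \<open>Groebner categories\<close>

definition coslice_equiv :: "('o, 'm) cat \<Rightarrow> 'o \<Rightarrow> ('m \<times> 'm) set" where
  "coslice_equiv C x = {(f, g). f \<in> Arr C \<and> g \<in> Arr C \<and> Dom C f = x \<and> Dom C g = x \<and>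
    (\<exists>h \<in> iso_set C (Cod C f) (Cod C g). Cmp C h f = g)}"

definition coslice :: "('o, 'm) cat \<Rightarrow> 'o \<Rightarrow> 'm set set" where
  "coslice C x = {f \<in> Arr C. Dom C f = x} // coslice_equiv C x"

definition coslice_class :: "('o, 'm) cat \<Rightarrow> 'o \<Rightarrow> 'm \<Rightarrow> 'm set" where
  "coslice_class C x f = coslice_equiv C x `` {f}"

definition coslice_le :: "('o, 'm) cat \<Rightarrow> 'm set \<Rightarrow> 'm set \<Rightarrow> bool" where
  "coslice_le C P Q \<longleftrightarrow> (\<exists>f \<in> P. \<exists>g \<in> Q. \<exists>h \<in> hom_set C (Cod C f) (Cod C g). Cmp C h f = g)"

definition G1 :: "('o, 'm) cat \<Rightarrow> bool" where
  "G1 C \<longleftrightarrow> (\<forall>x \<in> Obj C. \<exists>r. linear_order_on (coslice C x) r \<and>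
    (\<forall>y \<in> Obj C. \<forall>z \<in> Obj C. \<forall>f \<in> hom_set C x y. \<forall>g \<in> hom_set C x y. \<forall>h \<in> hom_set C y z.
      (coslice_class C x f, coslice_class C x g) \<in> r \<longrightarrow>
      (coslice_class C x (Cmp C h f), coslice_class C x (Cmp C h g)) \<in> r))"

definition G2 :: "('o, 'm) cat \<Rightarrow> bool" where
  "G2 C \<longleftrightarrow> (\<forall>x \<in> Obj C. \<not> (\<exists>s :: nat \<Rightarrow> 'm set. (\<forall>i. s i \<in> coslice C x) \<and>
    (\<forall>i j. i < j \<longrightarrow> \<not> coslice_le C (s i) (s j))))"

definition groebner :: "('o, 'm) cat \<Rightarrow> bool" where
  "groebner C \<longleftrightarrow> category C \<and> G1 C \<and> G2 C \<and>
    (\<forall>x \<in> Obj C. \<forall>f \<in> hom_set C x x. f = Idn C x)"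

definition property_F ::
  "('p, 'n) cat \<Rightarrow> ('o, 'm) cat \<Rightarrow> ('p \<Rightarrow> 'o) \<Rightarrow> ('n \<Rightarrow> 'm) \<Rightarrow> bool" where
  "property_F C' C F0 F1 \<longleftrightarrow> (\<forall>x \<in> Obj C. \<exists>S. finite S \<and>
    (\<forall>(y, f) \<in> S. y \<in> Obj C' \<and> f \<in> hom_set C x (F0 y)) \<and>
    (\<forall>y \<in> Obj C'. \<forall>f \<in> hom_set C x (F0 y).
      \<exists>(z, e) \<in> S. \<exists>g \<in> hom_set C' z y. f = Cmp C (F1 g) e))"

text \<open>
  HOL has no existential quantification over types, so the objects and arrows of the Groebner
  category \<open>C'\<close> are taken from fixed types built from the type of objects of \<open>C\<close>. These
  are always large enough. Hom sets in a Groebner category are finite: by the absence of nontrivial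
  endomorphisms, distinct \<open>f, g : x \<rightarrow> y\<close> are incomparable in the coslice under \<open>x\<close>, which has
  no bad sequences. Moreover, (F) and essential surjectivity survive restriction to a full
  subcategory containing, for each object \<open>x\<close> of \<open>C\<close>, the finitely many objects chosen for
  \<open>x\<close> in (F) and one object whose image is isomorphic to \<open>x\<close>; a full subcategory of a
  Groebner category is again Groebner. So \<open>'o \<times> nat\<close> suffices for objects, and arrows may be
  named by their source, their target and a natural number.
\<close>

definition quasi_groebner :: "('o, 'm) cat \<Rightarrow> bool" where
  "quasi_groebner C \<longleftrightarrow> category C \<and>
    (\<exists>(C' :: ('o \<times> nat, ('o \<times> nat) \<times> ('o \<times> nat) \<times> nat) cat) F0 F1.
      groebner C' \<and> is_functor C' C F0 F1 \<and> essentially_surjective C' C F0 \<and>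
      property_F C' C F0 F1)"


section \<open>Representations of categories\<close>

record ('o, 'm, 'a, 'b) rep =
  Val :: "'o \<Rightarrow> ('a, 'b) module"
  Act :: "'m \<Rightarrow> 'b \<Rightarrow> 'b"

definition linear_map ::
  "('a, 'r) ring_scheme \<Rightarrow> ('a, 'b) module \<Rightarrow> ('a, 'c) module \<Rightarrow> ('b \<Rightarrow> 'c) \<Rightarrow> bool" where
  "linear_map k M N \<phi> \<longleftrightarrow> \<phi> \<in> carrier M \<rightarrow> carrier N \<and>
    (\<forall>u \<in> carrier M. \<forall>v \<in> carrier M. \<phi> (u \<oplus>\<^bsub>M\<^esub> v) = \<phi> u \<oplus>\<^bsub>N\<^esub> \<phi> v) \<and>
    (\<forall>a \<in> carrier k. \<forall>u \<in> carrier M. \<phi> (a \<odot>\<^bsub>M\<^esub> u) = a \<odot>\<^bsub>N\<^esub> \<phi> u)"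

definition is_rep ::
  "('a, 'r) ring_scheme \<Rightarrow> ('o, 'm) cat \<Rightarrow> ('o, 'm, 'a, 'b) rep \<Rightarrow> bool" where
  "is_rep k C M \<longleftrightarrow>
    (\<forall>x \<in> Obj C. module k (Val M x)) \<and>
    (\<forall>x \<in> Obj C. \<forall>y \<in> Obj C. \<forall>f \<in> hom_set C x y.
      linear_map k (Val M x) (Val M y) (Act M f)) \<and>
    (\<forall>x \<in> Obj C. \<forall>v \<in> carrier (Val M x). Act M (Idn C x) v = v) \<and>
    (\<forall>x \<in> Obj C. \<forall>y \<in> Obj C. \<forall>z \<in> Obj C. \<forall>f \<in> hom_set C x y. \<forall>g \<in> hom_set C y z.
      \<forall>v \<in> carrier (Val M x). Act M (Cmp C g f) v = Act M g (Act M f v))"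

definition module_span ::
  "('a, 'r) ring_scheme \<Rightarrow> ('a, 'b) module \<Rightarrow> 'b set \<Rightarrow> 'b set" where
  "module_span k M S =
    {finsum M (\<lambda>v. c v \<odot>\<^bsub>M\<^esub> v) A | c A. finite A \<and> A \<subseteq> S \<and> c \<in> A \<rightarrow> carrier k}"

definition finitely_generated_rep ::
  "('a, 'r) ring_scheme \<Rightarrow> ('o, 'm) cat \<Rightarrow> ('o, 'm, 'a, 'b) rep \<Rightarrow> bool" where
  "finitely_generated_rep k C M \<longleftrightarrow> (\<exists>B. finite B \<and>
    (\<forall>(x, v) \<in> B. x \<in> Obj C \<and> v \<in> carrier (Val M x)) \<and>
    (\<forall>y \<in> Obj C. carrier (Val M y) =
      module_span k (Val M y) {Act M f v | x v f. (x, v) \<in> B \<and> f \<in> hom_set C x y}))"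

text \<open>A submodule of a functor \<open>M\<close> is a family of submodules \<open>N x\<close> of the \<open>M x\<close> preserved by
  the action of all arrows.\<close>

definition is_subrep ::
  "('a, 'r) ring_scheme \<Rightarrow> ('o, 'm) cat \<Rightarrow> ('o, 'm, 'a, 'b) rep \<Rightarrow> ('o \<Rightarrow> 'b set) \<Rightarrow> bool" where
  "is_subrep k C M N \<longleftrightarrow>
    (\<forall>x \<in> Obj C. submodule (N x) k (Val M x)) \<and>
    (\<forall>x \<in> Obj C. \<forall>y \<in> Obj C. \<forall>f \<in> hom_set C x y. Act M f ` N x \<subseteq> N y)"

definition restrict_rep ::
  "('o, 'm, 'a, 'b) rep \<Rightarrow> ('o \<Rightarrow> 'b set) \<Rightarrow> ('o, 'm, 'a, 'b) rep" where
  "restrict_rep M N = \<lparr>Val = (\<lambda>x. (Val M x)\<lparr>carrier := N x\<rparr>), Act = Act M\<rparr>"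

text \<open>The type argument \<open>'b\<close> is the type from which the elements of the modules are drawn;
  a theorem in which \<open>'b\<close> is free speaks about modules on arbitrary types.\<close>

definition locally_noetherian ::
  "'b itself \<Rightarrow> ('a, 'r) ring_scheme \<Rightarrow> ('o, 'm) cat \<Rightarrow> bool" where
  "locally_noetherian T k C \<longleftrightarrow> (\<forall>(M :: ('o, 'm, 'a, 'b) rep) N.
    is_rep k C M \<and> finitely_generated_rep k C M \<and> is_subrep k C M N \<longrightarrow>
    finitely_generated_rep k C (restrict_rep M N))"


section \<open>Graphs\<close>

text \<open>
  A finite CW complex of dimension at most 1 is presented by its finite sets of 0-cells and 1-cells
  and, for every 1-cell \<open>e\<close>, its attaching map \<open>{0,1} \<rightarrow> verts\<close>, given by \<open>0 \<mapsto> att0 e\<close> and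
  \<open>1 \<mapsto> att1 e\<close>. Every such complex is isomorphic to one whose cells are named by natural numbers.
\<close>

record graph =
  verts :: "nat set"
  edges :: "nat set"
  att0 :: "nat \<Rightarrow> nat"
  att1 :: "nat \<Rightarrow> nat"

definition is_graph :: "graph \<Rightarrow> bool" where
  "is_graph G \<longleftrightarrow> finite (verts G) \<and> finite (edges G) \<and>
    att0 G ` edges G \<subseteq> verts G \<and> att1 G ` edges G \<subseteq> verts G"

text \<open>The points of the complex: the vertices and, for \<open>0 < t < 1\<close>, the interior points of the
  edges.\<close>

datatype point = Vertex nat | Interior nat real

text \<open>The characteristic map \<open>[0,1] \<rightarrow> |G|\<close> of the 1-cell \<open>e\<close>.\<close>

definition char_map :: "graph \<Rightarrow> nat \<Rightarrow> real \<Rightarrow> point" where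
  "char_map G e t =
    (if t = 0 then Vertex (att0 G e) else if t = 1 then Vertex (att1 G e) else Interior e t)"

definition closed_edge :: "graph \<Rightarrow> nat \<Rightarrow> point set" where
  "closed_edge G e = char_map G e ` {0..1}"

definition points :: "graph \<Rightarrow> point set" where
  "points G = Vertex ` verts G \<union> (\<Union>e \<in> edges G. closed_edge G e)"

text \<open>The underlying space \<open>|G|\<close> has the quotient topology from the disjoint union of the discrete
  space of vertices and one copy of \<open>[0,1]\<close> for every edge.\<close>

definition graph_space :: "graph \<Rightarrow> point topology" where
  "graph_space G = topology (\<lambda>U. U \<subseteq> points G \<and>
    (\<forall>e \<in> edges G. openin (top_of_set {0..1}) {t \<in> {0..1}. char_map G e t \<in> U}))"

lemma openin_graph_space:
  "openin (graph_space G) U \<longleftrightarrow> U \<subseteq> points G \<and>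
    (\<forall>e \<in> edges G. openin (top_of_set {0..1}) {t \<in> {0..1}. char_map G e t \<in> U})"
proof -
  let ?I = "top_of_set {0..1::real}"
  let ?L = "\<lambda>U. U \<subseteq> points G \<and>
    (\<forall>e \<in> edges G. openin ?I {t \<in> {0..1}. char_map G e t \<in> U})"
  have inter: "?L (S \<inter> T)" if "?L S" "?L T" for S T
  proof -
    have "{t \<in> {0..1}. char_map G e t \<in> S \<inter> T} =
      {t \<in> {0..1}. char_map G e t \<in> S} \<inter> {t \<in> {0..1}. char_map G e t \<in> T}" for e
      by auto
    then show ?thesis using that by (auto simp del: Int_iff intro!: openin_Int)
  qed
  have union: "?L (\<Union>\<K>)" if "\<forall>K \<in> \<K>. ?L K" for \<K>
  proof -
    have "{t \<in> {0..1}. char_map G e t \<in> \<Union>\<K>} = (\<Union>K \<in> \<K>. {t \<in> {0..1}. char_map G e t \<in> K})" for e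
      by auto
    then show ?thesis using that by (auto simp del: Union_iff intro!: openin_Union)
  qed
  have "istopology ?L"
    unfolding istopology_def using inter union by blast
  then show ?thesis
    unfolding graph_space_def by (simp add: topology_inverse')
qed

lemma topspace_graph_space: "topspace (graph_space G) = points G"
proof
  show "topspace (graph_space G) \<subseteq> points G"
    using openin_graph_space openin_topspace by blast
  have "{t \<in> {0..1::real}. char_map G e t \<in> points G} = {0..1}" if "e \<in> edges G" for e
    using that by (auto simp: points_def closed_edge_def)
  then have "openin (graph_space G) (points G)"
    unfolding openin_graph_space by simp
  then show "points G \<subseteq> topspace (graph_space G)"
    by (rule openin_subset)
qed

text \<open>The rank of an abelian group (written multiplicatively, as the homology groups of the library
  are): the maximal number of elements that are linearly independent over the integers.\<close>

definition Z_independent :: "('a, 'r) monoid_scheme \<Rightarrow> 'a set \<Rightarrow> bool" where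
  "Z_independent A S \<longleftrightarrow> finite S \<and> S \<subseteq> carrier A \<and>
    (\<forall>c :: 'a \<Rightarrow> int. finprod A (\<lambda>s. s [^]\<^bsub>A\<^esub> c s) S = \<one>\<^bsub>A\<^esub> \<longrightarrow> (\<forall>s \<in> S. c s = 0))"

definition has_rank :: "('a, 'r) monoid_scheme \<Rightarrow> nat \<Rightarrow> bool" where
  "has_rank A n \<longleftrightarrow> (\<exists>S. Z_independent A S \<and> card S = n) \<and>
    (\<forall>S. Z_independent A S \<longrightarrow> card S \<le> n)"

definition graph_of_genus :: "nat \<Rightarrow> graph \<Rightarrow> bool" where
  "graph_of_genus g G \<longleftrightarrow> is_graph G \<and> verts G \<noteq> {} \<and> connected_space (graph_space G) \<and>
    has_rank (homology_group 1 (graph_space G)) g"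


section \<open>Graph morphisms and contractions\<close>

definition very_cellular :: "graph \<Rightarrow> graph \<Rightarrow> (point \<Rightarrow> point) \<Rightarrow> bool" where
  "very_cellular G H f \<longleftrightarrow> continuous_map (graph_space G) (graph_space H) f \<and>
    (\<forall>v \<in> verts G. \<exists>w \<in> verts H. f (Vertex v) = Vertex w) \<and>
    (\<forall>e \<in> edges G. (\<exists>w \<in> verts H. f ` closed_edge G e = {Vertex w}) \<or>
      (\<exists>e' \<in> edges H. f ` closed_edge G e = closed_edge H e'))"

text \<open>Functions that agree on \<open>|G|\<close> are related by \<open>very_cellular_homotopic\<close>, so the values outside
  of \<open>|G|\<close> do not matter for the classes below.\<close>

abbreviation very_cellular_homotopic ::
  "graph \<Rightarrow> graph \<Rightarrow> (point \<Rightarrow> point) \<Rightarrow> (point \<Rightarrow> point) \<Rightarrow> bool" where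
  "very_cellular_homotopic G H \<equiv>
    homotopic_with (very_cellular G H) (graph_space G) (graph_space H)"

definition morphism_class :: "graph \<Rightarrow> graph \<Rightarrow> (point \<Rightarrow> point) \<Rightarrow> (point \<Rightarrow> point) set" where
  "morphism_class G H f = {f'. very_cellular_homotopic G H f f'}"

definition graph_morphism :: "graph \<Rightarrow> graph \<Rightarrow> (point \<Rightarrow> point) set \<Rightarrow> bool" where
  "graph_morphism G H F \<longleftrightarrow> (\<exists>f. very_cellular G H f \<and> F = morphism_class G H f)"

definition fiber :: "graph \<Rightarrow> (point \<Rightarrow> point) \<Rightarrow> point \<Rightarrow> point topology" where
  "fiber G f y = subtopology (graph_space G) {x. f x = y}"

definition smooshing_map :: "graph \<Rightarrow> graph \<Rightarrow> (point \<Rightarrow> point) \<Rightarrow> bool" where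
  "smooshing_map G H f \<longleftrightarrow> f ` points G = points H \<and>
    (\<forall>y \<in> points H. connected_space (fiber G f y))"

text \<open>Surjectivity and the conditions on fibers are not invariant under homotopy, so a morphism has
  these properties if it has a representative with them.\<close>

definition smooshing :: "graph \<Rightarrow> graph \<Rightarrow> (point \<Rightarrow> point) set \<Rightarrow> bool" where
  "smooshing G H F \<longleftrightarrow> graph_morphism G H F \<and> (\<exists>f \<in> F. smooshing_map G H f)"

definition contraction :: "graph \<Rightarrow> graph \<Rightarrow> (point \<Rightarrow> point) set \<Rightarrow> bool" where
  "contraction G H F \<longleftrightarrow> graph_morphism G H F \<and>
    (\<exists>f \<in> F. smooshing_map G H f \<and> (\<forall>y \<in> points H. contractible_space (fiber G f y)))"

definition compose_classes ::
  "graph \<Rightarrow> graph \<Rightarrow> (point \<Rightarrow> point) set \<Rightarrow> (point \<Rightarrow> point) set \<Rightarrow> (point \<Rightarrow> point) set" where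
  "compose_classes G L K F = (\<Union>k \<in> K. \<Union>f \<in> F. morphism_class G L (k \<circ> f))"

definition contraction_cat ::
  "nat \<Rightarrow> (graph, graph \<times> (point \<Rightarrow> point) set \<times> graph) cat" where
  "contraction_cat g = \<lparr>
    Obj = {G. graph_of_genus g G},
    Arr = {(G, F, H). graph_of_genus g G \<and> graph_of_genus g H \<and> contraction G H F},
    Dom = (\<lambda>(G, F, H). G),
    Cod = (\<lambda>(G, F, H). H),
    Idn = (\<lambda>G. (G, morphism_class G G id, G)),
    Cmp = (\<lambda>(H, K, L) (G, F, H'). (G, compose_classes G L K F, L))\<rparr>"

end

theory Submission
  imports Defs "HOL-Library.Ramsey" "HOL-Library.Tree" "HOL-Library.Nat_Bijection" "HOL-Analysis.Further_Topology"
begin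

text \<open>
  Up to homotopy through very cellular maps, a contraction is determined by combinatorial data: a
  map on vertices, a partial map on edges and the orientations of the edges which are not collapsed.
  To find the orientation of an edge, push the outer quarters of the target edge onto its ends;
  connectedness of the fibers then makes the map on the edge a path from one end to the other, even
  if the target edge is a loop, and this path is homotopic to a linear one.

  Numbering the vertices of a graph of genus \<open>g\<close> along a planar rooted spanning tree in depth-first
  order rigidifies it. The rigidified graphs form a category with increasing, ancestor-preserving
  embeddings of the spanning trees as morphisms; each embedding induces a contraction in the opposite
  direction. There are no nontrivial endomorphisms, and the lexicographic order on embeddings is
  compatible with composition, which is (G1). A contraction onto a fixed graph labels the vertices
  of the spanning tree by elements of a finite set, since there are only \<open>g\<close> edges outside of
  the tree, so Kruskal's theorem for labelled planar trees gives both (G2) and property (F).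

  Noetherianity follows as in Hilbert's basis theorem: choose successively elements of a
  subrepresentation outside of the span of the earlier ones, with minimal leading terms. On a
  subsequence the leading terms increase, by (G2), and the ideals generated by the leading
  coefficients become stationary, so some leading term can be cancelled by earlier ones. Local
  noetherianity is inherited along essentially surjective functors with property (F).
\<close>

section \<open>Well-quasi-orders and Kruskal's theorem\<close>

text \<open>Graphs have automorphisms, so the category of graphs cannot itself be Groebner; the
  planar rooted spanning tree is there to kill them.

  Smooshing and contractibility are conditions on one representative of a class, and the topological
  fiber over a vertex may contain pieces of edges that are not collapsed. It has to be retracted to
  a combinatorial fiber before the latter is known to be a tree.

  That fibers are trees is recorded as connectedness together with preservation of the number of
  edges minus the number of vertices, which passes to composites at once. The same count fixes the
  number of edges outside of a spanning tree in terms of the target. So the first homology group is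
  never computed; only its invariance under homeomorphism is used.

  The order in (G1) allows different parallel morphisms to become equal after composition, whereas
  lower terms have to stay strictly lower when leading terms are cancelled. The noetherian argument
  therefore runs on a strict order; it is available because embeddings are strictly
  increasing.\<close>

definition wqo_on :: "('a \<Rightarrow> 'a \<Rightarrow> bool) \<Rightarrow> 'a set \<Rightarrow> bool" where
  "wqo_on qle A \<longleftrightarrow> (\<forall>s :: nat \<Rightarrow> 'a. (\<forall>i. s i \<in> A) \<longrightarrow> (\<exists>i j. i < j \<and> qle (s i) (s j)))"

text \<open>Ramsey's theorem for pairs of indices, coloured by whether they are good: a homogeneous
  infinite set of the other colour would be a bad sequence. This serves an arbitrary relation
  \<open>qle\<close>, for which the usual argument by chains is not at hand.\<close>

lemma wqo_on_subseq:
  assumes "wqo_on qle A" and s: "\<And>i::nat. s i \<in> A"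
  obtains r :: "nat \<Rightarrow> nat" where "strict_mono r" "\<And>i j. i < j \<Longrightarrow> qle (s (r i)) (s (r j))"
proof -
  \<comment> \<open>Ramsey's theorem colours unordered pairs; \<open>Min\<close> and
    \<open>Max\<close> recover the order of the two indices. Colour 0 means a good pair.\<close>
  define f where "f S = (if qle (s (Min S)) (s (Max S)) then 0 else 1 :: nat)" for S
  have "\<exists>Y t. Y \<subseteq> (UNIV :: nat set) \<and> infinite Y \<and> t < 2 \<and>
      (\<forall>x\<in>Y. \<forall>y\<in>Y. x \<noteq> y \<longrightarrow> f {x, y} = t)"
    by (rule Ramsey2) (auto simp: f_def)
  then obtain Y t where Y: "infinite Y" and t: "\<forall>x\<in>Y. \<forall>y\<in>Y. x \<noteq> y \<longrightarrow> f {x, y} = t"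
    by blast
  define r where "r = enumerate Y"
  have mono: "strict_mono r"
    unfolding r_def using Y by (intro strict_monoI enumerate_mono)
  have inY: "r i \<in> Y" for i
    unfolding r_def by (rule enumerate_in_set[OF Y])
  have prec: "r i < r j" if "i < j" for i j
    using mono that by (simp add: strict_mono_less)
  have col: "qle (s (r i)) (s (r j)) \<longleftrightarrow> t = 0" if "i < j" for i j
  proof -
    have "f {r i, r j} = t"
      using t inY prec[OF that] by (metis less_irrefl)
    then show ?thesis
      using prec[OF that] unfolding f_def by (auto simp: min_absorb1 max_absorb2 split: if_splits)
  qed
  have "\<exists>i j. i < j \<and> qle (s (r i)) (s (r j))"
    using assms(1)[unfolded wqo_on_def, rule_format, of "s \<circ> r"] s by auto
  then have "t = 0"
    using col by blast
  then show ?thesis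
    using that[OF mono] col by blast
qed

text \<open>Dickson's lemma: on a subsequence that increases in the first component, the second
  component still has a good pair.\<close>

lemma wqo_on_Times:
  assumes "wqo_on le1 A" "wqo_on le2 B"
  shows "wqo_on (\<lambda>(a, b) (a', b'). le1 a a' \<and> le2 b b') (A \<times> B)"
  unfolding wqo_on_def
proof (intro allI impI)
  fix s :: "nat \<Rightarrow> 'a \<times> 'b"
  assume s: "\<forall>i. s i \<in> A \<times> B"
  then have "fst (s i) \<in> A" for i
    by (auto simp: mem_Times_iff)
  then obtain r :: "nat \<Rightarrow> nat" where r: "strict_mono r" "\<And>i j. i < j \<Longrightarrow> le1 (fst (s (r i))) (fst (s (r j)))"
    using wqo_on_subseq[OF assms(1), of "\<lambda>i. fst (s i)"] by blast
  obtain i j where "i < j" "le2 (snd (s (r i))) (snd (s (r j)))"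
    using assms(2)[unfolded wqo_on_def, rule_format, of "snd \<circ> s \<circ> r"] s by (auto simp: mem_Times_iff)
  then have "r i < r j" "(case s (r i) of (a, b) \<Rightarrow> \<lambda>(a', b'). le1 a a' \<and> le2 b b') (s (r j))"
    using r(2)[OF \<open>i < j\<close>] \<open>i < j\<close> r(1) by (auto simp: strict_mono_less split: prod.splits)
  then show "\<exists>i j. i < j \<and> (case s i of (a, b) \<Rightarrow> \<lambda>(a', b'). le1 a a' \<and> le2 b b') (s j)"
    by (intro exI[of _ "r i"] exI[of _ "r j"] conjI)
qed

lemma wqo_on_finite_eq:
  assumes "finite A"
  shows "wqo_on (=) A"
  unfolding wqo_on_def
proof (intro allI impI)
  fix s :: "nat \<Rightarrow> 'a"
  assume "\<forall>i. s i \<in> A"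
  then have "finite (range s)"
    using assms by (auto intro: finite_subset)
  then have "\<not> inj s"
    using finite_imageD by blast
  then show "\<exists>i j. i < j \<and> s i = s j"
    by (metis injI linorder_neqE_nat)
qed

text \<open>The terms are fixed one after the other, each of least size among all bad sequences that
  begin with the terms fixed before.\<close>

lemma minimal_bad_sequence:
  fixes sz :: "'a \<Rightarrow> nat"
  assumes "\<not> wqo_on qle A"
  obtains m where "\<And>i :: nat. m i \<in> A" "\<And>i j. i < j \<Longrightarrow> \<not> qle (m i) (m j)"
    "\<And>n t. \<lbrakk>\<And>i :: nat. t i \<in> A; \<And>i j. i < j \<Longrightarrow> \<not> qle (t i) (t j); \<And>i. i < n \<Longrightarrow> t i = m i\<rbrakk>
      \<Longrightarrow> sz (m n) \<le> sz (t n)"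
proof -
  define bad where "bad s \<longleftrightarrow> (\<forall>i :: nat. s i \<in> A) \<and> (\<forall>i j. i < j \<longrightarrow> \<not> qle (s i) (s j))" for s
  have min: "\<exists>t. bad t \<and> (\<forall>i<n. t i = s i) \<and>
      (\<forall>u. bad u \<and> (\<forall>i<n. u i = s i) \<longrightarrow> sz (t n) \<le> sz (u n))" if "bad s" for s n
    using ex_has_least_nat[of "\<lambda>t. bad t \<and> (\<forall>i<n. t i = s i)" s "\<lambda>t. sz (t n)"] that by blast
  obtain s0 where s0: "bad s0"
    using assms unfolding wqo_on_def bad_def by blast
  let ?P = "\<lambda>n t. bad t \<and> (\<forall>u. bad u \<and> (\<forall>i<n. u i = t i) \<longrightarrow> sz (t n) \<le> sz (u n))"
  have P0: "\<exists>t. ?P 0 t"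
    using min[OF s0, of 0] by auto
  have PS: "\<exists>u. ?P (Suc n) u \<and> (\<forall>i\<le>n. u i = t i)" if t: "?P n t" for t n
  proof -
    obtain u where u: "bad u" "\<forall>i<Suc n. u i = t i"
      "\<forall>v. bad v \<and> (\<forall>i<Suc n. v i = t i) \<longrightarrow> sz (u (Suc n)) \<le> sz (v (Suc n))"
      using min[of t "Suc n"] t by blast
    then have "?P (Suc n) u"
      by metis
    then show ?thesis
      using u(2) by (auto simp: less_Suc_eq_le)
  qed
  \<comment> \<open>Each \<open>f n\<close> is an entire bad sequence whose term number
    \<open>n\<close> is optimal. Later sequences keep the terms up to \<open>n\<close>, so the
    diagonal agrees with \<open>f j\<close> up to index \<open>j\<close> and is bad itself.\<close>
  obtain f where f: "\<And>n. ?P n (f n)" "\<And>n. \<forall>i\<le>n. f (Suc n) i = f n i"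
    using dependent_nat_choice[of ?P "\<lambda>n t u. \<forall>i\<le>n. u i = t i", OF P0 PS] by blast
  have agree: "f (n + k) i = f n i" if "i \<le> n" for n k i
    using that by (induction k) (auto simp: f(2))
  have agree': "f j i = f i i" if "i \<le> j" for i j
    using agree[of i i "j - i"] that by (metis le_add_diff_inverse order_refl)
  show ?thesis
  proof
    show "f i i \<in> A" for i
      using f(1)[of i] by (auto simp: bad_def)
    show "\<not> qle (f i i) (f j j)" if "i < j" for i j
      using f(1)[of j] that agree'[of i j] unfolding bad_def by (metis less_imp_le)
    show "sz (f n n) \<le> sz (t n)"
      if "\<And>i. t i \<in> A" "\<And>i j. i < j \<Longrightarrow> \<not> qle (t i) (t j)" "\<And>i. i < n \<Longrightarrow> t i = f i i" for n t
    proof -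
      have "bad t" "\<forall>i<n. t i = f n i"
        using that agree'[of _ n] by (auto simp: bad_def)
      then show ?thesis
        using f(1)[of n] by blast
    qed
  qed
qed

text \<open>Homeomorphic embedding of ordered binary trees. Labels of matched nodes have to be
  equal, which suits a finite set of labels.\<close>

inductive tree_emb :: "'a tree \<Rightarrow> 'a tree \<Rightarrow> bool" where
  Leaf: "tree_emb Leaf t"
| Node: "\<lbrakk>tree_emb l l'; tree_emb r r'\<rbrakk> \<Longrightarrow> tree_emb (Node l a r) (Node l' a r')"
| left: "tree_emb t l \<Longrightarrow> tree_emb t (Node l a r)"
| right: "tree_emb t r \<Longrightarrow> tree_emb t (Node l a r)"

text \<open>Kruskal's theorem for binary trees, by the minimal bad sequence argument of Nash-Williams.\<close>

theorem wqo_on_tree_emb: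
  assumes "finite L"
  shows "wqo_on tree_emb {t. set_tree t \<subseteq> L}"
proof (rule ccontr)
  assume "\<not> wqo_on tree_emb {t. set_tree t \<subseteq> L}"
  then obtain m where m: "\<And>i :: nat. set_tree (m i) \<subseteq> L" "\<And>i j. i < j \<Longrightarrow> \<not> tree_emb (m i) (m j)"
    and min: "\<And>n t. \<lbrakk>\<And>i :: nat. set_tree (t i) \<subseteq> L; \<And>i j. i < j \<Longrightarrow> \<not> tree_emb (t i) (t j);
      \<And>i. i < n \<Longrightarrow> t i = m i\<rbrakk> \<Longrightarrow> size (m n) \<le> size (t n)"
    using minimal_bad_sequence[of tree_emb "{t. set_tree t \<subseteq> L}" size, unfolded mem_Collect_eq] by metis
  have nonleaf: "m i \<noteq> Leaf" for i
    using m(2)[of i "Suc i"] tree_emb.Leaf by force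
  define sub where "sub t = {left t, right t}" for t :: "'a tree"
  have sub_emb: "tree_emb t (m i)" if "u \<in> sub (m i)" "tree_emb t u" for t u i
    using that nonleaf[of i] by (cases "m i") (auto simp: sub_def intro: tree_emb.left tree_emb.right)
  have sub_size: "size u < size (m i)" "set_tree u \<subseteq> L" if "u \<in> sub (m i)" for u i
    using that nonleaf[of i] m(1)[of i] by (cases "m i"; auto simp: sub_def)+
  have "wqo_on tree_emb (\<Union>i. sub (m i))"
  proof (rule ccontr)
    assume "\<not> wqo_on tree_emb (\<Union>i. sub (m i))"
    then obtain u where u: "\<And>k :: nat. u k \<in> (\<Union>i. sub (m i))" "\<And>i j. i < j \<Longrightarrow> \<not> tree_emb (u i) (u j)"
      unfolding wqo_on_def by blast
    have "\<forall>k. \<exists>i. u k \<in> sub (m i)"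
      using u(1) by blast
    then obtain idx where idx: "\<And>k. u k \<in> sub (m (idx k))"
      by metis
    obtain k0 where k0: "\<And>k. idx k0 \<le> idx k"
      using ex_has_least_nat[of "\<lambda>_. True" undefined idx] by blast
    define n where "n = idx k0"
    \<comment> \<open>The sequence follows \<open>m\<close> up to the least index \<open>n\<close>
      of a tree that contributes to \<open>u\<close>, and then \<open>u\<close> from a subtree of
      \<open>m n\<close> on. An embedding of an early \<open>m i\<close> into a later
      \<open>u k\<close> would embed \<open>m i\<close> into a later tree of \<open>m\<close>, so
      \<open>t\<close> is bad; but its term number \<open>n\<close> is smaller than
      \<open>m n\<close>.\<close>
    define t where "t i = (if i < n then m i else u (k0 + (i - n)))" for i
    have "size (m n) \<le> size (t n)"
    proof (rule min)
      show "set_tree (t i) \<subseteq> L" for i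
        using m(1) sub_size(2)[OF idx] by (simp add: t_def)
      show "\<not> tree_emb (t i) (t j)" if "i < j" for i j
      proof (cases "i < n \<and> n \<le> j")
        case True
        have "i < idx (k0 + (j - n))"
          using k0[of "k0 + (j - n)"] True by (simp add: n_def)
        then have "\<not> tree_emb (m i) (u (k0 + (j - n)))"
          using m(2) sub_emb[OF idx] by blast
        then show ?thesis
          using True by (simp add: t_def)
      next
        case False
        then show ?thesis
          using that m(2) u(2) by (auto simp: t_def)
      qed
    qed (simp add: t_def)
    then show False
      using sub_size(1)[OF idx[of k0]] by (simp add: t_def n_def)
  qed
  \<comment> \<open>A node is determined by its two subtrees and its label, and all three now range
    over well-quasi-ordered sets. A good pair of triples is an instance of the rule
    \<open>tree_emb.Node\<close>.\<close>
  then have "wqo_on (\<lambda>(l, r, a) (l', r', a'). tree_emb l l' \<and> tree_emb r r' \<and> a = a')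
      ((\<Union>i. sub (m i)) \<times> (\<Union>i. sub (m i)) \<times> L)"
    using wqo_on_Times[OF _ wqo_on_Times[OF _ wqo_on_finite_eq[OF assms]]]
    by (simp add: case_prod_beta')
  moreover have "value (m i) \<in> L" for i
    using nonleaf[of i] m(1)[of i] by (cases "m i") auto
  ultimately obtain i j where "i < j" "tree_emb (left (m i)) (left (m j))"
    "tree_emb (right (m i)) (right (m j))" "value (m i) = value (m j)"
    unfolding wqo_on_def
    by (drule_tac x="\<lambda>i. (left (m i), right (m i), value (m i))" in spec) (auto simp: sub_def)
  then show False
    using m(2)[of i j] nonleaf[of i] nonleaf[of j]
    by (cases "m i"; cases "m j") (auto simp: tree_emb.Node)
qed

section \<open>The topology of graphs\<close>

lemma att_in_verts:
  assumes "is_graph G" "e \<in> edges G"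
  shows "att0 G e \<in> verts G" "att1 G e \<in> verts G"
  using assms by (auto simp: is_graph_def)

lemma char_map_simps [simp]:
  "char_map G e 0 = Vertex (att0 G e)" "char_map G e 1 = Vertex (att1 G e)"
  by (auto simp: char_map_def)

lemma char_map_Interior: "0 < t \<Longrightarrow> t < 1 \<Longrightarrow> char_map G e t = Interior e t"
  by (auto simp: char_map_def)

lemma points_cases [consumes 2, case_names Vertex Interior]:
  assumes "x \<in> points G" and "is_graph G"
  obtains v where "v \<in> verts G" "x = Vertex v"
  | e t where "e \<in> edges G" "0 < t" "t < 1" "x = Interior e t"
proof -
  consider v where "v \<in> verts G" "x = Vertex v"
    | e t where "e \<in> edges G" "0 \<le> t" "t \<le> 1" "x = char_map G e t"
    using assms(1) by (auto simp: points_def closed_edge_def)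
  then show ?thesis
  proof cases
    case (2 e t)
    then show ?thesis
      using that att_in_verts[OF assms(2), of e] by (cases "t = 0"; cases "t = 1") (auto simp: char_map_def)
  qed (rule that)
qed

lemma points_iff [simp]:
  assumes "is_graph G"
  shows "Vertex v \<in> points G \<longleftrightarrow> v \<in> verts G"
    "Interior e t \<in> points G \<longleftrightarrow> e \<in> edges G \<and> 0 < t \<and> t < 1"
  using assms att_in_verts[OF assms]
  by (auto simp: points_def closed_edge_def char_map_def image_iff split: if_splits)

lemma char_map_in_points:
  assumes "e \<in> edges G" "0 \<le> t" "t \<le> 1"
  shows "char_map G e t \<in> points G"
  using assms by (force simp: points_def closed_edge_def)

lemma closedin_graph_space:
  "closedin (graph_space G) C \<longleftrightarrow> C \<subseteq> points G \<and>
    (\<forall>e \<in> edges G. closedin (top_of_set {0..1}) {t \<in> {0..1}. char_map G e t \<in> C})"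
proof -
  have "{0..1} - {t \<in> {0..1}. char_map G e t \<in> C} = {t \<in> {0..1}. char_map G e t \<in> points G - C}"
    if "e \<in> edges G" for e
    using that by (auto simp: char_map_in_points)
  then show ?thesis
    unfolding closedin_def topspace_graph_space openin_graph_space by auto
qed

lemma continuous_map_char_map:
  assumes "e \<in> edges G"
  shows "continuous_map (top_of_set {0..1}) (graph_space G) (char_map G e)"
  using assms by (auto simp: continuous_map_def topspace_graph_space openin_graph_space char_map_in_points)

text \<open>The universal property of the quotient topology. The condition on vertices takes care of
  those that lie on no edge.\<close>

lemma continuous_map_from_graph_space:
  assumes "is_graph G"
  shows "continuous_map (graph_space G) Y f \<longleftrightarrow> (\<forall>v \<in> verts G. f (Vertex v) \<in> topspace Y) \<and>
    (\<forall>e \<in> edges G. continuous_map (top_of_set {0..1}) Y (\<lambda>t. f (char_map G e t)))"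
    (is "?L \<longleftrightarrow> ?R")
proof
  assume L: ?L
  then have "f x \<in> topspace Y" if "x \<in> points G" for x
    using that by (auto simp: continuous_map_def topspace_graph_space)
  moreover have "continuous_map (top_of_set {0..1}) Y (f \<circ> char_map G e)" if "e \<in> edges G" for e
    using continuous_map_compose[OF continuous_map_char_map[OF that] L] .
  ultimately show ?R
    using assms by (auto simp: o_def)
next
  assume R: ?R
  have "f x \<in> topspace Y" if "x \<in> points G" for x
    using that assms
  proof (cases rule: points_cases)
    case (Interior e t)
    then have "(\<lambda>t. f (char_map G e t)) \<in> {0..1} \<rightarrow> topspace Y"
      using R by (auto simp: continuous_map_def)
    then have "f (char_map G e t) \<in> topspace Y"
      using Interior by (auto simp: Pi_iff)
    then show ?thesis
      using Interior by (simp add: char_map_Interior)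
  qed (use R in auto)
  moreover have "openin (graph_space G) {x \<in> points G. f x \<in> U}" if "openin Y U" for U
    unfolding openin_graph_space
  proof (intro conjI ballI)
    fix e assume e: "e \<in> edges G"
    then have "openin (top_of_set {0..1}) {t \<in> {0..1}. f (char_map G e t) \<in> U}"
      using R that by (auto simp: continuous_map_def)
    moreover have "{t \<in> {0..1}. char_map G e t \<in> {x \<in> points G. f x \<in> U}} =
        {t \<in> {0..1}. f (char_map G e t) \<in> U}"
      using e by (auto simp: char_map_in_points)
    ultimately show "openin (top_of_set {0..1}) {t \<in> {0..1}. char_map G e t \<in> {x \<in> points G. f x \<in> U}}"
      by simp
  qed auto
  ultimately show ?L
    by (auto simp: continuous_map_def topspace_graph_space)
qed

text \<open>Points are separated by continuous real functions: two vertices by the indicator of one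
  of them, extended linearly over the edges, and an interior point of an edge by a tent function on
  this edge.\<close>

lemma Hausdorff_space_graph_space:
  assumes G: "is_graph G"
  shows "Hausdorff_space (graph_space G)"
proof -
  have sep: "\<exists>g. continuous_map (graph_space G) euclideanreal g \<and> g x \<noteq> g y"
    if x: "x \<in> points G" and y: "y \<in> points G" and "x \<noteq> y" and xy: "\<And>v. x = Vertex v \<Longrightarrow> \<exists>w. y = Vertex w"
    for x y
    using x G
  proof (cases rule: points_cases)
    case (Vertex v)
    then obtain w where w: "y = Vertex w" "w \<noteq> v"
      using xy \<open>x \<noteq> y\<close> by blast
    define ind where "ind u = (if u = v then 1 else 0 :: real)" for u
    define g where "g z = (case z of Vertex u \<Rightarrow> ind u
        | Interior e t \<Rightarrow> (1 - t) * ind (att0 G e) + t * ind (att1 G e))" for z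
    have "(\<lambda>t. g (char_map G e t)) = (\<lambda>t. (1 - t) * ind (att0 G e) + t * ind (att1 G e))" for e
      by (auto simp: g_def char_map_def)
    then have "continuous_map (graph_space G) euclideanreal g"
      unfolding continuous_map_from_graph_space[OF G] by (auto intro!: continuous_intros)
    then show ?thesis
      using w Vertex by (intro exI[of _ g]) (auto simp: g_def ind_def)
  next
    case (Interior e s)
    define c where "c = (case y of Interior e' s' \<Rightarrow> if e' = e then \<bar>s' - s\<bar> else 1 | Vertex _ \<Rightarrow> 1)"
    have "c > 0"
      using \<open>x \<noteq> y\<close> Interior by (auto simp: c_def split: point.splits)
    \<comment> \<open>The radius is at most the distance to either end of the edge and at most
      \<open>c\<close>, the distance to \<open>y\<close> if \<open>y\<close> lies on the same edge.
      So the tent of height \<open>r\<close> over \<open>s\<close> vanishes at the ends and at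
      \<open>y\<close>.\<close>
    define r where "r = min c (min s (1 - s))"
    have r: "r > 0" "r \<le> s" "r \<le> 1 - s" "r \<le> c"
      using \<open>c > 0\<close> Interior by (auto simp: r_def)
    define g where "g z = (case z of Interior e' t \<Rightarrow> if e' = e then max 0 (r - \<bar>t - s\<bar>) else 0
        | Vertex _ \<Rightarrow> 0)" for z
    have "(\<lambda>t. g (char_map G e' t)) = (if e' = e then (\<lambda>t. max 0 (r - \<bar>t - s\<bar>)) else (\<lambda>_. 0))" for e'
      using r by (auto simp: g_def char_map_def)
    then have "continuous_map (graph_space G) euclideanreal g"
      unfolding continuous_map_from_graph_space[OF G] by (auto intro!: continuous_intros)
    moreover have "g y = 0"
      using r by (auto simp: g_def c_def split: point.splits)
    moreover have "g x = r"
      using Interior r by (auto simp: g_def)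
    ultimately show ?thesis
      using r by (intro exI[of _ g]) auto
  qed
  have sep': "\<exists>g. continuous_map (graph_space G) euclideanreal g \<and> g x \<noteq> g y"
    if "x \<in> points G" "y \<in> points G" "x \<noteq> y" for x y
  proof (cases "\<exists>v. x = Vertex v")
    case True
    then show ?thesis
      using sep[of y x] that by metis
  next
    case False
    then show ?thesis
      using sep[of x y] that by metis
  qed
  show ?thesis
    unfolding Hausdorff_space_def topspace_graph_space
  proof (intro allI impI)
    fix x y assume xy: "x \<in> points G \<and> y \<in> points G \<and> x \<noteq> y"
    then obtain g where g: "continuous_map (graph_space G) euclideanreal g" "g x \<noteq> g y"
      using sep' by blast
    obtain U V where UV: "open U" "open V" "g x \<in> U" "g y \<in> V" "U \<inter> V = {}"
      using hausdorff[OF g(2)] by blast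
    have op: "openin (graph_space G) {z \<in> points G. g z \<in> W}" if "open W" for W
      using openin_continuous_map_preimage[OF g(1)] that by (simp add: topspace_graph_space)
    have "disjnt {z \<in> points G. g z \<in> U} {z \<in> points G. g z \<in> V}"
      using UV(5) by (auto simp: disjnt_iff)
    then show "\<exists>U V. openin (graph_space G) U \<and> openin (graph_space G) V \<and> x \<in> U \<and> y \<in> V \<and> disjnt U V"
      using op[OF UV(1)] op[OF UV(2)] UV(3,4) xy by blast
  qed
qed

text \<open>Homotopies may be checked edge by edge. That the product of a quotient map with the
  interval is again a quotient map is obtained from compactness: the preimage of a closed set is a
  finite union of compact images of segments and squares, which are closed in the Hausdorff
  product.\<close>

lemma continuous_map_from_prod_graph_space:
  assumes G: "is_graph G"
    and verts: "\<And>v. v \<in> verts G \<Longrightarrow> continuous_map (top_of_set {0..1}) Y (\<lambda>\<tau>. h (\<tau>, Vertex v))"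
    and edges: "\<And>e. e \<in> edges G \<Longrightarrow>
      continuous_map (top_of_set ({0..1} \<times> {0..1})) Y (\<lambda>(\<tau>, t). h (\<tau>, char_map G e t))"
  shows "continuous_map (prod_topology (top_of_set {0..1 :: real}) (graph_space G)) Y h"
proof -
  let ?I = "top_of_set {0..1 :: real}" and ?P = "prod_topology (top_of_set {0..1 :: real}) (graph_space G)"
  have top: "topspace ?P = {0..1} \<times> points G"
    by (simp add: topspace_graph_space)
  have haus: "Hausdorff_space ?P"
    unfolding Hausdorff_space_prod_topology
    using Hausdorff_space_graph_space[OF G] by (simp add: Hausdorff_space_subtopology)
  have range: "h z \<in> topspace Y" if "z \<in> {0..1} \<times> points G" for z
  proof -
    obtain \<tau> x where z: "z = (\<tau>, x)" "0 \<le> \<tau>" "\<tau> \<le> 1" "x \<in> points G"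
      using \<open>z \<in> _\<close> by (auto elim!: SigmaE)
    from z(4) G show ?thesis
    proof (cases rule: points_cases)
      case (Vertex v)
      then show ?thesis
        using verts[of v] z by (auto simp: continuous_map_def)
    next
      case (Interior e t)
      then have "(\<lambda>(\<tau>, t). h (\<tau>, char_map G e t)) \<in> {0..1} \<times> {0..1} \<rightarrow> topspace Y"
        using edges[of e] by (simp add: continuous_map_def)
      then have "(\<lambda>(\<tau>, t). h (\<tau>, char_map G e t)) (\<tau>, t) \<in> topspace Y"
        by (rule funcset_mem) (use z Interior in auto)
      then show ?thesis
        using Interior z by (simp add: char_map_Interior)
    qed
  qed
  have "closedin ?P {z \<in> topspace ?P. h z \<in> C}" if C: "closedin Y C" for C
  proof -
    define A where "A v = (\<lambda>\<tau>. (\<tau>, Vertex v)) ` {\<tau> \<in> {0..1}. h (\<tau>, Vertex v) \<in> C}" for v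
    define B where "B e = (\<lambda>(\<tau>, t). (\<tau>, char_map G e t)) `
        {z \<in> {0..1} \<times> {0..1}. (case z of (\<tau>, t) \<Rightarrow> h (\<tau>, char_map G e t)) \<in> C}" for e
    have A: "compactin ?P (A v)" if "v \<in> verts G" for v
      unfolding A_def
    proof (rule image_compactin)
      have "closedin ?I {\<tau> \<in> {0..1}. h (\<tau>, Vertex v) \<in> C}"
        using verts[OF that] C by (auto simp: continuous_map_closedin)
      then show "compactin ?I {\<tau> \<in> {0..1}. h (\<tau>, Vertex v) \<in> C}"
        by (intro closedin_compact_space) (auto simp: compact_space_subtopology)
      show "continuous_map ?I ?P (\<lambda>\<tau>. (\<tau>, Vertex v))"
        using that G by (auto simp: continuous_map_pairwise o_def topspace_graph_space)
    qed
    have B: "compactin ?P (B e)" if "e \<in> edges G" for e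
      unfolding B_def
    proof (rule image_compactin)
      let ?II = "top_of_set ({0..1 :: real} \<times> {0..1 :: real})"
      have "closedin ?II {z \<in> {0..1} \<times> {0..1}. (case z of (\<tau>, t) \<Rightarrow> h (\<tau>, char_map G e t)) \<in> C}"
        using edges[OF that] C unfolding continuous_map_closedin by auto
      then show "compactin ?II {z \<in> {0..1} \<times> {0..1}. (case z of (\<tau>, t) \<Rightarrow> h (\<tau>, char_map G e t)) \<in> C}"
        by (intro closedin_compact_space) (auto simp: compact_space_subtopology compact_Times)
      have "continuous_map ?II ?I fst" "continuous_map ?II ?I snd"
        by (auto simp: continuous_on_fst continuous_on_snd continuous_on_id)
      then show "continuous_map ?II ?P (\<lambda>(\<tau>, t). (\<tau>, char_map G e t))"
        using continuous_map_compose[OF _ continuous_map_char_map[OF that], of ?II snd]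
        by (auto simp: continuous_map_pairwise o_def case_prod_beta')
    qed
    have "{z \<in> topspace ?P. h z \<in> C} = (\<Union>v \<in> verts G. A v) \<union> (\<Union>e \<in> edges G. B e)" (is "?l = ?r")
    proof
      show "?r \<subseteq> ?l"
        using G by (auto simp: A_def B_def topspace_graph_space char_map_in_points)
      show "?l \<subseteq> ?r"
      proof
        fix z assume z: "z \<in> ?l"
        then obtain \<tau> x where zx: "z = (\<tau>, x)" "0 \<le> \<tau>" "\<tau> \<le> 1" "x \<in> points G" "h (\<tau>, x) \<in> C"
          by (auto simp: topspace_graph_space)
        from zx(4) G show "z \<in> ?r"
        proof (cases rule: points_cases)
          case (Vertex v)
          then show ?thesis using zx by (auto simp: A_def)
        next
          case (Interior e t)
          then have "z \<in> B e"
            unfolding B_def using zx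
            by (intro rev_image_eqI[of "(\<tau>, t)"]) (auto simp: char_map_Interior)
          then show ?thesis using Interior by blast
        qed
      qed
    qed
    moreover have "compactin ?P ((\<Union>v \<in> verts G. A v) \<union> (\<Union>e \<in> edges G. B e))"
      using G A B by (intro compactin_Un compactin_Union) (auto simp: is_graph_def)
    ultimately show ?thesis
      using compactin_imp_closedin[OF haus] by simp
  qed
  then show ?thesis
    unfolding continuous_map_closedin using range top by blast
qed

section \<open>Subgraphs, trees and contractibility\<close>

definition subgraph :: "graph \<Rightarrow> nat set \<Rightarrow> nat set \<Rightarrow> graph" where
  "subgraph G V E = G\<lparr>verts := V, edges := E\<rparr>"

lemma subgraph_simps [simp]:
  "verts (subgraph G V E) = V" "edges (subgraph G V E) = E"
  "att0 (subgraph G V E) = att0 G" "att1 (subgraph G V E) = att1 G"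
  by (simp_all add: subgraph_def)

lemma char_map_subgraph [simp]: "char_map (subgraph G V E) = char_map G"
  by (auto simp: char_map_def fun_eq_iff)

text \<open>A closed subset of the subgraph meets an edge outside of \<open>E\<close> at most in its
  two ends, hence in a closed set; so it is closed in the whole graph and the two topologies
  agree.\<close>

lemma subtopology_subgraph:
  assumes G: "is_graph G" and S: "is_graph (subgraph G V E)" "V \<subseteq> verts G" "E \<subseteq> edges G"
  shows "subtopology (graph_space G) (points (subgraph G V E)) = graph_space (subgraph G V E)"
proof -
  let ?S = "subgraph G V E"
  have sub: "points ?S \<subseteq> points G"
    using S by (auto simp: points_def closed_edge_def)
  have *: "closedin (graph_space G) C" if C: "closedin (graph_space ?S) C" for C
    unfolding closedin_graph_space
  proof (intro conjI ballI)
    show "C \<subseteq> points G"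
      using closedin_subset[OF C] sub by (auto simp: topspace_graph_space)
    fix e assume "e \<in> edges G"
    show "closedin (top_of_set {0..1}) {t \<in> {0..1}. char_map G e t \<in> C}"
    proof (cases "e \<in> E")
      case True
      then show ?thesis
        using C by (auto simp: closedin_graph_space)
    next
      case False
      have "{t \<in> {0..1}. char_map G e t \<in> C} \<subseteq> {0, 1}"
      proof
        fix t assume "t \<in> {t \<in> {0..1}. char_map G e t \<in> C}"
        then have "0 \<le> t" "t \<le> 1" "char_map G e t \<in> points ?S"
          using closedin_subset[OF C] by (auto simp: topspace_graph_space)
        then show "t \<in> {0, 1}"
          using False S(1) by (auto simp: char_map_def split: if_splits)
      qed
      then have "finite {t \<in> {0..1}. char_map G e t \<in> C}"
        by (rule finite_subset) simp
      then have "closed {t \<in> {0..1}. char_map G e t \<in> C}"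
        by (rule finite_imp_closed)
      then show ?thesis
        by (rule closed_subset[rotated]) auto
    qed
  qed
  have "closedin (subtopology (graph_space G) (points ?S)) C \<longleftrightarrow> closedin (graph_space ?S) C" for C
  proof
    assume "closedin (subtopology (graph_space G) (points ?S)) C"
    then obtain D where D: "closedin (graph_space G) D" "C = D \<inter> points ?S"
      by (auto simp: closedin_subtopology)
    have "{t \<in> {0..1}. char_map G e t \<in> D \<inter> points ?S} = {t \<in> {0..1}. char_map G e t \<in> D}" if "e \<in> E" for e
      using that char_map_in_points[of e ?S] by auto
    then show "closedin (graph_space ?S) C"
      using D S(3) by (auto simp: closedin_graph_space)
  next
    assume "closedin (graph_space ?S) C"
    then show "closedin (subtopology (graph_space G) (points ?S)) C"
      using * closedin_subset by (fastforce simp: closedin_subtopology topspace_graph_space)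
  qed
  then show ?thesis
    by (metis topology_finer_closedin topology_eq topspace_graph_space topspace_subtopology_subset sub)
qed

definition adj :: "graph \<Rightarrow> nat set \<Rightarrow> nat \<Rightarrow> nat \<Rightarrow> bool" where
  "adj G E u v \<longleftrightarrow> (\<exists>e \<in> E. (att0 G e = u \<and> att1 G e = v) \<or> (att0 G e = v \<and> att1 G e = u))"

definition connected_on :: "graph \<Rightarrow> nat set \<Rightarrow> nat set \<Rightarrow> bool" where
  "connected_on G V E \<longleftrightarrow> (\<forall>u \<in> V. \<forall>v \<in> V. (adj G E)\<^sup>*\<^sup>* u v)"

text \<open>Growing a tree leaf by leaf provides the induction behind the vertex count,
  connectedness, contractibility and the depth-first numbering.\<close>

inductive is_tree :: "graph \<Rightarrow> nat set \<Rightarrow> nat set \<Rightarrow> bool" for G where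
  single: "is_tree G {v} {}"
| leaf: "\<lbrakk>is_tree G V E; e \<notin> E; u \<in> V; w \<notin> V; att0 G e = u \<and> att1 G e = w \<or> att0 G e = w \<and> att1 G e = u\<rbrakk>
    \<Longrightarrow> is_tree G (insert w V) (insert e E)"

lemma adj_sym: "adj G E u v \<Longrightarrow> adj G E v u"
  by (auto simp: adj_def)

lemma adj_mono: "adj G E u v \<Longrightarrow> E \<subseteq> E' \<Longrightarrow> adj G E' u v"
  by (auto simp: adj_def)

lemma rtranclp_adj_sym: "(adj G E)\<^sup>*\<^sup>* u v \<Longrightarrow> (adj G E)\<^sup>*\<^sup>* v u"
  by (metis adj_sym symp_def symp_rtranclp)

lemma is_tree_props:
  assumes "is_tree G V E"
  shows "finite V" "finite E" "V \<noteq> {}" "card V = Suc (card E)" "is_graph (subgraph G V E)"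
  using assms by (induction) (auto simp: is_graph_def)

lemma is_tree_connected:
  assumes "is_tree G V E"
  shows "connected_on G V E"
  using assms
proof induction
  case (leaf V E e u w)
  have old: "(adj G (insert e E))\<^sup>*\<^sup>* a b" if "a \<in> V" "b \<in> V" for a b
  proof -
    have "(adj G E)\<^sup>*\<^sup>* a b"
      using leaf.IH that by (auto simp: connected_on_def)
    then show ?thesis
      by (rule rtranclp_mono[THEN predicate2D, rotated]) (auto intro: adj_mono)
  qed
  have "adj G (insert e E) u w"
    using leaf.hyps by (auto simp: adj_def)
  then have new: "(adj G (insert e E))\<^sup>*\<^sup>* a w" if "a \<in> V" for a
    using old[OF that \<open>u \<in> V\<close>] by (meson rtranclp.rtrancl_into_rtrancl)
  then have new': "(adj G (insert e E))\<^sup>*\<^sup>* w a" if "a \<in> V" for a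
    using that rtranclp_adj_sym by blast
  show ?case
    using old new new' by (auto simp: connected_on_def)
qed (auto simp: connected_on_def)

text \<open>A subtree with the largest number of vertices is spanning: a path from it to a missing
  vertex has a first edge that leaves it, and this edge could be added as a leaf.\<close>

lemma spanning_tree_exists:
  assumes con: "connected_on G V E" and S: "is_graph (subgraph G V E)" and "V \<noteq> {}"
  obtains E0 where "E0 \<subseteq> E" "is_tree G V E0"
proof -
  obtain v where v: "v \<in> V"
    using \<open>V \<noteq> {}\<close> by blast
  have fin: "finite V"
    using S by (auto simp: is_graph_def)
  define P where "P V' \<longleftrightarrow> V' \<subseteq> V \<and> (\<exists>E' \<subseteq> E. is_tree G V' E')" for V'
  have "P {v}"
    using v is_tree.single by (auto simp: P_def)
  moreover have "\<forall>V'. P V' \<longrightarrow> card V' < Suc (card V)"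
    using fin by (auto simp: P_def card_mono less_Suc_eq_le)
  ultimately obtain V' where V': "P V'" "\<And>V''. P V'' \<Longrightarrow> card V'' \<le> card V'"
    using ex_has_greatest_nat[of P "{v}" card "Suc (card V)"] by blast
  then obtain E' where E': "V' \<subseteq> V" "E' \<subseteq> E" "is_tree G V' E'"
    by (auto simp: P_def)
  have "V' = V"
  proof (rule ccontr)
    assume "V' \<noteq> V"
    then obtain b where b: "b \<in> V" "b \<notin> V'"
      using E' by blast
    obtain a where a: "a \<in> V'"
      using is_tree_props(3)[OF E'(3)] by blast
    have "(adj G E)\<^sup>*\<^sup>* a b"
      using con a b E' by (auto simp: connected_on_def)
    then have "b \<in> V' \<or> (\<exists>u w. u \<in> V' \<and> w \<notin> V' \<and> adj G E u w)"
      using a by (induction) auto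
    then obtain u w where uw: "u \<in> V'" "w \<notin> V'" "adj G E u w"
      using b by blast
    then obtain e where e: "e \<in> E" "att0 G e = u \<and> att1 G e = w \<or> att0 G e = w \<and> att1 G e = u"
      by (auto simp: adj_def)
    have "e \<notin> E'"
      using uw e is_tree_props(5)[OF E'(3)] by (auto simp: is_graph_def)
    then have "is_tree G (insert w V') (insert e E')"
      using E'(3) uw e by (intro is_tree.leaf[of _ _ _ _ u])
    moreover have "w \<in> V"
      using e S by (auto simp: is_graph_def)
    ultimately have "P (insert w V')"
      using E' e(1) unfolding P_def by (intro conjI exI[of _ "insert e E'"]) auto
    then show False
      using V'(2)[of "insert w V'"] uw(2) is_tree_props(1)[OF E'(3)] by simp
  qed
  then show ?thesis
    using that E' by blast
qed

lemma continuous_map_into_graph_space: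
  assumes "e \<in> edges G" "continuous_on S \<sigma>" "\<sigma> ` S \<subseteq> {0..1}"
  shows "continuous_map (top_of_set S) (graph_space G) (\<lambda>x. char_map G e (\<sigma> x))"
  using continuous_map_compose[OF _ continuous_map_char_map[OF assms(1)], of "top_of_set S" \<sigma>] assms(2,3)
  by (auto simp: o_def)

text \<open>Shrinking the last edge to its old end \<open>u\<close> exhibits the tree as homotopy
  dominated by the tree without the leaf.\<close>

lemma is_tree_contractible:
  assumes "is_tree G V E"
  shows "contractible_space (graph_space (subgraph G V E))"
  using assms
proof induction
  case (single v)
  have "points (subgraph G {v} {}) \<subseteq> {Vertex v}"
    by (auto simp: points_def)
  then show ?case
    by (metis contractible_space_subset_singleton topspace_graph_space)
next
  case (leaf V E e u w)
  let ?S = "subgraph G V E" and ?S' = "subgraph G (insert w V) (insert e E)"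
  have gS: "is_graph ?S" and gS': "is_graph ?S'"
    using is_tree_props(5)[OF leaf.hyps(1)] is_tree_props(5)[OF is_tree.leaf[OF leaf.hyps]] .
  have sub: "subtopology (graph_space ?S') (points ?S) = graph_space ?S"
    using subtopology_subgraph[OF gS', of V E] gS by (auto simp: subgraph_def)
  have "u \<noteq> w"
    using leaf.hyps by blast
  \<comment> \<open>In the coordinate \<open>fl\<close>, the new edge starts at the old vertex
    \<open>u\<close> and ends at the leaf \<open>w\<close>, whichever way it is attached.\<close>
  obtain fl :: "real \<Rightarrow> real" where fl: "fl = (\<lambda>t. t) \<or> fl = (\<lambda>t. 1 - t)"
    "char_map G e (fl 0) = Vertex u" "char_map G e (fl 1) = Vertex w"
  proof (cases "att0 G e = u \<and> att1 G e = w")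
    case True
    then show ?thesis
      by (intro that[of "\<lambda>t. t"]) auto
  next
    case False
    then show ?thesis
      using leaf.hyps(5) by (intro that[of "\<lambda>t. 1 - t"]) auto
  qed
  have fl': "fl (fl t) = t" "0 \<le> t \<Longrightarrow> t \<le> 1 \<Longrightarrow> 0 \<le> fl t \<and> fl t \<le> 1" "continuous_on A fl" for t A
    using fl(1) by (auto intro!: continuous_intros)
  have fl_end: "fl t = 0 \<and> char_map G e t = Vertex u \<or> fl t = 1 \<and> char_map G e t = Vertex w"
    if "t = 0 \<or> t = 1" for t
    using that fl by (auto simp del: char_map_simps)
  \<comment> \<open>A point at coordinate \<open>fl t\<close> on the new edge is moved to
    \<open>\<tau> * fl t\<close>: the identity at time 1, the retraction onto the smaller tree at
    time 0.\<close>
  define k where "k = (\<lambda>(\<tau> :: real, x). case x of Vertex v \<Rightarrow> if v = w then char_map G e (fl \<tau>) else Vertex v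
    | Interior e' t \<Rightarrow> if e' = e then char_map G e (fl (\<tau> * fl t)) else Interior e' t)"
  have k_e: "k (\<tau>, char_map G e t) = char_map G e (fl (\<tau> * fl t))" if "0 \<le> t" "t \<le> 1" for \<tau> t
  proof (cases "t = 0 \<or> t = 1")
    case True
    then show ?thesis
      using fl_end[OF True] fl(2) \<open>u \<noteq> w\<close> by (auto simp: k_def simp del: char_map_simps)
  next
    case False
    then show ?thesis
      using that by (simp add: k_def char_map_Interior)
  qed
  have k_e': "k (\<tau>, char_map G e' t) = char_map G e' t" if "e' \<in> E" for \<tau> e' t
    using that leaf.hyps gS att_in_verts[OF gS, of e'] by (auto simp: k_def char_map_def)
  have prod_le: "0 \<le> a * b \<and> a * b \<le> 1" if "0 \<le> a" "a \<le> 1" "0 \<le> b" "b \<le> 1" for a b :: real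
    using that by (simp add: mult_le_one)
  have contk: "continuous_map (prod_topology (top_of_set {0..1}) (graph_space ?S')) (graph_space ?S') k"
  proof (rule continuous_map_from_prod_graph_space[OF gS'])
    fix v assume v: "v \<in> verts ?S'"
    have "continuous_map (top_of_set {0..1}) (graph_space ?S') (\<lambda>\<tau>. char_map ?S' e (fl \<tau>))"
      by (rule continuous_map_into_graph_space) (use fl' in auto)
    moreover have "continuous_map (top_of_set {0..1}) (graph_space ?S') (\<lambda>\<tau> :: real. Vertex v)"
      using v gS' by (simp add: topspace_graph_space)
    ultimately show "continuous_map (top_of_set {0..1}) (graph_space ?S') (\<lambda>\<tau>. k (\<tau>, Vertex v))"
      by (cases "v = w") (auto simp: k_def)
  next
    fix e' assume e': "e' \<in> edges ?S'"
    show "continuous_map (top_of_set ({0..1} \<times> {0..1})) (graph_space ?S')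
        (\<lambda>(\<tau>, t). k (\<tau>, char_map ?S' e' t))"
    proof (cases "e' = e")
      case True
      have "continuous_map (top_of_set ({0..1} \<times> {0..1})) (graph_space ?S')
          (\<lambda>z. char_map ?S' e (fl (fst z * fl (snd z))))"
      proof (rule continuous_map_into_graph_space)
        show "continuous_on ({0..1} \<times> {0..1}) (\<lambda>z. fl (fst z * fl (snd z)))"
          using fl(1) by (auto intro!: continuous_intros)
        show "(\<lambda>z. fl (fst z * fl (snd z))) ` ({0..1} \<times> {0..1}) \<subseteq> {0..1}"
          using fl'(2) prod_le by fastforce
      qed auto
      then show ?thesis
        by (rule continuous_map_eq) (auto simp: k_e True)
    next
      case False
      then have "e' \<in> E"
        using e' by simp
      have "continuous_map (top_of_set ({0..1} \<times> {0..1})) (graph_space ?S')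
          (\<lambda>z. char_map ?S' e' (snd z))"
        by (rule continuous_map_into_graph_space) (use e' in \<open>auto intro!: continuous_intros\<close>)
      then show ?thesis
        by (rule continuous_map_eq) (auto simp: k_e' \<open>e' \<in> E\<close>)
    qed
  qed
  define r where "r x = k (0, x)" for x
  have k1: "k (1, x) = x" if "x \<in> points ?S'" for x
    using that gS'
  proof (cases rule: points_cases)
    case (Interior e' t)
    then show ?thesis
      by (auto simp: k_def fl'(1) char_map_Interior)
  qed (use fl in \<open>auto simp: k_def simp del: char_map_simps\<close>)
  have r_in: "r x \<in> points ?S" if "x \<in> points ?S'" for x
    using that gS'
  proof (cases rule: points_cases)
    case (Vertex v)
    then show ?thesis
      using gS fl leaf.hyps(3) by (auto simp: r_def k_def simp del: char_map_simps)
  next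
    case (Interior e' t)
    then show ?thesis
      using gS fl leaf.hyps(3) by (auto simp: r_def k_def simp del: char_map_simps)
  qed
  have hom: "homotopic_with (\<lambda>_. True) (graph_space ?S') (graph_space ?S') (id \<circ> r) id"
    using contk k1 by (subst homotopic_with) (auto simp: r_def topspace_graph_space intro!: exI[of _ k])
  have "continuous_map (graph_space ?S') (graph_space ?S') r"
    using homotopic_with_imp_continuous_maps[OF hom] by simp
  then have r: "continuous_map (graph_space ?S') (graph_space ?S) r"
    using r_in sub by (metis continuous_map_into_subtopology image_subsetI topspace_graph_space image_subset_iff_funcset)
  have i: "continuous_map (graph_space ?S) (graph_space ?S') id"
    using sub by (metis continuous_map_from_subtopology continuous_map_id)
  show ?case
    using homotopy_dominated_contractibility[OF i r hom leaf.IH] .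
qed

text \<open>The vertices reachable from \<open>u\<close>, with the edges between them, have a
  locally constant characteristic function, which must be constant on a connected space.\<close>

lemma connected_space_imp_connected_on:
  assumes G: "is_graph G" and con: "connected_space (graph_space G)"
  shows "connected_on G (verts G) (edges G)"
  unfolding connected_on_def
proof (intro ballI)
  fix u v assume uv: "u \<in> verts G" "v \<in> verts G"
  define A where "A = {x. (adj G (edges G))\<^sup>*\<^sup>* u x}"
  have A: "att0 G e \<in> A \<longleftrightarrow> att1 G e \<in> A" if "e \<in> edges G" for e
  proof -
    have "adj G (edges G) (att0 G e) (att1 G e)" "adj G (edges G) (att1 G e) (att0 G e)"
      using that by (auto simp: adj_def)
    then show ?thesis
      unfolding A_def mem_Collect_eq by (meson rtranclp.rtrancl_into_rtrancl)
  qed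
  define f where "f x = (case x of Vertex x \<Rightarrow> x \<in> A | Interior e _ \<Rightarrow> att0 G e \<in> A)" for x
  have "(\<lambda>t. f (char_map G e t)) = (\<lambda>_. att0 G e \<in> A)" if "e \<in> edges G" for e
    using A[OF that] by (auto simp: f_def char_map_def)
  then have "continuous_map (graph_space G) (discrete_topology UNIV) f"
    by (simp add: continuous_map_from_graph_space[OF G])
  then have "connectedin (discrete_topology UNIV) (f ` topspace (graph_space G))"
    using con connectedin_continuous_map_image connectedin_topspace by blast
  then obtain b where "f ` points G \<subseteq> {b}"
    by (auto simp: connectedin_discrete_topology topspace_graph_space)
  then have "f (Vertex u) = b" "f (Vertex v) = b"
    using uv G by (simp_all add: image_subset_iff)
  then have "f (Vertex u) = f (Vertex v)"
    by simp
  then show "(adj G (edges G))\<^sup>*\<^sup>* u v"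
    by (auto simp: f_def A_def)
qed

text \<open>Two logarithms of the same function differ by integral multiples of
  \<open>2 * pi * \<i>\<close>, and a continuous function with such a discrete range is constant on
  a connected set.\<close>

lemma logarithm_difference_constant:
  fixes f g :: "'a::topological_space \<Rightarrow> complex"
  assumes "connected S" "continuous_on S f" "continuous_on S g" "\<And>x. x \<in> S \<Longrightarrow> exp (f x) = exp (g x)"
    and "x \<in> S" "y \<in> S"
  shows "f x - g x = f y - g y"
proof -
  have "(\<lambda>x. f x - g x) constant_on S"
  proof (rule continuous_discrete_range_constant)
    show "continuous_on S (\<lambda>x. f x - g x)"
      using assms by (intro continuous_intros)
    have int: "\<exists>n :: int. f x - g x = of_int (2 * n) * pi * \<i>" if "x \<in> S" for x
      using assms(4)[OF that] exp_eq[of "f x" "g x"] by (auto simp: algebra_simps)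
    show "\<exists>e>0. \<forall>y. y \<in> S \<and> f y - g y \<noteq> f x - g x \<longrightarrow> e \<le> norm ((f y - g y) - (f x - g x))"
      if xS: "x \<in> S" for x
    proof (intro exI[of _ 1] conjI allI impI)
      fix y assume y: "y \<in> S \<and> f y - g y \<noteq> f x - g x"
      obtain m n :: int where mn: "f x - g x = of_int (2 * m) * pi * \<i>" "f y - g y = of_int (2 * n) * pi * \<i>"
        using int[OF xS] int[of y] y by blast
      then have eq: "(f y - g y) - (f x - g x) = of_real (2 * pi * of_int (n - m)) * \<i>"
        by (simp add: algebra_simps)
      have "n \<noteq> m"
        using y mn by auto
      then have "1 \<le> \<bar>real_of_int (n - m)\<bar>"
        by linarith
      then have "2 * pi * 1 \<le> 2 * pi * \<bar>real_of_int (n - m)\<bar>"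
        by (intro mult_left_mono) auto
      then have "1 \<le> 2 * pi * \<bar>real_of_int (n - m)\<bar>"
        using pi_gt3 by linarith
      then show "1 \<le> norm ((f y - g y) - (f x - g x))"
        unfolding eq by (simp add: norm_mult abs_mult flip: of_int_diff)
    qed simp
  qed (rule assms(1))
  then show ?thesis
    using assms(5,6) by (auto simp: constant_on_def)
qed

text \<open>An edge outside of a spanning tree closes up to a loop which winds once around the circle
  obtained by collapsing all other edges.\<close>

lemma contractible_imp_is_tree:
  assumes G: "is_graph G" and ctr: "contractible_space (graph_space G)" and ne: "verts G \<noteq> {}"
  shows "is_tree G (verts G) (edges G)"
proof -
  have [simp]: "subgraph G (verts G) (edges G) = G"
    by (simp add: subgraph_def)
  have con: "connected_on G (verts G) (edges G)"
    using connected_space_imp_connected_on[OF G contractible_imp_connected_space[OF ctr]] .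
  obtain E0 where E0: "E0 \<subseteq> edges G" "is_tree G (verts G) E0"
    using spanning_tree_exists[OF con] G ne by auto
  have "edges G \<subseteq> E0"
  proof (rule ccontr)
    assume "\<not> edges G \<subseteq> E0"
    then obtain e where e: "e \<in> edges G" "e \<notin> E0"
      by blast
    let ?S = "subgraph G (verts G) E0"
    have S: "is_graph ?S"
      using is_tree_props[OF E0(2)] by simp
    have "path_connected_space (graph_space ?S)"
      using contractible_imp_path_connected_space[OF is_tree_contractible[OF E0(2)]] .
    moreover have "Vertex (att0 G e) \<in> points ?S" "Vertex (att1 G e) \<in> points ?S"
      using S att_in_verts[OF G e(1)] by auto
    ultimately obtain g where g: "pathin (graph_space ?S) g" "g 0 = Vertex (att1 G e)" "g 1 = Vertex (att0 G e)"
      unfolding path_connected_space_def topspace_graph_space by metis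
    have gS: "g t \<in> points ?S" if "0 \<le> t" "t \<le> 1" for t
      using path_image_subset_topspace[OF g(1)] that by (auto simp: topspace_graph_space)
    have "subtopology (graph_space G) (points ?S) = graph_space ?S"
      using subtopology_subgraph[OF G S] E0 by auto
    then have g': "continuous_map (top_of_set {0..1}) (graph_space G) g"
      using g(1) by (metis continuous_map_in_subtopology pathin_def)
    \<comment> \<open>The path \<open>g\<close> through the spanning tree closes \<open>e\<close> to
      a loop. The map \<open>p\<close> to the unit circle goes around once along \<open>e\<close>
      and is 1 elsewhere.\<close>
    define p where "p x = (case x of Interior e' t \<Rightarrow> if e' = e then exp (2 * pi * \<i> * of_real t) else 1
      | Vertex _ \<Rightarrow> 1)" for x
    have p_e: "p (char_map G e t) = exp (2 * pi * \<i> * of_real t)" for t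
      by (auto simp: p_def char_map_def)
    have p_e': "p (char_map G e' t) = 1" if "e' \<noteq> e" for e' t
      using that by (auto simp: p_def char_map_def)
    have contp: "continuous_map (graph_space G) euclidean p"
      unfolding continuous_map_from_graph_space[OF G]
    proof (intro conjI ballI)
      fix e' assume "e' \<in> edges G"
      show "continuous_map (top_of_set {0..1}) euclidean (\<lambda>t. p (char_map G e' t))"
        by (cases "e' = e") (auto simp: p_e p_e' intro!: continuous_intros)
    qed auto
    have p_nz: "p x \<noteq> 0" for x
      by (auto simp: p_def split: point.splits)
    have p_S: "p x = 1" if "x \<in> points ?S" for x
      using that S by (cases rule: points_cases) (use e in \<open>auto simp: p_def\<close>)
    obtain a h where h: "continuous_map (prod_topology (top_of_set {0..1 :: real}) (graph_space G)) (graph_space G) h"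
      "\<And>x. h (0, x) = x" "\<And>x. h (1, x) = a"
      using ctr unfolding contractible_space_def homotopic_with_def by (auto simp: id_def)
    let ?Q = "{0..1 :: real} \<times> {0..1 :: real}"
    \<comment> \<open>Along either piece of the loop, the contraction \<open>h\<close> followed by
      \<open>p\<close> gives a nowhere vanishing function on a square, which has a continuous
      logarithm.\<close>
    have log: "\<exists>\<theta>. continuous_on ?Q \<theta> \<and> (\<forall>\<tau>\<in>{0..1}. \<forall>t\<in>{0..1}. p (h (\<tau>, c t)) = exp (\<theta> (\<tau>, t)))"
      if c: "continuous_map (top_of_set {0..1}) (graph_space G) c" for c
    proof -
      have fs: "continuous_map (top_of_set ?Q) (top_of_set {0..1 :: real}) fst"
        "continuous_map (top_of_set ?Q) (top_of_set {0..1 :: real}) snd"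
        by (auto simp: continuous_on_fst continuous_on_snd continuous_on_id)
      have "continuous_map (top_of_set ?Q) (prod_topology (top_of_set {0..1}) (graph_space G)) (\<lambda>z. (fst z, c (snd z)))"
        using fs continuous_map_compose[OF fs(2) c] by (auto simp: continuous_map_pairwise o_def)
      from continuous_map_compose[OF continuous_map_compose[OF this h(1)] contp]
      have "continuous_on ?Q (\<lambda>z. p (h (fst z, c (snd z))))"
        by (simp add: o_def)
      moreover have "contractible ?Q"
        by (intro convex_imp_contractible convex_Times) auto
      ultimately obtain \<theta> where "continuous_on ?Q \<theta>" "\<And>z. z \<in> ?Q \<Longrightarrow> p (h (fst z, c (snd z))) = exp (\<theta> z)"
        using continuous_logarithm_on_contractible[of ?Q "\<lambda>z. p (h (fst z, c (snd z)))"] p_nz by blast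
      then show ?thesis
        by (intro exI[of _ \<theta>]) auto
    qed
    obtain \<theta>1 where \<theta>1: "continuous_on ?Q \<theta>1"
      "\<And>\<tau> t. 0 \<le> \<tau> \<Longrightarrow> \<tau> \<le> 1 \<Longrightarrow> 0 \<le> t \<Longrightarrow> t \<le> 1 \<Longrightarrow> exp (\<theta>1 (\<tau>, t)) = p (h (\<tau>, char_map G e t))"
      using log[OF continuous_map_char_map[OF e(1)]] by auto
    obtain \<theta>2 where \<theta>2: "continuous_on ?Q \<theta>2"
      "\<And>\<tau> t. 0 \<le> \<tau> \<Longrightarrow> \<tau> \<le> 1 \<Longrightarrow> 0 \<le> t \<Longrightarrow> t \<le> 1 \<Longrightarrow> exp (\<theta>2 (\<tau>, t)) = p (h (\<tau>, g t))"
      using log[OF g'] by auto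
    have side: "continuous_on {0..1} (\<lambda>s. \<theta> (a s, b s))"
      if "continuous_on ?Q \<theta>" "continuous_on {0..1} a" "continuous_on {0..1} b" "a ` {0..1} \<subseteq> {0..1}" "b ` {0..1} \<subseteq> {0..1}"
      for \<theta> :: "real \<times> real \<Rightarrow> complex" and a b :: "real \<Rightarrow> real"
      by (rule continuous_on_compose2[OF that(1)]) (use that in \<open>auto intro!: continuous_intros\<close>)
    have diff: "f 0 - f' 0 = f 1 - f' 1"
      if "continuous_on {0..1} f" "continuous_on {0..1} f'" "\<And>x. 0 \<le> x \<Longrightarrow> x \<le> 1 \<Longrightarrow> exp (f x) = exp (f' x)"
      for f f' :: "real \<Rightarrow> complex"
      by (rule logarithm_difference_constant[of "{0..1}"]) (use that in auto)
    \<comment> \<open>The logarithms are compared along the sides of the two squares. At time 0 the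
      logarithm grows by \<open>2 * pi * \<i>\<close> along \<open>e\<close> and is constant along
      \<open>g\<close>; at time 1 both are constant; and the traces of the two common end points
      belong to both squares. Going around, the growth along \<open>e\<close> would have to be
      0.\<close>
    have turn: "\<theta>1 (0, 0) - 2 * pi * \<i> * of_real 0 = \<theta>1 (0, 1) - 2 * pi * \<i> * of_real 1"
      by (rule diff) (auto intro!: side \<theta>1(1) continuous_intros simp: \<theta>1(2) h(2) p_e)
    have f1: "\<theta>1 (1, 0) - \<theta>1 (1, 0) = \<theta>1 (1, 1) - \<theta>1 (1, 0)"
      by (rule diff) (auto intro!: side \<theta>1(1) continuous_intros simp: \<theta>1(2) h(3))
    have f2: "\<theta>2 (0, 0) - 0 = \<theta>2 (0, 1) - 0"
      by (rule diff) (auto intro!: side \<theta>2(1) continuous_intros simp: \<theta>2(2) h(2) p_S gS)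
    have f3: "\<theta>2 (1, 0) - \<theta>2 (1, 0) = \<theta>2 (1, 1) - \<theta>2 (1, 0)"
      by (rule diff) (auto intro!: side \<theta>2(1) continuous_intros simp: \<theta>2(2) h(3))
    have f4: "\<theta>1 (0, 1) - \<theta>2 (0, 0) = \<theta>1 (1, 1) - \<theta>2 (1, 0)"
      by (rule diff) (auto intro!: side \<theta>1(1) \<theta>2(1) continuous_intros simp: \<theta>1(2) \<theta>2(2) g)
    have f5: "\<theta>1 (0, 0) - \<theta>2 (0, 1) = \<theta>1 (1, 0) - \<theta>2 (1, 1)"
      by (rule diff) (auto intro!: side \<theta>1(1) \<theta>2(1) continuous_intros simp: \<theta>1(2) \<theta>2(2) g)
    have "\<theta>1 (0, 0) = \<theta>1 (1, 0) - \<theta>2 (1, 1) + \<theta>2 (0, 1)"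
      using f5 by (metis diff_add_cancel)
    also have "\<dots> = \<theta>1 (1, 1) - \<theta>2 (1, 0) + \<theta>2 (0, 0)"
      using f1 f2 f3 by simp
    also have "\<dots> = \<theta>1 (0, 1)"
      using f4 by (metis diff_add_cancel)
    finally have "\<theta>1 (0, 0) = \<theta>1 (0, 1)" .
    then show False
      using turn by simp
  qed
  then show ?thesis
    using E0 by (metis subset_antisym)
qed

section \<open>Combinatorial description of contractions\<close>

text \<open>The representative that is linear on edges. The orientation \<open>fl\<close> is
  separate data because the map on vertices does not see it if the target edge is a loop.\<close>

fun std_map :: "graph \<Rightarrow> (nat \<Rightarrow> nat) \<Rightarrow> (nat \<Rightarrow> nat option) \<Rightarrow> (nat \<Rightarrow> bool) \<Rightarrow>
    point \<Rightarrow> point" where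
  "std_map G fv fe fl (Vertex v) = Vertex (fv v)"
| "std_map G fv fe fl (Interior e t) = (case fe e of None \<Rightarrow> Vertex (fv (att0 G e))
    | Some e' \<Rightarrow> Interior e' (if fl e then 1 - t else t))"

definition graph_hom ::
  "graph \<Rightarrow> graph \<Rightarrow> (nat \<Rightarrow> nat) \<Rightarrow> (nat \<Rightarrow> nat option) \<Rightarrow> (nat \<Rightarrow> bool) \<Rightarrow> bool" where
  "graph_hom G H fv fe fl \<longleftrightarrow> fv ` verts G \<subseteq> verts H \<and> (\<forall>e \<in> edges G. case fe e of
      None \<Rightarrow> fv (att0 G e) = fv (att1 G e)
    | Some e' \<Rightarrow> e' \<in> edges H \<and>
        fv (att0 G e) = (if fl e then att1 H e' else att0 H e') \<and>
        fv (att1 G e) = (if fl e then att0 H e' else att1 H e'))"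

definition fib_verts :: "graph \<Rightarrow> (nat \<Rightarrow> nat) \<Rightarrow> nat \<Rightarrow> nat set" where
  "fib_verts G fv w = {v \<in> verts G. fv v = w}"

definition fib_edges ::
  "graph \<Rightarrow> (nat \<Rightarrow> nat) \<Rightarrow> (nat \<Rightarrow> nat option) \<Rightarrow> nat \<Rightarrow> nat set" where
  "fib_edges G fv fe w = {e \<in> edges G. fe e = None \<and> fv (att0 G e) = w}"

definition edge_bijective :: "graph \<Rightarrow> graph \<Rightarrow> (nat \<Rightarrow> nat option) \<Rightarrow> bool" where
  "edge_bijective G H fe \<longleftrightarrow> (\<forall>e' \<in> edges H. \<exists>!e. e \<in> edges G \<and> fe e = Some e')"

text \<open>Given connected fibers, the last condition forces every fiber to be a tree.\<close>

definition graph_contraction ::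
  "graph \<Rightarrow> graph \<Rightarrow> (nat \<Rightarrow> nat) \<Rightarrow> (nat \<Rightarrow> nat option) \<Rightarrow> (nat \<Rightarrow> bool) \<Rightarrow> bool" where
  "graph_contraction G H fv fe fl \<longleftrightarrow> graph_hom G H fv fe fl \<and> edge_bijective G H fe \<and>
    (\<forall>w \<in> verts H. fib_verts G fv w \<noteq> {} \<and> connected_on G (fib_verts G fv w) (fib_edges G fv fe w)) \<and>
    card (edges G) + card (verts H) = card (edges H) + card (verts G)"

lemma graph_homD:
  assumes "graph_hom G H fv fe fl"
  shows "v \<in> verts G \<Longrightarrow> fv v \<in> verts H"
    "e \<in> edges G \<Longrightarrow> fe e = None \<Longrightarrow> fv (att0 G e) = fv (att1 G e)"
    "e \<in> edges G \<Longrightarrow> fe e = Some e' \<Longrightarrow> e' \<in> edges H"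
    "e \<in> edges G \<Longrightarrow> fe e = Some e' \<Longrightarrow> fv (att0 G e) = (if fl e then att1 H e' else att0 H e')"
    "e \<in> edges G \<Longrightarrow> fe e = Some e' \<Longrightarrow> fv (att1 G e) = (if fl e then att0 H e' else att1 H e')"
  using assms by (auto simp: graph_hom_def split: option.splits)

lemma std_map_char_map:
  assumes "graph_hom G H fv fe fl" "e \<in> edges G"
  shows "std_map G fv fe fl (char_map G e t) = (case fe e of None \<Rightarrow> Vertex (fv (att0 G e))
    | Some e' \<Rightarrow> char_map H e' (if fl e then 1 - t else t))"
  using graph_homD(2-)[OF assms(1,2)] by (auto simp: char_map_def split: option.splits)

lemma unit_interval_flip: "(\<lambda>t :: real. if b then 1 - t else t) ` {0..1} = {0..1}"
proof (cases b)
  case True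
  have "(\<lambda>t :: real. 1 - t) ` {0..1} = {0..1}"
    by (auto intro!: image_eqI[where x = "1 - _"])
  then show ?thesis
    using True by simp
qed auto

lemma continuous_on_flip: "continuous_on A (\<lambda>t :: real. if b then 1 - t else t)"
  by (cases b) (auto intro!: continuous_intros)

lemma std_map_closed_edge:
  assumes "graph_hom G H fv fe fl" "e \<in> edges G"
  shows "std_map G fv fe fl ` closed_edge G e =
    (case fe e of None \<Rightarrow> {Vertex (fv (att0 G e))} | Some e' \<Rightarrow> closed_edge H e')"
proof (cases "fe e")
  case None
  then have "std_map G fv fe fl ` closed_edge G e = (\<lambda>_. Vertex (fv (att0 G e))) ` {0..1 :: real}"
    unfolding closed_edge_def image_image by (intro image_cong) (simp_all add: std_map_char_map[OF assms])
  then show ?thesis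
    using None by (simp add: image_constant_conv)
next
  case (Some e')
  have "std_map G fv fe fl ` closed_edge G e = char_map H e' ` (\<lambda>t. if fl e then 1 - t else t) ` {0..1 :: real}"
    unfolding closed_edge_def image_image
    by (intro image_cong) (simp_all add: std_map_char_map[OF assms] Some)
  then show ?thesis
    using Some by (simp add: unit_interval_flip closed_edge_def)
qed

lemma very_cellular_std_map:
  assumes G: "is_graph G" and H: "is_graph H" and D: "graph_hom G H fv fe fl"
  shows "very_cellular G H (std_map G fv fe fl)"
  unfolding very_cellular_def
proof (intro conjI ballI)
  show "continuous_map (graph_space G) (graph_space H) (std_map G fv fe fl)"
    unfolding continuous_map_from_graph_space[OF G]
  proof (intro conjI ballI)
    fix v assume "v \<in> verts G"
    then show "std_map G fv fe fl (Vertex v) \<in> topspace (graph_space H)"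
      using graph_homD(1)[OF D] H by (simp add: topspace_graph_space)
  next
    fix e assume e: "e \<in> edges G"
    show "continuous_map (top_of_set {0..1}) (graph_space H) (\<lambda>t. std_map G fv fe fl (char_map G e t))"
    proof (cases "fe e")
      case None
      then show ?thesis
        using graph_homD(1)[OF D] att_in_verts[OF G e] H
        by (simp add: std_map_char_map[OF D e] topspace_graph_space)
    next
      case (Some e')
      have "continuous_map (top_of_set {0..1}) (graph_space H) (\<lambda>t. char_map H e' (if fl e then 1 - t else t))"
        using graph_homD(3)[OF D e] Some
        by (intro continuous_map_into_graph_space) (auto intro!: continuous_on_flip)
      then show ?thesis
        by (simp add: std_map_char_map[OF D e] Some)
    qed
  qed
  show "\<exists>w \<in> verts H. std_map G fv fe fl (Vertex v) = Vertex w" if "v \<in> verts G" for v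
    using graph_homD(1)[OF D that] by simp
  show "(\<exists>w\<in>verts H. std_map G fv fe fl ` closed_edge G e = {Vertex w}) \<or>
      (\<exists>e'\<in>edges H. std_map G fv fe fl ` closed_edge G e = closed_edge H e')" if e: "e \<in> edges G" for e
    using std_map_closed_edge[OF D e] graph_homD(1)[OF D] att_in_verts[OF G e] graph_homD(3)[OF D e]
    by (auto split: option.splits)
qed

lemma edge_bijectiveD:
  assumes "edge_bijective G H fe" "e' \<in> edges H"
  obtains e where "e \<in> edges G" "fe e = Some e'" "\<And>e1. e1 \<in> edges G \<Longrightarrow> fe e1 = Some e' \<Longrightarrow> e1 = e"
  using assms unfolding edge_bijective_def by (metis (no_types, lifting))

lemma fib_subgraph:
  assumes "is_graph G" "graph_hom G H fv fe fl"
  shows "is_graph (subgraph G (fib_verts G fv w) (fib_edges G fv fe w))"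
    "fib_verts G fv w \<subseteq> verts G" "fib_edges G fv fe w \<subseteq> edges G"
  using assms(1) graph_homD(2)[OF assms(2)] by (auto simp: is_graph_def fib_verts_def fib_edges_def)

lemma fiber_points_Vertex:
  assumes G: "is_graph G" and D: "graph_hom G H fv fe fl"
  shows "{x \<in> points G. std_map G fv fe fl x = Vertex w} =
    points (subgraph G (fib_verts G fv w) (fib_edges G fv fe w))" (is "?l = points ?S")
proof (intro Set.set_eqI)
  fix x
  have S: "is_graph ?S"
    using fib_subgraph(1)[OF G D] .
  show "x \<in> ?l \<longleftrightarrow> x \<in> points ?S"
    using G S by (cases x) (auto simp: fib_verts_def fib_edges_def split: option.splits)
qed

lemma fiber_points_Interior:
  assumes G: "is_graph G" and D: "graph_hom G H fv fe fl" and B: "edge_bijective G H fe"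
    and y: "e' \<in> edges H" "0 < s" "s < 1"
  obtains x where "x \<in> points G" "{x \<in> points G. std_map G fv fe fl x = Interior e' s} = {x}"
proof -
  obtain e where e: "e \<in> edges G" "fe e = Some e'"
    "\<And>e1. e1 \<in> edges G \<Longrightarrow> fe e1 = Some e' \<Longrightarrow> e1 = e"
    using edge_bijectiveD[OF B y(1)] by blast
  define x where "x = Interior e (if fl e then 1 - s else s)"
  have "x \<in> points G"
    using y e(1) G by (simp add: x_def)
  moreover have "{x \<in> points G. std_map G fv fe fl x = Interior e' s} = {x}" (is "?l = _")
  proof (intro Set.set_eqI)
    fix z
    show "z \<in> ?l \<longleftrightarrow> z \<in> {x}"
    proof (cases z)
      case (Interior e1 t)
      have "e1 = e" if "fe e1 = Some e'" "e1 \<in> edges G"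
        using e(3) that by blast
      then show ?thesis
        using G e(1,2) y Interior by (cases "fe e1") (auto simp: x_def split: if_splits)
    qed (simp add: x_def)
  qed
  ultimately show ?thesis
    using that by blast
qed

lemma fiber_eq: "fiber G f y = subtopology (graph_space G) {x \<in> points G. f x = y}"
proof -
  have "topspace (graph_space G) \<inter> {x. f x = y} = {x \<in> points G. f x = y}"
    by (auto simp: topspace_graph_space)
  then show ?thesis
    unfolding fiber_def by (metis subtopology_restrict)
qed

lemma card_contracted:
  assumes G: "is_graph G" and H: "is_graph H" and D: "graph_hom G H fv fe fl" and B: "edge_bijective G H fe"
  shows "card (edges G) = card (edges H) + (\<Sum>w\<in>verts H. card (fib_edges G fv fe w))"
    "card (verts G) = (\<Sum>w\<in>verts H. card (fib_verts G fv w))"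
proof -
  have fin: "finite (verts G)" "finite (edges G)" "finite (verts H)" "finite (edges H)"
    using G H by (auto simp: is_graph_def)
  let ?N = "{e \<in> edges G. fe e = None}" and ?S = "{e \<in> edges G. fe e \<noteq> None}"
  have "?N = (\<Union>w\<in>verts H. fib_edges G fv fe w)"
    using graph_homD(1)[OF D] att_in_verts(1)[OF G] by (auto simp: fib_edges_def)
  then have "card ?N = (\<Sum>w\<in>verts H. card (fib_edges G fv fe w))"
    using fin by (simp only:) (subst card_UN_disjoint, auto simp: fib_edges_def)
  moreover have "card ?S = card (edges H)"
  proof (rule bij_betw_same_card)
    show "bij_betw (\<lambda>e. the (fe e)) ?S (edges H)"
      unfolding bij_betw_def
    proof
      show "inj_on (\<lambda>e. the (fe e)) ?S"
      proof (rule inj_onI)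
        fix e1 e2 assume e: "e1 \<in> ?S" "e2 \<in> ?S" "the (fe e1) = the (fe e2)"
        then obtain e' where "fe e1 = Some e'" "fe e2 = Some e'"
          by (cases "fe e1"; cases "fe e2") auto
        then show "e1 = e2"
          using e B graph_homD(3)[OF D] by (auto simp: edge_bijective_def)
      qed
      show "(\<lambda>e. the (fe e)) ` ?S = edges H"
      proof (intro equalityI subsetI)
        fix e' assume "e' \<in> edges H"
        then obtain e where "e \<in> edges G" "fe e = Some e'"
          using edge_bijectiveD[OF B] by metis
        then show "e' \<in> (\<lambda>e. the (fe e)) ` ?S"
          by (intro image_eqI[of _ _ e]) auto
      qed (use graph_homD(3)[OF D] in auto)
    qed
  qed
  moreover have "card (edges G) = card ?N + card ?S"
  proof -
    have "edges G = ?N \<union> ?S" "?N \<inter> ?S = {}"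
      by blast+
    then show ?thesis
      using fin by (metis (no_types, lifting) card_Un_disjoint finite_Un)
  qed
  ultimately show "card (edges G) = card (edges H) + (\<Sum>w\<in>verts H. card (fib_edges G fv fe w))"
    by simp
  have "verts G = (\<Union>w\<in>verts H. fib_verts G fv w)"
    using graph_homD(1)[OF D] by (auto simp: fib_verts_def)
  then show "card (verts G) = (\<Sum>w\<in>verts H. card (fib_verts G fv w))"
    using fin by (subst card_UN_disjoint[symmetric]) (auto simp: fib_verts_def)
qed

text \<open>A connected fiber has a spanning tree, so it has at most one vertex more than it has
  edges. The count of all cells turns the sum of these inequalities into an equality, so each of
  them is one and every fiber is its own spanning tree. The form with counts is convenient for
  composition, the form with trees for topology.\<close>

lemma graph_contraction_iff_trees:
  assumes G: "is_graph G" and H: "is_graph H"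
  shows "graph_contraction G H fv fe fl \<longleftrightarrow> graph_hom G H fv fe fl \<and> edge_bijective G H fe \<and>
    (\<forall>w \<in> verts H. is_tree G (fib_verts G fv w) (fib_edges G fv fe w))" (is "?L \<longleftrightarrow> ?R")
proof
  assume R: ?R
  have "(\<Sum>w\<in>verts H. card (fib_verts G fv w)) = (\<Sum>w\<in>verts H. Suc (card (fib_edges G fv fe w)))"
    using R is_tree_props(4) by (intro sum.cong) auto
  then show ?L
    using R is_tree_props(3) is_tree_connected card_contracted[OF G H, of fv fe]
    by (auto simp: graph_contraction_def sum_Suc)
next
  assume L: ?L
  then have D: "graph_hom G H fv fe fl" and B: "edge_bijective G H fe"
    by (auto simp: graph_contraction_def)
  have ex: "\<exists>E0 \<subseteq> fib_edges G fv fe w. is_tree G (fib_verts G fv w) E0" if "w \<in> verts H" for w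
    using spanning_tree_exists[OF _ fib_subgraph(1)[OF G D], of w] L that
    unfolding graph_contraction_def by metis
  then obtain E0 where E0: "\<And>w. w \<in> verts H \<Longrightarrow> E0 w \<subseteq> fib_edges G fv fe w"
    "\<And>w. w \<in> verts H \<Longrightarrow> is_tree G (fib_verts G fv w) (E0 w)"
    by metis
  have fin: "finite (fib_edges G fv fe w)" for w
    using G by (auto simp: fib_edges_def is_graph_def)
  have le: "card (fib_verts G fv w) \<le> Suc (card (fib_edges G fv fe w))" if "w \<in> verts H" for w
    using card_mono[OF fin E0(1)[OF that]] is_tree_props(4)[OF E0(2)[OF that]] by simp
  have sum_eq: "(\<Sum>w\<in>verts H. card (fib_verts G fv w)) = (\<Sum>w\<in>verts H. Suc (card (fib_edges G fv fe w)))"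
    using L card_contracted[OF G H D B]
    by (simp add: graph_contraction_def sum_Suc)
  have "is_tree G (fib_verts G fv w) (fib_edges G fv fe w)" if w: "w \<in> verts H" for w
  proof -
    have "card (fib_verts G fv w) = Suc (card (fib_edges G fv fe w))"
      by (rule sum_mono_inv[OF sum_eq le w]) (use H in \<open>auto simp: is_graph_def\<close>)
    then have "card (E0 w) = card (fib_edges G fv fe w)"
      using is_tree_props(4)[OF E0(2)[OF w]] by simp
    then have "E0 w = fib_edges G fv fe w"
      using card_subset_eq[OF fin E0(1)[OF w]] by simp
    then show ?thesis
      using E0(2)[OF w] by simp
  qed
  then show ?R
    using D B by blast
qed

text \<open>The fiber over a vertex is the space of a tree, the fiber over an interior point of an
  edge is a single point.\<close>

lemma contraction_std_map:
  assumes G: "is_graph G" and H: "is_graph H" and C: "graph_contraction G H fv fe fl"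
  shows "contraction G H (morphism_class G H (std_map G fv fe fl))"
proof -
  have D: "graph_hom G H fv fe fl" and B: "edge_bijective G H fe"
    and T: "\<And>w. w \<in> verts H \<Longrightarrow> is_tree G (fib_verts G fv w) (fib_edges G fv fe w)"
    using C unfolding graph_contraction_iff_trees[OF G H] by auto
  let ?f = "std_map G fv fe fl"
  have vc: "very_cellular G H ?f"
    using very_cellular_std_map[OF G H D] .
  then have cont: "continuous_map (graph_space G) (graph_space H) ?f"
    by (simp add: very_cellular_def)
  have fib: "contractible_space (fiber G ?f y) \<and> (\<exists>x \<in> points G. ?f x = y)" if "y \<in> points H" for y
    using that H
  proof (cases rule: points_cases)
    case (Vertex w)
    let ?S = "subgraph G (fib_verts G fv w) (fib_edges G fv fe w)"
    have "fiber G ?f y = graph_space ?S"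
      unfolding fiber_eq Vertex(2) fiber_points_Vertex[OF G D]
      by (rule subtopology_subgraph[OF G fib_subgraph[OF G D]])
    moreover obtain v where "v \<in> fib_verts G fv w"
      using is_tree_props(3)[OF T[OF Vertex(1)]] by blast
    ultimately show ?thesis
      using is_tree_contractible[OF T[OF Vertex(1)]] Vertex(2) G
      by (auto simp: fib_verts_def intro!: bexI[of _ "Vertex v"])
  next
    case (Interior e' s)
    then obtain x where "x \<in> points G" "{x \<in> points G. ?f x = y} = {x}"
      using fiber_points_Interior[OF G D B] by metis
    then show ?thesis
      unfolding fiber_eq by auto
  qed
  have "?f ` points G = points H"
    using fib continuous_map_image_subset_topspace[OF cont] by (auto simp: topspace_graph_space)
  then have "smooshing_map G H ?f"
    using fib contractible_imp_connected_space by (auto simp: smooshing_map_def)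
  moreover have "?f \<in> morphism_class G H ?f"
    using vc cont by (simp add: morphism_class_def)
  ultimately show ?thesis
    using vc fib unfolding contraction_def graph_morphism_def by blast
qed

text \<open>Outside of the vertices the graph is the disjoint union of its open edges. This confines
  fibers over interior points to one edge.\<close>

lemma connectedin_subset_edge:
  assumes con: "connectedin (graph_space G) S" and S: "Interior e t \<in> S" "\<And>v. Vertex v \<notin> S"
    and G: "is_graph G"
  shows "S \<subseteq> Interior e ` {0<..<1}"
proof (rule ccontr)
  assume n: "\<not> S \<subseteq> Interior e ` {0<..<1}"
  have sub: "S \<subseteq> points G"
    using connectedin_subset_topspace[OF con] by (simp add: topspace_graph_space)
  define U where "U A = {Interior e' t | e' t. e' \<in> A \<and> 0 < t \<and> t < 1}" for A
  have op: "openin (graph_space G) (U A)" if "A \<subseteq> edges G" for A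
    unfolding openin_graph_space
  proof (intro conjI ballI)
    show "U A \<subseteq> points G"
      using that G by (auto simp: U_def)
    fix e' assume "e' \<in> edges G"
    have "{t \<in> {0..1}. char_map G e' t \<in> U A} = (if e' \<in> A then {0<..<1} else {})"
      by (auto simp: U_def char_map_def)
    then show "openin (top_of_set {0..1}) {t \<in> {0..1}. char_map G e' t \<in> U A}"
      by (auto intro: open_subset)
  qed
  have e: "e \<in> edges G" "0 < t" "t < 1"
    using S(1) sub G by auto
  have cover: "S \<subseteq> U {e} \<union> U (edges G - {e})"
  proof
    fix x assume "x \<in> S"
    with sub G show "x \<in> U {e} \<union> U (edges G - {e})"
      using S(2) by (cases x) (auto simp: U_def)
  qed
  have "openin (graph_space G) (U {e})" "openin (graph_space G) (U (edges G - {e}))"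
    using e op by auto
  moreover have "U {e} \<inter> U (edges G - {e}) \<inter> S = {}" "U {e} \<inter> S \<noteq> {}"
    using S(1) e by (auto simp: U_def)
  moreover have "U (edges G - {e}) \<inter> S \<noteq> {}"
  proof -
    have "U {e} = Interior e ` {0<..<1}"
      by (auto simp: U_def)
    then show ?thesis
      using n cover by blast
  qed
  ultimately show False
    using con cover unfolding connectedin by metis
qed

lemma connected_edge_coordinates:
  assumes con: "connectedin (graph_space G) S" and S: "S \<subseteq> Interior e ` {0<..<1}" and e: "e \<in> edges G"
    and G: "is_graph G"
  shows "connected {t. Interior e t \<in> S}"
proof -
  define c where "c x = (case x of Interior _ t \<Rightarrow> t | Vertex _ \<Rightarrow> 0)" for x
  have "continuous_map (subtopology (graph_space G) (Interior e ` {0<..<1})) euclideanreal c"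
    unfolding continuous_map_def
  proof (intro conjI allI impI)
    fix U assume "openin euclideanreal U"
    then have U: "open U"
      by simp
    have "openin (graph_space G) (Interior e ` ({0<..<1} \<inter> U))"
      unfolding openin_graph_space
    proof (intro conjI ballI)
      show "Interior e ` ({0<..<1} \<inter> U) \<subseteq> points G"
        using e G by auto
      fix e' assume "e' \<in> edges G"
      have "{t \<in> {0..1}. char_map G e' t \<in> Interior e ` ({0<..<1} \<inter> U)} =
          (if e' = e then {0<..<1} \<inter> U else {})"
        by (auto simp: char_map_def)
      then show "openin (top_of_set {0..1}) {t \<in> {0..1}. char_map G e' t \<in> Interior e ` ({0<..<1} \<inter> U)}"
        using U by (auto intro!: open_subset open_Int)
    qed
    moreover have "{x \<in> topspace (subtopology (graph_space G) (Interior e ` {0<..<1})). c x \<in> U} =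
        Interior e ` ({0<..<1} \<inter> U) \<inter> Interior e ` {0<..<1}"
      using e G by (auto simp: c_def topspace_graph_space)
    ultimately show "openin (subtopology (graph_space G) (Interior e ` {0<..<1}))
        {x \<in> topspace (subtopology (graph_space G) (Interior e ` {0<..<1})). c x \<in> U}"
      by (auto simp: openin_subtopology)
  qed simp
  moreover have "connectedin (subtopology (graph_space G) (Interior e ` {0<..<1})) S"
    using con S by (simp add: connectedin_subtopology)
  ultimately have "connectedin euclideanreal (c ` S)"
    by (rule connectedin_continuous_map_image)
  moreover have "c ` S = {t. Interior e t \<in> S}"
    using S by (force simp: c_def image_iff)
  ultimately show ?thesis
    by simp
qed

text \<open>The vertices form a closed discrete subspace.\<close>

lemma connectedin_vertices:
  assumes con: "connectedin (graph_space G) S" and S: "S \<subseteq> Vertex ` verts G" and xy: "x \<in> S" "y \<in> S"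
    and G: "is_graph G"
  shows "x = y"
proof (rule ccontr)
  assume "x \<noteq> y"
  have cl: "closedin (graph_space G) (Vertex ` A)" if "A \<subseteq> verts G" for A
    unfolding closedin_graph_space
  proof (intro conjI ballI)
    show "Vertex ` A \<subseteq> points G"
      using that G by auto
    fix e assume "e \<in> edges G"
    have "{t \<in> {0..1}. char_map G e t \<in> Vertex ` A} \<subseteq> {0, 1}"
      by (auto simp: char_map_def split: if_splits)
    then have "closed {t \<in> {0..1}. char_map G e t \<in> Vertex ` A}"
      by (intro finite_imp_closed) (rule finite_subset, auto)
    then show "closedin (top_of_set {0..1}) {t \<in> {0..1}. char_map G e t \<in> Vertex ` A}"
      by (rule closed_subset[rotated]) auto
  qed
  obtain v where v: "x = Vertex v" "v \<in> verts G"
    using S xy by auto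
  have "closedin (graph_space G) (Vertex ` {v})" "closedin (graph_space G) (Vertex ` (verts G - {v}))"
    using v by (auto intro!: cl simp del: image_insert image_empty)
  moreover have "S \<subseteq> Vertex ` {v} \<union> Vertex ` (verts G - {v})"
    using S by auto
  moreover have "Vertex ` {v} \<inter> Vertex ` (verts G - {v}) \<inter> S = {}" "Vertex ` {v} \<inter> S \<noteq> {}"
    "Vertex ` (verts G - {v}) \<inter> S \<noteq> {}"
    using xy v S \<open>x \<noteq> y\<close> by auto
  ultimately show False
    using con unfolding connectedin_closedin by metis
qed

section \<open>Pushing the outer quarters of an edge onto its ends\<close>

definition clamp01 :: "real \<Rightarrow> real" where
  "clamp01 t = max 0 (min 1 t)"

lemma clamp01_in: "0 \<le> clamp01 t" "clamp01 t \<le> 1"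
  by (auto simp: clamp01_def)

lemma continuous_on_clamp01 [continuous_intros]:
  "continuous_on A f \<Longrightarrow> continuous_on A (\<lambda>x. clamp01 (f x))"
  unfolding clamp01_def by (intro continuous_intros)

text \<open>Expansion about the midpoint by the factor \<open>1 + \<tau>\<close>, cut off at the
  ends. At time 1 the middle half of the edge covers all of it and the outer quarters sit on the
  ends; this is the origin of the constants 1/4 and 3/4 below.\<close>

definition stretch :: "real \<Rightarrow> real \<Rightarrow> real" where
  "stretch \<tau> s = clamp01 (1 / 2 + (1 + \<tau>) * (s - 1 / 2))"

definition push :: "graph \<Rightarrow> real \<Rightarrow> point \<Rightarrow> point" where
  "push G \<tau> x = (case x of Vertex v \<Rightarrow> Vertex v | Interior e s \<Rightarrow> char_map G e (stretch \<tau> s))"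

lemma stretch_ends: "0 \<le> \<tau> \<Longrightarrow> stretch \<tau> 0 = 0" "0 \<le> \<tau> \<Longrightarrow> stretch \<tau> 1 = 1" "0 \<le> s \<Longrightarrow> s \<le> 1 \<Longrightarrow> stretch 0 s = s"
  by (auto simp: stretch_def clamp01_def min_def max_def field_simps)

lemma stretch_in: "0 \<le> stretch \<tau> s" "stretch \<tau> s \<le> 1"
  by (simp_all add: stretch_def clamp01_in)

lemma continuous_on_stretch [continuous_intros]:
  "continuous_on A f \<Longrightarrow> continuous_on A g \<Longrightarrow> continuous_on A (\<lambda>x. stretch (f x) (g x))"
  unfolding stretch_def by (intro continuous_intros)

lemma push_char_map: "0 \<le> \<tau> \<Longrightarrow> push G \<tau> (char_map G e t) = char_map G e (stretch \<tau> t)"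
  by (cases "t = 0 \<or> t = 1") (auto simp: push_def stretch_ends, simp add: char_map_def)

lemma onto_unit_interval:
  fixes \<sigma> :: "real \<Rightarrow> real"
  assumes "continuous_on {0..1} \<sigma>" "\<sigma> ` {0..1} \<subseteq> {0..1}"
    and ends: "\<sigma> 0 = 0 \<and> \<sigma> 1 = 1 \<or> \<sigma> 0 = 1 \<and> \<sigma> 1 = 0"
  shows "\<sigma> ` {0..1} = {0..1}"
proof -
  have "connected (\<sigma> ` {0..1})"
    by (intro connected_continuous_image assms) auto
  moreover have "0 \<in> \<sigma> ` {0..1}" "1 \<in> \<sigma> ` {0..1}"
    using ends by (auto simp: image_iff intro: bexI[of _ 0] bexI[of _ 1])
  ultimately have "{0..1} \<subseteq> \<sigma> ` {0..1}"
    by (rule connected_contains_Icc)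
  then show ?thesis
    using assms(2) by blast
qed

text \<open>The characterization of \<open>homotopic_with\<close> by explicit homotopies asks for a
  property of maps that depends only on their values on the space.\<close>

lemma very_cellular_cong:
  assumes G: "is_graph G" and eq: "\<And>x. x \<in> points G \<Longrightarrow> h x = k x"
  shows "very_cellular G H h \<longleftrightarrow> very_cellular G H k"
proof -
  have "continuous_map (graph_space G) (graph_space H) h = continuous_map (graph_space G) (graph_space H) k"
    by (rule iffI; erule continuous_map_eq) (simp_all add: topspace_graph_space eq)
  moreover have "h ` closed_edge G e = k ` closed_edge G e" if "e \<in> edges G" for e
    using that by (intro image_cong eq) (auto simp: points_def)
  ultimately show ?thesis
    using eq G by (auto simp: very_cellular_def)
qed

lemma very_cellular_homotopic_iff:
  assumes G: "is_graph G"
  shows "very_cellular_homotopic G H f g \<longleftrightarrow>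
    (\<exists>h. continuous_map (prod_topology (top_of_set {0..1 :: real}) (graph_space G)) (graph_space H) h \<and>
      (\<forall>x \<in> points G. h (0, x) = f x) \<and> (\<forall>x \<in> points G. h (1, x) = g x) \<and>
      (\<forall>\<tau> \<in> {0..1}. very_cellular G H (\<lambda>x. h (\<tau>, x))))"
proof -
  have "very_cellular G H h \<longleftrightarrow> very_cellular G H k" if "\<And>x. x \<in> points G \<Longrightarrow> h x = k x" for h k
    using very_cellular_cong[OF G that] .
  then show ?thesis
    by (rule homotopic_with[where X = "graph_space G", unfolded topspace_graph_space])
qed

text \<open>Every stage of the expansion fixes the ends of each edge and hence, by the intermediate
  value theorem, maps the edge onto itself. So the homotopy runs through very cellular maps.\<close>

lemma homotopic_push:
  assumes H: "is_graph H"
  shows "very_cellular_homotopic H H id (push H 1)"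
proof -
  have edge: "continuous_map (top_of_set ({0..1} \<times> {0..1})) (graph_space H) (\<lambda>(\<tau>, t). push H \<tau> (char_map H e t))"
    if e: "e \<in> edges H" for e
  proof -
    have "continuous_map (top_of_set ({0..1} \<times> {0..1})) (graph_space H) (\<lambda>z. char_map H e (stretch (fst z) (snd z)))"
      using stretch_in by (intro continuous_map_into_graph_space[OF e]) (auto intro!: continuous_intros)
    then show ?thesis
      by (rule continuous_map_eq) (auto simp: push_char_map)
  qed
  have cont: "continuous_map (prod_topology (top_of_set {0..1}) (graph_space H)) (graph_space H) (\<lambda>(\<tau>, x). push H \<tau> x)"
    using edge H by (intro continuous_map_from_prod_graph_space[OF H]) (auto simp: push_def topspace_graph_space)
  have vc: "very_cellular H H (push H \<tau>)" if \<tau>: "\<tau> \<in> {0..1}" for \<tau>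
    unfolding very_cellular_def
  proof (intro conjI ballI)
    have "continuous_map (graph_space H) (graph_space H) ((\<lambda>(\<tau>, x). push H \<tau> x) \<circ> (\<lambda>x. (\<tau>, x)))"
      using \<tau> by (intro continuous_map_compose[OF _ cont]) (auto simp: continuous_map_pairwise o_def)
    then show "continuous_map (graph_space H) (graph_space H) (push H \<tau>)"
      by (simp add: o_def)
    show "\<exists>w\<in>verts H. push H \<tau> (Vertex v) = Vertex w" if "v \<in> verts H" for v
      using that by (simp add: push_def)
    show "(\<exists>w\<in>verts H. push H \<tau> ` closed_edge H e = {Vertex w}) \<or>
        (\<exists>e'\<in>edges H. push H \<tau> ` closed_edge H e = closed_edge H e')" if e: "e \<in> edges H" for e
    proof -
      have "stretch \<tau> ` {0..1} = {0..1}"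
        using \<tau> stretch_in by (intro onto_unit_interval) (auto simp: stretch_ends intro!: continuous_intros)
      then have "closed_edge H e = char_map H e ` stretch \<tau> ` {0..1}"
        by (simp add: closed_edge_def)
      also have "\<dots> = push H \<tau> ` closed_edge H e"
        using \<tau> unfolding closed_edge_def image_image by (intro image_cong) (auto simp: push_char_map)
      finally show ?thesis
        using e by metis
    qed
  qed
  show ?thesis
    unfolding very_cellular_homotopic_iff[OF H]
  proof (intro exI[of _ "\<lambda>(\<tau>, x). push H \<tau> x"] conjI ballI)
    fix x assume "x \<in> points H"
    then show "(case (0, x) of (\<tau>, x) \<Rightarrow> push H \<tau> x) = id x"
      using H by (cases rule: points_cases) (auto simp: push_def stretch_ends char_map_Interior)
  qed (use cont vc in auto)
qed

lemma stretch_mid: "stretch 1 s \<in> {0, 1} \<longleftrightarrow> s \<notin> {1/4<..<3/4}"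
  by (auto simp: stretch_def clamp01_def min_def max_def field_simps split: if_splits)

text \<open>On a closed loop there is no continuous coordinate with values in the interval, so
  \<open>f\<close> on \<open>e\<close> does not come with a path \<open>\<sigma>\<close>. On the
  middle half of \<open>e'\<close> a coordinate exists. The part of \<open>e\<close> over this half
  is an interval from \<open>a\<close> to \<open>b\<close>, as the fibers are connected, and outside
  of this interval the pushed map is constant on each side. The last conclusion says where
  \<open>e\<close> can meet a fiber over a vertex; it is used to retract these fibers.\<close>

lemma smooshed_edge:
  assumes G: "is_graph G" and H: "is_graph H" and e: "e \<in> edges G" and e': "e' \<in> edges H"
    and cont: "continuous_map (graph_space G) (graph_space H) f"
    and verts: "\<And>v. v \<in> verts G \<Longrightarrow> f (Vertex v) = Vertex (fv v) \<and> fv v \<in> verts H"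
    and onto: "f ` closed_edge G e = closed_edge H e'"
    and fib: "\<And>s. 0 < s \<Longrightarrow> s < 1 \<Longrightarrow> connected_space (fiber G f (Interior e' s))"
  obtains \<sigma> a b where "continuous_on {0..1} \<sigma>" "\<sigma> ` {0..1} \<subseteq> {0..1}"
    "\<sigma> 0 = 0 \<and> \<sigma> 1 = 1 \<or> \<sigma> 0 = 1 \<and> \<sigma> 1 = 0"
    "\<And>t. 0 \<le> t \<Longrightarrow> t \<le> 1 \<Longrightarrow> push H 1 (f (char_map G e t)) = char_map H e' (\<sigma> t)"
    "0 < a" "a < b" "b < 1"
    "\<And>t w. 0 \<le> t \<Longrightarrow> t \<le> 1 \<Longrightarrow> f (char_map G e t) = Vertex w \<Longrightarrow>
      t < a \<and> w = fv (att0 G e) \<or> b < t \<and> w = fv (att1 G e)"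
proof -
  define \<gamma> where "\<gamma> t = f (char_map G e t)" for t
  have cont_\<gamma>: "continuous_map (top_of_set {0..1}) (graph_space H) \<gamma>"
    using continuous_map_compose[OF continuous_map_char_map[OF e] cont] by (simp add: o_def \<gamma>_def[abs_def])
  have \<gamma>_im: "\<gamma> ` {0..1} = char_map H e' ` {0..1}"
    using onto by (simp add: closed_edge_def image_image \<gamma>_def)
  have \<gamma>0: "\<gamma> 0 = Vertex (fv (att0 G e))" and \<gamma>1: "\<gamma> 1 = Vertex (fv (att1 G e))"
    using verts att_in_verts[OF G e] by (auto simp: \<gamma>_def)
  have \<gamma>_cases: "(\<exists>w \<in> verts H. \<gamma> t = Vertex w) \<or> (\<exists>s. 0 < s \<and> s < 1 \<and> \<gamma> t = Interior e' s)"
    if "0 \<le> t" "t \<le> 1" for t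
  proof -
    have "\<gamma> t \<in> char_map H e' ` {0..1}"
      using that \<gamma>_im by auto
    then show ?thesis
      using att_in_verts[OF H e'] by (auto simp: char_map_def)
  qed
  have hit: "\<exists>t. 0 \<le> t \<and> t \<le> 1 \<and> \<gamma> t = Interior e' s" if "0 < s" "s < 1" for s
  proof -
    have "char_map H e' s \<in> \<gamma> ` {0..1}"
      using that unfolding \<gamma>_im by auto
    then show ?thesis
      using that by (auto simp: char_map_Interior)
  qed
  text \<open>Continuous functions on the target which see the coordinate on the middle half of \<open>e'\<close>
    and the distance to the ends of \<open>e'\<close>.\<close>
  define coord where "coord x = (case x of Interior e1 s \<Rightarrow>
      if e1 = e' then 1 / 2 + max (- s) (min (s - 1 / 2) (1 - s)) else 1 / 2 | Vertex _ \<Rightarrow> 1 / 2)" for x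
  define depth where "depth x = (case x of Interior e1 s \<Rightarrow>
      if e1 = e' then min s (1 - s) else 0 | Vertex _ \<Rightarrow> 0)" for x
  have "(\<lambda>t. coord (char_map H e1 t)) = (\<lambda>t. if e1 = e' then 1 / 2 + max (- t) (min (t - 1 / 2) (1 - t)) else 1 / 2)"
    "(\<lambda>t. depth (char_map H e1 t)) = (\<lambda>t. if e1 = e' then min t (1 - t) else 0)" for e1
    by (auto simp: coord_def depth_def char_map_def)
  then have "continuous_map (graph_space H) euclideanreal coord" "continuous_map (graph_space H) euclideanreal depth"
    unfolding continuous_map_from_graph_space[OF H] by (auto intro!: continuous_intros)
  from continuous_map_compose[OF cont_\<gamma> this(1)] continuous_map_compose[OF cont_\<gamma> this(2)]
  have cont_sg: "continuous_on {0..1} (\<lambda>t. coord (\<gamma> t))" and cont_depth: "continuous_on {0..1} (\<lambda>t. depth (\<gamma> t))"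
    by (simp_all add: o_def)
  define sg where "sg t = coord (\<gamma> t)" for t
  \<comment> \<open>Along \<open>e'\<close>, \<open>coord\<close> falls from 1/2 to 1/4, then
    follows \<open>s\<close> up to 3/4, and falls back to 1/2. Its equal values at both ends make it
    continuous on the graph even if \<open>e'\<close> is a loop.\<close>
  have coord_mid: "coord (Interior e' s) = s" if "1/4 \<le> s" "s \<le> 3/4" for s
    using that by (auto simp: coord_def min_def max_def)
  have depth_iff: "1/4 \<le> depth (Interior e' s) \<longleftrightarrow> 1/4 \<le> s \<and> s \<le> 3/4" for s
    by (auto simp: depth_def)
  define A where "A = {t \<in> {0..1}. 1/4 \<le> depth (\<gamma> t)}"
  have A_eq: "\<gamma> t = Interior e' (sg t) \<and> 1/4 \<le> sg t \<and> sg t \<le> 3/4" if "t \<in> A" for t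
  proof -
    have t: "0 \<le> t" "t \<le> 1" "1/4 \<le> depth (\<gamma> t)"
      using that by (auto simp: A_def)
    then obtain s where s: "\<gamma> t = Interior e' s"
      using \<gamma>_cases[OF t(1,2)] by (auto simp: depth_def)
    then show ?thesis
      using t(3) depth_iff[of s] coord_mid[of s] by (auto simp: sg_def)
  qed
  have A_I: "t \<in> A" if "0 \<le> t" "t \<le> 1" "\<gamma> t = Interior e' s" "1/4 \<le> s" "s \<le> 3/4" for t s
    using that depth_iff[of s] by (simp add: A_def)
  have closed_A: "closed A"
  proof -
    have "closed ({0..1} \<inter> (\<lambda>t. depth (\<gamma> t)) -` {1/4..})"
      by (intro continuous_closed_preimage cont_depth) auto
    moreover have "A = {0..1} \<inter> (\<lambda>t. depth (\<gamma> t)) -` {1/4..}"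
      by (auto simp: A_def)
    ultimately show ?thesis
      by simp
  qed
  then have compact_A: "compact A"
  proof -
    have "{0..1} \<inter> A = A"
      by (auto simp: A_def)
    then show ?thesis
      using compact_Int_closed[OF compact_Icc closed_A, of 0 1] by simp
  qed
  have cont_sgA: "continuous_on A sg"
    using cont_sg unfolding sg_def by (rule continuous_on_subset) (auto simp: A_def)
  have sg_im: "sg ` A = {1/4..3/4}"
  proof (intro equalityI subsetI)
    fix s :: real assume s: "s \<in> {1/4..3/4}"
    then obtain t where t: "0 \<le> t" "t \<le> 1" "\<gamma> t = Interior e' s"
      using hit[of s] by auto
    then have "t \<in> A"
      using s by (intro A_I) auto
    moreover have "sg t = s"
      using t s coord_mid by (simp add: sg_def)
    ultimately show "s \<in> sg ` A"
      by blast
  qed (use A_eq in auto)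
  \<comment> \<open>Vertices go to vertices, so the fiber avoids them. Being connected and meeting
    \<open>e\<close>, it lies in the open edge \<open>e\<close>, where its coordinates form a
    connected set.\<close>
  have fib_conn: "connected {t \<in> {0..1}. \<gamma> t = Interior e' s}" if s: "0 < s" "s < 1" for s
  proof -
    let ?F = "{x \<in> points G. f x = Interior e' s}"
    have F: "connectedin (graph_space G) ?F"
      using fib[OF s] unfolding fiber_eq connectedin_def by (auto simp: topspace_graph_space)
    obtain t where t: "0 \<le> t" "t \<le> 1" "\<gamma> t = Interior e' s"
      using hit[OF s] by blast
    then have "t \<noteq> 0" "t \<noteq> 1"
      using \<gamma>0 \<gamma>1 by auto
    then have "Interior e t \<in> ?F"
      using t e G by (auto simp: \<gamma>_def char_map_Interior)
    moreover have nv: "Vertex v \<notin> ?F" for v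
      using verts G by auto
    ultimately have sub: "?F \<subseteq> Interior e ` {0<..<1}"
      by (rule connectedin_subset_edge[OF F _ _ G])
    have "{t \<in> {0..1}. \<gamma> t = Interior e' s} = {t. Interior e t \<in> ?F}"
    proof (intro Set.set_eqI iffI)
      fix t assume t: "t \<in> {t \<in> {0..1}. \<gamma> t = Interior e' s}"
      then have "t \<noteq> 0" "t \<noteq> 1"
        using \<gamma>0 \<gamma>1 by auto
      then show "t \<in> {t. Interior e t \<in> ?F}"
        using t e G by (auto simp: \<gamma>_def char_map_Interior)
    next
      fix t assume t: "t \<in> {t. Interior e t \<in> ?F}"
      then show "t \<in> {t \<in> {0..1}. \<gamma> t = Interior e' s}"
        using G by (auto simp: \<gamma>_def char_map_Interior)
    qed
    then show ?thesis
      using connected_edge_coordinates[OF F sub e G] by simp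
  qed
  \<comment> \<open>A closed continuous map with connected fibers has connected preimages of
    connected sets. So the compact set \<open>A\<close> is an interval.\<close>
  have "connected (A \<inter> sg -` {1/4..3/4})"
  proof (rule connected_closed_monotone_preimage[OF cont_sgA sg_im])
    show "closedin (top_of_set {1/4..3/4}) (sg ` C)" if C: "closedin (top_of_set A) C" for C
    proof -
      have "compact C"
        using C compact_A closedin_compact by blast
      then have "compact (sg ` C)"
        using closedin_imp_subset[OF C] by (intro compact_continuous_image continuous_on_subset[OF cont_sgA])
      then show ?thesis
        using sg_im closedin_imp_subset[OF C] by (intro closed_subset) (auto intro: compact_imp_closed)
    qed
    show "connected (A \<inter> sg -` {y})" if y: "y \<in> {1/4..3/4}" for y
    proof -
      have "A \<inter> sg -` {y} = {t \<in> {0..1}. \<gamma> t = Interior e' y}"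
        using y A_eq A_I coord_mid by (auto simp: sg_def A_def)
      then show ?thesis
        using fib_conn[of y] y by simp
    qed
  qed auto
  moreover have "A \<inter> sg -` {1/4..3/4} = A"
    using sg_im by auto
  ultimately obtain a b where ab: "A = {a..b}"
    using compact_A connected_compact_interval_1 by metis
  have "A \<noteq> {}"
    using sg_im by auto
  then have "a \<le> b"
    using ab by auto
  then have aA: "a \<in> A" and bA: "b \<in> A"
    using ab by auto
  have "0 \<notin> A" "1 \<notin> A"
    using \<gamma>0 \<gamma>1 A_eq by force+
  then have a0: "0 < a" and b1: "b < 1"
    using aA bA by (auto simp: A_def order_le_less)
  have outside: "depth (\<gamma> t) < 1/4" if "0 \<le> t" "t \<le> 1" "t < a \<or> b < t" for t
    using that ab A_def by (metis (no_types, lifting) atLeastAtMost_iff mem_Collect_eq not_le)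
  \<comment> \<open>The inequality holds strictly outside of \<open>A\<close> and passes to the
    boundary points by continuity. Since both points also belong to \<open>A\<close>, their depth is
    exactly 1/4, and \<open>sg\<close> takes one of its extreme values there.\<close>
  have closed_le: "depth (\<gamma> t) \<le> 1/4" if "t = a \<or> t = b" for t
  proof -
    have cl: "closed ({0..1} \<inter> (\<lambda>t. depth (\<gamma> t)) -` {..1/4})"
      by (intro continuous_closed_preimage cont_depth) auto
    have "{0..<a} \<subseteq> {0..1} \<inter> (\<lambda>t. depth (\<gamma> t)) -` {..1/4}" "{b<..1} \<subseteq> {0..1} \<inter> (\<lambda>t. depth (\<gamma> t)) -` {..1/4}"
      using outside a0 b1 \<open>a \<le> b\<close> by (force intro: less_imp_le)+
    from closure_minimal[OF this(1) cl] closure_minimal[OF this(2) cl]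
    have "{0..a} \<subseteq> {0..1} \<inter> (\<lambda>t. depth (\<gamma> t)) -` {..1/4}" "{b..1} \<subseteq> {0..1} \<inter> (\<lambda>t. depth (\<gamma> t)) -` {..1/4}"
      using a0 b1 by (simp_all add: closure_atLeastLessThan closure_greaterThanAtMost)
    moreover have "a \<in> {0..a}" "b \<in> {b..1}"
      using a0 b1 by auto
    ultimately show ?thesis
      using that by blast
  qed
  have ends: "sg t = 1/4 \<or> sg t = 3/4" if "t = a \<or> t = b" for t
  proof -
    have "t \<in> A"
      using that aA bA by blast
    then have "\<gamma> t = Interior e' (sg t)" "1/4 \<le> sg t" "sg t \<le> 3/4"
      using A_eq by blast+
    then show ?thesis
      using closed_le[OF that] by (auto simp: depth_def min_def split: if_splits)
  qed
  have push_out: "push H 1 (\<gamma> t) \<in> Vertex ` verts H" if t: "0 \<le> t" "t \<le> 1" "t \<le> a \<or> b \<le> t" for t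
  proof -
    have d: "depth (\<gamma> t) \<le> 1/4"
      using outside[OF t(1,2)] closed_le[of t] t(3) by (auto simp: order_le_less)
    from \<gamma>_cases[OF t(1,2)] show ?thesis
    proof
      assume "\<exists>s. 0 < s \<and> s < 1 \<and> \<gamma> t = Interior e' s"
      then obtain s where s: "0 < s" "s < 1" "\<gamma> t = Interior e' s"
        by blast
      then have "stretch 1 s \<in> {0, 1}"
        using d stretch_mid[of s] by (auto simp: depth_def min_def split: if_splits)
      then show ?thesis
        using s att_in_verts[OF H e'] by (auto simp: push_def)
    qed (auto simp: push_def)
  qed
  have cont_push: "continuous_map (graph_space H) (graph_space H) (push H 1)"
    using homotopic_with_imp_continuous_maps[OF homotopic_push[OF H]] by blast
  \<comment> \<open>On these two intervals the pushed path runs in the discrete set of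
    vertices.\<close>
  have const: "push H 1 (\<gamma> t) = push H 1 (\<gamma> t')"
    if J: "J = {0..a} \<or> J = {b..1}" and tt: "t \<in> J" "t' \<in> J" for t t' J
  proof -
    have JI: "J \<subseteq> {0..1}" "connected J"
      using J a0 b1 aA bA by (auto simp: A_def)
    have "connectedin (top_of_set {0..1}) J"
      using JI by (simp add: connectedin_subtopology)
    then have "connectedin (graph_space H) ((push H 1 \<circ> \<gamma>) ` J)"
      by (rule connectedin_continuous_map_image[OF continuous_map_compose[OF cont_\<gamma> cont_push]])
    moreover have "(push H 1 \<circ> \<gamma>) ` J \<subseteq> Vertex ` verts H"
      using push_out J JI(1) by fastforce
    ultimately show ?thesis
      using connectedin_vertices[OF _ _ _ _ H] tt by (metis comp_apply imageI)
  qed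
  \<comment> \<open>Clamping the parameter to the interval from \<open>a\<close> to \<open>b\<close>
    makes the path constant before \<open>a\<close> and after \<open>b\<close>, in accordance with
    \<open>const\<close>.\<close>
  define \<sigma> where "\<sigma> t = stretch 1 (sg (max a (min b t)))" for t
  have clampA: "max a (min b t) \<in> A" for t
    using ab \<open>a \<le> b\<close> by auto
  have push_A: "push H 1 (\<gamma> t) = char_map H e' (stretch 1 (sg t))" if "t \<in> A" for t
    using A_eq[OF that] by (simp add: push_def)
  have push_\<sigma>: "push H 1 (f (char_map G e t)) = char_map H e' (\<sigma> t)" if t: "0 \<le> t" "t \<le> 1" for t
  proof -
    consider "t < a" | "t \<in> {a..b}" | "b < t"
      by force
    then have "push H 1 (\<gamma> t) = char_map H e' (\<sigma> t)"
    proof cases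
      case 1
      then have "push H 1 (\<gamma> t) = push H 1 (\<gamma> a)"
        using t a0 by (intro const[of "{0..a}"]) auto
      then show ?thesis
        using 1 \<open>a \<le> b\<close> push_A[OF aA] by (simp add: \<sigma>_def)
    next
      case 2
      then show ?thesis
        using push_A[of t] ab by (simp add: \<sigma>_def)
    next
      case 3
      then have "push H 1 (\<gamma> t) = push H 1 (\<gamma> b)"
        using t b1 by (intro const[of "{b..1}"]) auto
      then show ?thesis
        using 3 \<open>a \<le> b\<close> push_A[OF bA] by (simp add: \<sigma>_def)
    qed
    then show ?thesis
      by (simp add: \<gamma>_def)
  qed
  \<comment> \<open>Otherwise the connected fiber over the common value contains \<open>a\<close>
    and \<open>b\<close>, hence all of \<open>A\<close>, and \<open>sg\<close> is constant although
    it covers the middle half.\<close>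
  have sg_ne: "sg a \<noteq> sg b"
  proof
    assume eq: "sg a = sg b"
    define y where "y = sg a"
    have y: "y = 1/4 \<or> y = 3/4"
      using ends y_def by blast
    let ?F = "{t \<in> {0..1}. \<gamma> t = Interior e' y}"
    have "connected ?F"
      using y by (intro fib_conn) auto
    moreover have "a \<in> ?F" "b \<in> ?F"
      using A_eq[OF aA] A_eq[OF bA] eq aA bA by (auto simp: y_def A_def)
    ultimately have "{a..b} \<subseteq> ?F"
      by (rule connected_contains_Icc)
    then have "sg t = y" if "t \<in> A" for t
      using that ab A_eq[OF that] by auto
    then have "sg ` A \<subseteq> {y}"
      by blast
    then have "{1/4..3/4} \<subseteq> {y}"
      using sg_im by simp
    moreover have "1/4 \<in> {1/4..3/4::real}" "3/4 \<in> {1/4..3/4::real}"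
      by auto
    ultimately have "1/4 = y" "3/4 = y"
      by blast+
    then show False
      by simp
  qed
  have st: "stretch 1 (1/4) = 0" "stretch 1 (3/4) = 1"
    by (simp_all add: stretch_def clamp01_def)
  show thesis
  proof (rule that[of \<sigma> a b])
    show "continuous_on {0..1} \<sigma>"
      unfolding \<sigma>_def using clampA
      by (intro continuous_on_stretch continuous_on_compose2[OF cont_sgA] continuous_intros) auto
    show "\<sigma> ` {0..1} \<subseteq> {0..1}"
      using stretch_in by (auto simp: \<sigma>_def)
    show "\<sigma> 0 = 0 \<and> \<sigma> 1 = 1 \<or> \<sigma> 0 = 1 \<and> \<sigma> 1 = 0"
    proof -
      have "\<sigma> 0 = stretch 1 (sg a)" "\<sigma> 1 = stretch 1 (sg b)"
        using a0 b1 \<open>a \<le> b\<close> by (simp_all add: \<sigma>_def)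
      then show ?thesis
        using ends[of a] ends[of b] sg_ne st by metis
    qed
    show "a < b"
      using \<open>a \<le> b\<close> sg_ne by (auto simp: order_le_less)
    show "t < a \<and> w = fv (att0 G e) \<or> b < t \<and> w = fv (att1 G e)"
      if t: "0 \<le> t" "t \<le> 1" "f (char_map G e t) = Vertex w" for t w
    proof -
      have w: "\<gamma> t = Vertex w" "push H 1 (\<gamma> t) = Vertex w"
        using t by (auto simp: \<gamma>_def push_def)
      have "t \<notin> A"
        using A_eq w by force
      then consider "t < a" | "b < t"
        using ab by force
      then show ?thesis
      proof cases
        case 1
        then have "push H 1 (\<gamma> t) = push H 1 (\<gamma> 0)"
          using t by (intro const[of "{0..a}"]) auto
        then show ?thesis
          using 1 w \<gamma>0 by (simp add: push_def)
      next
        case 2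
        then have "push H 1 (\<gamma> t) = push H 1 (\<gamma> 1)"
          using t by (intro const[of "{b..1}"]) auto
        then show ?thesis
          using 2 w \<gamma>1 by (simp add: push_def)
      qed
    qed
  qed (use push_\<sigma> a0 b1 in auto)
qed

lemma closed_edge_inject:
  assumes "closed_edge G e = closed_edge G e'"
  shows "e = e'"
proof -
  have "char_map G e (1/2) \<in> closed_edge G e"
    by (simp add: closed_edge_def)
  then show ?thesis
    unfolding assms by (auto simp: closed_edge_def char_map_def split: if_splits)
qed

lemma Interior_in_closed_edge: "Interior e' s \<in> closed_edge G e \<Longrightarrow> e' = e"
  by (auto simp: closed_edge_def char_map_def split: if_splits)

lemma very_cellular_comp:
  assumes f: "very_cellular G H f" and k: "very_cellular H L k"
  shows "very_cellular G L (k \<circ> f)"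
  unfolding very_cellular_def
proof (intro conjI ballI)
  show "continuous_map (graph_space G) (graph_space L) (k \<circ> f)"
    using f k by (auto simp: very_cellular_def intro: continuous_map_compose)
  show "\<exists>w\<in>verts L. (k \<circ> f) (Vertex v) = Vertex w" if "v \<in> verts G" for v
    using that f k unfolding very_cellular_def by (metis comp_apply)
  show "(\<exists>w\<in>verts L. (k \<circ> f) ` closed_edge G e = {Vertex w}) \<or>
      (\<exists>e'\<in>edges L. (k \<circ> f) ` closed_edge G e = closed_edge L e')" if e: "e \<in> edges G" for e
  proof -
    from f e consider w where "w \<in> verts H" "f ` closed_edge G e = {Vertex w}"
      | e' where "e' \<in> edges H" "f ` closed_edge G e = closed_edge H e'"
      by (auto simp: very_cellular_def)
    then show ?thesis
    proof cases
      case 1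
      then obtain z where "z \<in> verts L" "k (Vertex w) = Vertex z"
        using k unfolding very_cellular_def by metis
      then show ?thesis
        using 1 by (metis image_comp image_empty image_insert)
    next
      case 2
      then show ?thesis
        using k unfolding very_cellular_def by (metis image_comp)
    qed
  qed
qed

text \<open>The map is deformed in two stages: first by pushing, after which each edge that is not
  collapsed follows a path \<open>\<sigma>\<close> from end to end of its target edge, then linearly
  inside of this edge. The combinatorial fibers are trees because they are retracts of the
  contractible topological ones.\<close>

lemma contraction_std_rep:
  assumes G: "is_graph G" and H: "is_graph H" and vc: "very_cellular G H f" and sm: "smooshing_map G H f"
    and ctr: "\<And>y. y \<in> points H \<Longrightarrow> contractible_space (fiber G f y)"
  obtains fv fe fl where "graph_contraction G H fv fe fl" "very_cellular_homotopic G H f (std_map G fv fe fl)"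
proof -
  have cont: "continuous_map (graph_space G) (graph_space H) f"
    and vc_e: "\<And>e. e \<in> edges G \<Longrightarrow> (\<exists>w \<in> verts H. f ` closed_edge G e = {Vertex w}) \<or>
      (\<exists>e' \<in> edges H. f ` closed_edge G e = closed_edge H e')"
    and vc_v: "\<forall>v \<in> verts G. \<exists>w. w \<in> verts H \<and> f (Vertex v) = Vertex w"
    using vc by (auto simp: very_cellular_def)
  obtain fv where fv: "\<And>v. v \<in> verts G \<Longrightarrow> f (Vertex v) = Vertex (fv v) \<and> fv v \<in> verts H"
    using bchoice[OF vc_v] by blast
  have onto: "f ` points G = points H" and con: "\<And>y. y \<in> points H \<Longrightarrow> connected_space (fiber G f y)"
    using sm by (auto simp: smooshing_map_def)
  define fe where "fe e = (if \<exists>e' \<in> edges H. f ` closed_edge G e = closed_edge H e'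
    then Some (THE e'. e' \<in> edges H \<and> f ` closed_edge G e = closed_edge H e') else None)" for e
  have fe_Some: "fe e = Some e' \<longleftrightarrow> e' \<in> edges H \<and> f ` closed_edge G e = closed_edge H e'" for e e'
  proof (cases "\<exists>e' \<in> edges H. f ` closed_edge G e = closed_edge H e'")
    case True
    then obtain e1 where e1: "e1 \<in> edges H" "f ` closed_edge G e = closed_edge H e1"
      by blast
    then have "(THE e'. e' \<in> edges H \<and> f ` closed_edge G e = closed_edge H e') = e1"
      using closed_edge_inject by (intro the_equality) auto
    then have "fe e = Some e1"
      using True by (simp add: fe_def)
    then show ?thesis
      using e1 closed_edge_inject[of H e1 e'] by auto
  qed (auto simp: fe_def)
  have fe_None: "f (char_map G e t) = Vertex (fv (att0 G e))"
    if e: "e \<in> edges G" "fe e = None" and t: "0 \<le> t" "t \<le> 1" for e t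
  proof -
    obtain w where w: "f ` closed_edge G e = {Vertex w}"
      using vc_e[OF e(1)] e(2) by (auto simp: fe_def split: if_splits)
    have "char_map G e 0 \<in> closed_edge G e" "char_map G e t \<in> closed_edge G e"
      using t by (auto simp: closed_edge_def simp del: char_map_simps)
    then have "f (char_map G e t) = f (char_map G e 0)"
      using w by (metis image_eqI singletonD)
    then show ?thesis
      using fv att_in_verts[OF G e(1)] by simp
  qed
  define good where "good e e' \<sigma> a b \<longleftrightarrow> continuous_on {0..1} \<sigma> \<and> \<sigma> ` {0..1} \<subseteq> {0..1} \<and>
    (\<sigma> 0 = 0 \<and> \<sigma> 1 = 1 \<or> \<sigma> 0 = 1 \<and> \<sigma> 1 = 0) \<and>
    (\<forall>t. 0 \<le> t \<longrightarrow> t \<le> 1 \<longrightarrow> push H 1 (f (char_map G e t)) = char_map H e' (\<sigma> t)) \<and>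
    0 < a \<and> a < b \<and> b < 1 \<and>
    (\<forall>t w. 0 \<le> t \<longrightarrow> t \<le> 1 \<longrightarrow> f (char_map G e t) = Vertex w \<longrightarrow>
      t < a \<and> w = fv (att0 G e) \<or> b < t \<and> w = fv (att1 G e))" for e e' and \<sigma> :: "real \<Rightarrow> real" and a b :: real
  have good_ex: "\<exists>\<sigma> a b. good e e' \<sigma> a b" if e: "e \<in> edges G" "fe e = Some e'" for e e'
  proof -
    have e': "e' \<in> edges H" "f ` closed_edge G e = closed_edge H e'"
      using e fe_Some by auto
    have c: "connected_space (fiber G f (Interior e' s))" if "0 < s" "s < 1" for s
      using that e' H by (intro con) simp
    show ?thesis
    proof (rule smooshed_edge[OF G H e(1) e'(1) cont fv e'(2) c], goal_cases)
      case (4 \<sigma> a b)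
      then have "good e e' \<sigma> a b"
        unfolding good_def by blast
      then show ?case
        by blast
    qed auto
  qed
  then have "\<forall>e. \<exists>\<sigma> a b. e \<in> edges G \<longrightarrow> fe e \<noteq> None \<longrightarrow> good e (the (fe e)) \<sigma> a b"
    by auto
  then obtain \<sigma> a b where good: "\<And>e. e \<in> edges G \<Longrightarrow> fe e \<noteq> None \<Longrightarrow> good e (the (fe e)) (\<sigma> e) (a e) (b e)"
    by metis
  have \<sigma>: "continuous_on {0..1} (\<sigma> e)" "\<sigma> e ` {0..1} \<subseteq> {0..1}"
      "\<sigma> e 0 = 0 \<and> \<sigma> e 1 = 1 \<or> \<sigma> e 0 = 1 \<and> \<sigma> e 1 = 0"
      "\<And>t. 0 \<le> t \<Longrightarrow> t \<le> 1 \<Longrightarrow> push H 1 (f (char_map G e t)) = char_map H e' (\<sigma> e t)"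
      "0 < a e" "a e < b e" "b e < 1"
      "\<And>t w. 0 \<le> t \<Longrightarrow> t \<le> 1 \<Longrightarrow> f (char_map G e t) = Vertex w \<Longrightarrow>
        t < a e \<and> w = fv (att0 G e) \<or> b e < t \<and> w = fv (att1 G e)"
    if "e \<in> edges G" "fe e = Some e'" for e e'
    using good[of e] that unfolding good_def by auto
  \<comment> \<open>The two ends of the target edge are told apart by the parameter values 0 and 1,
    not by the vertices there, which may coincide.\<close>
  define fl where "fl e = (\<sigma> e 0 = 1)" for e
  have D: "graph_hom G H fv fe fl"
    unfolding graph_hom_def
  proof (intro conjI ballI)
    fix e assume e: "e \<in> edges G"
    show "case fe e of None \<Rightarrow> fv (att0 G e) = fv (att1 G e)
      | Some e' \<Rightarrow> e' \<in> edges H \<and> fv (att0 G e) = (if fl e then att1 H e' else att0 H e') \<and>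
        fv (att1 G e) = (if fl e then att0 H e' else att1 H e')"
    proof (cases "fe e")
      case None
      then show ?thesis
        using fe_None[OF e None, of 1] fv att_in_verts[OF G e] by simp
    next
      case (Some e')
      have "push H 1 (f (char_map G e 0)) = char_map H e' (\<sigma> e 0)" "push H 1 (f (char_map G e 1)) = char_map H e' (\<sigma> e 1)"
        by (rule \<sigma>(4)[OF e Some], simp, simp)+
      then have "Vertex (fv (att0 G e)) = char_map H e' (\<sigma> e 0)" "Vertex (fv (att1 G e)) = char_map H e' (\<sigma> e 1)"
        using fv att_in_verts[OF G e] by (simp_all add: push_def)
      then show ?thesis
        using Some fe_Some[of e e'] \<sigma>(3)[OF e Some] by (auto simp: fl_def)
    qed
  qed (use fv in auto)
  have B: "edge_bijective G H fe"
    unfolding edge_bijective_def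
  proof
    fix e' assume e': "e' \<in> edges H"
    \<comment> \<open>The fiber over the midpoint of \<open>e'\<close> is nonempty, connected and
      free of vertices, so it lies in one open edge. Every edge mapped onto \<open>e'\<close> meets
      it.\<close>
    let ?y = "Interior e' (1/2)" and ?F = "{x \<in> points G. f x = Interior e' (1/2)}"
    have y: "?y \<in> points H"
      using e' H by simp
    have F: "connectedin (graph_space G) ?F"
      using con[OF y] unfolding fiber_eq connectedin_def by (auto simp: topspace_graph_space)
    have nv: "Vertex v \<notin> ?F" for v
      using fv G by auto
    have hit: "\<exists>t. Interior e t \<in> ?F" if "e \<in> edges G" "fe e = Some e'" for e
    proof -
      have "?y \<in> f ` closed_edge G e"
      proof -
        have "char_map H e' (1/2) \<in> closed_edge H e'"
          by (simp add: closed_edge_def)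
        then show ?thesis
          using that fe_Some[of e e'] by (simp add: char_map_Interior)
      qed
      then obtain t where t: "0 \<le> t" "t \<le> 1" "f (char_map G e t) = ?y"
        by (auto simp: closed_edge_def)
      then have "t \<noteq> 0" "t \<noteq> 1"
        using fv att_in_verts[OF G that(1)] by auto
      then show ?thesis
        using t that(1) G by (intro exI[of _ t]) (auto simp: char_map_Interior)
    qed
    obtain x where x: "x \<in> points G" "f x = ?y"
      using y onto by (metis imageE)
    from x(1) G obtain e t where e: "e \<in> edges G" "x = Interior e t" "0 < t" "t < 1"
      using x(2) fv by (cases rule: points_cases) auto
    have "?y \<in> f ` closed_edge G e"
    proof -
      have "x \<in> closed_edge G e"
        using e(3,4) unfolding e(2) closed_edge_def by (intro image_eqI[of _ _ t]) (auto simp: char_map_Interior)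
      then show ?thesis
        unfolding x(2)[symmetric] by (rule imageI)
    qed
    moreover have "?y \<notin> {Vertex w}" for w
      by simp
    ultimately obtain e'' where "e'' \<in> edges H" "f ` closed_edge G e = closed_edge H e''"
      using vc_e[OF e(1)] by metis
    then have e_e': "fe e = Some e'"
      using \<open>?y \<in> f ` closed_edge G e\<close> Interior_in_closed_edge[of e' "1/2" H e''] fe_Some by auto
    have uniq: "e1 = e" if e1: "e1 \<in> edges G" "fe e1 = Some e'" for e1
    proof -
      obtain t1 where t1: "Interior e1 t1 \<in> ?F"
        using hit[OF e1] by blast
      have "?F \<subseteq> Interior e ` {0<..<1}"
        by (rule connectedin_subset_edge[OF F _ nv G, of e t]) (use x e in auto)
      then have "Interior e1 t1 \<in> Interior e ` {0<..<1}"
        using t1 by (rule subsetD)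
      then show ?thesis
        by auto
    qed
    show "\<exists>!e. e \<in> edges G \<and> fe e = Some e'"
    proof (rule ex1I)
      show "e \<in> edges G \<and> fe e = Some e'"
        using e e_e' by blast
      show "\<And>e1. e1 \<in> edges G \<and> fe e1 = Some e' \<Longrightarrow> e1 = e"
        using uniq by blast
    qed
  qed
  \<comment> \<open>On an edge that is not collapsed, \<open>Q\<close> sends everything before
    \<open>a e\<close> and after \<open>b e\<close> to the ends and expands the rest. As such an
    edge meets a fiber over a vertex only before \<open>a e\<close> or after \<open>b e\<close>,
    \<open>Q\<close> retracts this fiber onto its vertices and collapsed edges.\<close>
  define crush where "crush e t = clamp01 ((t - a e) / (b e - a e))" for e t
  define Q where "Q x = (case x of Vertex v \<Rightarrow> Vertex v
    | Interior e t \<Rightarrow> if fe e = None then Interior e t else char_map G e (crush e t))" for x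
  have crush: "t \<le> a e \<Longrightarrow> crush e t = 0" "b e \<le> t \<Longrightarrow> crush e t = 1" if "e \<in> edges G" "fe e = Some e'" for e e' t
    using \<sigma>(5-7)[OF that] by (auto simp: crush_def clamp01_def divide_simps)
  have Q_char: "Q (char_map G e t) = (if fe e = None then char_map G e t else char_map G e (crush e t))"
    if "e \<in> edges G" for e t
  proof (cases "fe e")
    case (Some e')
    then show ?thesis
      using crush[OF that Some] \<sigma>(5-7)[OF that Some]
      by (cases "t = 0 \<or> t = 1") (auto simp: Q_def, simp add: char_map_def)
  qed (auto simp: Q_def char_map_def)
  have cont_Q: "continuous_map (graph_space G) (graph_space G) Q"
    unfolding continuous_map_from_graph_space[OF G]
  proof (intro conjI ballI)
    fix e assume e: "e \<in> edges G"
    have "continuous_map (top_of_set {0..1}) (graph_space G) (\<lambda>t. char_map G e (crush e t))"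
      using clamp01_in by (intro continuous_map_into_graph_space[OF e])
        (auto simp: crush_def[abs_def] divide_inverse intro!: continuous_intros)
    then show "continuous_map (top_of_set {0..1}) (graph_space G) (\<lambda>t. Q (char_map G e t))"
      using continuous_map_char_map[OF e] by (cases "fe e") (simp_all add: Q_char[OF e])
  qed (use G in \<open>auto simp: Q_def topspace_graph_space\<close>)
  have T: "is_tree G (fib_verts G fv w) (fib_edges G fv fe w)" if w: "w \<in> verts H" for w
  proof -
    let ?S = "subgraph G (fib_verts G fv w) (fib_edges G fv fe w)"
    let ?F = "{x \<in> points G. f x = Vertex w}"
    note S = fib_subgraph[OF G D, of w]
    have sub: "subtopology (graph_space G) (points ?S) = graph_space ?S"
      using subtopology_subgraph[OF G S] .
    have SF: "points ?S \<subseteq> ?F"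
    proof
      fix x assume "x \<in> points ?S"
      then show "x \<in> ?F"
        using S(1)
      proof (cases rule: points_cases)
        case (Vertex v)
        then show ?thesis
          using fv G by (auto simp: fib_verts_def)
      next
        case (Interior e t)
        then have "f (char_map G e t) = Vertex w"
          using fe_None[of e t] by (auto simp: fib_edges_def)
        then show ?thesis
          using Interior G by (auto simp: fib_edges_def char_map_Interior)
      qed
    qed
    have Q_S: "Q x = x" if "x \<in> points ?S" for x
      using that S(1) by (cases rule: points_cases) (auto simp: Q_def fib_edges_def)
    have Q_F: "Q x \<in> points ?S" if x: "x \<in> ?F" for x
    proof -
      from x have "x \<in> points G" "f x = Vertex w"
        by auto
      from this(1) G show ?thesis
      proof (cases rule: points_cases)
        case (Vertex v)
        then show ?thesis
          using S(1) fv \<open>f x = Vertex w\<close> by (auto simp: Q_def fib_verts_def)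
      next
        case (Interior e t)
        have ft: "f (char_map G e t) = Vertex w"
          using Interior \<open>f x = Vertex w\<close> by (simp add: char_map_Interior)
        show ?thesis
        proof (cases "fe e")
          case None
          then have "fv (att0 G e) = w"
            using fe_None[OF Interior(1) None, of t] ft Interior by simp
          then show ?thesis
            using None Interior S(1) by (auto simp: Q_def fib_edges_def)
        next
          case (Some e')
          have "t < a e \<and> w = fv (att0 G e) \<or> b e < t \<and> w = fv (att1 G e)"
            using \<sigma>(8)[OF Interior(1) Some _ _ ft] Interior by simp
          then show ?thesis
            using Some Interior S(1) crush[OF Interior(1) Some, of t] att_in_verts[OF G Interior(1)]
            by (auto simp: Q_def fib_verts_def)
        qed
      qed
    qed
    have F: "fiber G f (Vertex w) = subtopology (graph_space G) ?F"
      by (rule fiber_eq)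
    have "continuous_map (fiber G f (Vertex w)) (graph_space ?S) Q"
      unfolding F sub[symmetric] using Q_F
      by (auto simp: continuous_map_in_subtopology intro: continuous_map_from_subtopology[OF cont_Q])
    moreover have "continuous_map (graph_space ?S) (fiber G f (Vertex w)) id"
      unfolding F sub[symmetric] using SF
      by (auto simp: continuous_map_in_subtopology id_def intro: continuous_map_from_subtopology)
    ultimately have "retraction_map (fiber G f (Vertex w)) (graph_space ?S) Q"
      using Q_S unfolding retraction_map_def retraction_maps_def
      by (intro exI[of _ id]) (auto simp: topspace_graph_space)
    then have ctr_S: "contractible_space (graph_space ?S)"
      using contractible_space_retraction_map_image ctr[of "Vertex w"] w H by auto
    have "Vertex w \<in> f ` points G"
      using onto w H by simp
    then obtain x where "x \<in> ?F"
      by auto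
    then have "Q x \<in> points ?S"
      by (rule Q_F)
    then have "fib_verts G fv w \<noteq> {}"
      using S(1) by (cases rule: points_cases) (use att_in_verts(1)[OF S(1)] in auto)
    then have "is_tree ?S (verts ?S) (edges ?S)"
      using contractible_imp_is_tree[OF S(1) ctr_S] by simp
    then have "is_tree ?S (fib_verts G fv w) (fib_edges G fv fe w)"
      by simp
    then show ?thesis
    proof induction
      case (leaf V E e u w)
      then show ?case
        by (intro is_tree.leaf[of _ _ _ _ u]) auto
    qed (rule is_tree.single)
  qed
  have C: "graph_contraction G H fv fe fl"
    unfolding graph_contraction_iff_trees[OF G H] using D B T by blast
  let ?std = "std_map G fv fe fl"
  have hom1: "very_cellular_homotopic G H f (push H 1 \<circ> f)"
    using homotopic_with_compose_continuous_map_right[OF homotopic_push[OF H] cont, of "very_cellular G H"]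
      very_cellular_comp[OF vc] by simp
  \<comment> \<open>Both \<open>\<sigma> e\<close> and the linear parametrization have the same
    values at 0 and 1. So all stages between them keep the ends fixed and cover the target edge, as
    a very cellular homotopy must.\<close>
  define lin where "lin e \<tau> t = (1 - \<tau>) * \<sigma> e t + \<tau> * (if fl e then 1 - t else t)" for e \<tau> t
  define k where "k z = (case z of (\<tau>, x) \<Rightarrow> (case x of Vertex v \<Rightarrow> Vertex (fv v)
    | Interior e t \<Rightarrow> (case fe e of None \<Rightarrow> Vertex (fv (att0 G e)) | Some e' \<Rightarrow> char_map H e' (lin e \<tau> t))))" for z
  have lin_in: "0 \<le> lin e \<tau> t \<and> lin e \<tau> t \<le> 1" if "e \<in> edges G" "fe e = Some e'" "0 \<le> \<tau>" "\<tau> \<le> 1" "0 \<le> t" "t \<le> 1"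
    for e e' \<tau> t
  proof -
    have "\<sigma> e t \<in> {0..1}"
      using \<sigma>(2)[OF that(1,2)] that by (simp add: image_subset_iff)
    moreover have "(if fl e then 1 - t else t) \<in> {0..1}"
      using that by auto
    ultimately have "lin e \<tau> t \<in> {0..1}"
      unfolding lin_def using that convexD[of "{0..1::real}" _ _ "1 - \<tau>" \<tau>] by auto
    then show ?thesis
      by simp
  qed
  have lin_ends: "lin e \<tau> 0 = (if fl e then 1 else 0)" "lin e \<tau> 1 = (if fl e then 0 else 1)"
    if "e \<in> edges G" "fe e = Some e'" for e e' \<tau>
    using \<sigma>(3)[OF that] by (auto simp: lin_def fl_def)
  have k_char: "k (\<tau>, char_map G e t) = (case fe e of None \<Rightarrow> Vertex (fv (att0 G e)) | Some e' \<Rightarrow> char_map H e' (lin e \<tau> t))"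
    if e: "e \<in> edges G" for e \<tau> t
  proof (cases "fe e")
    case None
    then show ?thesis
      using graph_homD(2)[OF D e None] by (auto simp: k_def char_map_def)
  next
    case (Some e')
    then show ?thesis
      using graph_homD(4,5)[OF D e Some] lin_ends[OF e Some, of \<tau>]
      by (cases "t = 0 \<or> t = 1") (auto simp: k_def, simp add: char_map_def)
  qed
  have cont_k: "continuous_map (prod_topology (top_of_set {0..1}) (graph_space G)) (graph_space H) k"
  proof (rule continuous_map_from_prod_graph_space[OF G])
    fix v assume "v \<in> verts G"
    then show "continuous_map (top_of_set {0..1}) (graph_space H) (\<lambda>\<tau>. k (\<tau>, Vertex v))"
      using fv H by (simp add: k_def topspace_graph_space)
  next
    fix e assume e: "e \<in> edges G"
    show "continuous_map (top_of_set ({0..1} \<times> {0..1})) (graph_space H) (\<lambda>(\<tau>, t). k (\<tau>, char_map G e t))"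
    proof (cases "fe e")
      case None
      then show ?thesis
        using fv H att_in_verts[OF G e] by (simp add: k_char[OF e] topspace_graph_space case_prod_beta')
    next
      case (Some e')
      have "continuous_on ({0..1} \<times> {0..1}) (\<lambda>z. \<sigma> e (snd z))"
        by (rule continuous_on_compose2[OF \<sigma>(1)[OF e Some]]) (auto intro!: continuous_intros)
      moreover have "continuous_on ({0..1} \<times> {0..1}) (\<lambda>z. if fl e then 1 - snd z else snd z :: real)"
        by (cases "fl e") (auto intro!: continuous_intros)
      ultimately have "continuous_on ({0..1} \<times> {0..1}) (\<lambda>z. lin e (fst z) (snd z))"
        unfolding lin_def by (intro continuous_intros)
      then have "continuous_map (top_of_set ({0..1} \<times> {0..1})) (graph_space H) (\<lambda>z. char_map H e' (lin e (fst z) (snd z)))"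
        using lin_in[OF e Some] graph_homD(3)[OF D e Some] by (intro continuous_map_into_graph_space) auto
      then show ?thesis
        using Some by (simp add: k_char[OF e] case_prod_beta')
    qed
  qed
  have vc_k: "very_cellular G H (\<lambda>x. k (\<tau>, x))" if \<tau>: "\<tau> \<in> {0..1}" for \<tau>
    unfolding very_cellular_def
  proof (intro conjI ballI)
    have "continuous_map (graph_space G) (graph_space H) (k \<circ> (\<lambda>x. (\<tau>, x)))"
      using \<tau> by (intro continuous_map_compose[OF _ cont_k]) (auto simp: continuous_map_pairwise o_def)
    then show "continuous_map (graph_space G) (graph_space H) (\<lambda>x. k (\<tau>, x))"
      by (simp add: o_def)
    show "\<exists>w\<in>verts H. k (\<tau>, Vertex v) = Vertex w" if "v \<in> verts G" for v
      using fv[OF that] by (simp add: k_def)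
    fix e assume e: "e \<in> edges G"
    show "(\<exists>w\<in>verts H. (\<lambda>x. k (\<tau>, x)) ` closed_edge G e = {Vertex w}) \<or>
        (\<exists>e'\<in>edges H. (\<lambda>x. k (\<tau>, x)) ` closed_edge G e = closed_edge H e')"
    proof (cases "fe e")
      case None
      then have "(\<lambda>x. k (\<tau>, x)) ` closed_edge G e = {Vertex (fv (att0 G e))}"
        by (simp add: closed_edge_def image_image k_char[OF e] image_constant_conv)
      then show ?thesis
        using fv att_in_verts[OF G e] by auto
    next
      case (Some e')
      have "lin e \<tau> ` {0..1} = {0..1}"
      proof (rule onto_unit_interval)
        show "continuous_on {0..1} (lin e \<tau>)"
          unfolding lin_def[abs_def]
          by (intro continuous_intros continuous_on_flip \<sigma>(1)[OF e Some])
      qed (use lin_in[OF e Some] lin_ends[OF e Some] \<tau> in auto)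
      then have "(\<lambda>x. k (\<tau>, x)) ` closed_edge G e = closed_edge H e'"
        using Some by (simp add: closed_edge_def image_image k_char[OF e] flip: image_image[of "char_map H e'" "lin e \<tau>"])
      then show ?thesis
        using graph_homD(3)[OF D e Some] by blast
    qed
  qed
  have hom2: "very_cellular_homotopic G H (push H 1 \<circ> f) ?std"
    unfolding very_cellular_homotopic_iff[OF G]
  proof (intro exI[of _ k] conjI ballI cont_k vc_k)
    fix x assume x: "x \<in> points G"
    from x G show "k (0, x) = (push H 1 \<circ> f) x"
    proof (cases rule: points_cases)
      case (Vertex v)
      then show ?thesis
        using fv by (simp add: k_def push_def)
    next
      case (Interior e t)
      then have xt: "x = char_map G e t"
        by (simp add: char_map_Interior)
      show ?thesis
        using \<sigma>(4)[OF Interior(1)] fe_None[OF Interior(1)] Interior(2,3)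
        by (cases "fe e") (simp_all add: xt k_char[OF Interior(1)] lin_def push_def)
    qed
    from x G show "k (1, x) = ?std x"
    proof (cases rule: points_cases)
      case (Vertex v)
      then show ?thesis
        by (simp add: k_def)
    next
      case (Interior e t)
      then have xt: "x = char_map G e t"
        by (simp add: char_map_Interior)
      show ?thesis
        unfolding xt k_char[OF Interior(1)] std_map_char_map[OF D Interior(1)]
        by (cases "fe e") (simp_all add: lin_def)
    qed
  qed
  show thesis
    using that[OF C homotopic_with_trans[OF hom1 hom2]] .
qed

section \<open>Composition of classes and of combinatorial contractions\<close>

lemma rtranclp_adj_mono: "(adj G E)\<^sup>*\<^sup>* u v \<Longrightarrow> E \<subseteq> E' \<Longrightarrow> (adj G E')\<^sup>*\<^sup>* u v"
  by (induction rule: rtranclp_induct) (auto intro: rtranclp.rtrancl_into_rtrancl adj_mono)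

lemma homotopic_comp:
  assumes "very_cellular_homotopic G H f f'" "very_cellular_homotopic H L k k'"
  shows "very_cellular_homotopic G L (k \<circ> f) (k' \<circ> f')"
proof -
  have f: "very_cellular G H f'" "continuous_map (graph_space G) (graph_space H) f'"
    using homotopic_with_imp_property[OF assms(1)] homotopic_with_imp_continuous_maps[OF assms(1)] by auto
  have k: "very_cellular H L k" "continuous_map (graph_space H) (graph_space L) k"
    using homotopic_with_imp_property[OF assms(2)] homotopic_with_imp_continuous_maps[OF assms(2)] by auto
  have "very_cellular_homotopic G L (k \<circ> f) (k \<circ> f')"
    by (rule homotopic_with_compose_continuous_map_left[OF assms(1) k(2)]) (rule very_cellular_comp[OF _ k(1)])
  moreover have "very_cellular_homotopic G L (k \<circ> f') (k' \<circ> f')"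
    by (rule homotopic_with_compose_continuous_map_right[OF assms(2) f(2)]) (rule very_cellular_comp[OF f(1)])
  ultimately show ?thesis
    by (rule homotopic_with_trans)
qed

lemma very_cellular_homotopic_refl: "very_cellular G H f \<Longrightarrow> very_cellular_homotopic G H f f"
  by (simp add: very_cellular_def)

lemma morphism_class_eq:
  "very_cellular_homotopic G H f g \<Longrightarrow> morphism_class G H f = morphism_class G H g"
  unfolding morphism_class_def by (blast intro: homotopic_with_trans homotopic_with_symD)

lemma morphism_class_cong:
  assumes "is_graph G" "very_cellular G H f" "\<And>x. x \<in> points G \<Longrightarrow> f x = g x"
  shows "morphism_class G H f = morphism_class G H g"
  using assms very_cellular_cong[of G f g H]
  by (intro morphism_class_eq homotopic_with_equal) (auto simp: very_cellular_def topspace_graph_space)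

text \<open>All composites of representatives are very cellularly homotopic, so the union that
  defines \<open>compose_classes\<close> is a union of equal classes.\<close>

lemma compose_classes_morphism_class:
  assumes f: "very_cellular G H f" and k: "very_cellular H L k"
  shows "compose_classes G L (morphism_class H L k) (morphism_class G H f) = morphism_class G L (k \<circ> f)"
proof -
  have "morphism_class G L (k' \<circ> f') = morphism_class G L (k \<circ> f)"
    if "k' \<in> morphism_class H L k" "f' \<in> morphism_class G H f" for k' f'
    using that morphism_class_eq[OF homotopic_comp[of G H f f' L k k']] by (simp add: morphism_class_def)
  moreover have "k \<in> morphism_class H L k" "f \<in> morphism_class G H f"
    using f k by (simp_all add: morphism_class_def very_cellular_homotopic_refl del: homotopic_with_refl)
  ultimately show ?thesis
    unfolding compose_classes_def by blast
qed

definition comp_fe :: "(nat \<Rightarrow> nat option) \<Rightarrow> (nat \<Rightarrow> nat option) \<Rightarrow> nat \<Rightarrow> nat option" where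
  "comp_fe fe2 fe1 e = Option.bind (fe1 e) fe2"

definition comp_fl :: "(nat \<Rightarrow> bool) \<Rightarrow> (nat \<Rightarrow> nat option) \<Rightarrow> (nat \<Rightarrow> bool) \<Rightarrow> nat \<Rightarrow> bool" where
  "comp_fl fl2 fe1 fl1 e \<longleftrightarrow> fl1 e \<noteq> fl2 (the (fe1 e))"

lemma graph_hom_comp:
  assumes D1: "graph_hom G H fv1 fe1 fl1" and D2: "graph_hom H L fv2 fe2 fl2"
  shows "graph_hom G L (fv2 \<circ> fv1) (comp_fe fe2 fe1) (comp_fl fl2 fe1 fl1)"
  unfolding graph_hom_def
proof (intro conjI ballI)
  show "(fv2 \<circ> fv1) ` verts G \<subseteq> verts L"
    using graph_homD(1)[OF D1] graph_homD(1)[OF D2] by auto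
  fix e assume e: "e \<in> edges G"
  show "case comp_fe fe2 fe1 e of None \<Rightarrow> (fv2 \<circ> fv1) (att0 G e) = (fv2 \<circ> fv1) (att1 G e)
    | Some e' \<Rightarrow> e' \<in> edges L \<and>
      (fv2 \<circ> fv1) (att0 G e) = (if comp_fl fl2 fe1 fl1 e then att1 L e' else att0 L e') \<and>
      (fv2 \<circ> fv1) (att1 G e) = (if comp_fl fl2 fe1 fl1 e then att0 L e' else att1 L e')"
  proof (cases "fe1 e")
    case None
    then show ?thesis
      using graph_homD(2)[OF D1 e None] by (simp add: comp_fe_def)
  next
    case (Some e')
    note e' = graph_homD(3)[OF D1 e Some]
    show ?thesis
      using graph_homD(4,5)[OF D1 e Some] graph_homD(2)[OF D2 e'] graph_homD(3)[OF D2 e']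
        graph_homD(4)[OF D2 e'] graph_homD(5)[OF D2 e']
      by (cases "fe2 e'") (auto simp: comp_fe_def comp_fl_def Some)
  qed
qed

lemma std_map_comp:
  assumes G: "is_graph G" and D1: "graph_hom G H fv1 fe1 fl1" and D2: "graph_hom H L fv2 fe2 fl2"
    and x: "x \<in> points G"
  shows "std_map H fv2 fe2 fl2 (std_map G fv1 fe1 fl1 x) =
    std_map G (fv2 \<circ> fv1) (comp_fe fe2 fe1) (comp_fl fl2 fe1 fl1) x"
  using x G
proof (cases rule: points_cases)
  case (Interior e t)
  show ?thesis
  proof (cases "fe1 e")
    case (Some e')
    note e' = graph_homD(3)[OF D1 Interior(1) Some]
    show ?thesis
      using graph_homD(4,5)[OF D1 Interior(1) Some] graph_homD(2)[OF D2 e'] Interior Some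
      by (cases "fe2 e'") (auto simp: comp_fe_def comp_fl_def)
  qed (use Interior in \<open>auto simp: comp_fe_def\<close>)
qed simp

text \<open>A path in a fiber of the second map is lifted edge by edge; consecutive lifts are joined
  inside the connected fibers of the first map. The count of edges and vertices is additive.\<close>

lemma graph_contraction_comp:
  assumes G: "is_graph G" and H: "is_graph H" and L: "is_graph L"
    and C1: "graph_contraction G H fv1 fe1 fl1" and C2: "graph_contraction H L fv2 fe2 fl2"
  shows "graph_contraction G L (fv2 \<circ> fv1) (comp_fe fe2 fe1) (comp_fl fl2 fe1 fl1)"
proof -
  have D1: "graph_hom G H fv1 fe1 fl1" and B1: "edge_bijective G H fe1"
    and con1: "\<And>w. w \<in> verts H \<Longrightarrow> fib_verts G fv1 w \<noteq> {} \<and> connected_on G (fib_verts G fv1 w) (fib_edges G fv1 fe1 w)"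
    using C1 by (auto simp: graph_contraction_def)
  have D2: "graph_hom H L fv2 fe2 fl2" and B2: "edge_bijective H L fe2"
    and con2: "\<And>w. w \<in> verts L \<Longrightarrow> fib_verts H fv2 w \<noteq> {} \<and> connected_on H (fib_verts H fv2 w) (fib_edges H fv2 fe2 w)"
    using C2 by (auto simp: graph_contraction_def)
  let ?fv = "fv2 \<circ> fv1" and ?fe = "comp_fe fe2 fe1"
  have "edge_bijective G L ?fe"
    unfolding edge_bijective_def
  proof
    fix e'' assume "e'' \<in> edges L"
    then obtain e' where e': "e' \<in> edges H" "fe2 e' = Some e''"
      "\<And>e1. e1 \<in> edges H \<Longrightarrow> fe2 e1 = Some e'' \<Longrightarrow> e1 = e'"
      using edge_bijectiveD[OF B2] by blast
    then obtain e where e: "e \<in> edges G" "fe1 e = Some e'"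
      "\<And>e1. e1 \<in> edges G \<Longrightarrow> fe1 e1 = Some e' \<Longrightarrow> e1 = e"
      using edge_bijectiveD[OF B1] by blast
    show "\<exists>!e. e \<in> edges G \<and> ?fe e = Some e''"
    proof (rule ex1I)
      show "e \<in> edges G \<and> ?fe e = Some e''"
        using e(1,2) e'(2) by (simp add: comp_fe_def)
      fix e1 assume e1: "e1 \<in> edges G \<and> ?fe e1 = Some e''"
      then obtain e1' where e1': "fe1 e1 = Some e1'" "fe2 e1' = Some e''"
        by (cases "fe1 e1") (auto simp: comp_fe_def)
      then have "e1' = e'"
        using e'(3) graph_homD(3)[OF D1] e1 by blast
      then show "e1 = e"
        using e(3) e1 e1' by blast
    qed
  qed
  moreover have "fib_verts G ?fv w \<noteq> {} \<and> connected_on G (fib_verts G ?fv w) (fib_edges G ?fv ?fe w)"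
    if w: "w \<in> verts L" for w
  proof
    obtain a where "a \<in> fib_verts H fv2 w"
      using con2[OF w] by blast
    then show "fib_verts G ?fv w \<noteq> {}"
      using con1[of a] by (auto simp: fib_verts_def)
    let ?E = "fib_edges G ?fv ?fe w"
    have vertical: "(adj G ?E)\<^sup>*\<^sup>* u v" if "a \<in> fib_verts H fv2 w" "u \<in> fib_verts G fv1 a" "v \<in> fib_verts G fv1 a" for a u v
    proof -
      have "(adj G (fib_edges G fv1 fe1 a))\<^sup>*\<^sup>* u v"
        using con1[of a] that by (auto simp: connected_on_def fib_verts_def)
      moreover have "fib_edges G fv1 fe1 a \<subseteq> ?E"
        using that(1) by (auto simp: fib_edges_def comp_fe_def fib_verts_def)
      ultimately show ?thesis
        by (rule rtranclp_adj_mono)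
    qed
    \<comment> \<open>The induction along the path in \<open>H\<close> has to reach the whole fiber
      over the current vertex, since the next edge may be lifted to start anywhere in it.\<close>
    have path: "\<forall>v \<in> fib_verts G fv1 b. (adj G ?E)\<^sup>*\<^sup>* u v"
      if "(adj H (fib_edges H fv2 fe2 w))\<^sup>*\<^sup>* a b" "a \<in> fib_verts H fv2 w" "u \<in> fib_verts G fv1 a" for a b u
      using that
    proof induction
      case base
      then show ?case
        using vertical by blast
    next
      case (step b c)
      then obtain e' where e': "e' \<in> fib_edges H fv2 fe2 w" "{att0 H e', att1 H e'} = {b, c}"
        by (auto simp: adj_def)
      then have eH: "e' \<in> edges H" "fe2 e' = None"
        by (auto simp: fib_edges_def)
      obtain e where e: "e \<in> edges G" "fe1 e = Some e'"
        using edge_bijectiveD[OF B1 eH(1)] by blast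
      have bc: "b \<in> fib_verts H fv2 w" "c \<in> fib_verts H fv2 w"
        using e' graph_homD(2)[OF D2 eH] att_in_verts[OF H eH(1)] by (auto simp: fib_edges_def fib_verts_def doubleton_eq_iff)
      \<comment> \<open>The lift \<open>e\<close> of \<open>e'\<close> may run in either direction;
        \<open>p\<close> is its end over \<open>b\<close> and \<open>q\<close> its end over
        \<open>c\<close>.\<close>
      define p q where "p = (if fv1 (att0 G e) = b then att0 G e else att1 G e)"
        and "q = (if fv1 (att0 G e) = b then att1 G e else att0 G e)"
      have ends: "{fv1 (att0 G e), fv1 (att1 G e)} = {b, c}"
        using graph_homD(4,5)[OF D1 e] e'(2) by auto
      then have pq: "fv1 p = b" "fv1 q = c" "p \<in> verts G" "q \<in> verts G"
        using att_in_verts[OF G e(1)] by (auto simp: p_def q_def doubleton_eq_iff)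
      have "fv2 (fv1 (att0 G e)) = w"
        using ends bc by (auto simp: fib_verts_def doubleton_eq_iff)
      then have "e \<in> ?E"
        using e eH by (auto simp: fib_edges_def comp_fe_def)
      then have "adj G ?E p q"
        by (auto simp: adj_def p_def q_def)
      moreover have "p \<in> fib_verts G fv1 b"
        using pq by (simp add: fib_verts_def)
      then have "(adj G ?E)\<^sup>*\<^sup>* u p"
        using step.IH step.prems by blast
      ultimately have "(adj G ?E)\<^sup>*\<^sup>* u q"
        by (rule rtranclp.rtrancl_into_rtrancl[rotated])
      moreover have "(adj G ?E)\<^sup>*\<^sup>* q v" if "v \<in> fib_verts G fv1 c" for v
        using vertical[OF bc(2) _ that] pq by (auto simp: fib_verts_def)
      ultimately show ?case
        by (blast intro: rtranclp_trans)
    qed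
    show "connected_on G (fib_verts G ?fv w) ?E"
      unfolding connected_on_def
    proof (intro ballI)
      fix u v assume u: "u \<in> fib_verts G ?fv w" and v: "v \<in> fib_verts G ?fv w"
      have "fv1 u \<in> fib_verts H fv2 w" "fv1 v \<in> fib_verts H fv2 w" "u \<in> fib_verts G fv1 (fv1 u)" "v \<in> fib_verts G fv1 (fv1 v)"
        using u v graph_homD(1)[OF D1] by (auto simp: fib_verts_def)
      then show "(adj G ?E)\<^sup>*\<^sup>* u v"
        using path[of "fv1 u" "fv1 v" u] con2[OF w] by (auto simp: connected_on_def)
    qed
  qed
  moreover have "card (edges G) + card (verts L) = card (edges L) + card (verts G)"
    using C1 C2 by (simp add: graph_contraction_def)
  ultimately show ?thesis
    using graph_hom_comp[OF D1 D2] by (simp add: graph_contraction_def)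
qed

lemma graph_contraction_id:
  assumes G: "is_graph G"
  shows "graph_contraction G G id Some (\<lambda>_. False)"
proof -
  have "fib_verts G id w = {w}" "fib_edges G id Some w = {}" if "w \<in> verts G" for w
    using that by (auto simp: fib_verts_def fib_edges_def)
  then show ?thesis
    unfolding graph_contraction_iff_trees[OF G G]
    by (auto simp: graph_hom_def edge_bijective_def intro: is_tree.single)
qed

lemma std_map_id: "is_graph G \<Longrightarrow> x \<in> points G \<Longrightarrow> std_map G id Some (\<lambda>_. False) x = x"
  by (cases x) auto

text \<open>The dictionary between topology and combinatorics. The representative with contractible
  fibers need not be the one that names the class, so it is connected to \<open>std_map\<close> by a
  homotopy first.\<close>

lemma contraction_iff:
  assumes G: "is_graph G" and H: "is_graph H"
  shows "contraction G H F \<longleftrightarrow>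
    (\<exists>fv fe fl. graph_contraction G H fv fe fl \<and> F = morphism_class G H (std_map G fv fe fl))"
proof
  assume "contraction G H F"
  then obtain f0 f where f0: "very_cellular G H f0" "F = morphism_class G H f0" and f: "f \<in> F"
    "smooshing_map G H f" "\<forall>y \<in> points H. contractible_space (fiber G f y)"
    by (auto simp: contraction_def graph_morphism_def)
  have hom: "very_cellular_homotopic G H f0 f"
    using f(1) f0(2) by (simp add: morphism_class_def)
  then have vc: "very_cellular G H f"
    using homotopic_with_imp_property by blast
  have ctr: "contractible_space (fiber G f y)" if "y \<in> points H" for y
    using f(3) that by blast
  show "\<exists>fv fe fl. graph_contraction G H fv fe fl \<and> F = morphism_class G H (std_map G fv fe fl)"
  proof (rule contraction_std_rep[OF G H vc f(2) ctr])
    fix fv fe fl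
    assume C: "graph_contraction G H fv fe fl" "very_cellular_homotopic G H f (std_map G fv fe fl)"
    then have "F = morphism_class G H (std_map G fv fe fl)"
      using morphism_class_eq[OF homotopic_with_trans[OF hom C(2)]] f0(2) by simp
    then show ?thesis
      using C(1) by (intro exI conjI)
  qed
qed (use contraction_std_map[OF G H] in auto)

lemma compose_classes_std_map:
  assumes G: "is_graph G" and H: "is_graph H" and L: "is_graph L"
    and D1: "graph_hom G H fv1 fe1 fl1" and D2: "graph_hom H L fv2 fe2 fl2"
  shows "compose_classes G L (morphism_class H L (std_map H fv2 fe2 fl2)) (morphism_class G H (std_map G fv1 fe1 fl1)) =
    morphism_class G L (std_map G (fv2 \<circ> fv1) (comp_fe fe2 fe1) (comp_fl fl2 fe1 fl1))"
proof -
  note vc = very_cellular_std_map[OF G H D1] very_cellular_std_map[OF H L D2]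
  have "morphism_class G L (std_map H fv2 fe2 fl2 \<circ> std_map G fv1 fe1 fl1) =
      morphism_class G L (std_map G (fv2 \<circ> fv1) (comp_fe fe2 fe1) (comp_fl fl2 fe1 fl1))"
    using std_map_comp[OF G D1 D2] by (intro morphism_class_cong[OF G very_cellular_comp[OF vc]]) simp
  then show ?thesis
    using compose_classes_morphism_class[OF vc] by simp
qed

lemma contraction_compose:
  assumes G: "is_graph G" and H: "is_graph H" and L: "is_graph L"
    and "contraction G H F" "contraction H L K"
  shows "contraction G L (compose_classes G L K F)"
proof -
  obtain fv1 fe1 fl1 where 1: "graph_contraction G H fv1 fe1 fl1" "F = morphism_class G H (std_map G fv1 fe1 fl1)"
    using assms(4) unfolding contraction_iff[OF G H] by blast
  obtain fv2 fe2 fl2 where 2: "graph_contraction H L fv2 fe2 fl2" "K = morphism_class H L (std_map H fv2 fe2 fl2)"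
    using assms(5) unfolding contraction_iff[OF H L] by blast
  have "graph_hom G H fv1 fe1 fl1" "graph_hom H L fv2 fe2 fl2"
    using 1 2 by (auto simp: graph_contraction_def)
  then have "compose_classes G L K F =
      morphism_class G L (std_map G (fv2 \<circ> fv1) (comp_fe fe2 fe1) (comp_fl fl2 fe1 fl1))"
    using compose_classes_std_map[OF G H L] 1(2) 2(2) by blast
  then show ?thesis
    using graph_contraction_comp[OF G H L 1(1) 2(1)] contraction_std_map[OF G L] by simp
qed

lemma contraction_id:
  assumes G: "is_graph G"
  shows "contraction G G (morphism_class G G id)"
proof -
  have D: "graph_hom G G id Some (\<lambda>_. False)"
    using graph_contraction_id[OF G] by (simp add: graph_contraction_def)
  have "morphism_class G G (std_map G id Some (\<lambda>_. False)) = morphism_class G G id"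
    using std_map_id[OF G] by (intro morphism_class_cong[OF G very_cellular_std_map[OF G G D]]) simp
  then show ?thesis
    using contraction_std_map[OF G G graph_contraction_id[OF G]] by simp
qed

section \<open>The category of contractions and its opposite\<close>

lemma very_cellular_id: "very_cellular G G id"
  by (auto simp: very_cellular_def)

lemma contraction_rep:
  assumes "contraction G H F"
  obtains f where "very_cellular G H f" "F = morphism_class G H f"
  using assms by (auto simp: contraction_def graph_morphism_def)

lemma hom_set_contraction_cat:
  "\<alpha> \<in> hom_set (contraction_cat g) G H \<longleftrightarrow>
    (\<exists>F. \<alpha> = (G, F, H) \<and> graph_of_genus g G \<and> graph_of_genus g H \<and> contraction G H F)"
  by (cases \<alpha>) (auto simp: hom_set_def contraction_cat_def)

lemma graph_of_genus_is_graph: "graph_of_genus g G \<Longrightarrow> is_graph G"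
  by (simp add: graph_of_genus_def)

lemma category_contraction_cat: "category (contraction_cat g)"
proof
  fix f assume "f \<in> Arr (contraction_cat g)"
  then show "Dom (contraction_cat g) f \<in> Obj (contraction_cat g)" "Cod (contraction_cat g) f \<in> Obj (contraction_cat g)"
    by (auto simp: contraction_cat_def)
next
  fix x assume "x \<in> Obj (contraction_cat g)"
  then show "Idn (contraction_cat g) x \<in> hom_set (contraction_cat g) x x"
    unfolding hom_set_contraction_cat using contraction_id graph_of_genus_is_graph
    by (auto simp: contraction_cat_def)
next
  fix f k x y z
  assume "f \<in> hom_set (contraction_cat g) x y" "k \<in> hom_set (contraction_cat g) y z"
  then obtain F K where *: "f = (x, F, y)" "k = (y, K, z)" "contraction x y F" "contraction y z K"
    and gen: "graph_of_genus g x" "graph_of_genus g y" "graph_of_genus g z"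
    unfolding hom_set_contraction_cat by blast
  have "contraction x z (compose_classes x z K F)"
    using contraction_compose[OF gen[THEN graph_of_genus_is_graph] *(3,4)] .
  then show "Cmp (contraction_cat g) k f \<in> hom_set (contraction_cat g) x z"
    unfolding hom_set_contraction_cat using gen by (simp add: *(1,2) contraction_cat_def)
next
  fix f k h w x y z
  assume "f \<in> hom_set (contraction_cat g) w x" "k \<in> hom_set (contraction_cat g) x y" "h \<in> hom_set (contraction_cat g) y z"
  then obtain F K L where *: "f = (w, F, x)" "k = (x, K, y)" "h = (y, L, z)" "contraction w x F" "contraction x y K"
    "contraction y z L"
    unfolding hom_set_contraction_cat by blast
  obtain f' where f': "very_cellular w x f'" "F = morphism_class w x f'"
    using contraction_rep[OF *(4)] by blast
  obtain k' where k': "very_cellular x y k'" "K = morphism_class x y k'"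
    using contraction_rep[OF *(5)] by blast
  obtain l' where l': "very_cellular y z l'" "L = morphism_class y z l'"
    using contraction_rep[OF *(6)] by blast
  note r = f' k' l'
  show "Cmp (contraction_cat g) h (Cmp (contraction_cat g) k f) = Cmp (contraction_cat g) (Cmp (contraction_cat g) h k) f"
    using r by (simp add: *(1-3) contraction_cat_def compose_classes_morphism_class very_cellular_comp comp_assoc)
next
  fix f x y
  assume "f \<in> hom_set (contraction_cat g) x y"
  then obtain F where *: "f = (x, F, y)" "contraction x y F"
    unfolding hom_set_contraction_cat by blast
  then obtain f' where r: "very_cellular x y f'" "F = morphism_class x y f'"
    using contraction_rep by metis
  show "Cmp (contraction_cat g) f (Idn (contraction_cat g) x) = f" "Cmp (contraction_cat g) (Idn (contraction_cat g) y) f = f"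
    using compose_classes_morphism_class[OF very_cellular_id r(1)] compose_classes_morphism_class[OF r(1) very_cellular_id]
    by (simp_all add: * r(2) contraction_cat_def)
qed

lemma hom_set_op_cat [simp]: "hom_set (op_cat C) x y = hom_set C y x"
  by (auto simp: hom_set_def op_cat_def)

lemma op_cat_simps [simp]:
  "Obj (op_cat C) = Obj C" "Arr (op_cat C) = Arr C" "Dom (op_cat C) = Cod C" "Cod (op_cat C) = Dom C"
  "Idn (op_cat C) = Idn C" "Cmp (op_cat C) k f = Cmp C f k"
  by (simp_all add: op_cat_def)

lemma category_op_cat:
  assumes "category C"
  shows "category (op_cat C)"
proof -
  interpret category C
    by (rule assms)
  show ?thesis
    by unfold_locales (auto simp: Dom_in Cod_in Idn_in Cmp_in Cmp_assoc Cmp_Idn_left Cmp_Idn_right)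
qed

text \<open>An inductive form of \<open>module_span\<close>: linear combinations grow by one summand
  at a time and generators may repeat. Closure properties become plain inductions, without finite
  sums.\<close>

inductive_set span_set :: "('a, 'r) ring_scheme \<Rightarrow> ('a, 'b, 'm) module_scheme \<Rightarrow> 'b set \<Rightarrow> 'b set" for k M S where
  zero: "\<zero>\<^bsub>M\<^esub> \<in> span_set k M S"
| add: "\<lbrakk>v \<in> span_set k M S; s \<in> S; a \<in> carrier k\<rbrakk> \<Longrightarrow> a \<odot>\<^bsub>M\<^esub> s \<oplus>\<^bsub>M\<^esub> v \<in> span_set k M S"

section \<open>Spans and representations\<close>

lemma span_set_mono: "S \<subseteq> T \<Longrightarrow> span_set k M S \<subseteq> span_set k M T"
proof
  fix x assume S: "S \<subseteq> T" and "x \<in> span_set k M S"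
  from this(2) show "x \<in> span_set k M T"
    by induction (use S in \<open>auto intro: span_set.intros\<close>)
qed

lemma span_set_restrict: "span_set k (M\<lparr>carrier := N\<rparr>) S = span_set k M S"
proof -
  have "x \<in> span_set k M S" if "x \<in> span_set k (M\<lparr>carrier := N\<rparr>) S" for x
    using that by induction (auto intro: span_set.intros)
  moreover have "x \<in> span_set k (M\<lparr>carrier := N\<rparr>) S" if "x \<in> span_set k M S" for x
    using that by induction (use span_set.zero[of "M\<lparr>carrier := N\<rparr>" k S] span_set.add[of _ k "M\<lparr>carrier := N\<rparr>" S] in auto)
  ultimately show ?thesis
    by blast
qed

context Module.module
begin

lemma span_set_carrier:
  assumes "S \<subseteq> carrier M" "v \<in> span_set R M S"
  shows "v \<in> carrier M"
  using assms(2,1) by induction auto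

lemma span_set_base: "S \<subseteq> carrier M \<Longrightarrow> s \<in> S \<Longrightarrow> s \<in> span_set R M S"
  using span_set.add[OF span_set.zero, where s = s and S = S and a = \<one> and k = R and M = M] by auto

lemma span_set_add:
  assumes "S \<subseteq> carrier M" "u \<in> span_set R M S" "v \<in> span_set R M S"
  shows "u \<oplus>\<^bsub>M\<^esub> v \<in> span_set R M S"
  using assms(2,1,3)
proof induction
  case (add w s a)
  have "s \<in> carrier M" "w \<in> carrier M" "v \<in> carrier M"
    using add span_set_carrier by auto
  then have "a \<odot>\<^bsub>M\<^esub> s \<oplus>\<^bsub>M\<^esub> w \<oplus>\<^bsub>M\<^esub> v = a \<odot>\<^bsub>M\<^esub> s \<oplus>\<^bsub>M\<^esub> (w \<oplus>\<^bsub>M\<^esub> v)"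
    using add by (simp add: M.a_assoc)
  then show ?case
    using add by (auto intro: span_set.add)
qed (auto simp: span_set_carrier)

lemma span_set_smult:
  assumes "S \<subseteq> carrier M" "c \<in> carrier R" "u \<in> span_set R M S"
  shows "c \<odot>\<^bsub>M\<^esub> u \<in> span_set R M S"
  using assms(3,1,2)
proof induction
  case zero
  then show ?case
    by (simp add: span_set.zero)
next
  case (add w s a)
  have "s \<in> carrier M" "w \<in> carrier M"
    using add span_set_carrier by auto
  then have "c \<odot>\<^bsub>M\<^esub> (a \<odot>\<^bsub>M\<^esub> s \<oplus>\<^bsub>M\<^esub> w) = (c \<otimes> a) \<odot>\<^bsub>M\<^esub> s \<oplus>\<^bsub>M\<^esub> c \<odot>\<^bsub>M\<^esub> w"
    using add by (simp add: smult_r_distr smult_assoc1)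
  then show ?case
    using add by (auto intro: span_set.add)
qed

lemma span_set_minus:
  assumes S: "S \<subseteq> carrier M" and "u \<in> span_set R M S" "v \<in> span_set R M S"
  shows "u \<ominus>\<^bsub>M\<^esub> v \<in> span_set R M S"
proof -
  have v: "v \<in> carrier M"
    using assms span_set_carrier by blast
  have "\<ominus>\<^bsub>M\<^esub> v = (\<ominus> \<one>) \<odot>\<^bsub>M\<^esub> v"
    using v smult_l_minus[of \<one> v] by simp
  then show ?thesis
    using assms span_set_add span_set_smult by (simp add: M.minus_eq)
qed

lemma span_set_least:
  assumes N: "submodule N R M" and S: "S \<subseteq> N"
  shows "span_set R M S \<subseteq> N"
proof
  fix v assume "v \<in> span_set R M S"
  then show "v \<in> N"
  proof induction
    case zero
    show ?case
      using subgroup.one_closed[OF submodule.axioms(1)[OF N]] by simp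
  next
    case (add v s a)
    then show ?case
      using S submoduleE(4,5)[OF N] by blast
  qed
qed

lemma submodule_carrier: "submodule N R M \<Longrightarrow> v \<in> N \<Longrightarrow> v \<in> carrier M"
  using submoduleE(1) by blast

lemma submodule_minus:
  assumes N: "submodule N R M" and "u \<in> N" "v \<in> N"
  shows "u \<ominus>\<^bsub>M\<^esub> v \<in> N"
  using assms submoduleE(3,5)[OF N] by (simp add: M.minus_eq)

lemma span_set_Un:
  assumes S: "S \<subseteq> carrier M" and T: "T \<subseteq> carrier M" and "x \<in> span_set R M (S \<union> T)"
  shows "\<exists>u \<in> span_set R M S. \<exists>v \<in> span_set R M T. x = u \<oplus>\<^bsub>M\<^esub> v"
  using assms(3)
proof induction
  case zero
  then show ?case
    using span_set.zero by (metis M.zero_closed M.r_zero)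
next
  case (add w s a)
  then obtain u v where uv: "u \<in> span_set R M S" "v \<in> span_set R M T" "w = u \<oplus>\<^bsub>M\<^esub> v"
    by blast
  then have c: "u \<in> carrier M" "v \<in> carrier M" "s \<in> carrier M" "a \<odot>\<^bsub>M\<^esub> s \<in> carrier M"
    using S T add span_set_carrier by auto
  show ?case
  proof (cases "s \<in> S")
    case True
    have "a \<odot>\<^bsub>M\<^esub> s \<oplus>\<^bsub>M\<^esub> w = (a \<odot>\<^bsub>M\<^esub> s \<oplus>\<^bsub>M\<^esub> u) \<oplus>\<^bsub>M\<^esub> v"
      using c uv by (simp add: M.a_assoc)
    then show ?thesis
      using span_set.add[OF uv(1) True add(3)] uv(2) by blast
  next
    case False
    have "a \<odot>\<^bsub>M\<^esub> s \<oplus>\<^bsub>M\<^esub> w = u \<oplus>\<^bsub>M\<^esub> (a \<odot>\<^bsub>M\<^esub> s \<oplus>\<^bsub>M\<^esub> v)"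
      using c uv by (simp add: M.a_lcomm)
    then show ?thesis
      using span_set.add[OF uv(2) _ add(3)] uv(1) add(2) False by blast
  qed
qed

text \<open>This isolates a coefficient at \<open>s\<close>; if \<open>s\<close> is the leading
  monomial and \<open>T\<close> consists of lower ones, it serves as a leading coefficient.\<close>

lemma span_set_insert:
  assumes T: "T \<subseteq> carrier M" and s: "s \<in> carrier M" and "x \<in> span_set R M (insert s T)"
  shows "\<exists>a \<in> carrier R. \<exists>v \<in> span_set R M T. x = a \<odot>\<^bsub>M\<^esub> s \<oplus>\<^bsub>M\<^esub> v"
proof -
  obtain u v where uv: "u \<in> span_set R M {s}" "v \<in> span_set R M T" "x = u \<oplus>\<^bsub>M\<^esub> v"
    using span_set_Un[of "{s}" T x] assms by auto
  from uv(1) have "\<exists>a \<in> carrier R. u = a \<odot>\<^bsub>M\<^esub> s"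
  proof induction
    case zero
    then show ?case
      using s by (intro bexI[of _ \<zero>]) (auto simp: smult_l_null)
  next
    case (add w s' a)
    then obtain b where "b \<in> carrier R" "w = b \<odot>\<^bsub>M\<^esub> s"
      by blast
    then show ?case
      using add s by (intro bexI[of _ "a \<oplus> b"]) (auto simp: smult_l_distr)
  qed
  then show ?thesis
    using uv by blast
qed

end

lemma module_span_eq:
  fixes R (structure)
  assumes "Module.module R M" and S: "S \<subseteq> carrier M"
  shows "module_span R M S = span_set R M S"
proof -
  interpret Module.module R M
    by (rule assms(1))
  show ?thesis
  proof
    show "module_span R M S \<subseteq> span_set R M S"
    proof
      fix x assume "x \<in> module_span R M S"
      then obtain c A where x: "x = finsum M (\<lambda>v. c v \<odot>\<^bsub>M\<^esub> v) A" and A: "finite A" "A \<subseteq> S" "c \<in> A \<rightarrow> carrier R"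
        by (auto simp: module_span_def)
      from A have "finsum M (\<lambda>v. c v \<odot>\<^bsub>M\<^esub> v) A \<in> span_set R M S"
      proof induction
        case empty
        then show ?case
          by (simp add: span_set.zero)
      next
        case (insert v A)
        have "finsum M (\<lambda>v. c v \<odot>\<^bsub>M\<^esub> v) (insert v A) = c v \<odot>\<^bsub>M\<^esub> v \<oplus>\<^bsub>M\<^esub> finsum M (\<lambda>v. c v \<odot>\<^bsub>M\<^esub> v) A"
          using insert S by (intro M.finsum_insert) (auto intro!: smult_closed)
        then show ?case
          using insert by (auto intro!: span_set.add)
      qed
      then show "x \<in> span_set R M S"
        using x by simp
    qed
    show "span_set R M S \<subseteq> module_span R M S"
    proof
      fix x assume "x \<in> span_set R M S"
      then show "x \<in> module_span R M S"
      proof induction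
        case zero
        show ?case
          unfolding module_span_def by (intro CollectI exI[of _ "\<lambda>_. \<zero>"] exI[of _ "{}"]) auto
      next
        case (add w s a)
        then obtain c A where w: "w = finsum M (\<lambda>v. c v \<odot>\<^bsub>M\<^esub> v) A" and A: "finite A" "A \<subseteq> S" "c \<in> A \<rightarrow> carrier R"
          by (auto simp: module_span_def)
        have s: "s \<in> carrier M"
          using add S by auto
        have cl: "(\<lambda>v. c v \<odot>\<^bsub>M\<^esub> v) \<in> A \<rightarrow> carrier M"
          using A S by (auto intro!: smult_closed)
        \<comment> \<open>The new generator may already occur in the sum, in which case the
          coefficients are added.\<close>
        define c' where "c' = c(s := if s \<in> A then a \<oplus> c s else a)"
        have c': "c' \<in> insert s A \<rightarrow> carrier R"
          using A add by (auto simp: c'_def Pi_iff)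
        have rest: "finsum M (\<lambda>v. c' v \<odot>\<^bsub>M\<^esub> v) (A - {s}) = finsum M (\<lambda>v. c v \<odot>\<^bsub>M\<^esub> v) (A - {s})"
          using cl by (intro M.finsum_cong') (auto simp: c'_def)
        have fc: "finsum M (\<lambda>v. c v \<odot>\<^bsub>M\<^esub> v) (A - {s}) \<in> carrier M"
          using cl by (intro M.finsum_closed) auto
        have "finsum M (\<lambda>v. c' v \<odot>\<^bsub>M\<^esub> v) (insert s (A - {s})) =
            c' s \<odot>\<^bsub>M\<^esub> s \<oplus>\<^bsub>M\<^esub> finsum M (\<lambda>v. c' v \<odot>\<^bsub>M\<^esub> v) (A - {s})"
          using A c' s S by (intro M.finsum_insert) (auto intro!: smult_closed)
        then have eq: "finsum M (\<lambda>v. c' v \<odot>\<^bsub>M\<^esub> v) (insert s A) =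
            c' s \<odot>\<^bsub>M\<^esub> s \<oplus>\<^bsub>M\<^esub> finsum M (\<lambda>v. c v \<odot>\<^bsub>M\<^esub> v) (A - {s})"
          by (simp add: rest)
        have "a \<odot>\<^bsub>M\<^esub> s \<oplus>\<^bsub>M\<^esub> w = finsum M (\<lambda>v. c' v \<odot>\<^bsub>M\<^esub> v) (insert s A)"
        proof (cases "s \<in> A")
          case True
          have "finsum M (\<lambda>v. c v \<odot>\<^bsub>M\<^esub> v) (insert s (A - {s})) =
              c s \<odot>\<^bsub>M\<^esub> s \<oplus>\<^bsub>M\<^esub> finsum M (\<lambda>v. c v \<odot>\<^bsub>M\<^esub> v) (A - {s})"
            using A cl s True by (intro M.finsum_insert) auto
          then have w': "w = c s \<odot>\<^bsub>M\<^esub> s \<oplus>\<^bsub>M\<^esub> finsum M (\<lambda>v. c v \<odot>\<^bsub>M\<^esub> v) (A - {s})"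
            using True w by (simp add: insert_absorb)
          have "c s \<in> carrier R"
            using A True by auto
          then show ?thesis
            unfolding eq w' using True add s fc by (simp add: c'_def smult_l_distr M.a_assoc)
        next
          case False
          then show ?thesis
            unfolding eq w by (simp add: c'_def)
        qed
        then show ?case
          unfolding module_span_def using A add c'
          by (intro CollectI exI[of _ c'] exI[of _ "insert s A"]) auto
      qed
    qed
  qed
qed

lemma linear_map_zero:
  assumes "Module.module k M" "Module.module k N" "linear_map k M N \<phi>"
  shows "\<phi> \<zero>\<^bsub>M\<^esub> = \<zero>\<^bsub>N\<^esub>"
proof -
  interpret M: Module.module k M by (rule assms(1))
  interpret N: Module.module k N by (rule assms(2))
  have "\<phi> \<zero>\<^bsub>M\<^esub> \<in> carrier N"
    using assms(3) by (auto simp: linear_map_def)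
  moreover have "\<zero>\<^bsub>k\<^esub> \<in> carrier k" "\<zero>\<^bsub>M\<^esub> \<in> carrier M"
    by simp_all
  then have "\<phi> (\<zero>\<^bsub>k\<^esub> \<odot>\<^bsub>M\<^esub> \<zero>\<^bsub>M\<^esub>) = \<zero>\<^bsub>k\<^esub> \<odot>\<^bsub>N\<^esub> \<phi> \<zero>\<^bsub>M\<^esub>"
    using assms(3) unfolding linear_map_def by blast
  ultimately show ?thesis
    by (simp add: M.smult_l_null N.smult_l_null)
qed

lemma linear_map_span_set:
  assumes M: "Module.module k M" and N: "Module.module k N" and \<phi>: "linear_map k M N \<phi>"
    and S: "S \<subseteq> carrier M" and v: "v \<in> span_set k M S"
  shows "\<phi> v \<in> span_set k N (\<phi> ` S)"
  using v
proof induction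
  case zero
  then show ?case
    using linear_map_zero[OF M N \<phi>] by (simp add: span_set.zero)
next
  case (add w s a)
  interpret M: Module.module k M by (rule M)
  have "s \<in> carrier M" "w \<in> carrier M"
    using add S M.span_set_carrier[OF S] by auto
  then have "\<phi> (a \<odot>\<^bsub>M\<^esub> s \<oplus>\<^bsub>M\<^esub> w) = a \<odot>\<^bsub>N\<^esub> \<phi> s \<oplus>\<^bsub>N\<^esub> \<phi> w"
    using add \<phi> by (simp add: linear_map_def)
  then show ?case
    using add by (auto intro!: span_set.add)
qed

lemma is_repD:
  assumes "is_rep k C M"
  shows "x \<in> Obj C \<Longrightarrow> Module.module k (Val M x)"
    "x \<in> Obj C \<Longrightarrow> y \<in> Obj C \<Longrightarrow> f \<in> hom_set C x y \<Longrightarrow> linear_map k (Val M x) (Val M y) (Act M f)"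
    "x \<in> Obj C \<Longrightarrow> y \<in> Obj C \<Longrightarrow> f \<in> hom_set C x y \<Longrightarrow> v \<in> carrier (Val M x) \<Longrightarrow> Act M f v \<in> carrier (Val M y)"
    "x \<in> Obj C \<Longrightarrow> v \<in> carrier (Val M x) \<Longrightarrow> Act M (Idn C x) v = v"
    "x \<in> Obj C \<Longrightarrow> y \<in> Obj C \<Longrightarrow> z \<in> Obj C \<Longrightarrow> f \<in> hom_set C x y \<Longrightarrow> h \<in> hom_set C y z \<Longrightarrow>
      v \<in> carrier (Val M x) \<Longrightarrow> Act M (Cmp C h f) v = Act M h (Act M f v)"
  using assms unfolding is_rep_def linear_map_def Pi_iff by blast+

lemma finitely_generated_rep_iff:
  assumes M: "is_rep k C M"
  shows "finitely_generated_rep k C M \<longleftrightarrow> (\<exists>B. finite B \<and>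
    (\<forall>(x, v) \<in> B. x \<in> Obj C \<and> v \<in> carrier (Val M x)) \<and>
    (\<forall>y \<in> Obj C. carrier (Val M y) \<subseteq>
      span_set k (Val M y) {Act M f v | x v f. (x, v) \<in> B \<and> f \<in> hom_set C x y}))"
proof -
  have "carrier (Val M y) = module_span k (Val M y) {Act M f v | x v f. (x, v) \<in> B \<and> f \<in> hom_set C x y} \<longleftrightarrow>
      carrier (Val M y) \<subseteq> span_set k (Val M y) {Act M f v | x v f. (x, v) \<in> B \<and> f \<in> hom_set C x y}"
    if B: "\<forall>(x, v) \<in> B. x \<in> Obj C \<and> v \<in> carrier (Val M x)" and y: "y \<in> Obj C" for B y
  proof -
    interpret Module.module k "Val M y" by (rule is_repD(1)[OF M y])
    have "{Act M f v | x v f. (x, v) \<in> B \<and> f \<in> hom_set C x y} \<subseteq> carrier (Val M y)"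
      using B is_repD(3)[OF M _ y] by blast
    then show ?thesis
      using module_span_eq[OF is_repD(1)[OF M y]] span_set_carrier by blast
  qed
  then show ?thesis
    unfolding finitely_generated_rep_def by (intro ex_cong1 conj_cong refl ball_cong) auto
qed

lemma is_rep_restrict:
  assumes M: "is_rep k C M" and N: "is_subrep k C M N"
  shows "is_rep k C (restrict_rep M N)"
proof -
  have sub: "N x \<subseteq> carrier (Val M x)" "submodule (N x) k (Val M x)" if "x \<in> Obj C" for x
    using N that Module.module.submoduleE(1)[OF is_repD(1)[OF M that]] by (auto simp: is_subrep_def)
  have act: "Act M f v \<in> N y" if "x \<in> Obj C" "y \<in> Obj C" "f \<in> hom_set C x y" "v \<in> N x" for x y f v
    using N that unfolding is_subrep_def by blast
  have mem: "v \<in> carrier (Val M x)" if "x \<in> Obj C" "v \<in> N x" for x v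
    using sub that by blast
  have "Module.module k ((Val M x)\<lparr>carrier := N x\<rparr>)" if "x \<in> Obj C" for x
    using submodule.submodule_is_module[OF sub(2)[OF that] is_repD(1)[OF M that]] .
  moreover have "linear_map k ((Val M x)\<lparr>carrier := N x\<rparr>) ((Val M y)\<lparr>carrier := N y\<rparr>) (Act M f)"
    if "x \<in> Obj C" "y \<in> Obj C" "f \<in> hom_set C x y" for x y f
    using is_repD(2)[OF M that] act[OF that] mem[OF that(1)] by (auto simp: linear_map_def)
  ultimately show ?thesis
    using M mem unfolding is_rep_def restrict_rep_def by (simp add: Ball_def)
qed

lemma finitely_generated_subrep_iff:
  assumes M: "is_rep k C M" and N: "is_subrep k C M N"
  shows "finitely_generated_rep k C (restrict_rep M N) \<longleftrightarrow> (\<exists>B. finite B \<and>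
    (\<forall>(x, v) \<in> B. x \<in> Obj C \<and> v \<in> N x) \<and>
    (\<forall>y \<in> Obj C. N y \<subseteq> span_set k (Val M y) {Act M f v | x v f. (x, v) \<in> B \<and> f \<in> hom_set C x y}))"
  unfolding finitely_generated_rep_iff[OF is_rep_restrict[OF M N]]
  by (simp add: restrict_rep_def span_set_restrict)

section \<open>Leading terms and noetherianity\<close>

text \<open>The data needed for the leading term argument: in contrast to (G1), composition has to
  preserve the strict order.\<close>

definition strict_groebner :: "('o, 'm) cat \<Rightarrow> ('m \<Rightarrow> 'm \<Rightarrow> bool) \<Rightarrow> bool" where
  "strict_groebner C lt \<longleftrightarrow> category C \<and>
    (\<forall>x \<in> Obj C. \<forall>y \<in> Obj C. finite (hom_set C x y)) \<and>
    (\<forall>f. \<not> lt f f) \<and> (\<forall>f f' f''. lt f f' \<longrightarrow> lt f' f'' \<longrightarrow> lt f f'') \<and>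
    (\<forall>x \<in> Obj C. \<forall>y \<in> Obj C. \<forall>f \<in> hom_set C x y. \<forall>f' \<in> hom_set C x y. f = f' \<or> lt f f' \<or> lt f' f) \<and>
    (\<forall>x \<in> Obj C. \<forall>y \<in> Obj C. \<forall>z \<in> Obj C. \<forall>f \<in> hom_set C x y. \<forall>f' \<in> hom_set C x y. \<forall>h \<in> hom_set C y z.
      lt f f' \<longrightarrow> lt (Cmp C h f) (Cmp C h f')) \<and>
    (\<forall>x \<in> Obj C. wqo_on (\<lambda>f f'. \<exists>h \<in> hom_set C (Cod C f) (Cod C f'). Cmp C h f = f') {f \<in> Arr C. Dom C f = x})"

lemma finite_strict_order_max:
  assumes "finite T" "T \<noteq> {}" and irrefl: "\<And>a. \<not> prec a a"
    and trans: "\<And>a b c. prec a b \<Longrightarrow> prec b c \<Longrightarrow> prec a c"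
    and total: "\<And>a b. a \<in> T \<Longrightarrow> b \<in> T \<Longrightarrow> a = b \<or> prec a b \<or> prec b a"
  shows "\<exists>m \<in> T. \<forall>t \<in> T. t = m \<or> prec t m"
  using assms(1,2) total
proof (induction rule: finite_ne_induct)
  case (insert x F)
  then obtain m where m: "m \<in> F" "\<forall>t \<in> F. t = m \<or> prec t m"
    by auto
  then consider "x = m" | "prec x m" | "prec m x"
    using insert.prems[of x m] by auto
  then show ?case
  proof cases
    case 3
    then show ?thesis
      using m trans by (intro bexI[of _ x]) auto
  qed (use m in auto)
qed auto

lemma finite_strict_order_minimal:
  assumes "finite T" "T \<noteq> {}" and irrefl: "\<And>a. \<not> prec a a"
    and trans: "\<And>a b c. prec a b \<Longrightarrow> prec b c \<Longrightarrow> prec a c"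
  shows "\<exists>m \<in> T. \<forall>t \<in> T. \<not> prec t m"
  using assms(1,2)
proof (induction rule: finite_ne_induct)
  case (singleton x)
  then show ?case
    using irrefl by auto
next
  case (insert x F)
  then obtain m where m: "m \<in> F" "\<forall>t \<in> F. \<not> prec t m"
    by auto
  show ?case
  proof (cases "prec x m")
    case True
    have "\<not> prec t x" if "t \<in> F" for t
      using m(2) that trans[OF _ True] by blast
    then show ?thesis
      using irrefl by auto
  next
    case False
    then show ?thesis
      using m by auto
  qed
qed

lemma wqo_on_Sigma_finite:
  assumes "finite B" and wqo: "\<And>b. b \<in> B \<Longrightarrow> wqo_on qle (A b)"
  shows "wqo_on (\<lambda>(b, f) (b', f'). b = b' \<and> qle f f') (Sigma B A)"
  unfolding wqo_on_def
proof (intro allI impI)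
  fix s :: "nat \<Rightarrow> 'a \<times> 'b"
  assume s: "\<forall>i. s i \<in> Sigma B A"
  then have fst_B: "fst (s i) \<in> B" for i
    using s[rule_format, of i] by (cases "s i") auto
  then obtain r :: "nat \<Rightarrow> nat" where r: "strict_mono r" "\<And>i j. i < j \<Longrightarrow> fst (s (r i)) = fst (s (r j))"
    using wqo_on_subseq[OF wqo_on_finite_eq[OF assms(1)], of "\<lambda>i. fst (s i)"] by blast
  have const: "fst (s (r i)) = fst (s (r 0))" for i
    using r(2)[of 0 i] by (cases i) auto
  have "snd (s (r i)) \<in> A (fst (s (r 0)))" for i
    using s[rule_format, of "r i"] const[of i] by (cases "s (r i)") auto
  then obtain i j where ij: "i < j" "qle (snd (s (r i))) (snd (s (r j)))"
    using wqo[OF fst_B[of "r 0"], unfolded wqo_on_def, THEN spec, of "\<lambda>i. snd (s (r i))"] by auto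
  have "r i < r j"
    using r(1) ij(1) by (simp add: strict_mono_less)
  moreover have "(case s (r i) of (b, f) \<Rightarrow> \<lambda>(b', f'). b = b' \<and> qle f f') (s (r j))"
    using r(2)[OF ij(1)] ij(2) by (simp add: case_prod_beta')
  ultimately show "\<exists>i j. i < j \<and> (case s i of (b, f) \<Rightarrow> \<lambda>(b', f'). b = b' \<and> qle f f') (s j)"
    by (intro exI[of _ "r i"] exI[of _ "r j"] conjI)
qed

lemma hom_setD: "f \<in> hom_set C x y \<Longrightarrow> f \<in> Arr C \<and> Dom C f = x \<and> Cod C f = y"
  by (simp add: hom_set_def)

text \<open>A monomial at \<open>y\<close> consists of a generator of \<open>M\<close> and a
  morphism from its object to \<open>y\<close>. Monomials span \<open>M\<close> but may be linearly
  dependent, so leading terms are not read off from coefficients: they are expressed by the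
  filtration \<open>Low\<close>, \<open>LowEq\<close> of \<open>M y\<close> by spans of lower
  monomials. In this way no free module has to be introduced.\<close>

theorem strict_groebner_noetherian:
  fixes C :: "('o, 'm) cat" and k :: "('a, 'r) ring_scheme" and M :: "('o, 'm, 'a, 'b) rep"
  assumes SG: "strict_groebner C lt" and k: "cring k" "noetherian_ring k"
    and M: "is_rep k C M" and fg: "finitely_generated_rep k C M" and N: "is_subrep k C M N"
  shows "finitely_generated_rep k C (restrict_rep M N)"
proof (rule ccontr)
  assume not_fg: "\<not> finitely_generated_rep k C (restrict_rep M N)"
  interpret C: category C
    using SG by (simp add: strict_groebner_def)
  have fin_hom: "finite (hom_set C x y)" if "x \<in> Obj C" "y \<in> Obj C" for x y
    using SG that by (simp add: strict_groebner_def)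
  have irrefl: "\<not> lt f f" for f
    using SG by (simp add: strict_groebner_def)
  have trans: "lt f f''" if "lt f f'" "lt f' f''" for f f' f''
    using SG that unfolding strict_groebner_def by (elim conjE) metis
  have total: "f = f' \<or> lt f f' \<or> lt f' f" if "x \<in> Obj C" "y \<in> Obj C" "f \<in> hom_set C x y" "f' \<in> hom_set C x y" for x y f f'
    using SG that unfolding strict_groebner_def by blast
  have strict: "lt (Cmp C h f) (Cmp C h f')"
    if "x \<in> Obj C" "y \<in> Obj C" "z \<in> Obj C" "f \<in> hom_set C x y" "f' \<in> hom_set C x y" "h \<in> hom_set C y z" "lt f f'"
    for x y z f f' h
    using SG that unfolding strict_groebner_def by blast
  let ?qle = "\<lambda>f f'. \<exists>h \<in> hom_set C (Cod C f) (Cod C f'). Cmp C h f = f'"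
  have wqo: "wqo_on ?qle {f \<in> Arr C. Dom C f = x}" if "x \<in> Obj C" for x
    using SG that by (simp add: strict_groebner_def)
  note mod = is_repD(1)[OF M]
  have subN: "submodule (N y) k (Val M y)" if "y \<in> Obj C" for y
    using N that by (simp add: is_subrep_def)
  have actN: "Act M f v \<in> N y" if "x \<in> Obj C" "y \<in> Obj C" "f \<in> hom_set C x y" "v \<in> N x" for x y f v
    using N that unfolding is_subrep_def by blast
  have Ncarr: "v \<in> carrier (Val M y)" if "y \<in> Obj C" "v \<in> N y" for y v
    using module.submodule_carrier[OF mod subN] that by blast
  from fg[unfolded finitely_generated_rep_iff[OF M]]
  obtain B where B0: "finite B \<and> (\<forall>(x, v) \<in> B. x \<in> Obj C \<and> v \<in> carrier (Val M x)) \<and>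
    (\<forall>y \<in> Obj C. carrier (Val M y) \<subseteq>
      span_set k (Val M y) {Act M f v | x v f. (x, v) \<in> B \<and> f \<in> hom_set C x y})"
    by (rule exE)
  then have B: "finite B" "\<And>x v. (x, v) \<in> B \<Longrightarrow> x \<in> Obj C \<and> v \<in> carrier (Val M x)"
    by blast+
  have Bgen: "carrier (Val M y) \<subseteq> span_set k (Val M y) {Act M f v | x v f. (x, v) \<in> B \<and> f \<in> hom_set C x y}"
    if "y \<in> Obj C" for y
    using B0 that by blast
  \<comment> \<open>An arbitrary numbering of the generators. Monomials are compared by generator
    first and by \<open>lt\<close> on the morphisms for the same generator.\<close>
  obtain num :: "'o \<times> 'b \<Rightarrow> nat" where num: "inj_on num B"
    using finite_imp_inj_to_nat_seg[OF B(1)] by blast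
  define mon where "mon y = Sigma B (\<lambda>b. hom_set C (fst b) y)" for y
  define e where "e \<mu> = Act M (snd \<mu>) (snd (fst \<mu>))" for \<mu> :: "('o \<times> 'b) \<times> 'm"
  define prec where "prec \<mu> \<nu> \<longleftrightarrow> num (fst \<mu>) < num (fst \<nu>) \<or> fst \<mu> = fst \<nu> \<and> lt (snd \<mu>) (snd \<nu>)" for \<mu> \<nu> :: "('o \<times> 'b) \<times> 'm"
  have prec_irrefl: "\<not> prec \<mu> \<mu>" for \<mu>
    using irrefl by (simp add: prec_def)
  have prec_trans: "prec \<mu> \<rho>" if "prec \<mu> \<nu>" "prec \<nu> \<rho>" for \<mu> \<nu> \<rho>
    using that trans by (auto simp: prec_def)
  have prec_total: "\<mu> = \<nu> \<or> prec \<mu> \<nu> \<or> prec \<nu> \<mu>" if "y \<in> Obj C" "\<mu> \<in> mon y" "\<nu> \<in> mon y" for \<mu> \<nu> y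
  proof (cases "fst \<mu> = fst \<nu>")
    case True
    then show ?thesis
      using that total[of "fst (fst \<mu>)" y "snd \<mu>" "snd \<nu>"] B(2)[of "fst (fst \<mu>)" "snd (fst \<mu>)"]
      by (auto simp: mon_def prec_def mem_Times_iff prod_eq_iff)
  next
    case False
    then have "num (fst \<mu>) \<noteq> num (fst \<nu>)"
      using that inj_onD[OF num] by (auto simp: mon_def)
    then show ?thesis
      by (auto simp: prec_def)
  qed
  have fin_mon: "finite (mon y)" if "y \<in> Obj C" for y
    unfolding mon_def using B that by (intro finite_SigmaI fin_hom) auto
  have e_carr: "e \<mu> \<in> carrier (Val M y)" if "y \<in> Obj C" "\<mu> \<in> mon y" for \<mu> y
    using that B(2)[of "fst (fst \<mu>)" "snd (fst \<mu>)"] is_repD(3)[OF M] by (auto simp: mon_def e_def)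
  define below where "below y \<mu> = {\<nu> \<in> mon y. prec \<nu> \<mu>}" for y \<mu>
  define Low where "Low y \<mu> = span_set k (Val M y) (e ` below y \<mu>)" for y \<mu>
  define LowEq where "LowEq y \<mu> = span_set k (Val M y) (insert (e \<mu>) (e ` below y \<mu>))" for y \<mu>
  have below_carr: "e ` below y \<mu> \<subseteq> carrier (Val M y)" if "y \<in> Obj C" for y \<mu>
    using e_carr[OF that] by (auto simp: below_def)
  have leading: "v = \<zero>\<^bsub>Val M y\<^esub> \<or> (\<exists>\<nu> \<in> T. v \<in> LowEq y \<nu>)"
    if y: "y \<in> Obj C" and T: "T \<subseteq> mon y" and v: "v \<in> span_set k (Val M y) (e ` T)" for y T v
  proof (cases "T = {}")
    case True
    then show ?thesis
      using v by (auto elim: span_set.cases)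
  next
    case False
    have "finite T"
      using fin_mon[OF y] T finite_subset by blast
    then obtain m where m: "m \<in> T" "\<forall>t \<in> T. t = m \<or> prec t m"
      using finite_strict_order_max[of T prec] False prec_irrefl prec_trans prec_total[OF y] T by blast
    have "e ` T \<subseteq> insert (e m) (e ` below y m)"
      using m T by (auto simp: below_def)
    then show ?thesis
      using span_set_mono v m(1) unfolding LowEq_def by blast
  qed
  have mon_span: "carrier (Val M y) \<subseteq> span_set k (Val M y) (e ` mon y)" if "y \<in> Obj C" for y
  proof -
    have "{Act M f v | x v f. (x, v) \<in> B \<and> f \<in> hom_set C x y} \<subseteq> e ` mon y"
      by (force simp: mon_def e_def)
    then show ?thesis
      using Bgen[OF that] span_set_mono by blast
  qed
  define gens where "gens P y = {Act M f v | x v f. (x, v) \<in> P \<and> f \<in> hom_set C x y}" for P :: "('o \<times> 'b) set" and y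
  define Gen where "Gen P y = span_set k (Val M y) (gens P y)" for P y
  define inN where "inN P \<longleftrightarrow> (\<forall>(x, v) \<in> P. x \<in> Obj C \<and> v \<in> N x)" for P
  have gens_N: "gens P y \<subseteq> N y" if "inN P" "y \<in> Obj C" for P y
    using that actN by (auto simp: gens_def inN_def)
  have Gen_N: "Gen P y \<subseteq> N y" if "inN P" "y \<in> Obj C" for P y
    unfolding Gen_def using module.span_set_least[OF mod subN gens_N] that by blast
  have gens_carr: "gens P y \<subseteq> carrier (Val M y)" if "inN P" "y \<in> Obj C" for P y
    using gens_N[OF that] Ncarr[OF that(2)] by blast
  \<comment> \<open>One step of the choice: \<open>z\<close> lies in \<open>N y\<close> but is not
    generated by \<open>P\<close>, it has the form \<open>a\<close> times the monomial
    \<open>\<mu>\<close> plus lower terms \<open>l\<close>, and \<open>\<mu>\<close> is so low that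
    all elements of \<open>N y\<close> made of monomials below it are already generated by
    \<open>P\<close>.\<close>
  define good where "good P q \<longleftrightarrow> (case q of (y, z, \<mu>, a, l) \<Rightarrow> y \<in> Obj C \<and> z \<in> N y \<and> z \<notin> Gen P y \<and> \<mu> \<in> mon y \<and>
      a \<in> carrier k \<and> l \<in> Low y \<mu> \<and> z = a \<odot>\<^bsub>Val M y\<^esub> e \<mu> \<oplus>\<^bsub>Val M y\<^esub> l \<and> N y \<inter> Low y \<mu> \<subseteq> Gen P y)" for P q
  have step: "\<exists>q. good P q" if P: "finite P" "inN P" for P
  proof -
    obtain y z where y: "y \<in> Obj C" "z \<in> N y" "z \<notin> Gen P y"
      using not_fg P unfolding finitely_generated_subrep_iff[OF M N] Gen_def gens_def inN_def by blast
    interpret Module.module k "Val M y" by (rule mod[OF y(1)])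
    have zero_Gen: "\<zero>\<^bsub>Val M y\<^esub> \<in> Gen P y"
      unfolding Gen_def by (rule span_set.zero)
    \<comment> \<open>These are the monomials that bound some element of \<open>N y\<close> not
      generated by \<open>P\<close>. Below a minimal one there are none, and this is the last clause
      of \<open>good\<close>.\<close>
    define Z where "Z = {\<mu> \<in> mon y. \<exists>z \<in> N y - Gen P y. z \<in> LowEq y \<mu>}"
    have "z \<in> span_set k (Val M y) (e ` mon y)"
      using mon_span[OF y(1)] Ncarr[OF y(1,2)] by blast
    then have "Z \<noteq> {}"
      using leading[OF y(1) order_refl] y zero_Gen unfolding Z_def by blast
    moreover have "finite Z"
      using fin_mon[OF y(1)] by (simp add: Z_def)
    ultimately obtain \<mu> where \<mu>: "\<mu> \<in> Z" "\<forall>\<nu> \<in> Z. \<not> prec \<nu> \<mu>"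
      using finite_strict_order_minimal[of Z prec] prec_irrefl prec_trans by blast
    then obtain z' where z': "\<mu> \<in> mon y" "z' \<in> N y" "z' \<notin> Gen P y" "z' \<in> LowEq y \<mu>"
      by (auto simp: Z_def)
    then obtain a l where "a \<in> carrier k" "l \<in> Low y \<mu>" "z' = a \<odot>\<^bsub>Val M y\<^esub> e \<mu> \<oplus>\<^bsub>Val M y\<^esub> l"
      using span_set_insert[OF below_carr[OF y(1)] e_carr[OF y(1) z'(1)], of z' \<mu>] unfolding LowEq_def Low_def by blast
    moreover have "N y \<inter> Low y \<mu> \<subseteq> Gen P y"
    proof
      fix w assume w: "w \<in> N y \<inter> Low y \<mu>"
      show "w \<in> Gen P y"
      proof (rule ccontr)
        assume nw: "w \<notin> Gen P y"
        have "below y \<mu> \<subseteq> mon y"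
          by (auto simp: below_def)
        then obtain \<nu> where "\<nu> \<in> below y \<mu>" "w \<in> LowEq y \<nu>"
          using leading[OF y(1), of "below y \<mu>" w] w nw zero_Gen unfolding Low_def by blast
        then have "\<nu> \<in> Z" "prec \<nu> \<mu>"
          using w nw by (auto simp: Z_def below_def)
        then show False
          using \<mu>(2) by blast
      qed
    qed
    ultimately have "good P (y, z', \<mu>, a, l)"
      using y(1) z' by (simp add: good_def)
    then show ?thesis
      by blast
  qed
  define pick where "pick P = (SOME q. good P q)" for P
  define pt where "pt q = (fst q, fst (snd q))" for q :: "'o \<times> 'b \<times> (('o \<times> 'b) \<times> 'm) \<times> 'a \<times> 'b"
  \<comment> \<open>The elements chosen so far, each with its object. Every choice is made relative
    to all earlier ones.\<close>
  define Ps where "Ps = rec_nat {} (\<lambda>_ P. insert (pt (pick P)) P)"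
  have Ps_simps: "Ps 0 = {}" "Ps (Suc n) = insert (pt (pick (Ps n))) (Ps n)" for n
    by (simp_all add: Ps_def)
  have Ps: "finite (Ps n) \<and> inN (Ps n)" for n
  proof (induction n)
    case (Suc n)
    then have "good (Ps n) (pick (Ps n))"
      using step someI_ex unfolding pick_def by metis
    then show ?case
      using Suc by (auto simp: Ps_simps inN_def good_def pt_def split: prod.splits)
  qed (simp add: Ps_simps inN_def)
  have good: "good (Ps n) (pick (Ps n))" for n
    using step Ps someI_ex unfolding pick_def by metis
  define ys zs \<mu>s cs ls where "ys n = fst (pick (Ps n))" and "zs n = fst (snd (pick (Ps n)))"
    and "\<mu>s n = fst (snd (snd (pick (Ps n))))" and "cs n = fst (snd (snd (snd (pick (Ps n)))))"
    and "ls n = snd (snd (snd (snd (pick (Ps n)))))" for n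
  have S: "ys n \<in> Obj C" "zs n \<in> N (ys n)" "zs n \<notin> Gen (Ps n) (ys n)" "\<mu>s n \<in> mon (ys n)" "cs n \<in> carrier k"
      "ls n \<in> Low (ys n) (\<mu>s n)" "zs n = cs n \<odot>\<^bsub>Val M (ys n)\<^esub> e (\<mu>s n) \<oplus>\<^bsub>Val M (ys n)\<^esub> ls n"
      "N (ys n) \<inter> Low (ys n) (\<mu>s n) \<subseteq> Gen (Ps n) (ys n)" for n
    using good[of n] by (auto simp: good_def ys_def zs_def \<mu>s_def cs_def ls_def split: prod.splits)
  have prior: "(ys i, zs i) \<in> Ps n" if "i < n" for i n
    using that by (induction n) (auto simp: Ps_simps pt_def ys_def zs_def less_Suc_eq)
  \<comment> \<open>Pigeonhole on the finitely many generators together with (G2) for the morphisms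
    out of each: along a subsequence, all leading monomials have the same generator and each divides
    the later ones.\<close>
  have wqoB: "wqo_on (\<lambda>(b, f) (b', f'). b = b' \<and> ?qle f f') (Sigma B (\<lambda>b. {f \<in> Arr C. Dom C f = fst b}))"
    using B(2) by (intro wqo_on_Sigma_finite B(1) wqo) auto
  have \<mu>s_in: "\<mu>s n \<in> Sigma B (\<lambda>b. {f \<in> Arr C. Dom C f = fst b})" for n
    using S(4)[of n] by (auto simp: mon_def hom_set_def)
  obtain r :: "nat \<Rightarrow> nat" where r1: "strict_mono r"
    and r': "\<And>i j. i < j \<Longrightarrow> (\<lambda>(b, f) (b', f'). b = b' \<and> ?qle f f') (\<mu>s (r i)) (\<mu>s (r j))"
    using wqo_on_subseq[OF wqoB, of \<mu>s, OF \<mu>s_in] by blast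
  have r2: "fst (\<mu>s (r i)) = fst (\<mu>s (r j)) \<and> ?qle (snd (\<mu>s (r i))) (snd (\<mu>s (r j)))" if "i < j" for i j
    using r'[OF that] by (simp add: case_prod_beta')
  note r = r1 r2
  interpret k: cring k by (rule k(1))
  interpret k: noetherian_ring k by (rule k(2))
  \<comment> \<open>Stationarity of this chain is only used at one place \<open>m\<close>, where the
    leading coefficient number \<open>m\<close> of the subsequence lies in the ideal of the earlier
    ones.\<close>
  define I where "I m = genideal k ((\<lambda>j. cs (r j)) ` {..<m})" for m :: nat
  have I_ideal: "ideal (I m) k" for m
    unfolding I_def using S(5) by (intro k.genideal_ideal) auto
  have I_mono: "I m \<subseteq> I m'" if "m \<le> m'" for m m'
    unfolding I_def using that S(5) by (intro k.subset_Idl_subset) auto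
  have I_chain: "I a \<subseteq> I b \<or> I b \<subseteq> I a" for a b
    using I_mono[of a b] I_mono[of b a] by (cases "a \<le> b") auto
  have "\<Union> (range I) \<in> range I"
  proof (rule k.ideal_chain_is_trivial)
    show "subset.chain {I. ideal I k} (range I)"
      unfolding subset_chain_def using I_ideal I_chain by auto
  qed auto
  then obtain m where m: "I (Suc m) \<subseteq> I m"
    by auto
  have am: "cs (r m) \<in> I m"
  proof -
    have "cs (r m) \<in> (\<lambda>j. cs (r j)) ` {..<Suc m}"
      by auto
    then have "cs (r m) \<in> I (Suc m)"
      unfolding I_def using S(5) k.genideal_self[of "(\<lambda>j. cs (r j)) ` {..<Suc m}"] by blast
    then show ?thesis
      using m by blast
  qed
  define y P \<mu> where "y = ys (r m)" and "P = Ps (r m)" and "\<mu> = \<mu>s (r m)"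
  have y: "y \<in> Obj C" and P: "inN P" and \<mu>: "\<mu> \<in> mon y"
    using S Ps by (auto simp: y_def P_def \<mu>_def)
  interpret My: Module.module k "Val M y" by (rule mod[OF y])
  define G L where "G = gens P y" and "L = e ` below y \<mu>"
  have GL: "G \<subseteq> carrier (Val M y)" "L \<subseteq> carrier (Val M y)"
    using gens_carr[OF P y] below_carr[OF y] by (auto simp: G_def L_def)
  then have GL': "G \<union> L \<subseteq> carrier (Val M y)"
    by blast
  define W where "W = span_set k (Val M y) (G \<union> L)"
  have W_carr: "w \<in> carrier (Val M y)" if "w \<in> W" for w
    using that My.span_set_carrier[OF GL'] by (simp add: W_def)
  note e\<mu> = e_carr[OF y \<mu>]
  \<comment> \<open>\<open>W\<close> consists of what \<open>P\<close> generates at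
    \<open>y\<close>, plus lower monomials. Collecting the scalars that bring the leading monomial
    into \<open>W\<close> in an ideal reduces the cancellation to single earlier coefficients, with
    no explicit linear combination.\<close>
  define K where "K = {c \<in> carrier k. c \<odot>\<^bsub>Val M y\<^esub> e \<mu> \<in> W}"
  have "ideal K k"
  proof (rule idealI)
    show "ring k"
      by (rule k.ring_axioms)
    show "subgroup K (add_monoid k)"
    proof (rule k.add.subgroupI)
      show "K \<noteq> {}"
        using e\<mu> by (auto simp: K_def W_def My.smult_l_null span_set.zero intro!: exI[of _ "\<zero>\<^bsub>k\<^esub>"])
      fix c d assume c: "c \<in> K"
      have "(\<ominus>\<^bsub>k\<^esub> c) \<odot>\<^bsub>Val M y\<^esub> e \<mu> = (\<ominus>\<^bsub>k\<^esub> \<one>\<^bsub>k\<^esub>) \<odot>\<^bsub>Val M y\<^esub> (c \<odot>\<^bsub>Val M y\<^esub> e \<mu>)"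
        using c e\<mu> by (simp add: K_def k.l_minus flip: My.smult_assoc1)
      then show "\<ominus>\<^bsub>k\<^esub> c \<in> K"
        using c My.span_set_smult[OF GL'] by (simp add: K_def W_def)
      assume d: "d \<in> K"
      show "c \<oplus>\<^bsub>k\<^esub> d \<in> K"
        using c d e\<mu> My.span_set_add[OF GL'] by (simp add: K_def W_def My.smult_l_distr)
    qed (auto simp: K_def)
    fix c x assume c: "c \<in> K" and x: "x \<in> carrier k"
    show "x \<otimes>\<^bsub>k\<^esub> c \<in> K"
      using c x e\<mu> My.span_set_smult[OF GL'] by (simp add: K_def W_def My.smult_assoc1)
    then show "c \<otimes>\<^bsub>k\<^esub> x \<in> K"
      using c x by (simp add: K_def k.m_comm)
  qed
  \<comment> \<open>The earlier element \<open>zs (r j)\<close> is transported along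
    \<open>h\<close> to \<open>y\<close>. Its leading monomial becomes \<open>\<mu>\<close>, its
    lower terms stay lower, and the image is generated by \<open>P\<close>.\<close>
  moreover have "cs (r j) \<in> K" if jm: "j < m" for j
  proof -
    define y' \<mu>' where "y' = ys (r j)" and "\<mu>' = \<mu>s (r j)"
    have y': "y' \<in> Obj C" and \<mu>': "\<mu>' \<in> mon y'"
      using S by (auto simp: y'_def \<mu>'_def)
    interpret My': Module.module k "Val M y'" by (rule mod[OF y'])
    have fst_eq: "fst \<mu>' = fst \<mu>"
      using r(2)[OF jm] by (simp add: \<mu>_def \<mu>'_def)
    have f': "snd \<mu>' \<in> hom_set C (fst (fst \<mu>)) y'" and f: "snd \<mu> \<in> hom_set C (fst (fst \<mu>)) y" and bB: "fst \<mu> \<in> B"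
      using \<mu> \<mu>' fst_eq by (auto simp: mon_def)
    have "\<exists>h \<in> hom_set C (Cod C (snd \<mu>')) (Cod C (snd \<mu>)). Cmp C h (snd \<mu>') = snd \<mu>"
      using r(2)[OF jm] by (simp add: \<mu>_def \<mu>'_def)
    then obtain h where h: "h \<in> hom_set C y' y" "Cmp C h (snd \<mu>') = snd \<mu>"
      using hom_setD[OF f'] hom_setD[OF f] by auto
    have b: "fst (fst \<mu>) \<in> Obj C" "snd (fst \<mu>) \<in> carrier (Val M (fst (fst \<mu>)))"
      using B(2)[of "fst (fst \<mu>)" "snd (fst \<mu>)"] bB by auto
    have act_e: "Act M h (e \<mu>') = e \<mu>"
      using is_repD(5)[OF M b(1) y' y f' h(1) b(2)] h(2) fst_eq by (simp add: e_def)
    have lin: "linear_map k (Val M y') (Val M y) (Act M h)"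
      by (rule is_repD(2)[OF M y' y h(1)])
    \<comment> \<open>Here composition must preserve the strict order: a lower monomial that merged
      with the leading one would spoil its coefficient.\<close>
    have low_im: "Act M h ` (e ` below y' \<mu>') \<subseteq> L"
    proof
      fix w assume "w \<in> Act M h ` (e ` below y' \<mu>')"
      then obtain \<nu> where \<nu>: "\<nu> \<in> mon y'" "prec \<nu> \<mu>'" "w = Act M h (e \<nu>)"
        by (auto simp: below_def)
      have \<nu>B: "fst \<nu> \<in> B" "snd \<nu> \<in> hom_set C (fst (fst \<nu>)) y'"
        using \<nu>(1) by (auto simp: mon_def)
      have \<nu>C: "fst (fst \<nu>) \<in> Obj C" "snd (fst \<nu>) \<in> carrier (Val M (fst (fst \<nu>)))"
        using B(2)[of "fst (fst \<nu>)" "snd (fst \<nu>)"] \<nu>B by auto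
      define \<nu>' where "\<nu>' = (fst \<nu>, Cmp C h (snd \<nu>))"
      have "w = e \<nu>'"
        using is_repD(5)[OF M \<nu>C(1) y' y \<nu>B(2) h(1) \<nu>C(2)] \<nu>(3) by (simp add: e_def \<nu>'_def)
      moreover have "\<nu>' \<in> mon y"
        using \<nu>B C.Cmp_in[OF \<nu>B(2) h(1)] by (simp add: mon_def \<nu>'_def)
      moreover have "prec \<nu>' \<mu>"
        using \<nu>(2) fst_eq h(2) strict[OF b(1) y' y _ f' h(1), of "snd \<nu>"] \<nu>B(2) by (auto simp: prec_def \<nu>'_def)
      ultimately show "w \<in> L"
        by (auto simp: L_def below_def)
    qed
    have ez: "e \<mu>' \<in> carrier (Val M y')" "ls (r j) \<in> carrier (Val M y')"
      using e_carr[OF y' \<mu>'] S(6)[of "r j"] My'.span_set_carrier[OF below_carr[OF y']]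
      by (auto simp: Low_def y'_def \<mu>'_def)
    have "Act M h (zs (r j)) = cs (r j) \<odot>\<^bsub>Val M y\<^esub> e \<mu> \<oplus>\<^bsub>Val M y\<^esub> Act M h (ls (r j))"
      using S(7)[of "r j"] lin ez S(5)[of "r j"] act_e unfolding linear_map_def by (simp flip: y'_def \<mu>'_def)
    moreover have l: "Act M h (ls (r j)) \<in> span_set k (Val M y) L"
      using linear_map_span_set[OF mod[OF y'] mod[OF y] lin below_carr[OF y'], of "ls (r j)" \<mu>'] S(6)[of "r j"]
        span_set_mono[OF low_im] by (auto simp: Low_def y'_def \<mu>'_def)
    moreover have "Act M h (zs (r j)) \<in> G"
    proof -
      have "r j < r m"
        using r(1) jm by (simp add: strict_mono_less)
      then have "(y', zs (r j)) \<in> P"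
        using prior by (simp add: P_def y'_def)
      then show ?thesis
        using h(1) by (auto simp: G_def gens_def)
    qed
    ultimately have "cs (r j) \<odot>\<^bsub>Val M y\<^esub> e \<mu> = Act M h (zs (r j)) \<ominus>\<^bsub>Val M y\<^esub> Act M h (ls (r j))"
      using My.span_set_carrier[OF GL(2) l] e\<mu> S(5)[of "r j"]
      by (simp add: My.M.minus_eq My.M.a_assoc My.M.r_neg)
    moreover have "Act M h (zs (r j)) \<in> W" "Act M h (ls (r j)) \<in> W"
      using \<open>Act M h (zs (r j)) \<in> G\<close> l My.span_set_base[OF GL'] span_set_mono[of L "G \<union> L" k "Val M y"]
      by (auto simp: W_def)
    ultimately show ?thesis
      using S(5) My.span_set_minus[OF GL'] by (simp add: K_def W_def)
  qed
  ultimately have "I m \<subseteq> K"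
    unfolding I_def by (intro k.genideal_minimal) auto
  then have "cs (r m) \<odot>\<^bsub>Val M y\<^esub> e \<mu> \<in> W"
    using am by (auto simp: K_def)
  moreover have lL: "ls (r m) \<in> span_set k (Val M y) L"
    using S(6)[of "r m"] by (simp add: Low_def L_def y_def \<mu>_def)
  then have "ls (r m) \<in> W"
    using span_set_mono[of L "G \<union> L" k "Val M y"] by (auto simp: W_def)
  ultimately have "zs (r m) \<in> W"
    using S(7)[of "r m"] My.span_set_add[OF GL'] by (simp add: W_def y_def \<mu>_def)
  \<comment> \<open>The part \<open>v\<close> of lower terms is the difference of two elements of
    \<open>N y\<close>, so it lies in \<open>N y\<close> and is generated by \<open>P\<close>
    through the minimality of \<open>\<mu>\<close>. Then so is \<open>zs (r m)\<close>, against its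
    choice.\<close>
  then obtain u v where uv: "u \<in> span_set k (Val M y) G" "v \<in> span_set k (Val M y) L" "zs (r m) = u \<oplus>\<^bsub>Val M y\<^esub> v"
    using My.span_set_Un[OF GL] unfolding W_def by blast
  have uG: "u \<in> Gen P y"
    using uv(1) by (simp add: Gen_def G_def)
  have carr: "u \<in> carrier (Val M y)" "v \<in> carrier (Val M y)"
    using uv My.span_set_carrier GL by auto
  have zN: "zs (r m) \<in> N y"
    using S(2)[of "r m"] by (simp add: y_def)
  have uN: "u \<in> N y"
    using uG Gen_N[OF P y] by blast
  have "v = zs (r m) \<ominus>\<^bsub>Val M y\<^esub> u"
    using carr uv(3) by (simp add: My.M.minus_eq My.M.a_comm[of u v] My.M.a_assoc My.M.r_neg)
  then have "v \<in> N y"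
    using My.submodule_minus[OF subN[OF y] zN uN] by simp
  then have "v \<in> Gen P y"
    using S(8)[of "r m"] uv(2) by (auto simp: Low_def L_def y_def \<mu>_def P_def)
  then have "zs (r m) \<in> Gen P y"
    using uv(3) uG My.span_set_add[OF gens_carr[OF P y]] by (simp add: Gen_def)
  then show False
    using S(3)[of "r m"] by (simp add: y_def P_def)
qed

section \<open>Transfer of noetherianity along a functor with property (F)\<close>

lemma is_functorD:
  assumes "is_functor C D F0 F1"
  shows "x \<in> Obj C \<Longrightarrow> F0 x \<in> Obj D"
    "x \<in> Obj C \<Longrightarrow> y \<in> Obj C \<Longrightarrow> f \<in> hom_set C x y \<Longrightarrow> F1 f \<in> hom_set D (F0 x) (F0 y)"
    "x \<in> Obj C \<Longrightarrow> F1 (Idn C x) = Idn D (F0 x)"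
    "x \<in> Obj C \<Longrightarrow> y \<in> Obj C \<Longrightarrow> z \<in> Obj C \<Longrightarrow> f \<in> hom_set C x y \<Longrightarrow> h \<in> hom_set C y z \<Longrightarrow>
      F1 (Cmp C h f) = Cmp D (F1 h) (F1 f)"
  using assms unfolding is_functor_def by auto

text \<open>Representations are pulled back along the functor. Property (F) says that the pullback
  of a finitely generated representation is finitely generated; essential surjectivity brings
  generators of the pulled back subrepresentation back to all objects.\<close>

theorem locally_noetherian_transfer:
  fixes C :: "('o, 'm) cat" and C' :: "('p, 'n) cat" and k :: "('a, 'r) ring_scheme"
  assumes SG: "strict_groebner C' lt" and F: "is_functor C' C F0 F1"
    and ess: "essentially_surjective C' C F0" and pF: "property_F C' C F0 F1" and C: "category C"
    and k: "cring k" "noetherian_ring k"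
  shows "locally_noetherian TYPE('b) k C"
  unfolding locally_noetherian_def
proof (intro allI impI, elim conjE)
  fix M :: "('o, 'm, 'a, 'b) rep" and N
  assume M: "is_rep k C M" and fg: "finitely_generated_rep k C M" and N: "is_subrep k C M N"
  interpret C: category C
    by (rule C)
  note F0 = is_functorD(1)[OF F] and F1 = is_functorD(2)[OF F]
  define M' :: "('p, 'n, 'a, 'b) rep" where "M' = \<lparr>Val = (\<lambda>y. Val M (F0 y)), Act = (\<lambda>f. Act M (F1 f))\<rparr>"
  define N' where "N' y = N (F0 y)" for y
  have M'_simps [simp]: "Val M' y = Val M (F0 y)" "Act M' f = Act M (F1 f)" for y f
    by (simp_all add: M'_def)
  have M': "is_rep k C' M'"
    unfolding is_rep_def
  proof (intro conjI ballI)
    fix x assume x: "x \<in> Obj C'"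
    show "Module.module k (Val M' x)"
      using is_repD(1)[OF M F0[OF x]] by simp
    show "Act M' (Idn C' x) v = v" if "v \<in> carrier (Val M' x)" for v
      using is_repD(4)[OF M F0[OF x]] that by (simp add: is_functorD(3)[OF F x])
    fix y f assume y: "y \<in> Obj C'" and f: "f \<in> hom_set C' x y"
    show "linear_map k (Val M' x) (Val M' y) (Act M' f)"
      using is_repD(2)[OF M F0[OF x] F0[OF y] F1[OF x y f]] by simp
    fix z h v assume z: "z \<in> Obj C'" and h: "h \<in> hom_set C' y z" and v: "v \<in> carrier (Val M' x)"
    show "Act M' (Cmp C' h f) v = Act M' h (Act M' f v)"
      using is_repD(5)[OF M F0[OF x] F0[OF y] F0[OF z] F1[OF x y f] F1[OF y z h]] v
      by (simp add: is_functorD(4)[OF F x y z f h])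
  qed
  have N': "is_subrep k C' M' N'"
    unfolding is_subrep_def
  proof (intro conjI ballI)
    fix x assume x: "x \<in> Obj C'"
    show "submodule (N' x) k (Val M' x)"
      using N F0[OF x] by (simp add: is_subrep_def N'_def)
    fix y f assume y: "y \<in> Obj C'" and f: "f \<in> hom_set C' x y"
    show "Act M' f ` N' x \<subseteq> N' y"
      using N F0[OF x] F0[OF y] F1[OF x y f] unfolding is_subrep_def N'_def M'_simps by blast
  qed
  have fg': "finitely_generated_rep k C' M'"
  proof -
    from fg[unfolded finitely_generated_rep_iff[OF M]]
    obtain B where B0: "finite B \<and> (\<forall>(x, v) \<in> B. x \<in> Obj C \<and> v \<in> carrier (Val M x)) \<and>
      (\<forall>y \<in> Obj C. carrier (Val M y) \<subseteq>
        span_set k (Val M y) {Act M f v | x v f. (x, v) \<in> B \<and> f \<in> hom_set C x y})"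
      by (rule exE)
    have "\<forall>x \<in> Obj C. \<exists>S. finite S \<and> (\<forall>(y, f) \<in> S. y \<in> Obj C' \<and> f \<in> hom_set C x (F0 y)) \<and>
      (\<forall>y \<in> Obj C'. \<forall>f \<in> hom_set C x (F0 y). \<exists>(z, e) \<in> S. \<exists>g \<in> hom_set C' z y. f = Cmp C (F1 g) e)"
      using pF by (simp add: property_F_def)
    from bchoice[OF this] obtain S where S0: "\<forall>x \<in> Obj C. finite (S x) \<and>
      (\<forall>(y, f) \<in> S x. y \<in> Obj C' \<and> f \<in> hom_set C x (F0 y)) \<and>
      (\<forall>y \<in> Obj C'. \<forall>f \<in> hom_set C x (F0 y). \<exists>(z, e) \<in> S x. \<exists>g \<in> hom_set C' z y. f = Cmp C (F1 g) e)"
      by (rule exE)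
    have S: "finite (S x)" "\<And>y f. (y, f) \<in> S x \<Longrightarrow> y \<in> Obj C' \<and> f \<in> hom_set C x (F0 y)"
      "\<And>y f. y \<in> Obj C' \<Longrightarrow> f \<in> hom_set C x (F0 y) \<Longrightarrow> \<exists>z e g. (z, e) \<in> S x \<and> g \<in> hom_set C' z y \<and> f = Cmp C (F1 g) e"
      if "x \<in> Obj C" for x
      using S0 that by (blast, blast, fast)
    \<comment> \<open>Each generator at \<open>x\<close> is moved along the finitely many morphisms
      that (F) provides for \<open>x\<close>. Any other image of it in the pullback factors through
      one of these.\<close>
    define B' where "B' = (\<Union>(x, v) \<in> B. (\<lambda>(y, f). (y, Act M f v)) ` S x)"
    have Bx: "x \<in> Obj C" "v \<in> carrier (Val M x)" if "(x, v) \<in> B" for x v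
      using B0 that by blast+
    show ?thesis
      unfolding finitely_generated_rep_iff[OF M']
    proof (intro exI[of _ B'] conjI ballI)
      show "finite B'"
        unfolding B'_def using B0 S(1) Bx by (intro finite_UN_I) (auto split: prod.splits)
      show "case p of (x, v) \<Rightarrow> x \<in> Obj C' \<and> v \<in> carrier (Val M' x)" if pB: "p \<in> B'" for p
      proof -
        obtain x v y f where p: "p = (y, Act M f v)" "(x, v) \<in> B" "(y, f) \<in> S x"
          using pB by (auto simp: B'_def)
        note x = Bx[OF p(2)]
        have y: "y \<in> Obj C'" "f \<in> hom_set C x (F0 y)"
          using S(2)[OF x(1) p(3)] by auto
        then show ?thesis
          using is_repD(3)[OF M x(1) F0[OF y(1)] y(2) x(2)] p(1) by simp
      qed
      fix y assume y: "y \<in> Obj C'"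
      have "{Act M f v | x v f. (x, v) \<in> B \<and> f \<in> hom_set C x (F0 y)}
        \<subseteq> {Act M' f v | x v f. (x, v) \<in> B' \<and> f \<in> hom_set C' x y}"
      proof
        fix w assume "w \<in> {Act M f v | x v f. (x, v) \<in> B \<and> f \<in> hom_set C x (F0 y)}"
        then obtain x v f where w: "w = Act M f v" "(x, v) \<in> B" "f \<in> hom_set C x (F0 y)"
          by blast
        note x = Bx[OF w(2)]
        obtain z e g where zeg: "(z, e) \<in> S x" "g \<in> hom_set C' z y" "f = Cmp C (F1 g) e"
          using S(3)[OF x(1) y w(3)] by blast
        have z: "z \<in> Obj C'" "e \<in> hom_set C x (F0 z)"
          using S(2)[OF x(1) zeg(1)] by auto
        have "w = Act M' g (Act M e v)"
          using is_repD(5)[OF M x(1) F0[OF z(1)] F0[OF y] z(2) F1[OF z(1) y zeg(2)] x(2)] w(1) zeg(3) by simp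
        moreover have "(z, Act M e v) \<in> B'"
          using w(2) zeg(1) by (force simp: B'_def)
        ultimately show "w \<in> {Act M' f v | x v f. (x, v) \<in> B' \<and> f \<in> hom_set C' x y}"
          using zeg(2) by blast
      qed
      moreover have "carrier (Val M (F0 y)) \<subseteq>
          span_set k (Val M (F0 y)) {Act M f v | x v f. (x, v) \<in> B \<and> f \<in> hom_set C x (F0 y)}"
        using B0 F0[OF y] by blast
      ultimately show "carrier (Val M' y) \<subseteq> span_set k (Val M' y) {Act M' f v | x v f. (x, v) \<in> B' \<and> f \<in> hom_set C' x y}"
        using span_set_mono unfolding M'_simps by blast
    qed
  qed
  from strict_groebner_noetherian[OF SG k M' fg' N', unfolded finitely_generated_subrep_iff[OF M' N']]
  obtain B where B0: "finite B \<and> (\<forall>(x, v) \<in> B. x \<in> Obj C' \<and> v \<in> N' x) \<and>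
    (\<forall>y \<in> Obj C'. N' y \<subseteq> span_set k (Val M' y) {Act M' f v | x v f. (x, v) \<in> B \<and> f \<in> hom_set C' x y})"
    by (rule exE)
  have Bx: "x \<in> Obj C'" "v \<in> N (F0 x)" if "(x, v) \<in> B" for x v
    using B0 that by (auto simp: N'_def)
  have Ncarr: "v \<in> carrier (Val M x)" if "x \<in> Obj C" "v \<in> N x" for x v
  proof -
    have "submodule (N x) k (Val M x)"
      using N that(1) by (simp add: is_subrep_def)
    then show ?thesis
      using module.submodule_carrier[OF is_repD(1)[OF M that(1)]] that(2) by blast
  qed
  show "finitely_generated_rep k C (restrict_rep M N)"
    unfolding finitely_generated_subrep_iff[OF M N]
  proof (intro exI[of _ "(\<lambda>(y, v). (F0 y, v)) ` B"] conjI ballI)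
    show "finite ((\<lambda>(y, v). (F0 y, v)) ` B)"
      using B0 by blast
    show "case p of (x, v) \<Rightarrow> x \<in> Obj C \<and> v \<in> N x" if "p \<in> (\<lambda>(y, v). (F0 y, v)) ` B" for p
      using that Bx F0 by auto
    fix x assume x: "x \<in> Obj C"
    \<comment> \<open>An element at \<open>x\<close> is carried to the isomorphic object
      \<open>F0 y\<close>, expressed there by the generators found in the pullback, and carried
      back.\<close>
    obtain y \<alpha> where y: "y \<in> Obj C'" and \<alpha>: "\<alpha> \<in> iso_set C x (F0 y)"
      using ess x unfolding essentially_surjective_def by blast
    obtain \<beta> where \<alpha>\<beta>: "\<alpha> \<in> hom_set C x (F0 y)" "\<beta> \<in> hom_set C (F0 y) x" "Cmp C \<beta> \<alpha> = Idn C x"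
      using \<alpha> by (auto simp: iso_set_def)
    let ?G = "{Act M' f v | x v f. (x, v) \<in> B \<and> f \<in> hom_set C' x y}"
    let ?H = "{Act M f v | x' v f. (x', v) \<in> (\<lambda>(y, v). (F0 y, v)) ` B \<and> f \<in> hom_set C x' x}"
    show "N x \<subseteq> span_set k (Val M x) ?H"
    proof
      fix v assume v: "v \<in> N x"
      have "Act M \<alpha> v \<in> N (F0 y)"
        using N x F0[OF y] \<alpha>\<beta>(1) v unfolding is_subrep_def by blast
      then have "Act M \<alpha> v \<in> span_set k (Val M (F0 y)) ?G"
        using B0 y by (auto simp: N'_def)
      moreover have G: "?G \<subseteq> carrier (Val M (F0 y))"
      proof
        fix w assume "w \<in> ?G"
        then obtain x' u f where w: "w = Act M (F1 f) u" "(x', u) \<in> B" "f \<in> hom_set C' x' y"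
          by auto
        show "w \<in> carrier (Val M (F0 y))"
          unfolding w(1)
          by (rule is_repD(3)[OF M F0 F0 F1]) (use Bx[OF w(2)] w(3) y Ncarr F0 in auto)
      qed
      ultimately have "Act M \<beta> (Act M \<alpha> v) \<in> span_set k (Val M x) (Act M \<beta> ` ?G)"
        using linear_map_span_set[OF is_repD(1)[OF M F0[OF y]] is_repD(1)[OF M x] is_repD(2)[OF M F0[OF y] x \<alpha>\<beta>(2)]]
        by blast
      moreover have "Act M \<beta> (Act M \<alpha> v) = v"
        using is_repD(5)[OF M x F0[OF y] x \<alpha>\<beta>(1,2) Ncarr[OF x v]] is_repD(4)[OF M x Ncarr[OF x v]] \<alpha>\<beta>(3) by simp
      moreover have "Act M \<beta> ` ?G \<subseteq> ?H"
      proof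
        fix w assume "w \<in> Act M \<beta> ` ?G"
        then obtain x' u f where w: "w = Act M \<beta> (Act M (F1 f) u)" "(x', u) \<in> B" "f \<in> hom_set C' x' y"
          by auto
        note x' = Bx[OF w(2)]
        have f: "F1 f \<in> hom_set C (F0 x') (F0 y)"
          by (rule F1[OF x'(1) y w(3)])
        have "w = Act M (Cmp C \<beta> (F1 f)) u"
          using is_repD(5)[OF M F0[OF x'(1)] F0[OF y] x f \<alpha>\<beta>(2) Ncarr[OF F0[OF x'(1)] x'(2)]] w(1) by simp
        moreover have "Cmp C \<beta> (F1 f) \<in> hom_set C (F0 x') x"
          by (rule C.Cmp_in[OF f \<alpha>\<beta>(2)])
        moreover have "(F0 x', u) \<in> (\<lambda>(y, v). (F0 y, v)) ` B"
          using w(2) by force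
        ultimately show "w \<in> ?H"
          by blast
      qed
      ultimately show "v \<in> span_set k (Val M x) ?H"
        using span_set_mono by fastforce
    qed
  qed
qed

section \<open>Canonical graphs and their embeddings\<close>

text \<open>In a canonical graph \<open>att1\<close> maps a vertex to its parent and fixes the root
  0, so the ancestors of a vertex are the values of the iterates of \<open>att1\<close>.\<close>

definition anc :: "graph \<Rightarrow> nat \<Rightarrow> nat \<Rightarrow> bool" where
  "anc Y i j \<longleftrightarrow> (\<exists>k. (att1 Y ^^ k) j = i)"

abbreviation nv :: "graph \<Rightarrow> nat" where "nv Y \<equiv> card (verts Y)"

text \<open>For a connected graph this is the first Betti number, that is the number of edges
  outside of a spanning tree.\<close>

abbreviation nx :: "graph \<Rightarrow> nat" where "nx Y \<equiv> Suc (card (edges Y)) - card (verts Y)"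

text \<open>A canonical graph is a graph with a spanning tree, rooted at \<open>0\<close> and planar, in a
  normal form. The vertices are numbered in depth-first order, the tree edge \<open>i\<close> connects the
  vertex \<open>i\<close> to its parent, and the \<open>nx Y\<close> remaining edges have the numbers from \<open>nv Y\<close> on.
  That the parent of \<open>i\<close> is an ancestor of \<open>i - 1\<close> characterizes depth-first numberings.\<close>

definition canonical :: "graph \<Rightarrow> bool" where
  "canonical Y \<longleftrightarrow> (\<exists>n m. 1 \<le> n \<and> n \<le> m \<and> verts Y = {..<n} \<and> edges Y = {1..<m} \<and>
    (\<forall>i. 1 \<le> i \<and> i < n \<longrightarrow> att0 Y i = i \<and> att1 Y i < i \<and> anc Y (att1 Y i) (i - 1)) \<and>
    (\<forall>i. n \<le> i \<and> i < m \<longrightarrow> att0 Y i < n \<and> att1 Y i < n) \<and>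
    (\<forall>i. i = 0 \<or> m \<le> i \<longrightarrow> att0 Y i = 0 \<and> att1 Y i = 0))"

lemma canonicalD:
  assumes "canonical Y"
  shows "v \<in> verts Y \<longleftrightarrow> v < nv Y" "e \<in> edges Y \<longleftrightarrow> 1 \<le> e \<and> e < nv Y + nx Y" "0 < nv Y"
    "1 \<le> i \<Longrightarrow> i < nv Y \<Longrightarrow> att0 Y i = i" "1 \<le> i \<Longrightarrow> i < nv Y \<Longrightarrow> att1 Y i < i"
    "1 \<le> i \<Longrightarrow> i < nv Y \<Longrightarrow> anc Y (att1 Y i) (i - 1)"
    "c < nx Y \<Longrightarrow> att0 Y (nv Y + c) < nv Y" "c < nx Y \<Longrightarrow> att1 Y (nv Y + c) < nv Y"
    "i = 0 \<or> nv Y + nx Y \<le> i \<Longrightarrow> att0 Y i = 0 \<and> att1 Y i = 0"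
proof -
  obtain n m where Y: "1 \<le> n" "n \<le> m" "verts Y = {..<n}" "edges Y = {1..<m}"
    "\<forall>i. 1 \<le> i \<and> i < n \<longrightarrow> att0 Y i = i \<and> att1 Y i < i \<and> anc Y (att1 Y i) (i - 1)"
    "\<forall>i. n \<le> i \<and> i < m \<longrightarrow> att0 Y i < n \<and> att1 Y i < n"
    "\<forall>i. i = 0 \<or> m \<le> i \<longrightarrow> att0 Y i = 0 \<and> att1 Y i = 0"
    using assms unfolding canonical_def by blast
  have *: "nv Y = n" "nv Y + nx Y = m"
    using Y(1-4) by auto
  have **: "n + c < m" if "c < nx Y"
    using that * by linarith
  show "v \<in> verts Y \<longleftrightarrow> v < nv Y" "e \<in> edges Y \<longleftrightarrow> 1 \<le> e \<and> e < nv Y + nx Y" "0 < nv Y"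
    "1 \<le> i \<Longrightarrow> i < nv Y \<Longrightarrow> att0 Y i = i" "1 \<le> i \<Longrightarrow> i < nv Y \<Longrightarrow> att1 Y i < i"
    "1 \<le> i \<Longrightarrow> i < nv Y \<Longrightarrow> anc Y (att1 Y i) (i - 1)"
    "c < nx Y \<Longrightarrow> att0 Y (nv Y + c) < nv Y" "c < nx Y \<Longrightarrow> att1 Y (nv Y + c) < nv Y"
    "i = 0 \<or> nv Y + nx Y \<le> i \<Longrightarrow> att0 Y i = 0 \<and> att1 Y i = 0"
    unfolding * using Y ** by auto
qed

lemma canonical_edge_cases:
  assumes "canonical Y" "e \<in> edges Y"
  obtains "1 \<le> e" "e < nv Y" | c where "e = nv Y + c" "c < nx Y"
proof (cases "e < nv Y")
  case True
  have "1 \<le> e"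
    using assms(2) unfolding canonicalD(2)[OF assms(1)] by blast
  then show ?thesis
    using that(1) True by blast
next
  case False
  then obtain c where c: "e = nv Y + c"
    using le_Suc_ex not_less by blast
  have "e < nv Y + nx Y"
    using assms(2) unfolding canonicalD(2)[OF assms(1)] by blast
  then show ?thesis
    using that(2)[of c] c by linarith
qed

lemma canonical_is_graph:
  assumes "canonical Y"
  shows "is_graph Y"
proof -
  have fin: "finite (verts Y)" "finite (edges Y)"
    using assms by (auto simp: canonical_def)
  have "att0 Y e \<in> verts Y \<and> att1 Y e \<in> verts Y" if "e \<in> edges Y" for e
    using assms that
  proof (cases rule: canonical_edge_cases)
    case 1
    then show ?thesis
      unfolding canonicalD(1)[OF assms] using canonicalD(4,5)[OF assms, of e] by linarith
  next
    case (2 c)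
    then show ?thesis
      unfolding canonicalD(1)[OF assms] using canonicalD(7,8)[OF assms, of c] by simp
  qed
  then show ?thesis
    unfolding is_graph_def using fin by blast
qed

lemma anc_refl [simp]: "anc Y i i"
  unfolding anc_def by (intro exI[of _ 0]) simp

lemma anc_trans: "anc Y i j \<Longrightarrow> anc Y j l \<Longrightarrow> anc Y i l"
  unfolding anc_def by (metis comp_apply funpow_add)

lemma anc_parent: "anc Y (att1 Y j) j"
  unfolding anc_def by (intro exI[of _ 1]) simp

lemma anc_step: "anc Y i j \<Longrightarrow> i \<noteq> j \<Longrightarrow> anc Y i (att1 Y j)"
  unfolding anc_def by (metis funpow_0 funpow_Suc_right comp_apply not0_implies_Suc)

context
  fixes Y
  assumes Y: "canonical Y"
begin

text \<open>Even for the number of an edge outside of the tree, the value of \<open>att1\<close> is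
  a vertex and hence smaller. So iterates of \<open>att1\<close> decrease weakly on all natural
  numbers, and \<open>anc_le\<close> holds without a bound.\<close>

lemma parent_le: "att1 Y j \<le> j"
proof (cases "1 \<le> j \<and> j < nv Y")
  case True
  then show ?thesis
    using canonicalD(5)[OF Y, of j] by simp
next
  case False
  show ?thesis
  proof (cases "j = 0 \<or> nv Y + nx Y \<le> j")
    case True
    then show ?thesis
      using canonicalD(9)[OF Y, of j] by auto
  next
    case False
    then have "j - nv Y < nx Y" "nv Y + (j - nv Y) = j"
      using \<open>\<not> (1 \<le> j \<and> j < nv Y)\<close> by linarith+
    then show ?thesis
      using canonicalD(8)[OF Y, of "j - nv Y"] by simp
  qed
qed

lemma anc_le: "anc Y i j \<Longrightarrow> i \<le> j"
proof -
  have "(att1 Y ^^ k) j \<le> j" for k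
    by (induction k) (auto intro: order_trans[OF parent_le])
  then show "anc Y i j \<Longrightarrow> i \<le> j"
    by (auto simp: anc_def)
qed

lemma anc_root: "j < nv Y \<Longrightarrow> anc Y 0 j"
proof (induction j rule: less_induct)
  case (less j)
  show ?case
  proof (cases "j = 0")
    case False
    then have "att1 Y j < j"
      using canonicalD(5)[OF Y, of j] less.prems by simp
    then show ?thesis
      using less anc_trans[OF _ anc_parent] by (meson order.strict_trans)
  qed simp
qed

text \<open>Both are obtained from \<open>l\<close> by iterating the parent function, so the one
  with more iterations is an ancestor of the other.\<close>

lemma anc_chain:
  assumes "anc Y i l" "anc Y j l" "i \<le> j"
  shows "anc Y i j"
proof -
  obtain a b where ab: "(att1 Y ^^ a) l = i" "(att1 Y ^^ b) l = j"
    using assms by (auto simp: anc_def)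
  show ?thesis
  proof (cases "b \<le> a")
    case True
    then have "(att1 Y ^^ (a - b)) j = i"
      using ab by (metis comp_apply funpow_add le_add_diff_inverse2)
    then show ?thesis
      by (auto simp: anc_def)
  next
    case False
    then have "(att1 Y ^^ (b - a)) i = j"
      using ab by (metis comp_apply funpow_add le_add_diff_inverse2 nat_le_linear)
    then have "j \<le> i"
      using anc_le by (auto simp: anc_def)
    then show ?thesis
      using assms(3) by simp
  qed
qed

text \<open>The descendants of a vertex form an interval. This is the consequence of depth-first
  numbering that the proof uses: a proper ancestor of \<open>l\<close> is an ancestor of the parent
  of \<open>l\<close> and therefore of \<open>l - 1\<close>.\<close>

lemma anc_convex:
  assumes "anc Y i l" "i \<le> j" "j \<le> l" "l < nv Y"
  shows "anc Y i j"
  using assms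
proof (induction l rule: less_induct)
  case (less l)
  show ?case
  proof (cases "j = l \<or> i = l")
    case True
    then show ?thesis
      using less.prems by auto
  next
    case False
    then have l: "1 \<le> l"
      using less.prems by simp
    have "anc Y i (att1 Y l)"
      using anc_step[OF less.prems(1)] False by blast
    then have "anc Y i (l - 1)"
      using anc_trans canonicalD(6)[OF Y l less.prems(4)] by blast
    then show ?thesis
    proof (rule less.IH[rotated])
      show "l - 1 < l" "i \<le> j" "j \<le> l - 1" "l - 1 < nv Y"
        using less.prems False l by linarith+
    qed
  qed
qed

end

text \<open>An embedding \<open>m\<close> of the rooted tree of \<open>A\<close> into that of \<open>Y\<close> stands for the contraction from \<open>Y\<close>
  to \<open>A\<close> which maps each vertex to its closest ancestor in the image of \<open>m\<close>. So the morphisms of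
  the opposite category become increasing maps of numbers.\<close>

definition retr :: "graph \<Rightarrow> graph \<Rightarrow> (nat \<Rightarrow> nat) \<Rightarrow> nat \<Rightarrow> nat" where
  "retr A Y m w = Max {u. u < nv A \<and> anc Y (m u) w}"

definition tree_emb_map :: "graph \<Rightarrow> graph \<Rightarrow> (nat \<Rightarrow> nat) \<Rightarrow> bool" where
  "tree_emb_map A Y m \<longleftrightarrow> strict_mono_on {..<nv A} m \<and> m ` {..<nv A} \<subseteq> {..<nv Y} \<and> m 0 = 0 \<and>
    (\<forall>u < nv A. \<forall>v < nv A. anc A u v \<longleftrightarrow> anc Y (m u) (m v))"

definition emb :: "graph \<Rightarrow> graph \<Rightarrow> (nat \<Rightarrow> nat) \<Rightarrow> bool" where
  "emb A Y m \<longleftrightarrow> tree_emb_map A Y m \<and> nx A = nx Y \<and>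
    (\<forall>c < nx A. retr A Y m (att0 Y (nv Y + c)) = att0 A (nv A + c) \<and>
      retr A Y m (att1 Y (nv Y + c)) = att1 A (nv A + c))"

text \<open>A tree edge has the number of its lower vertex. It survives if this vertex is in the
  image of \<open>m\<close> and is collapsed otherwise; the edges outside of the tree all survive
  and keep their order.\<close>

definition emb_fe :: "graph \<Rightarrow> graph \<Rightarrow> (nat \<Rightarrow> nat) \<Rightarrow> nat \<Rightarrow> nat option" where
  "emb_fe A Y m e = (if e < nv Y then if e \<in> m ` {..<nv A} then Some (retr A Y m e) else None
    else Some (nv A + (e - nv Y)))"

lemma tree_emb_mapD:
  assumes "tree_emb_map A Y m"
  shows "u < nv A \<Longrightarrow> m u < nv Y" "m 0 = 0" "u < nv A \<Longrightarrow> v < nv A \<Longrightarrow> anc Y (m u) (m v) \<longleftrightarrow> anc A u v"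
    "u < nv A \<Longrightarrow> v < nv A \<Longrightarrow> m u < m v \<longleftrightarrow> u < v" "u < nv A \<Longrightarrow> v < nv A \<Longrightarrow> m u = m v \<longleftrightarrow> u = v"
  using assms unfolding tree_emb_map_def
  by (auto simp: strict_mono_on_less strict_mono_on_eq)

context
  fixes A Y m
  assumes A: "canonical A" and Y: "canonical Y" and m: "tree_emb_map A Y m"
begin

text \<open>The maps \<open>m\<close> and \<open>retr\<close> are adjoint for the ancestor orders.
  The maximum in the definition is the deepest choice, since the ancestors of \<open>w\<close> form
  a chain on which the numbers increase. All identities for \<open>retr\<close> follow from this
  property by uniqueness.\<close>

lemma retr_props:
  assumes w: "w < nv Y"
  shows "retr A Y m w < nv A" "u < nv A \<Longrightarrow> anc Y (m u) w \<longleftrightarrow> anc A u (retr A Y m w)"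
proof -
  let ?S = "{u. u < nv A \<and> anc Y (m u) w}"
  have "0 \<in> ?S"
    using canonicalD(3)[OF A] anc_root[OF Y w] tree_emb_mapD(2)[OF m] by simp
  then have in_S: "retr A Y m w \<in> ?S"
    unfolding retr_def by (intro Max_in) auto
  then show p: "retr A Y m w < nv A"
    by simp
  assume u: "u < nv A"
  show "anc Y (m u) w \<longleftrightarrow> anc A u (retr A Y m w)"
  proof
    assume uw: "anc Y (m u) w"
    then have "u \<le> retr A Y m w"
      unfolding retr_def using u by (intro Max_ge) auto
    then have "m u \<le> m (retr A Y m w)"
      using tree_emb_mapD(4)[OF m p u] by (simp flip: not_less)
    then have "anc Y (m u) (m (retr A Y m w))"
      using anc_chain[OF Y uw] in_S by blast
    then show "anc A u (retr A Y m w)"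
      using tree_emb_mapD(3)[OF m u p] by simp
  next
    assume "anc A u (retr A Y m w)"
    then have "anc Y (m u) (m (retr A Y m w))"
      using tree_emb_mapD(3)[OF m u p] by simp
    then show "anc Y (m u) w"
      using in_S anc_trans by blast
  qed
qed

lemma retr_unique:
  assumes w: "w < nv Y" and p: "p < nv A" "\<And>u. u < nv A \<Longrightarrow> anc Y (m u) w \<longleftrightarrow> anc A u p"
  shows "retr A Y m w = p"
proof -
  note q = retr_props[OF w]
  have "anc A p (retr A Y m w)" "anc A (retr A Y m w) p"
    using p(2)[OF p(1)] q(2)[OF p(1)] p(2)[OF q(1)] q(2)[OF q(1)] by auto
  then show ?thesis
    using anc_le[OF A] by (simp add: order_antisym)
qed

lemma retr_image: "u < nv A \<Longrightarrow> retr A Y m (m u) = u"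
  by (rule retr_unique) (auto simp: tree_emb_mapD[OF m])

text \<open>The ancestors of \<open>w\<close> in the image of \<open>m\<close> are those of its
  parent, so the edge between the two can be collapsed.\<close>

lemma retr_parent_out:
  assumes w: "w < nv Y" "w \<notin> m ` {..<nv A}"
  shows "retr A Y m (att1 Y w) = retr A Y m w"
proof (rule retr_unique)
  show "att1 Y w < nv Y"
    using parent_le[OF Y, of w] w by linarith
  show "retr A Y m w < nv A"
    by (rule retr_props[OF w(1)])
  fix u assume u: "u < nv A"
  then have "m u \<noteq> w"
    using w by blast
  then have "anc Y (m u) (att1 Y w) \<longleftrightarrow> anc Y (m u) w"
    using anc_step anc_trans[OF _ anc_parent] by blast
  then show "anc Y (m u) (att1 Y w) \<longleftrightarrow> anc A u (retr A Y m w)"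
    using retr_props(2)[OF w(1) u] by simp
qed

lemma retr_parent_in:
  assumes v: "1 \<le> v" "v < nv A"
  shows "retr A Y m (att1 Y (m v)) = att1 A v"
proof (rule retr_unique)
  have mv: "m v < nv Y" "1 \<le> m v"
    using tree_emb_mapD(1)[OF m v(2)] tree_emb_mapD(4)[OF m _ v(2), of 0] tree_emb_mapD(2)[OF m] v by auto
  show "att1 Y (m v) < nv Y"
    using parent_le[OF Y, of "m v"] mv by linarith
  show "att1 A v < nv A"
    using parent_le[OF A, of v] v by linarith
  fix u assume u: "u < nv A"
  have step: "anc Z a (att1 Z b) \<longleftrightarrow> anc Z a b \<and> a \<noteq> b" if "canonical Z" "1 \<le> b" "b < nv Z" for Z a b
  proof
    assume "anc Z a (att1 Z b)"
    then show "anc Z a b \<and> a \<noteq> b"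
      using anc_trans[OF _ anc_parent] anc_le[OF that(1)] canonicalD(5)[OF that] by fastforce
  qed (use anc_step in blast)
  show "anc Y (m u) (att1 Y (m v)) \<longleftrightarrow> anc A u (att1 A v)"
    unfolding step[OF Y mv(2,1)] step[OF A v] using tree_emb_mapD(3,5)[OF m u v(2)] by simp
qed

end

text \<open>This rules out truncation in the subtraction that defines \<open>nx\<close>.\<close>

lemma canonical_nv_le: "canonical Y \<Longrightarrow> nv Y \<le> Suc (card (edges Y))"
  by (auto simp: canonical_def)

context
  fixes A Y m
  assumes A: "canonical A" and Y: "canonical Y" and emb: "emb A Y m"
begin

lemma emb_tree: "tree_emb_map A Y m" and emb_nx: "nx A = nx Y"
  and emb_extra: "c < nx A \<Longrightarrow> retr A Y m (att0 Y (nv Y + c)) = att0 A (nv A + c)"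
    "c < nx A \<Longrightarrow> retr A Y m (att1 Y (nv Y + c)) = att1 A (nv A + c)"
  using emb by (auto simp: emb_def)

lemma emb_fe_image: "u < nv A \<Longrightarrow> emb_fe A Y m (m u) = Some u"
  using tree_emb_mapD(1)[OF emb_tree] retr_image[OF A Y emb_tree] by (simp add: emb_fe_def)

lemma emb_fe_out: "w < nv Y \<Longrightarrow> w \<notin> m ` {..<nv A} \<Longrightarrow> emb_fe A Y m w = None"
  by (simp add: emb_fe_def)

lemma emb_fe_extra: "emb_fe A Y m (nv Y + c) = Some (nv A + c)"
  by (simp add: emb_fe_def)

lemma emb_image_pos: "u < nv A \<Longrightarrow> 1 \<le> m u \<longleftrightarrow> 1 \<le> u"
  using tree_emb_mapD(4)[OF emb_tree canonicalD(3)[OF A], of u] tree_emb_mapD(2)[OF emb_tree] by (simp add: Suc_le_eq)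

lemma emb_graph_hom: "graph_hom Y A (retr A Y m) (emb_fe A Y m) (\<lambda>_. False)"
  unfolding graph_hom_def
proof (intro conjI ballI)
  show "retr A Y m ` verts Y \<subseteq> verts A"
    using retr_props(1)[OF A Y emb_tree] canonicalD(1)[OF A] canonicalD(1)[OF Y] by auto
  fix e assume "e \<in> edges Y"
  with Y show "case emb_fe A Y m e of None \<Rightarrow> retr A Y m (att0 Y e) = retr A Y m (att1 Y e)
    | Some e' \<Rightarrow> e' \<in> edges A \<and> retr A Y m (att0 Y e) = (if False then att1 A e' else att0 A e') \<and>
      retr A Y m (att1 Y e) = (if False then att0 A e' else att1 A e')"
  proof (cases rule: canonical_edge_cases)
    case 1
    show ?thesis
    proof (cases "e \<in> m ` {..<nv A}")
      case True
      then obtain u where u: "e = m u" "u < nv A"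
        by auto
      then have u1: "1 \<le> u"
        using 1 emb_image_pos by simp
      have "u \<in> edges A"
        unfolding canonicalD(2)[OF A] using u u1 by simp
      moreover have "retr A Y m (att0 Y e) = att0 A u"
        using canonicalD(4)[OF Y 1] canonicalD(4)[OF A u1 u(2)] u retr_image[OF A Y emb_tree u(2)] by simp
      moreover have "retr A Y m (att1 Y e) = att1 A u"
        using retr_parent_in[OF A Y emb_tree u1 u(2)] u(1) by simp
      ultimately show ?thesis
        using emb_fe_image[OF u(2)] u(1) by simp
    next
      case False
      then show ?thesis
        using emb_fe_out[OF 1(2) False] retr_parent_out[OF A Y emb_tree 1(2) False] canonicalD(4)[OF Y 1] by simp
    qed
  next
    case (2 c)
    have c: "c < nx A"
      using 2 emb_nx by simp
    have "nv A + c \<in> edges A"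
      unfolding canonicalD(2)[OF A] using canonicalD(3)[OF A] c by linarith
    then show ?thesis
      using emb_extra[OF c] by (simp add: 2(1) emb_fe_extra)
  qed
qed

lemma emb_edge_bijective: "edge_bijective Y A (emb_fe A Y m)"
  unfolding edge_bijective_def
proof
  fix e' assume "e' \<in> edges A"
  with A show "\<exists>!e. e \<in> edges Y \<and> emb_fe A Y m e = Some e'"
  proof (cases rule: canonical_edge_cases)
    case 1
    show ?thesis
    proof (rule ex1I[of _ "m e'"])
      have "m e' \<in> edges Y"
        unfolding canonicalD(2)[OF Y] using emb_image_pos[OF 1(2)] 1 tree_emb_mapD(1)[OF emb_tree 1(2)] by linarith
      then show "m e' \<in> edges Y \<and> emb_fe A Y m (m e') = Some e'"
        using emb_fe_image[OF 1(2)] by simp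
      fix e assume e: "e \<in> edges Y \<and> emb_fe A Y m e = Some e'"
      have eY: "e < nv Y"
      proof (rule ccontr)
        assume "\<not> e < nv Y"
        then have "emb_fe A Y m e = Some (nv A + (e - nv Y))"
          by (simp add: emb_fe_def)
        then have "e' = nv A + (e - nv Y)"
          using e by simp
        then show False
          using 1(2) by simp
      qed
      have "e \<in> m ` {..<nv A}"
        by (rule ccontr) (use e emb_fe_out[OF eY] in simp)
      then obtain u where u: "e = m u" "u < nv A"
        by auto
      then show "e = m e'"
        using e emb_fe_image[OF u(2)] by simp
    qed
  next
    case (2 c)
    show ?thesis
    proof (rule ex1I[of _ "nv Y + c"])
      have "nv Y + c \<in> edges Y"
        unfolding canonicalD(2)[OF Y] using canonicalD(3)[OF Y] 2 emb_nx by linarith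
      then show "nv Y + c \<in> edges Y \<and> emb_fe A Y m (nv Y + c) = Some e'"
        using 2 emb_fe_extra by simp
      fix e assume e: "e \<in> edges Y \<and> emb_fe A Y m e = Some e'"
      have "\<not> e < nv Y"
      proof
        assume eY: "e < nv Y"
        have "e \<in> m ` {..<nv A}"
          by (rule ccontr) (use e emb_fe_out[OF eY] in simp)
        then obtain u where u: "e = m u" "u < nv A"
          by auto
        then show False
          using e emb_fe_image[OF u(2)] 2 by simp
      qed
      then show "e = nv Y + c"
        using e 2 by (auto simp: emb_fe_def)
    qed
  qed
qed

text \<open>The top of the fiber over \<open>w\<close> is \<open>m w\<close>. Every other vertex of
  the fiber has its parent in the fiber, along a collapsed edge, and so it is connected to the
  top.\<close>

lemma emb_contraction: "graph_contraction Y A (retr A Y m) (emb_fe A Y m) (\<lambda>_. False)"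
  unfolding graph_contraction_def
proof (intro conjI ballI emb_graph_hom emb_edge_bijective)
  fix w assume "w \<in> verts A"
  then have w: "w < nv A"
    unfolding canonicalD(1)[OF A] .
  let ?V = "fib_verts Y (retr A Y m) w" and ?E = "fib_edges Y (retr A Y m) (emb_fe A Y m) w"
  have V: "v \<in> ?V \<longleftrightarrow> v < nv Y \<and> retr A Y m v = w" for v
    using canonicalD(1)[OF Y] by (simp add: fib_verts_def)
  have mw: "m w \<in> ?V"
    using V tree_emb_mapD(1)[OF emb_tree w] retr_image[OF A Y emb_tree w] by simp
  then show "?V \<noteq> {}"
    by blast
  have up: "(adj Y ?E)\<^sup>*\<^sup>* v (m w)" if "v \<in> ?V" for v
    using that
  proof (induction v rule: less_induct)
    case (less v)
    show ?case
    proof (cases "v = m w")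
      case False
      have v: "v < nv Y" "retr A Y m v = w"
        using less.prems V by auto
      have out: "v \<notin> m ` {..<nv A}"
        using False v retr_image[OF A Y emb_tree] by auto
      then have v1: "1 \<le> v"
      proof -
        have "m 0 \<in> m ` {..<nv A}"
          using canonicalD(3)[OF A] by blast
        then have "v \<noteq> 0"
          using out tree_emb_mapD(2)[OF emb_tree] by metis
        then show ?thesis
          by simp
      qed
      have p: "att1 Y v < v" "att1 Y v \<in> ?V"
        using canonicalD(5)[OF Y v1 v(1)] V v retr_parent_out[OF A Y emb_tree v(1) out] by auto
      have "v \<in> edges Y"
        unfolding canonicalD(2)[OF Y] using v1 v by simp
      then have "v \<in> ?E"
        using emb_fe_out[OF v(1) out] canonicalD(4)[OF Y v1 v(1)] v(2) by (simp add: fib_edges_def)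
      then have "adj Y ?E v (att1 Y v)"
        using canonicalD(4)[OF Y v1 v(1)] by (auto simp: adj_def)
      then show ?thesis
        using less.IH[OF p] by (rule converse_rtranclp_into_rtranclp)
    qed simp
  qed
  show "connected_on Y ?V ?E"
    unfolding connected_on_def
  proof (intro ballI)
    fix u v assume "u \<in> ?V" "v \<in> ?V"
    then show "(adj Y ?E)\<^sup>*\<^sup>* u v"
      using up[of u] rtranclp_adj_sym[OF up[of v]] by (rule_tac rtranclp_trans)
  qed
next
  show "card (edges Y) + card (verts A) = card (edges A) + card (verts Y)"
    using emb_nx canonical_nv_le[OF A] canonical_nv_le[OF Y] by linarith
qed

lemma emb_le: "w < nv Y \<Longrightarrow> m (retr A Y m w) \<le> w"
  using retr_props[OF A Y emb_tree] anc_le[OF Y] by (metis anc_refl)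

end

lemma retr_cong: "(\<And>u. u < nv A \<Longrightarrow> m u = m' u) \<Longrightarrow> retr A Y m w = retr A Y m' w"
  unfolding retr_def by (rule arg_cong[where f = Max]) auto

lemma emb_fe_cong:
  assumes "\<And>u. u < nv A \<Longrightarrow> m u = m' u"
  shows "emb_fe A Y m e = emb_fe A Y m' e"
proof -
  have "m ` {..<nv A} = m' ` {..<nv A}"
    using assms by (intro image_cong) auto
  then show ?thesis
    using retr_cong[OF assms] by (simp add: emb_fe_def)
qed

text \<open>An embedding can be recovered from its retraction, as \<open>m u\<close> is the least
  vertex that retracts to \<open>u\<close>.\<close>

lemma emb_eqI:
  assumes "canonical A" "canonical Y" "emb A Y m" "emb A Y m'"
    and eq: "\<And>w. w < nv Y \<Longrightarrow> retr A Y m w = retr A Y m' w" and u: "u < nv A"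
  shows "m u = m' u"
proof (rule order_antisym)
  have lt: "m u < nv Y" "m' u < nv Y"
    using tree_emb_mapD(1)[OF emb_tree] assms u by blast+
  have "retr A Y m (m u) = u" "retr A Y m' (m' u) = u"
    using retr_image[OF assms(1,2) emb_tree] assms(1-4) u by blast+
  then show "m u \<le> m' u" "m' u \<le> m u"
    using emb_le[OF assms(1,2,3) lt(2)] emb_le[OF assms(1,2,4) lt(1)] eq[OF lt(1)] eq[OF lt(2)] by simp_all
qed

context
  fixes A Y Z m m'
  assumes A: "canonical A" and Y: "canonical Y" and Z: "canonical Z"
    and emb1: "emb A Y m" and emb2: "emb Y Z m'"
begin

lemma tree_emb_map_comp: "tree_emb_map A Z (m' \<circ> m)"
proof -
  note 1 = tree_emb_mapD[OF emb_tree[OF A Y emb1]] and 2 = tree_emb_mapD[OF emb_tree[OF Y Z emb2]]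
  show ?thesis
    unfolding tree_emb_map_def using 1 2 by (auto simp: strict_mono_on_def)
qed

text \<open>Adjoints of composites are composites of adjoints, in the opposite order.\<close>

lemma retr_comp:
  assumes w: "w < nv Z"
  shows "retr A Z (m' \<circ> m) w = retr A Y m (retr Y Z m' w)"
proof (rule retr_unique[OF A Z tree_emb_map_comp w])
  note 1 = emb_tree[OF A Y emb1] and 2 = emb_tree[OF Y Z emb2]
  have v: "retr Y Z m' w < nv Y"
    by (rule retr_props(1)[OF Y Z 2 w])
  show "retr A Y m (retr Y Z m' w) < nv A"
    by (rule retr_props(1)[OF A Y 1 v])
  show "anc Z ((m' \<circ> m) u) w \<longleftrightarrow> anc A u (retr A Y m (retr Y Z m' w))" if "u < nv A" for u
    using retr_props(2)[OF A Y 1 v that] retr_props(2)[OF Y Z 2 w tree_emb_mapD(1)[OF 1 that]] by simp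
qed

lemma emb_comp: "emb A Z (m' \<circ> m)"
  unfolding emb_def
proof (intro conjI allI impI tree_emb_map_comp)
  show "nx A = nx Z"
    using emb_nx[OF A Y emb1] emb_nx[OF Y Z emb2] by simp
  fix c assume c: "c < nx A"
  then have c': "c < nx Y" "c < nx Z"
    using emb_nx[OF A Y emb1] emb_nx[OF Y Z emb2] by simp_all
  show "retr A Z (m' \<circ> m) (att0 Z (nv Z + c)) = att0 A (nv A + c)"
    "retr A Z (m' \<circ> m) (att1 Z (nv Z + c)) = att1 A (nv A + c)"
    using retr_comp canonicalD(7,8)[OF Z c'(2)] emb_extra[OF A Y emb1 c] emb_extra[OF Y Z emb2 c'(1)] by simp_all
qed

lemma emb_fe_comp: "e \<in> edges Z \<Longrightarrow> emb_fe A Z (m' \<circ> m) e = comp_fe (emb_fe A Y m) (emb_fe Y Z m') e"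
proof -
  note 1 = emb_tree[OF A Y emb1] and 2 = emb_tree[OF Y Z emb2]
  assume "e \<in> edges Z"
  with Z show ?thesis
  proof (cases rule: canonical_edge_cases)
    case C: 1
    show ?thesis
    proof (cases "e \<in> m' ` {..<nv Y}")
      case True
      then obtain v where v: "e = m' v" "v < nv Y"
        by auto
      have "e \<in> (m' \<circ> m) ` {..<nv A} \<longleftrightarrow> v \<in> m ` {..<nv A}"
        using v tree_emb_mapD(5)[OF 2 v(2)] tree_emb_mapD(1)[OF 1] by (auto simp: image_iff)
      then show ?thesis
        using C v retr_comp[OF C(2)] retr_image[OF Y Z 2 v(2)]
        by (simp add: comp_fe_def emb_fe_image[OF Y Z emb2 v(2)]) (simp add: emb_fe_def)
    next
      case False
      then have "e \<notin> (m' \<circ> m) ` {..<nv A}"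
        using tree_emb_mapD(1)[OF 1] by auto
      then show ?thesis
        using C(2) False by (simp add: comp_fe_def emb_fe_def)
    qed
  next
    case (2 c)
    then show ?thesis
      by (simp add: comp_fe_def emb_fe_def)
  qed
qed

end

lemma retr_id:
  assumes "canonical A" "w < nv A"
  shows "retr A A (\<lambda>u. u) w = w"
proof (rule retr_unique[OF assms(1,1)])
  show "tree_emb_map A A (\<lambda>u. u)"
    by (auto simp: tree_emb_map_def strict_mono_on_def)
qed (use assms in auto)

lemma emb_id:
  assumes "canonical A"
  shows "emb A A (\<lambda>u. u)"
  using retr_id[OF assms] canonicalD(7,8)[OF assms]
  by (auto simp: emb_def tree_emb_map_def strict_mono_on_def)

lemma emb_fe_id:
  assumes "canonical A" "e \<in> edges A"
  shows "emb_fe A A (\<lambda>u. u) e = Some e"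
  using assms(1,2)
proof (cases rule: canonical_edge_cases)
  case 1
  then show ?thesis
    using emb_fe_image[OF assms(1,1) emb_id[OF assms(1)], of e] by simp
next
  case (2 c)
  then show ?thesis
    by (simp add: emb_fe_def)
qed

section \<open>Contractions onto a fixed graph are well-quasi-ordered\<close>

text \<open>Kruskal's theorem is applied to the binary tree which encodes the planar forest on an interval
  of vertices: the left subtree stands for the descendants of the first root, the right one for the
  remaining trees.\<close>

inductive forest :: "graph \<Rightarrow> (nat \<Rightarrow> 'l) \<Rightarrow> nat \<Rightarrow> nat \<Rightarrow> 'l tree \<Rightarrow> bool" for Y lab where
  Leaf: "forest Y lab a a Leaf"
| Node: "\<lbrakk>a < s; s \<le> b; \<And>j. a < j \<Longrightarrow> j < s \<Longrightarrow> anc Y a j; \<And>j. s \<le> j \<Longrightarrow> j < b \<Longrightarrow> \<not> anc Y a j;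
    forest Y lab (Suc a) s l; forest Y lab s b r\<rbrakk> \<Longrightarrow> forest Y lab a b (Node l (lab a) r)"

inductive_cases forest_LeafE: "forest Y lab a b Leaf"
inductive_cases forest_NodeE: "forest Y lab a b (Node l c r)"

lemma forest_exists:
  assumes Y: "canonical Y" and "a \<le> b" "b \<le> nv Y"
  shows "\<exists>t. forest Y lab a b t"
  using assms(2,3)
proof (induction "b - a" arbitrary: a b rule: less_induct)
  case less
  show ?case
  proof (cases "a = b")
    case True
    then show ?thesis
      using forest.Leaf by blast
  next
    case False
    \<comment> \<open>The first vertex after \<open>a\<close> that is not a descendant of
      \<open>a\<close>, or the end of the interval. By convexity no later vertex of the interval is
      a descendant either.\<close>
    define s where "s = (LEAST s. a < s \<and> (s = b \<or> \<not> anc Y a s))"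
    have b: "a < b \<and> (b = b \<or> \<not> anc Y a b)"
      using False less.prems by simp
    have s: "a < s" "s = b \<or> \<not> anc Y a s"
      using LeastI[of "\<lambda>s. a < s \<and> (s = b \<or> \<not> anc Y a s)", OF b] by (simp_all add: s_def)
    have sb: "s \<le> b"
      unfolding s_def using b by (rule Least_le)
    have below: "anc Y a j" if "a < j" "j < s" for j
      using not_less_Least[of j "\<lambda>s. a < s \<and> (s = b \<or> \<not> anc Y a s)"] that by (simp add: s_def)
    have above: "\<not> anc Y a j" if "s \<le> j" "j < b" for j
    proof
      assume "anc Y a j"
      then have "anc Y a s"
        using anc_convex[OF Y _ _ that(1)] s(1) that(2) less.prems by simp
      then show False
        using s that by simp
    qed
    have sizes: "s - Suc a < b - a" "b - s < b - a" "Suc a \<le> s" "s \<le> nv Y"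
      using s(1) sb b less.prems by linarith+
    obtain l where l: "forest Y lab (Suc a) s l"
      using less.hyps[OF sizes(1,3,4)] by blast
    obtain r where r: "forest Y lab s b r"
      using less.hyps[OF sizes(2) sb less.prems(2)] by blast
    show ?thesis
      using forest.Node[OF s(1) sb below above l r] by blast
  qed
qed

lemma forest_labels: "forest Y lab a b t \<Longrightarrow> set_tree t \<subseteq> lab ` {a..<b}"
  by (induction rule: forest.induct) force+

text \<open>The rule \<open>Node\<close> matches the first roots of two forests and treats their
  descendants and the remaining trees separately, so both the depth-first order and the ancestor
  relation are respected. The rules \<open>left\<close> and \<open>right\<close> only shrink the
  target interval.\<close>

lemma tree_emb_forest:
  assumes Y: "canonical Y" and Y': "canonical Y'"
    and "tree_emb t t'" "forest Y lab a b t" "forest Y' lab' a' b' t'"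
  shows "\<exists>m. strict_mono_on {a..<b} m \<and> m ` {a..<b} \<subseteq> {a'..<b'} \<and>
    (\<forall>u \<in> {a..<b}. lab u = lab' (m u)) \<and>
    (\<forall>u \<in> {a..<b}. \<forall>v \<in> {a..<b}. anc Y u v \<longleftrightarrow> anc Y' (m u) (m v))"
  using assms(3-5)
proof (induction arbitrary: a b a' b' rule: tree_emb.induct)
  case (Leaf t)
  then have "a = b"
    by (auto elim: forest_LeafE)
  then show ?case
    by (auto simp: strict_mono_on_def)
next
  case (Node l l' r r' c)
  obtain s where s: "a < s" "s \<le> b" "\<And>j. a < j \<Longrightarrow> j < s \<Longrightarrow> anc Y a j"
    "\<And>j. s \<le> j \<Longrightarrow> j < b \<Longrightarrow> \<not> anc Y a j" "c = lab a" "forest Y lab (Suc a) s l" "forest Y lab s b r"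
    using Node.prems(1) by (elim forest_NodeE) blast
  obtain s' where s': "a' < s'" "s' \<le> b'" "\<And>j. a' < j \<Longrightarrow> j < s' \<Longrightarrow> anc Y' a' j"
    "\<And>j. s' \<le> j \<Longrightarrow> j < b' \<Longrightarrow> \<not> anc Y' a' j" "c = lab' a'" "forest Y' lab' (Suc a') s' l'" "forest Y' lab' s' b' r'"
    using Node.prems(2) by (elim forest_NodeE) blast
  obtain m1 where m1: "strict_mono_on {Suc a..<s} m1" "m1 ` {Suc a..<s} \<subseteq> {Suc a'..<s'}"
    "\<forall>u \<in> {Suc a..<s}. lab u = lab' (m1 u)"
    "\<forall>u \<in> {Suc a..<s}. \<forall>v \<in> {Suc a..<s}. anc Y u v \<longleftrightarrow> anc Y' (m1 u) (m1 v)"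
    using Node.IH(1)[OF s(6) s'(6)] by blast
  obtain m2 where m2: "strict_mono_on {s..<b} m2" "m2 ` {s..<b} \<subseteq> {s'..<b'}"
    "\<forall>u \<in> {s..<b}. lab u = lab' (m2 u)"
    "\<forall>u \<in> {s..<b}. \<forall>v \<in> {s..<b}. anc Y u v \<longleftrightarrow> anc Y' (m2 u) (m2 v)"
    using Node.IH(2)[OF s(7) s'(7)] by blast
  define m where "m u = (if u = a then a' else if u < s then m1 u else m2 u)" for u
  have ma: "m a = a'"
    by (simp add: m_def)
  have mm1: "m u = m1 u" "a' < m u" "m u < s'" if "a < u" "u < s" for u
    using that m1(2) by (auto simp: m_def image_subset_iff Suc_le_eq)
  have mm2: "m u = m2 u" "s' \<le> m u" "m u < b'" if "s \<le> u" "u < b" for u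
    using that m2(2) s(1) by (auto simp: m_def image_subset_iff)
  have cases: "u = a \<or> (a < u \<and> u < s) \<or> (s \<le> u \<and> u < b)" if "u \<in> {a..<b}" for u
    using that by force
  have "m u < m v" if uv: "u \<in> {a..<b}" "v \<in> {a..<b}" "u < v" for u v
  proof -
    consider "u = a" "a < v" "v < s" | "u = a" "s \<le> v" "v < b" | "a < u" "u < s" "a < v" "v < s"
      | "a < u" "u < s" "s \<le> v" "v < b" | "s \<le> u" "u < b" "s \<le> v" "v < b"
      using uv(3) s(1) cases[OF uv(1)] cases[OF uv(2)] by (elim disjE) auto
    then show ?thesis
    proof cases
      case 1
      then show ?thesis using ma mm1 by simp
    next
      case 2
      then show ?thesis using ma mm2[OF 2(2,3)] s' by simp
    next
      case 3
      then show ?thesis using mm1 m1(1) uv(3) by (simp add: strict_mono_on_def)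
    next
      case 4
      then show ?thesis using mm1(3)[OF 4(1,2)] mm2(2)[OF 4(3,4)] by simp
    next
      case 5
      then show ?thesis using mm2 m2(1) uv(3) by (simp add: strict_mono_on_def)
    qed
  qed
  then have mono: "strict_mono_on {a..<b} m"
    by (auto simp: strict_mono_on_def)
  moreover have "m ` {a..<b} \<subseteq> {a'..<b'}"
  proof
    fix w assume "w \<in> m ` {a..<b}"
    then obtain u where u: "w = m u" "u \<in> {a..<b}"
      by blast
    show "w \<in> {a'..<b'}"
      using cases[OF u(2)] ma mm1[of u] mm2[of u] s' u by auto
  qed
  moreover have "lab u = lab' (m u)" if "u \<in> {a..<b}" for u
    using cases[OF that] ma mm1(1)[of u] mm2(1)[of u] m1(3) m2(3) s(5) s'(5) by (elim disjE) auto
  moreover have "anc Y u v \<longleftrightarrow> anc Y' (m u) (m v)" if uv: "u \<in> {a..<b}" "v \<in> {a..<b}" for u v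
  proof -
    consider "u = v" | "v < u" | "u < v" "u = a" "a < v" "v < s" | "u < v" "u = a" "s \<le> v" "v < b"
      | "a < u" "u < s" "a < v" "v < s"
      | "u < v" "a < u" "u < s" "s \<le> v" "v < b" | "s \<le> u" "u < b" "s \<le> v" "v < b"
      using s(1) cases[OF uv(1)] cases[OF uv(2)] nat_neq_iff[of u v] by (elim disjE) auto
    then show ?thesis
    proof cases
      case 1
      then show ?thesis by simp
    next
      case 2
      then have "m v < m u"
        using mono uv by (simp add: strict_mono_on_def)
      then show ?thesis
        using 2 anc_le[OF Y, of u v] anc_le[OF Y', of "m u" "m v"] by auto
    next
      case 3
      then show ?thesis
        using s(3)[OF 3(3,4)] s'(3)[OF mm1(2,3)[OF 3(3,4)]] ma by simp
    next
      case 4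
      then show ?thesis
        using s(4)[OF 4(3,4)] s'(4)[OF mm2(2,3)[OF 4(3,4)]] ma by simp
    next
      case 5
      then show ?thesis
        using mm1(1)[OF 5(1,2)] mm1(1)[OF 5(3,4)] m1(4) by (simp add: Suc_le_eq)
    next
      case 6
      \<comment> \<open>Since \<open>a\<close> is an ancestor of \<open>u\<close>, it would also be
        one of \<open>v\<close>, which lies beyond its descendants.\<close>
      have "\<not> anc Y u v"
        using s(3)[OF 6(2,3)] s(4)[OF 6(4,5)] anc_trans by blast
      moreover have "\<not> anc Y' (m u) (m v)"
        using s'(3)[OF mm1(2,3)[OF 6(2,3)]] s'(4)[OF mm2(2,3)[OF 6(4,5)]] anc_trans by blast
      ultimately show ?thesis by simp
    next
      case 7
      then show ?thesis
        using mm2(1)[OF 7(1,2)] mm2(1)[OF 7(3,4)] m2(4) by simp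
    qed
  qed
  ultimately show ?case
    by blast
next
  case (left t l c r)
  obtain s' where s': "a' < s'" "s' \<le> b'" "forest Y' lab' (Suc a') s' l"
    using left.prems(2) by (elim forest_NodeE) blast
  obtain m where "strict_mono_on {a..<b} m" "m ` {a..<b} \<subseteq> {Suc a'..<s'}" "\<forall>u \<in> {a..<b}. lab u = lab' (m u)"
    "\<forall>u \<in> {a..<b}. \<forall>v \<in> {a..<b}. anc Y u v \<longleftrightarrow> anc Y' (m u) (m v)"
    using left.IH[OF left.prems(1) s'(3)] by blast
  moreover have "{Suc a'..<s'} \<subseteq> {a'..<b'}"
    using s' by auto
  ultimately show ?case
    by blast
next
  case (right t r l c)
  obtain s' where s': "a' < s'" "s' \<le> b'" "forest Y' lab' s' b' r"
    using right.prems(2) by (elim forest_NodeE) blast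
  obtain m where "strict_mono_on {a..<b} m" "m ` {a..<b} \<subseteq> {s'..<b'}" "\<forall>u \<in> {a..<b}. lab u = lab' (m u)"
    "\<forall>u \<in> {a..<b}. \<forall>v \<in> {a..<b}. anc Y u v \<longleftrightarrow> anc Y' (m u) (m v)"
    using right.IH[OF right.prems(1) s'(3)] by blast
  moreover have "{s'..<b'} \<subseteq> {a'..<b'}"
    using s' by auto
  ultimately show ?case
    by blast
qed

text \<open>Equal labels make the embedding of trees compatible with the edges outside of the trees
  and with the contractions on the image. Outside of the image compatibility is automatic: each edge
  of \<open>G\<close> is already hit by an edge of the image or outside of the tree, so all other
  edges have to be collapsed.\<close>

theorem contraction_wqo:
  fixes Y :: "nat \<Rightarrow> graph"
  assumes G: "is_graph G" and Y: "\<And>i. canonical (Y i)"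
    and C: "\<And>i. graph_contraction (Y i) G (fv i) (fe i) (fl i)"
  shows "\<exists>i j m. i < j \<and> emb (Y i) (Y j) m \<and>
    (\<forall>x \<in> points (Y j). std_map (Y j) (fv j) (fe j) (fl j) x =
      std_map (Y i) (fv i) (fe i) (fl i)
        (std_map (Y j) (retr (Y i) (Y j) m) (emb_fe (Y i) (Y j) m) (\<lambda>_. False) x))"
proof -
  note gY = canonical_is_graph[OF Y]
  have D: "graph_hom (Y i) G (fv i) (fe i) (fl i)" and B: "edge_bijective (Y i) G (fe i)" for i
    using C[of i] by (auto simp: graph_contraction_def)
  \<comment> \<open>Contractions preserve the number of edges minus the number of vertices, so the
    number of edges outside of the spanning tree is the same for all \<open>Y i\<close>. This is why
    finitely many labels suffice.\<close>
  define K where "K = Suc (card (edges G)) - card (verts G)"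
  have K: "nx (Y i) = K" for i
    using C[of i] canonical_nv_le[OF Y[of i]] unfolding graph_contraction_def K_def by linarith
  \<comment> \<open>The first component forces the root to go to the root. Then follow the image of
    the vertex, the image and orientation of the edge to its parent (the root has none), and the
    edges outside of the tree that start or end at the vertex. The two lists do not depend on the
    vertex; they describe the contraction on the edges outside of the tree.\<close>
  define lab where "lab i v = (v = 0, fv i v, if v = 0 then None else fe i v, fl i v,
    {c. c < K \<and> att0 (Y i) (nv (Y i) + c) = v}, {c. c < K \<and> att1 (Y i) (nv (Y i) + c) = v},
    map (\<lambda>c. fe i (nv (Y i) + c)) [0..<K], map (\<lambda>c. fl i (nv (Y i) + c)) [0..<K])" for i and v :: nat
  define E where "E = insert None (Some ` edges G)"
  define L where "L = (UNIV :: bool set) \<times> verts G \<times> E \<times> (UNIV :: bool set) \<times> Pow {..<K} \<times> Pow {..<K} \<times>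
    {xs. set xs \<subseteq> E \<and> length xs = K} \<times> {xs :: bool list. set xs \<subseteq> UNIV \<and> length xs = K}"
  have fin: "finite L"
    unfolding L_def E_def using G
    by (intro finite_cartesian_product finite_lists_length_eq) (auto simp: is_graph_def)
  have fe_E: "fe i e \<in> E" if "e \<in> edges (Y i)" for i e
    using graph_homD(3)[OF D that] by (cases "fe i e") (auto simp: E_def)
  have ext_edge: "nv (Y i) + c \<in> edges (Y i)" if "c < K" for i c
    unfolding canonicalD(2)[OF Y] using canonicalD(3)[OF Y[of i]] K[of i] that by linarith
  have tree_edge: "v \<in> edges (Y i)" if "v \<noteq> 0" "v < nv (Y i)" for i v
    unfolding canonicalD(2)[OF Y] using that by linarith
  have labL: "lab i v \<in> L" if "v < nv (Y i)" for i v
  proof -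
    have "fv i v \<in> verts G"
      using graph_homD(1)[OF D] canonicalD(1)[OF Y] that by blast
    moreover have "(if v = 0 then None else fe i v) \<in> E"
      using fe_E[OF tree_edge] that by (auto simp: E_def)
    moreover have "set (map (\<lambda>c. fe i (nv (Y i) + c)) [0..<K]) \<subseteq> E"
      using fe_E[OF ext_edge] by auto
    ultimately show ?thesis
      by (auto simp: lab_def L_def)
  qed
  define T where "T i = (SOME t. forest (Y i) (lab i) 0 (nv (Y i)) t)" for i
  have T: "forest (Y i) (lab i) 0 (nv (Y i)) (T i)" for i
    unfolding T_def by (rule someI_ex[OF forest_exists[OF Y]]) simp_all
  have "set_tree (T i) \<subseteq> L" for i
    using forest_labels[OF T[of i]] labL by force
  then obtain i j where ij: "i < j" "tree_emb (T i) (T j)"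
    using wqo_on_tree_emb[OF fin, unfolded wqo_on_def, THEN spec, of T] by auto
  let ?A = "Y i" and ?B = "Y j"
  obtain m where m: "strict_mono_on {0..<nv ?A} m" "m ` {0..<nv ?A} \<subseteq> {0..<nv ?B}"
    "\<forall>u \<in> {0..<nv ?A}. lab i u = lab j (m u)"
    "\<forall>u \<in> {0..<nv ?A}. \<forall>v \<in> {0..<nv ?A}. anc ?A u v \<longleftrightarrow> anc ?B (m u) (m v)"
    using tree_emb_forest[OF Y Y ij(2) T T] by blast
  have lab: "lab i u = lab j (m u)" if "u < nv ?A" for u
    using m(3) that by simp
  have m0: "m u = 0 \<longleftrightarrow> u = 0" and m_fv: "fv j (m u) = fv i u" and m_fl: "fl j (m u) = fl i u"
    and m_att: "c < K \<Longrightarrow> att0 ?A (nv ?A + c) = u \<Longrightarrow> att0 ?B (nv ?B + c) = m u"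
      "c < K \<Longrightarrow> att1 ?A (nv ?A + c) = u \<Longrightarrow> att1 ?B (nv ?B + c) = m u"
    if "u < nv ?A" for u c
    using lab[OF that] unfolding lab_def by auto
  have m_fe: "fe j (m u) = fe i u" if "u < nv ?A" "u \<noteq> 0" for u
    using lab[OF that(1)] m0[OF that(1)] that(2) unfolding lab_def by simp
  have pos: "0 < nv ?A"
    by (rule canonicalD(3)[OF Y])
  have e_fe: "fe j (nv ?B + c) = fe i (nv ?A + c)" and e_fl: "fl j (nv ?B + c) = fl i (nv ?A + c)" if "c < K" for c
    using lab[OF pos] that unfolding lab_def by auto
  have temb: "tree_emb_map ?A ?B m"
    using m(1,2,4) m0[OF pos] unfolding tree_emb_map_def by (simp add: atLeast0LessThan)
  note retr_m = retr_image[OF Y Y temb]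
  have emb: "emb ?A ?B m"
    unfolding emb_def
  proof (intro conjI allI impI temb)
    show "nx ?A = nx ?B"
      using K by simp
    fix c assume "c < nx ?A"
    then have c: "c < K" "c < nx ?A"
      using K by simp_all
    show "retr ?A ?B m (att0 ?B (nv ?B + c)) = att0 ?A (nv ?A + c)"
      using m_att(1)[OF canonicalD(7)[OF Y c(2)] c(1)] retr_m[OF canonicalD(7)[OF Y c(2)]] by simp
    show "retr ?A ?B m (att1 ?B (nv ?B + c)) = att1 ?A (nv ?A + c)"
      using m_att(2)[OF canonicalD(8)[OF Y c(2)] c(1)] retr_m[OF canonicalD(8)[OF Y c(2)]] by simp
  qed
  \<comment> \<open>If such an edge survived, its target in \<open>G\<close> would also be hit by an
    edge of the image or one outside of the tree, against bijectivity on surviving edges.\<close>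
  have fe_out: "fe j w = None" if w: "w < nv ?B" "w \<notin> m ` {..<nv ?A}" for w
  proof (rule ccontr)
    assume "fe j w \<noteq> None"
    then obtain e' where e': "fe j w = Some e'"
      by auto
    have "w \<noteq> 0"
      using w(2) pos m0[OF pos] by (metis imageI lessThan_iff)
    then have wE: "w \<in> edges ?B"
      using tree_edge w(1) by blast
    have e'G: "e' \<in> edges G"
      by (rule graph_homD(3)[OF D wE e'])
    obtain e where e: "e \<in> edges ?A" "fe i e = Some e'"
      using edge_bijectiveD[OF B e'G] by blast
    have uniq: "e1 = w" if "e1 \<in> edges ?B" "fe j e1 = Some e'" for e1
      using edge_bijectiveD[OF B e'G] wE e' that by metis
    from Y e(1) show False
    proof (cases rule: canonical_edge_cases)
      case 1
      then have "m e \<in> edges ?B" "fe j (m e) = Some e'"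
        using tree_edge[of "m e" j] m0[OF 1(2)] tree_emb_mapD(1)[OF temb 1(2)] m_fe[OF 1(2)] e(2) by auto
      then have "m e = w"
        by (rule uniq)
      then show False
        using w(2) 1(2) by blast
    next
      case (2 c)
      then have "c < K"
        using K by simp
      then have "nv ?B + c = w"
        using ext_edge e_fe e(2) 2(1) by (intro uniq) simp_all
      then show False
        using w(1) by simp
    qed
  qed
  \<comment> \<open>Outside of the image, a vertex and its parent have the same value because the
    edge between them is collapsed, and the same retraction; this reduces to smaller
    vertices.\<close>
  have fv_retr: "fv j w = fv i (retr ?A ?B m w)" if "w < nv ?B" for w
    using that
  proof (induction w rule: less_induct)
    case (less w)
    show ?case
    proof (cases "w \<in> m ` {..<nv ?A}")
      case True
      then show ?thesis
        using m_fv retr_m by auto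
    next
      case False
      then have w: "1 \<le> w"
        using pos m0[OF pos] by (metis One_nat_def Suc_leI imageI lessThan_iff neq0_conv)
      have "fv j w = fv j (att1 ?B w)"
        using graph_homD(2)[OF D tree_edge fe_out[OF less.prems False]] canonicalD(4)[OF Y w less.prems] w less.prems by simp
      also have "\<dots> = fv i (retr ?A ?B m (att1 ?B w))"
        using less.IH canonicalD(5)[OF Y w less.prems] less.prems by simp
      finally show ?thesis
        using retr_parent_out[OF Y Y temb less.prems False] by simp
    qed
  qed
  have "std_map ?B (fv j) (fe j) (fl j) x = std_map ?A (fv i) (fe i) (fl i)
      (std_map ?B (retr ?A ?B m) (emb_fe ?A ?B m) (\<lambda>_. False) x)" if x: "x \<in> points ?B" for x
    using x gY
  proof (cases rule: points_cases)
    case (Vertex v)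
    then show ?thesis
      using fv_retr canonicalD(1)[OF Y] by simp
  next
    case (Interior e t)
    from Y Interior(1) show ?thesis
    proof (cases rule: canonical_edge_cases)
      case 1
      show ?thesis
      proof (cases "e \<in> m ` {..<nv ?A}")
        case True
        then obtain u where u: "e = m u" "u < nv ?A"
          by auto
        then have u0: "u \<noteq> 0" "1 \<le> u"
          using 1(1) m0[OF u(2)] by auto
        have "att0 ?B e = e" "att0 ?A u = u"
          using canonicalD(4)[OF Y 1] canonicalD(4)[OF Y u0(2) u(2)] by auto
        then show ?thesis
          using Interior(4) u(1) emb_fe_image[OF Y Y emb u(2)] m_fe[OF u(2) u0(1)] m_fl[OF u(2)] m_fv[OF u(2)]
          by (simp split: option.split)
      next
        case False
        then show ?thesis
          using Interior(4) emb_fe_out[OF Y Y emb 1(2)] fe_out[OF 1(2)] fv_retr[OF 1(2)] canonicalD(4)[OF Y 1] by simp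
      qed
    next
      case (2 c)
      then have c: "c < K"
        using K by simp
      have "fv j (att0 ?B (nv ?B + c)) = fv i (att0 ?A (nv ?A + c))"
        using fv_retr[OF canonicalD(7)[OF Y 2(2)]] emb_extra(1)[OF Y Y emb, of c] K c by simp
      then show ?thesis
        using Interior(4) 2(1) emb_fe_extra[OF Y Y emb, of c] e_fe[OF c] e_fl[OF c] by (simp split: option.split)
    qed
  qed
  then show ?thesis
    using ij(1) emb by blast
qed

section \<open>Existence of canonical forms\<close>

text \<open>The numbering of a tree is extended to a new leaf by inserting it right after its parent.\<close>

lemma tree_numbering:
  assumes "is_tree G V E"
  shows "\<exists>vs par pe. distinct vs \<and> set vs = V \<and> vs \<noteq> [] \<and> par (hd vs) = hd vs \<and> par ` V \<subseteq> V \<and>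
    bij_betw pe (V - {hd vs}) E \<and>
    (\<forall>v \<in> V - {hd vs}. att0 G (pe v) = v \<and> att1 G (pe v) = par v \<or> att0 G (pe v) = par v \<and> att1 G (pe v) = v) \<and>
    successively (\<lambda>a b. \<exists>k. par b = (par ^^ k) a) vs"
  using assms
proof induction
  case (single v)
  show ?case
    by (intro exI[of _ "[v]"] exI[of _ id]) (auto simp: bij_betw_def)
next
  case (leaf V E e u w)
  then obtain vs par pe where vs: "distinct vs" "set vs = V" "vs \<noteq> []" "par (hd vs) = hd vs" "par ` V \<subseteq> V"
    and bij: "bij_betw pe (V - {hd vs}) E"
    and pe: "\<And>v. v \<in> V - {hd vs} \<Longrightarrow> att0 G (pe v) = v \<and> att1 G (pe v) = par v \<or> att0 G (pe v) = par v \<and> att1 G (pe v) = v"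
    and succ: "successively (\<lambda>a b. \<exists>k. par b = (par ^^ k) a) vs"
    by blast
  obtain xs ys where split: "vs = xs @ u # ys"
    using leaf.hyps(3) vs(2) by (metis split_list)
  \<comment> \<open>Only two neighbouring pairs are new: \<open>u\<close> with \<open>w\<close>, and
    \<open>w\<close> with the vertex that followed \<open>u\<close>.\<close>
  define vs' where "vs' = xs @ u # w # ys"
  define par' where "par' = par(w := u)"
  define pe' where "pe' = pe(w := e)"
  let ?P = "\<lambda>a b. \<exists>k. par' b = (par' ^^ k) a"
  have hd: "hd vs' = hd vs"
    by (cases xs) (auto simp: vs'_def split)
  have hdV: "hd vs \<in> V"
    using vs(2,3) by auto
  have iter: "(par' ^^ k) a = (par ^^ k) a \<and> (par ^^ k) a \<in> V" if "a \<in> V" for a k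
  proof (induction k)
    case (Suc k)
    then have "(par ^^ k) a \<noteq> w"
      using leaf.hyps(4) by blast
    then show ?case
      using Suc vs(5) by (auto simp: par'_def)
  qed (use that in simp)
  have succ': "successively ?P vs"
  proof (rule successively_mono[OF succ])
    fix a b assume ab: "a \<in> set vs" "b \<in> set vs" "\<exists>k. par b = (par ^^ k) a"
    then have "par' b = par b"
      using vs(2) leaf.hyps(4) by (auto simp: par'_def)
    then show "?P a b"
      using ab iter vs(2) by auto
  qed
  \<comment> \<open>The parent of the new leaf is \<open>u\<close>, so every ancestor of
    \<open>u\<close> is one of \<open>w\<close>; thus the vertex after \<open>u\<close> may also
    come after \<open>w\<close>.\<close>
  have Pw: "?P w y" if uy: "?P u y" for y
  proof -
    obtain k where "par' y = (par' ^^ k) u"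
      using uy by blast
    then have "par' y = (par' ^^ Suc k) w"
      by (simp add: funpow_Suc_right par'_def del: funpow.simps)
    then show ?thesis
      by blast
  qed
  have "?P u w"
    by (intro exI[of _ 0]) (simp add: par'_def)
  then have "successively ?P vs'"
    using succ' Pw unfolding vs'_def split by (cases ys) (auto simp: successively_append_iff)
  moreover have "distinct vs'" "set vs' = insert w V" "vs' \<noteq> []"
    using vs(1,2) leaf.hyps(4) by (auto simp: vs'_def split)
  moreover have "par' (hd vs') = hd vs'"
    using hd hdV vs(4) leaf.hyps(4) by (auto simp: par'_def)
  moreover have "par' ` insert w V \<subseteq> insert w V"
    using vs(5) leaf.hyps(3) by (auto simp: par'_def)
  moreover have "bij_betw pe' (insert w V - {hd vs'}) (insert e E)"
  proof -
    have "bij_betw pe' (V - {hd vs}) E"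
      using bij leaf.hyps(4) by (subst bij_betw_cong[of _ _ pe]) (auto simp: pe'_def)
    then have "bij_betw pe' ((V - {hd vs}) \<union> {w}) (E \<union> {pe' w})"
      using leaf.hyps(2,4) by (intro notIn_Un_bij_betw) (auto simp: pe'_def)
    moreover have "(V - {hd vs}) \<union> {w} = insert w V - {hd vs'}"
      using hd hdV leaf.hyps(4) by auto
    ultimately show ?thesis
      by (simp add: pe'_def)
  qed
  moreover have "att0 G (pe' v) = v \<and> att1 G (pe' v) = par' v \<or> att0 G (pe' v) = par' v \<and> att1 G (pe' v) = v"
    if "v \<in> insert w V - {hd vs'}" for v
    using that pe[of v] hd leaf.hyps(5) by (cases "v = w") (auto simp: pe'_def par'_def)
  ultimately show ?case
    by (intro exI[of _ vs'] exI[of _ par'] exI[of _ pe'] conjI ballI)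
qed

lemma iso_graph_contraction:
  assumes G: "is_graph G" and H: "is_graph H" and D: "graph_hom G H fv (Some \<circ> en) fl"
    and bv: "bij_betw fv (verts G) (verts H)" and be: "bij_betw en (edges G) (edges H)"
  shows "graph_contraction G H fv (Some \<circ> en) fl"
proof -
  have "edge_bijective G H (Some \<circ> en)"
    unfolding edge_bijective_def
  proof
    fix e' assume "e' \<in> edges H"
    then have "e' \<in> en ` edges G"
      using bij_betw_imp_surj_on[OF be] by simp
    then obtain e where "e \<in> edges G" "en e = e'"
      by blast
    then show "\<exists>!e. e \<in> edges G \<and> (Some \<circ> en) e = Some e'"
      using be by (intro ex1I[of _ e]) (auto simp: bij_betw_def inj_on_def)
  qed
  moreover have "is_tree G (fib_verts G fv w) (fib_edges G fv (Some \<circ> en) w)" if w: "w \<in> verts H" for w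
  proof -
    have "w \<in> fv ` verts G"
      using bij_betw_imp_surj_on[OF bv] w by simp
    then obtain v where "v \<in> verts G" "fv v = w"
      by blast
    then have "fib_verts G fv w = {v}"
      using bv by (auto simp: fib_verts_def bij_betw_def inj_on_def)
    moreover have "fib_edges G fv (Some \<circ> en) w = {}"
      by (auto simp: fib_edges_def)
    ultimately show ?thesis
      by (simp add: is_tree.single)
  qed
  ultimately show ?thesis
    unfolding graph_contraction_iff_trees[OF G H] using D by blast
qed

lemma iso_inverse:
  assumes G: "is_graph G" and H: "is_graph H" and D: "graph_hom G H fv (Some \<circ> en) fl"
    and bv: "bij_betw fv (verts G) (verts H)" and be: "bij_betw en (edges G) (edges H)"
  defines "gv \<equiv> inv_into (verts G) fv" and "ge \<equiv> inv_into (edges G) en"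
  shows "graph_contraction H G gv (Some \<circ> ge) (fl \<circ> ge)"
    "x \<in> points G \<Longrightarrow> std_map H gv (Some \<circ> ge) (fl \<circ> ge) (std_map G fv (Some \<circ> en) fl x) = x"
    "z \<in> points H \<Longrightarrow> std_map G fv (Some \<circ> en) fl (std_map H gv (Some \<circ> ge) (fl \<circ> ge) z) = z"
proof -
  have gv: "bij_betw gv (verts H) (verts G)" "v \<in> verts G \<Longrightarrow> gv (fv v) = v" "w \<in> verts H \<Longrightarrow> fv (gv w) = w" for v w
    using bv by (auto simp: gv_def bij_betw_inv_into bij_betw_inv_into_left bij_betw_inv_into_right)
  have ge: "bij_betw ge (edges H) (edges G)" "e \<in> edges G \<Longrightarrow> ge (en e) = e" "e' \<in> edges H \<Longrightarrow> en (ge e') = e'" for e e'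
    using be by (auto simp: ge_def bij_betw_inv_into bij_betw_inv_into_left bij_betw_inv_into_right)
  have geE: "ge e' \<in> edges G" if "e' \<in> edges H" for e'
    using ge(1) that by (auto simp: bij_betw_def)
  have D': "graph_hom H G gv (Some \<circ> ge) (fl \<circ> ge)"
    unfolding graph_hom_def
  proof (intro conjI ballI)
    show "gv ` verts H \<subseteq> verts G"
      using gv(1) by (auto simp: bij_betw_def)
    fix e' assume e': "e' \<in> edges H"
    note e = geE[OF e']
    have "(Some \<circ> en) (ge e') = Some e'"
      using ge(3)[OF e'] by simp
    note ends = graph_homD(4,5)[OF D e this]
    show "case (Some \<circ> ge) e' of None \<Rightarrow> gv (att0 H e') = gv (att1 H e')
      | Some e \<Rightarrow> e \<in> edges G \<and> gv (att0 H e') = (if (fl \<circ> ge) e' then att1 G e else att0 G e) \<and>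
        gv (att1 H e') = (if (fl \<circ> ge) e' then att0 G e else att1 G e)"
      using e ends gv(2)[OF att_in_verts(1)[OF G e]] gv(2)[OF att_in_verts(2)[OF G e]]
      by (auto split: if_splits)
  qed
  show "graph_contraction H G gv (Some \<circ> ge) (fl \<circ> ge)"
    by (rule iso_graph_contraction[OF H G D' gv(1) ge(1)])
  show "std_map H gv (Some \<circ> ge) (fl \<circ> ge) (std_map G fv (Some \<circ> en) fl x) = x" if "x \<in> points G"
    using that G by (cases rule: points_cases) (auto simp: gv(2) ge(2))
  show "std_map G fv (Some \<circ> en) fl (std_map H gv (Some \<circ> ge) (fl \<circ> ge) z) = z" if "z \<in> points H"
    using that H by (cases rule: points_cases) (auto simp: gv(3) ge(3))
qed

text \<open>The vertices get their positions in a depth-first list, each tree edge the position of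
  its lower vertex, and the other edges the numbers after that in any order.\<close>

lemma canonical_form_exists:
  assumes G: "is_graph G" and con: "connected_on G (verts G) (edges G)" and ne: "verts G \<noteq> {}"
  shows "\<exists>Y fv en fl. canonical Y \<and> graph_hom G Y fv (Some \<circ> en) fl \<and>
    bij_betw fv (verts G) (verts Y) \<and> bij_betw en (edges G) (edges Y)"
proof -
  have "is_graph (subgraph G (verts G) (edges G))"
    using G by (simp add: subgraph_def)
  then obtain E0 where E0: "E0 \<subseteq> edges G" "is_tree G (verts G) E0"
    using spanning_tree_exists[OF con _ ne] by blast
  obtain vs par pe where vs: "distinct vs" "set vs = verts G" "vs \<noteq> []" "par (hd vs) = hd vs" "par ` verts G \<subseteq> verts G"
    and bij: "bij_betw pe (verts G - {hd vs}) E0"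
    and pe: "\<And>v. v \<in> verts G - {hd vs} \<Longrightarrow> att0 G (pe v) = v \<and> att1 G (pe v) = par v \<or> att0 G (pe v) = par v \<and> att1 G (pe v) = v"
    and succ: "successively (\<lambda>a b. \<exists>k. par b = (par ^^ k) a) vs"
    using tree_numbering[OF E0(2)] by blast
  obtain es where es: "set es = edges G - E0" "distinct es"
    using finite_distinct_list[of "edges G - E0"] G by (auto simp: is_graph_def)
  define n m where "n = length vs" and "m = length vs + length es"
  have n: "1 \<le> n" "n \<le> m"
    using vs(3) by (auto simp: n_def m_def Suc_le_eq)
  define idx where "idx = inv_into {..<n} (nth vs)"
  have nth_bij: "bij_betw (nth vs) {..<n} (verts G)"
    using bij_betw_nth[OF vs(1)] vs(2) by (simp add: n_def)
  have idx: "bij_betw idx (verts G) {..<n}" and idx_nth: "i < n \<Longrightarrow> idx (vs ! i) = i" and nth_idx: "v \<in> verts G \<Longrightarrow> vs ! idx v = v"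
    and idx_less: "v \<in> verts G \<Longrightarrow> idx v < n" and nth_in: "i < n \<Longrightarrow> vs ! i \<in> verts G" for i v
  proof -
    show b: "bij_betw idx (verts G) {..<n}"
      unfolding idx_def by (rule bij_betw_inv_into[OF nth_bij])
    show "i < n \<Longrightarrow> idx (vs ! i) = i"
      unfolding idx_def using bij_betw_inv_into_left[OF nth_bij] by simp
    show "v \<in> verts G \<Longrightarrow> vs ! idx v = v"
      unfolding idx_def using bij_betw_inv_into_right[OF nth_bij] by simp
    show "v \<in> verts G \<Longrightarrow> idx v < n"
      using b by (auto simp: bij_betw_def)
    show "i < n \<Longrightarrow> vs ! i \<in> verts G"
      using vs(2) nth_mem by (auto simp: n_def)
  qed
  have hd: "hd vs = vs ! 0"
    using vs(3) by (rule hd_conv_nth)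
  define ne where "ne i = (if i < n then pe (vs ! i) else es ! (i - n))" for i
  have "bij_betw ne {1..<n} E0"
  proof -
    have "bij_betw (nth vs) {1..<n} (verts G - {hd vs})"
    proof -
      have "bij_betw (nth vs) ({..<n} - {0}) (verts G - {vs ! 0})"
        using nth_bij n(1) by (intro bij_betw_DiffI) (auto simp: bij_betw_def)
      moreover have "{..<n} - {0} = {1..<n}"
        by auto
      ultimately show ?thesis
        by (simp add: hd)
    qed
    then have "bij_betw (pe \<circ> nth vs) {1..<n} E0"
      using bij by (rule bij_betw_trans)
    then show ?thesis
      by (subst bij_betw_cong[of _ _ "pe \<circ> nth vs"]) (auto simp: ne_def)
  qed
  moreover have "bij_betw ne {n..<m} (edges G - E0)"
  proof -
    have "bij_betw (\<lambda>i. i - n) {n..<m} {..<length es}"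
      by (rule bij_betw_byWitness[of _ "\<lambda>i. i + n"]) (auto simp: m_def n_def)
    moreover have "bij_betw (nth es) {..<length es} (edges G - E0)"
      using bij_betw_nth[OF es(2)] es(1) by simp
    ultimately have "bij_betw (nth es \<circ> (\<lambda>i. i - n)) {n..<m} (edges G - E0)"
      by (rule bij_betw_trans)
    then show ?thesis
      by (subst bij_betw_cong[of _ _ "nth es \<circ> (\<lambda>i. i - n)"]) (auto simp: ne_def)
  qed
  ultimately have "bij_betw ne ({1..<n} \<union> {n..<m}) (E0 \<union> (edges G - E0))"
    by (rule bij_betw_combine) auto
  moreover have "{1..<n} \<union> {n..<m} = {1..<m}" "E0 \<union> (edges G - E0) = edges G"
    using n E0(1) by auto
  ultimately have ne: "bij_betw ne {1..<m} (edges G)"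
    by simp
  define en where "en = inv_into {1..<m} ne"
  have en: "bij_betw en (edges G) {1..<m}" and ne_en: "e \<in> edges G \<Longrightarrow> ne (en e) = e" for e
    using ne by (auto simp: en_def bij_betw_inv_into bij_betw_inv_into_right)
  define Y where "Y = \<lparr>verts = {..<n}, edges = {1..<m},
    att0 = (\<lambda>i. if 1 \<le> i \<and> i < n then i else if n \<le> i \<and> i < m then idx (att0 G (es ! (i - n))) else 0),
    att1 = (\<lambda>i. if 1 \<le> i \<and> i < n then idx (par (vs ! i)) else if n \<le> i \<and> i < m then idx (att1 G (es ! (i - n))) else 0)\<rparr>"
  have parV: "(par ^^ k) v \<in> verts G" if "v \<in> verts G" for v k
    using that vs(5) by (induction k) auto
  have att1_Y: "att1 Y i = idx (par (vs ! i))" if "i < n" for i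
  proof (cases "i = 0")
    case True
    then show ?thesis
      using idx_nth[of 0] vs(4) n(1) by (simp add: Y_def hd)
  next
    case False
    then show ?thesis
      using that by (simp add: Y_def)
  qed
  have iter: "(att1 Y ^^ k) i = idx ((par ^^ k) (vs ! i))" if "i < n" for i k
  proof (induction k)
    case (Suc k)
    have "(par ^^ k) (vs ! i) \<in> verts G"
      using parV nth_in that by blast
    then show ?case
      using Suc att1_Y idx_less nth_idx by simp
  qed (use idx_nth that in simp)
  have parent: "\<exists>k. par (vs ! Suc i) = (par ^^ k) (vs ! i)" if "Suc i < n" for i
    using succ that by (simp add: successively_conv_nth n_def)
  \<comment> \<open>The depth-first condition alone yields that ancestors come earlier: beyond the
    vertex itself, the ancestors of a vertex are ancestors of its predecessor in the list.\<close>
  have iter_le: "idx ((par ^^ k) (vs ! i)) \<le> i" if "i < n" for i k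
    using that
  proof (induction i arbitrary: k)
    case 0
    have "(par ^^ k) (vs ! 0) = vs ! 0"
      using vs(4) by (induction k) (auto simp: hd)
    then show ?case
      using idx_nth[of 0] 0 by simp
  next
    case (Suc i)
    show ?case
    proof (cases k)
      case 0
      then show ?thesis
        using idx_nth Suc.prems by simp
    next
      case (Suc k')
      obtain k0 where "par (vs ! Suc i) = (par ^^ k0) (vs ! i)"
        using parent[OF Suc.prems] by blast
      then have "(par ^^ k) (vs ! Suc i) = (par ^^ (k' + k0)) (vs ! i)"
        unfolding Suc funpow_Suc_right by (simp add: funpow_add)
      then show ?thesis
        using Suc.IH[of "k' + k0"] Suc.prems by simp
    qed
  qed
  have "canonical Y"
    unfolding canonical_def
  proof (rule exI[of _ n], rule exI[of _ m], intro conjI allI impI)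
    fix i assume i: "1 \<le> i \<and> i < n"
    then obtain j where j: "i = Suc j" "Suc j < n" "j < n"
      by (cases i) auto
    obtain k where k: "par (vs ! Suc j) = (par ^^ k) (vs ! j)"
      using parent[OF j(2)] by blast
    have "att1 Y i = idx ((par ^^ k) (vs ! j))"
      using att1_Y j k by simp
    then show "att1 Y i < i" "anc Y (att1 Y i) (i - 1)"
      using iter_le[OF j(3), of k] iter[OF j(3), of k] j(1) by (auto simp: anc_def)
    show "att0 Y i = i"
      using i by (simp add: Y_def)
  next
    fix i assume i: "n \<le> i \<and> i < m"
    then have "i - n < length es"
      unfolding m_def n_def by linarith
    then have "es ! (i - n) \<in> edges G"
      using es(1) nth_mem by blast
    then show "att0 Y i < n" "att1 Y i < n"
      using i idx_less att_in_verts[OF G] by (auto simp: Y_def)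
  qed (use n in \<open>auto simp: Y_def\<close>)
  \<comment> \<open>In canonical form a tree edge starts at its lower vertex, so it is reversed if
    it starts at the parent in \<open>G\<close>. The other edges keep their direction.\<close>
  moreover define fl where "fl e \<longleftrightarrow> en e < n \<and> idx (att0 G e) \<noteq> en e" for e
  have "graph_hom G Y idx (Some \<circ> en) fl"
    unfolding graph_hom_def
  proof (intro conjI ballI)
    show "idx ` verts G \<subseteq> verts Y"
      using idx_less by (auto simp: Y_def)
    fix e assume e: "e \<in> edges G"
    define i where "i = en e"
    have i: "1 \<le> i" "i < m" "ne i = e"
      using en e ne_en[OF e] by (auto simp: bij_betw_def i_def)
    have "i \<in> edges Y"
      using i by (simp add: Y_def)
    moreover have "idx (att0 G e) = (if fl e then att1 Y i else att0 Y i) \<and> idx (att1 G e) = (if fl e then att0 Y i else att1 Y i)"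
    proof (cases "i < n")
      case True
      have "vs ! i \<noteq> hd vs"
        using idx_nth[OF True] idx_nth[of 0] i(1) True hd by auto
      then have "vs ! i \<in> verts G - {hd vs}" "pe (vs ! i) = e"
        using nth_in[OF True] i(3) True by (auto simp: ne_def)
      then have "att0 G e = vs ! i \<and> att1 G e = par (vs ! i) \<or> att0 G e = par (vs ! i) \<and> att1 G e = vs ! i"
        using pe by blast
      then show ?thesis
        using idx_nth[OF True] att1_Y[OF True] True i(1) by (auto simp: fl_def Y_def simp flip: i_def)
    next
      case False
      then show ?thesis
        using i by (auto simp: fl_def Y_def ne_def simp flip: i_def)
    qed
    ultimately show "case (Some \<circ> en) e of None \<Rightarrow> idx (att0 G e) = idx (att1 G e)
      | Some e' \<Rightarrow> e' \<in> edges Y \<and> idx (att0 G e) = (if fl e then att1 Y e' else att0 Y e') \<and>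
        idx (att1 G e) = (if fl e then att0 Y e' else att1 Y e')"
      by (simp add: i_def)
  qed
  ultimately show ?thesis
    using idx en by (intro exI[of _ Y], rule_tac exI[of _ idx], rule_tac exI[of _ en], intro exI[of _ fl]) (auto simp: Y_def)
qed

section \<open>The Groebner category of canonical graphs\<close>

text \<open>Otherwise one could go on choosing elements that lie above none of those chosen before,
  which yields a bad sequence.\<close>

lemma wqo_on_finite_basis:
  assumes wqo: "wqo_on qle T"
  shows "\<exists>B. finite B \<and> B \<subseteq> T \<and> (\<forall>t \<in> T. \<exists>b \<in> B. qle b t)"
proof (rule ccontr)
  assume neg: "\<not> (\<exists>B. finite B \<and> B \<subseteq> T \<and> (\<forall>t \<in> T. \<exists>b \<in> B. qle b t))"
  have ex: "\<exists>t. t \<in> T \<and> (\<forall>b \<in> B. \<not> qle b t)" if B: "finite B" "B \<subseteq> T" for B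
  proof (rule ccontr)
    assume "\<not> (\<exists>t. t \<in> T \<and> (\<forall>b \<in> B. \<not> qle b t))"
    then have "\<forall>t \<in> T. \<exists>b \<in> B. qle b t"
      by auto
    then have "finite B \<and> B \<subseteq> T \<and> (\<forall>t \<in> T. \<exists>b \<in> B. qle b t)"
      using B by (intro conjI)
    then show False
      using neg by (elim notE) (rule exI)
  qed
  define pick where "pick B = (SOME t. t \<in> T \<and> (\<forall>b \<in> B. \<not> qle b t))" for B
  have pick: "pick B \<in> T \<and> (\<forall>b \<in> B. \<not> qle b (pick B))" if "finite B" "B \<subseteq> T" for B
    unfolding pick_def using someI_ex[OF ex[OF that]] .
  define Bs where "Bs = rec_nat {} (\<lambda>_ B. insert (pick B) B)"
  have Bs: "Bs 0 = {}" "Bs (Suc n) = insert (pick (Bs n)) (Bs n)" for n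
    by (simp_all add: Bs_def)
  have fin: "finite (Bs n) \<and> Bs n \<subseteq> T" for n
    using pick by (induction n) (auto simp: Bs)
  have mem: "pick (Bs i) \<in> Bs j" if "i < j" for i j
    using that by (induction j) (auto simp: Bs less_Suc_eq)
  obtain i j where "i < j" "qle (pick (Bs i)) (pick (Bs j))"
    using wqo[unfolded wqo_on_def, THEN spec, of "\<lambda>i. pick (Bs i)"] pick fin by blast
  then show False
    using pick[of "Bs j"] fin[of j] mem by blast
qed

text \<open>If all isomorphisms are identities, orders on morphisms are the same as orders on their
  classes.\<close>

lemma coslice_class_singleton:
  assumes C: "category C" and triv: "\<And>x y f. x \<in> Obj C \<Longrightarrow> y \<in> Obj C \<Longrightarrow> f \<in> iso_set C x y \<Longrightarrow> x = y \<and> f = Idn C x"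
    and f: "f \<in> Arr C" "Dom C f = x"
  shows "coslice_class C x f = {f}"
proof -
  interpret category C
    by (rule C)
  have hom: "f \<in> hom_set C x (Cod C f)"
    using f by (simp add: hom_set_def)
  have obj: "Cod C f \<in> Obj C"
    using Cod_in f by blast
  have "Idn C (Cod C f) \<in> iso_set C (Cod C f) (Cod C f)"
    unfolding iso_set_def using Idn_in[OF obj] Cmp_Idn_left[OF Idn_in[OF obj]] by auto
  then have "(f, f) \<in> coslice_equiv C x"
    using f Cmp_Idn_left[OF hom] by (auto simp: coslice_equiv_def)
  moreover have "f' = f" if eq: "(f, f') \<in> coslice_equiv C x" for f'
  proof -
    obtain h where h: "h \<in> iso_set C (Cod C f) (Cod C f')" "Cmp C h f = f'" "f' \<in> Arr C"
      using eq by (auto simp: coslice_equiv_def)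
    then have "h = Idn C (Cod C f)"
      using triv[OF obj Cod_in] by blast
    then show ?thesis
      using h(2) Cmp_Idn_left[OF hom] by simp
  qed
  ultimately show ?thesis
    by (auto simp: coslice_class_def)
qed

theorem strict_groebner_imp_groebner:
  assumes SG: "strict_groebner C lt"
    and triv: "\<And>x y f. x \<in> Obj C \<Longrightarrow> y \<in> Obj C \<Longrightarrow> f \<in> iso_set C x y \<Longrightarrow> x = y \<and> f = Idn C x"
    and endo: "\<And>x f. x \<in> Obj C \<Longrightarrow> f \<in> hom_set C x x \<Longrightarrow> f = Idn C x"
  shows "groebner C"
proof -
  have C: "category C"
    using SG by (simp add: strict_groebner_def)
  interpret category C
    by (rule C)
  note class_eq = coslice_class_singleton[OF C triv]
  have irrefl: "\<not> lt f f" for f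
    using SG by (simp add: strict_groebner_def)
  have trans: "lt f f''" if "lt f f'" "lt f' f''" for f f' f''
    using SG that unfolding strict_groebner_def by (elim conjE) metis
  have total: "f = f' \<or> lt f f' \<or> lt f' f" if "x \<in> Obj C" "y \<in> Obj C" "f \<in> hom_set C x y" "f' \<in> hom_set C x y" for x y f f'
    using SG that unfolding strict_groebner_def by blast
  have strict: "lt (Cmp C h f) (Cmp C h f')"
    if "x \<in> Obj C" "y \<in> Obj C" "z \<in> Obj C" "f \<in> hom_set C x y" "f' \<in> hom_set C x y" "h \<in> hom_set C y z" "lt f f'"
    for x y z f f' h
    using SG that unfolding strict_groebner_def by blast
  have coslice_eq: "coslice C x = (\<lambda>f. {f}) ` {f \<in> Arr C. Dom C f = x}" for x
    using class_eq[of _ x] unfolding coslice_def quotient_def coslice_class_def by auto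
  \<comment> \<open>The order \<open>lt\<close> compares parallel morphisms. Those with different
    targets are compared by an arbitrary well-order of the objects; the compatibility in (G1)
    concerns only parallel ones.\<close>
  obtain R where "well_order_on (UNIV :: 'a set) R"
    using well_order_on by blast
  then have R: "(a, b) \<in> R \<Longrightarrow> (b, c) \<in> R \<Longrightarrow> (a, c) \<in> R" "(a, b) \<in> R \<Longrightarrow> (b, a) \<in> R \<Longrightarrow> a = b" "a \<noteq> b \<Longrightarrow> (a, b) \<in> R \<or> (b, a) \<in> R" for a b c
    unfolding order_on_defs by (auto dest: transD antisymD simp: total_on_def)
  define le' where "le' f f' \<longleftrightarrow> (Cod C f = Cod C f' \<and> (f = f' \<or> lt f f')) \<or> (Cod C f \<noteq> Cod C f' \<and> (Cod C f, Cod C f') \<in> R)" for f f'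
  have "G1 C"
    unfolding G1_def
  proof
    fix x assume x: "x \<in> Obj C"
    let ?S = "{f \<in> Arr C. Dom C f = x}"
    define r where "r = (\<lambda>(f, f'). ({f}, {f'})) ` {(f, f'). f \<in> ?S \<and> f' \<in> ?S \<and> le' f f'}"
    have r_iff: "({f}, {f'}) \<in> r \<longleftrightarrow> f \<in> ?S \<and> f' \<in> ?S \<and> le' f f'" for f f'
      by (auto simp: r_def)
    have le'_trans: "le' f f''" if "le' f f'" "le' f' f''" for f f' f''
    proof (cases "Cod C f = Cod C f' \<or> Cod C f' = Cod C f''")
      case True
      then show ?thesis
        using that trans[of f f' f''] by (auto simp: le'_def)
    next
      case False
      then have "(Cod C f, Cod C f') \<in> R" "(Cod C f', Cod C f'') \<in> R"
        using that by (auto simp: le'_def)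
      then show ?thesis
        using False R(1)[of "Cod C f" "Cod C f'" "Cod C f''"] R(2)[of "Cod C f" "Cod C f'"] by (auto simp: le'_def)
    qed
    have le'_antisym: "f = f'" if "le' f f'" "le' f' f" for f f'
      using that trans[of f f' f] irrefl[of f] R(2)[of "Cod C f" "Cod C f'"] by (auto simp: le'_def)
    have le'_total: "le' f f' \<or> le' f' f" if "f \<in> ?S" "f' \<in> ?S" for f f'
    proof (cases "Cod C f = Cod C f'")
      case True
      have "Cod C f \<in> Obj C" "f \<in> hom_set C x (Cod C f)" "f' \<in> hom_set C x (Cod C f)"
        using that True Cod_in by (auto simp: hom_set_def)
      then show ?thesis
        using total[OF x] True by (auto simp: le'_def)
    next
      case False
      then show ?thesis
        using R(3) by (auto simp: le'_def)
    qed
    have "linear_order_on (coslice C x) r"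
      unfolding order_on_defs
    proof (intro conjI)
      show "r \<subseteq> coslice C x \<times> coslice C x"
        unfolding coslice_eq r_def by auto
      show "refl_on (coslice C x) r"
        unfolding coslice_eq refl_on_def using r_iff by (auto simp: le'_def)
      show "trans r"
        unfolding trans_def
      proof (intro allI impI)
        fix a b c assume "(a, b) \<in> r" "(b, c) \<in> r"
        moreover from this obtain f f' f'' where "a = {f}" "b = {f'}" "c = {f''}"
          by (auto simp: r_def)
        ultimately show "(a, c) \<in> r"
          using r_iff le'_trans by blast
      qed
      show "antisym r"
        unfolding antisym_def
      proof (intro allI impI)
        fix a b assume "(a, b) \<in> r" "(b, a) \<in> r"
        moreover from this obtain f f' where "a = {f}" "b = {f'}"
          by (auto simp: r_def)
        ultimately show "a = b"
          using r_iff le'_antisym by blast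
      qed
      show "total_on (coslice C x) r"
        unfolding total_on_def coslice_eq using r_iff le'_total by blast
    qed
    moreover have "(coslice_class C x (Cmp C h f), coslice_class C x (Cmp C h f')) \<in> r"
      if yz: "y \<in> Obj C" "z \<in> Obj C" and f: "f \<in> hom_set C x y" "f' \<in> hom_set C x y" and h: "h \<in> hom_set C y z"
        and le: "(coslice_class C x f, coslice_class C x f') \<in> r" for y z f f' h
    proof -
      have fS: "f \<in> ?S" "f' \<in> ?S" "Cod C f = y" "Cod C f' = y"
        using f by (auto simp: hom_set_def)
      have hS: "Cmp C h f \<in> ?S" "Cmp C h f' \<in> ?S" "Cod C (Cmp C h f) = z" "Cod C (Cmp C h f') = z"
        using Cmp_in[OF f(1) h] Cmp_in[OF f(2) h] by (auto simp: hom_set_def)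
      have "le' f f'"
        using le fS class_eq[of f x] class_eq[of f' x] r_iff by auto
      then have "le' (Cmp C h f) (Cmp C h f')"
        using fS hS strict[OF x yz f h] by (auto simp: le'_def)
      then show ?thesis
        using hS class_eq[of "Cmp C h f" x] class_eq[of "Cmp C h f'" x] r_iff by auto
    qed
    ultimately show "\<exists>r. linear_order_on (coslice C x) r \<and>
      (\<forall>y \<in> Obj C. \<forall>z \<in> Obj C. \<forall>f \<in> hom_set C x y. \<forall>g \<in> hom_set C x y. \<forall>h \<in> hom_set C y z.
        (coslice_class C x f, coslice_class C x g) \<in> r \<longrightarrow>
        (coslice_class C x (Cmp C h f), coslice_class C x (Cmp C h g)) \<in> r)"
      by (intro exI[of _ r]) blast
  qed
  moreover have "G2 C"
    unfolding G2_def
  proof (intro ballI notI)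
    fix x assume x: "x \<in> Obj C"
    assume "\<exists>s :: nat \<Rightarrow> 'b set. (\<forall>i. s i \<in> coslice C x) \<and> (\<forall>i j. i < j \<longrightarrow> \<not> coslice_le C (s i) (s j))"
    then obtain s :: "nat \<Rightarrow> 'b set" where s: "\<And>i. s i \<in> coslice C x" "\<And>i j. i < j \<Longrightarrow> \<not> coslice_le C (s i) (s j)"
      by blast
    have "\<exists>f. f \<in> {f \<in> Arr C. Dom C f = x} \<and> s i = {f}" for i
      using s(1)[of i] unfolding coslice_eq by blast
    then obtain f where f: "\<And>i. f i \<in> {f \<in> Arr C. Dom C f = x}" "\<And>i. s i = {f i}"
      by metis
    have "wqo_on (\<lambda>f f'. \<exists>h \<in> hom_set C (Cod C f) (Cod C f'). Cmp C h f = f') {f \<in> Arr C. Dom C f = x}"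
      using SG x by (simp add: strict_groebner_def)
    then obtain i j where "i < j" "\<exists>h \<in> hom_set C (Cod C (f i)) (Cod C (f j)). Cmp C h (f i) = f j"
      using f(1) unfolding wqo_on_def by blast
    then show False
      using s(2)[of i j] f(2) by (auto simp: coslice_le_def)
  qed
  ultimately show ?thesis
    unfolding groebner_def using C endo by blast
qed

section \<open>Invariance of rank and genus\<close>

lemma hom_finprod:
  assumes A: "comm_group A" and B: "comm_group B" and h: "h \<in> hom A B"
    and "finite S" "f \<in> S \<rightarrow> carrier A"
  shows "h (finprod A f S) = finprod B (\<lambda>x. h (f x)) S"
  using assms(4,5)
proof induction
  interpret A: comm_group A by (rule A)
  interpret B: comm_group B by (rule B)
  {
    case empty
    show ?case
      using hom_one[OF h A.is_group B.is_group] by simp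
  next
    case (insert s S)
    have "(\<lambda>x. h (f x)) \<in> insert s S \<rightarrow> carrier B"
      using insert.prems hom_in_carrier[OF h] by auto
    then have "finprod B (\<lambda>x. h (f x)) (insert s S) = h (f s) \<otimes>\<^bsub>B\<^esub> finprod B (\<lambda>x. h (f x)) S"
      using insert.hyps by (subst B.finprod_insert) auto
    moreover have "finprod A f (insert s S) = f s \<otimes>\<^bsub>A\<^esub> finprod A f S"
      using insert.hyps insert.prems by (subst A.finprod_insert) auto
    moreover have "f s \<in> carrier A" "finprod A f S \<in> carrier A"
      using insert.prems by (auto intro: A.finprod_closed)
    ultimately show ?case
      using insert hom_mult[OF h] by simp
  }
qed

lemma Z_independent_iso:
  assumes A: "comm_group A" and B: "comm_group B" and h: "h \<in> iso A B" and S: "Z_independent A S"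
  shows "Z_independent B (h ` S)" "card (h ` S) = card S"
proof -
  interpret A: comm_group A by (rule A)
  interpret B: comm_group B by (rule B)
  have hom: "h \<in> hom A B" and inj: "inj_on h (carrier A)" and im: "h ` carrier A = carrier B"
    using h by (auto simp: iso_def bij_betw_def)
  have S': "finite S" "S \<subseteq> carrier A"
    using S by (auto simp: Z_independent_def)
  have injS: "inj_on h S"
    using inj S'(2) by (rule inj_on_subset)
  show "card (h ` S) = card S"
    by (rule card_image[OF injS])
  have "c t = 0" if eq: "finprod B (\<lambda>s. s [^]\<^bsub>B\<^esub> c s) (h ` S) = \<one>\<^bsub>B\<^esub>" and t: "t \<in> h ` S" for c :: "_ \<Rightarrow> int" and t
  proof -
    let ?f = "\<lambda>s. s [^]\<^bsub>A\<^esub> c (h s)"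
    have f: "?f \<in> S \<rightarrow> carrier A"
      using S' by auto
    have "finprod B (\<lambda>s. s [^]\<^bsub>B\<^esub> c s) (h ` S) = finprod B (\<lambda>s. h s [^]\<^bsub>B\<^esub> c (h s)) S"
      using S' im by (intro B.finprod_reindex injS) auto
    also have "\<dots> = finprod B (\<lambda>s. h (?f s)) S"
      using S' hom_int_pow[OF hom _ A.is_group B.is_group]
      by (intro B.finprod_cong') (auto intro!: hom_in_carrier[OF hom] A.int_pow_closed)
    also have "\<dots> = h (finprod A ?f S)"
      using hom_finprod[OF A B hom S'(1) f] by simp
    finally have "h (finprod A ?f S) = h \<one>\<^bsub>A\<^esub>"
      using eq hom_one[OF hom A.is_group B.is_group] by simp
    then have "finprod A ?f S = \<one>\<^bsub>A\<^esub>"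
      using inj f by (auto dest: inj_onD)
    then have "\<forall>s \<in> S. c (h s) = 0"
      using S[unfolded Z_independent_def, THEN conjunct2, THEN conjunct2, THEN spec, of "\<lambda>s. c (h s)"] by simp
    then show ?thesis
      using t by blast
  qed
  then show "Z_independent B (h ` S)"
    unfolding Z_independent_def using S' im by blast
qed

lemma has_rank_iso:
  assumes A: "comm_group A" and B: "comm_group B" and AB: "A \<cong> B" and rank: "has_rank A n"
  shows "has_rank B n"
proof -
  obtain h where h: "h \<in> iso A B"
    using AB by (auto simp: is_iso_def)
  have "B \<cong> A"
    using group.iso_sym[OF _ AB] A by (simp add: comm_group_def)
  then obtain k where k: "k \<in> iso B A"
    by (auto simp: is_iso_def)
  show ?thesis
    using rank Z_independent_iso[OF A B h] Z_independent_iso[OF B A k] unfolding has_rank_def by metis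
qed

text \<open>The homology enters the proof through this invariance: the canonical form of a graph
  inherits its genus.\<close>

lemma graph_of_genus_homeomorphic:
  assumes G: "graph_of_genus g G" and H: "is_graph H" "verts H \<noteq> {}" and hom: "graph_space G homeomorphic_space graph_space H"
  shows "graph_of_genus g H"
proof -
  have "homology_group 1 (graph_space G) \<cong> homology_group 1 (graph_space H)"
    by (rule homeomorphic_space_imp_isomorphic_homology_groups[OF hom])
  then have "has_rank (homology_group 1 (graph_space H)) g"
    using has_rank_iso[OF abelian_homology_group abelian_homology_group] G[unfolded graph_of_genus_def] by blast
  then show ?thesis
    using G H homeomorphic_connected_space[OF hom] by (simp add: graph_of_genus_def)
qed

text \<open>The definition of \<open>quasi_groebner\<close> fixes the types of objects and arrows: the second components of
  the objects are dummies, and a map on vertices is encoded by the list of its values.\<close>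

type_synonym emb_arrow = "(graph \<times> nat) \<times> (graph \<times> nat) \<times> nat"

definition arrow :: "graph \<Rightarrow> graph \<Rightarrow> (nat \<Rightarrow> nat) \<Rightarrow> emb_arrow" where
  "arrow A Y m = ((A, 0), (Y, 0), list_encode (map m [0..<nv A]))"

definition arrow_map :: "emb_arrow \<Rightarrow> nat \<Rightarrow> nat" where
  "arrow_map \<alpha> u = list_decode (snd (snd \<alpha>)) ! u"

definition emb_cat :: "nat \<Rightarrow> (graph \<times> nat, emb_arrow) cat" where
  "emb_cat g = \<lparr>
    Obj = {(A, 0) | A. canonical A \<and> graph_of_genus g A},
    Arr = {arrow A Y m | A Y m. canonical A \<and> graph_of_genus g A \<and> canonical Y \<and> graph_of_genus g Y \<and> emb A Y m},
    Dom = fst,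
    Cod = (\<lambda>\<alpha>. fst (snd \<alpha>)),
    Idn = (\<lambda>x. arrow (fst x) (fst x) (\<lambda>u. u)),
    Cmp = (\<lambda>\<beta> \<alpha>. arrow (fst (fst \<alpha>)) (fst (fst (snd \<beta>))) (arrow_map \<beta> \<circ> arrow_map \<alpha>))\<rparr>"

lemma arrow_map_arrow: "u < nv A \<Longrightarrow> arrow_map (arrow A Y m) u = m u"
  by (simp add: arrow_map_def arrow_def)

lemma arrow_cong: "(\<And>u. u < nv A \<Longrightarrow> m u = m' u) \<Longrightarrow> arrow A Y m = arrow A Y m'"
proof -
  assume "\<And>u. u < nv A \<Longrightarrow> m u = m' u"
  then have "map m [0..<nv A] = map m' [0..<nv A]"
    by (intro map_cong) auto
  then show ?thesis
    by (simp only: arrow_def)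
qed

lemma arrow_eq_iff: "arrow A Y m = arrow A Y m' \<longleftrightarrow> (\<forall>u < nv A. m u = m' u)"
  by (metis arrow_cong arrow_map_arrow)

lemma arrow_ends [simp]: "fst (arrow A Y m) = (A, 0)" "fst (snd (arrow A Y m)) = (Y, 0)"
  by (simp_all add: arrow_def)

lemma emb_cat_simps [simp]:
  "x \<in> Obj (emb_cat g) \<longleftrightarrow> (\<exists>A. x = (A, 0) \<and> canonical A \<and> graph_of_genus g A)"
  "Dom (emb_cat g) \<alpha> = fst \<alpha>" "Cod (emb_cat g) \<alpha> = fst (snd \<alpha>)"
  "Idn (emb_cat g) x = arrow (fst x) (fst x) (\<lambda>u. u)"
  by (auto simp: emb_cat_def)

lemma hom_set_emb_cat:
  "\<alpha> \<in> hom_set (emb_cat g) x y \<longleftrightarrow> (\<exists>A Y m. x = (A, 0) \<and> y = (Y, 0) \<and> \<alpha> = arrow A Y m \<and>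
    canonical A \<and> graph_of_genus g A \<and> canonical Y \<and> graph_of_genus g Y \<and> emb A Y m)"
  unfolding hom_set_def by (auto simp: emb_cat_def)

lemma Cmp_arrow:
  assumes "canonical A" "canonical Y" "emb A Y m"
  shows "Cmp (emb_cat g) (arrow Y Z m') (arrow A Y m) = arrow A Z (m' \<circ> m)"
proof -
  have "arrow A Z (arrow_map (arrow Y Z m') \<circ> arrow_map (arrow A Y m)) = arrow A Z (m' \<circ> m)"
    using tree_emb_mapD(1)[OF emb_tree[OF assms]] by (intro arrow_cong) (simp add: arrow_map_arrow)
  then show ?thesis
    by (simp add: emb_cat_def)
qed

lemma category_emb_cat: "category (emb_cat g)"
proof
  fix \<alpha> assume "\<alpha> \<in> Arr (emb_cat g)"
  then show "Dom (emb_cat g) \<alpha> \<in> Obj (emb_cat g)" "Cod (emb_cat g) \<alpha> \<in> Obj (emb_cat g)"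
    by (auto simp: emb_cat_def)
next
  fix x assume "x \<in> Obj (emb_cat g)"
  then obtain A where A: "x = (A, 0)" "canonical A" "graph_of_genus g A"
    by auto
  have "Idn (emb_cat g) x = arrow A A (\<lambda>u. u)"
    by (simp add: A(1))
  then show "Idn (emb_cat g) x \<in> hom_set (emb_cat g) x x"
    unfolding hom_set_emb_cat using A emb_id[OF A(2)] by blast
next
  fix \<alpha> \<beta> x y z
  assume a: "\<alpha> \<in> hom_set (emb_cat g) x y" and b: "\<beta> \<in> hom_set (emb_cat g) y z"
  obtain A Y m where A: "x = (A, 0)" "y = (Y, 0)" "\<alpha> = arrow A Y m" "canonical A" "graph_of_genus g A"
    "canonical Y" "graph_of_genus g Y" "emb A Y m"
    using a unfolding hom_set_emb_cat by blast
  obtain Z m' where Z: "z = (Z, 0)" "\<beta> = arrow Y Z m'" "canonical Z" "graph_of_genus g Z" "emb Y Z m'"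
    using b A(2) unfolding hom_set_emb_cat by blast
  show "Cmp (emb_cat g) \<beta> \<alpha> \<in> hom_set (emb_cat g) x z"
    using A Z Cmp_arrow[OF A(4,6,8)] emb_comp[OF A(4,6) Z(3) A(8) Z(5)]
    unfolding hom_set_emb_cat by blast
next
  fix \<alpha> \<beta> \<gamma> w x y z
  assume a: "\<alpha> \<in> hom_set (emb_cat g) w x" and b: "\<beta> \<in> hom_set (emb_cat g) x y" and c: "\<gamma> \<in> hom_set (emb_cat g) y z"
  obtain A Y m where A: "w = (A, 0)" "x = (Y, 0)" "\<alpha> = arrow A Y m" "canonical A" "canonical Y" "emb A Y m"
    using a unfolding hom_set_emb_cat by blast
  obtain Z m' where Z: "y = (Z, 0)" "\<beta> = arrow Y Z m'" "canonical Z" "emb Y Z m'"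
    using b A(2) unfolding hom_set_emb_cat by blast
  obtain W m'' where W: "\<gamma> = arrow Z W m''"
    using c Z(1) unfolding hom_set_emb_cat by blast
  show "Cmp (emb_cat g) \<gamma> (Cmp (emb_cat g) \<beta> \<alpha>) = Cmp (emb_cat g) (Cmp (emb_cat g) \<gamma> \<beta>) \<alpha>"
    unfolding A(3) Z(2) W Cmp_arrow[OF A(4-6)] Cmp_arrow[OF A(5) Z(3,4)]
      Cmp_arrow[OF A(4) Z(3) emb_comp[OF A(4,5) Z(3) A(6) Z(4)]] comp_assoc ..
next
  fix \<alpha> x y assume "\<alpha> \<in> hom_set (emb_cat g) x y"
  then obtain A Y m where A: "x = (A, 0)" "y = (Y, 0)" "\<alpha> = arrow A Y m" "canonical A" "canonical Y" "emb A Y m"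
    unfolding hom_set_emb_cat by blast
  show "Cmp (emb_cat g) \<alpha> (Idn (emb_cat g) x) = \<alpha>" "Cmp (emb_cat g) (Idn (emb_cat g) y) \<alpha> = \<alpha>"
    using Cmp_arrow[OF A(4,4) emb_id[OF A(4)], of g Y m] Cmp_arrow[OF A(4-6), of g Y "\<lambda>u. u"]
    by (simp_all add: A(1-3) comp_def)
qed

text \<open>The lexicographic order of the sequences of values. Composition with a strictly
  increasing map keeps the first place of difference and its direction.\<close>

definition arrow_less :: "emb_arrow \<Rightarrow> emb_arrow \<Rightarrow> bool" where
  "arrow_less \<alpha> \<beta> \<longleftrightarrow> fst \<alpha> = fst \<beta> \<and> fst (snd \<alpha>) = fst (snd \<beta>) \<and>
    (\<exists>i < nv (fst (fst \<alpha>)). (\<forall>u < i. arrow_map \<alpha> u = arrow_map \<beta> u) \<and> arrow_map \<alpha> i < arrow_map \<beta> i)"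

lemma arrow_less_iff:
  "arrow_less (arrow A Y m) (arrow A Y m') \<longleftrightarrow> (\<exists>i < nv A. (\<forall>u < i. m u = m' u) \<and> m i < m' i)"
proof -
  have "(\<forall>u < i. arrow_map (arrow A Y m) u = arrow_map (arrow A Y m') u) \<and> arrow_map (arrow A Y m) i < arrow_map (arrow A Y m') i
      \<longleftrightarrow> (\<forall>u < i. m u = m' u) \<and> m i < m' i" if "i < nv A" for i
    using that by (simp add: arrow_map_arrow)
  then show ?thesis
    unfolding arrow_less_def by auto
qed

text \<open>For the well-quasi-order, the embeddings of \<open>A\<close> are turned into the
  contractions onto \<open>A\<close> which they induce. A factorization of contractions through an
  embedding is then translated back.\<close>

lemma strict_groebner_emb_cat: "strict_groebner (emb_cat g) arrow_less"
  unfolding strict_groebner_def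
proof (intro conjI ballI allI impI category_emb_cat)
  fix x y assume "x \<in> Obj (emb_cat g)" "y \<in> Obj (emb_cat g)"
  then obtain A Y where xy: "x = (A, 0)" "y = (Y, 0)"
    by auto
  have "hom_set (emb_cat g) x y \<subseteq> (\<lambda>l. ((A, 0), (Y, 0), list_encode l)) ` {l. set l \<subseteq> {..<nv Y} \<and> length l = nv A}"
  proof
    fix \<alpha> assume "\<alpha> \<in> hom_set (emb_cat g) x y"
    then obtain m where "\<alpha> = arrow A Y m" "canonical A" "canonical Y" "emb A Y m"
      using xy unfolding hom_set_emb_cat by blast
    moreover from this have "set (map m [0..<nv A]) \<subseteq> {..<nv Y}"
      using tree_emb_mapD(1)[OF emb_tree[of A Y m]] by auto
    ultimately show "\<alpha> \<in> (\<lambda>l. ((A, 0), (Y, 0), list_encode l)) ` {l. set l \<subseteq> {..<nv Y} \<and> length l = nv A}"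
      by (intro image_eqI[of _ _ "map m [0..<nv A]"]) (simp_all add: arrow_def)
  qed
  then show "finite (hom_set (emb_cat g) x y)"
    using finite_lists_length_eq[of "{..<nv Y}" "nv A"] by (auto intro: finite_subset)
next
  show "\<not> arrow_less f f" for f
    by (simp add: arrow_less_def)
next
  fix \<alpha> \<beta> \<gamma> assume 1: "arrow_less \<alpha> \<beta>" and 2: "arrow_less \<beta> \<gamma>"
  obtain i where i: "i < nv (fst (fst \<alpha>))" "\<forall>u < i. arrow_map \<alpha> u = arrow_map \<beta> u" "arrow_map \<alpha> i < arrow_map \<beta> i"
    using 1 by (auto simp: arrow_less_def)
  obtain j where j: "j < nv (fst (fst \<beta>))" "\<forall>u < j. arrow_map \<beta> u = arrow_map \<gamma> u" "arrow_map \<beta> j < arrow_map \<gamma> j"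
    using 2 by (auto simp: arrow_less_def)
  have "(\<forall>u < min i j. arrow_map \<alpha> u = arrow_map \<gamma> u) \<and> arrow_map \<alpha> (min i j) < arrow_map \<gamma> (min i j)"
    using i j by (cases i j rule: linorder_cases) auto
  moreover have "min i j < nv (fst (fst \<alpha>))"
    using i(1) by simp
  ultimately show "arrow_less \<alpha> \<gamma>"
    using 1 2 unfolding arrow_less_def by metis
next
  fix x y \<alpha> \<beta>
  assume "\<alpha> \<in> hom_set (emb_cat g) x y" "\<beta> \<in> hom_set (emb_cat g) x y"
  then obtain A Y m m' where \<alpha>\<beta>: "\<alpha> = arrow A Y m" "\<beta> = arrow A Y m'"
    unfolding hom_set_emb_cat by auto
  show "\<alpha> = \<beta> \<or> arrow_less \<alpha> \<beta> \<or> arrow_less \<beta> \<alpha>"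
  proof (cases "\<exists>u. u < nv A \<and> m u \<noteq> m' u")
    case True
    define i where "i = (LEAST u. u < nv A \<and> m u \<noteq> m' u)"
    have i: "i < nv A" "m i \<noteq> m' i"
      unfolding i_def using LeastI_ex[OF True] by auto
    have "m u = m' u" if "u < i" for u
      using not_less_Least[of u "\<lambda>u. u < nv A \<and> m u \<noteq> m' u"] that i(1) by (simp add: i_def)
    then show ?thesis
      using i unfolding \<alpha>\<beta> arrow_less_iff by (metis linorder_neqE_nat)
  next
    case False
    then show ?thesis
      unfolding \<alpha>\<beta> using arrow_eq_iff by blast
  qed
next
  fix x y z \<alpha> \<beta> \<gamma>
  assume h: "\<alpha> \<in> hom_set (emb_cat g) x y" "\<beta> \<in> hom_set (emb_cat g) x y" "\<gamma> \<in> hom_set (emb_cat g) y z"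
    and less: "arrow_less \<alpha> \<beta>"
  obtain A Y m where 1: "x = (A, 0)" "y = (Y, 0)" "\<alpha> = arrow A Y m" "canonical A" "canonical Y" "emb A Y m"
    using h(1) unfolding hom_set_emb_cat by blast
  obtain m' where 2: "\<beta> = arrow A Y m'" "emb A Y m'"
    using h(2) 1 unfolding hom_set_emb_cat by blast
  obtain Z k where 3: "\<gamma> = arrow Y Z k" "canonical Z" "emb Y Z k"
    using h(3) 1(2) unfolding hom_set_emb_cat by blast
  obtain i where i: "i < nv A" "\<forall>u < i. m u = m' u" "m i < m' i"
    using less unfolding 1(3) 2(1) arrow_less_iff by blast
  have "m i < nv Y" "m' i < nv Y"
    using tree_emb_mapD(1)[OF emb_tree[OF 1(4-6)] i(1)] tree_emb_mapD(1)[OF emb_tree[OF 1(4,5) 2(2)] i(1)] by auto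
  then have "k (m i) < k (m' i)"
    using tree_emb_mapD(4)[OF emb_tree[OF 1(5) 3(2,3)]] i(3) by simp
  then show "arrow_less (Cmp (emb_cat g) \<gamma> \<alpha>) (Cmp (emb_cat g) \<gamma> \<beta>)"
    unfolding 1(3) 2(1) 3(1) Cmp_arrow[OF 1(4-6)] Cmp_arrow[OF 1(4,5) 2(2)] arrow_less_iff
    using i(1,2) by auto
next
  fix x assume "x \<in> Obj (emb_cat g)"
  then obtain A where A: "x = (A, 0)" "canonical A"
    by auto
  show "wqo_on (\<lambda>f f'. \<exists>h \<in> hom_set (emb_cat g) (Cod (emb_cat g) f) (Cod (emb_cat g) f'). Cmp (emb_cat g) h f = f')
      {f \<in> Arr (emb_cat g). Dom (emb_cat g) f = x}"
    unfolding wqo_on_def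
  proof (intro allI impI)
    fix s :: "nat \<Rightarrow> emb_arrow"
    assume s: "\<forall>i. s i \<in> {f \<in> Arr (emb_cat g). Dom (emb_cat g) f = x}"
    have "\<exists>Y m. s i = arrow A Y m \<and> canonical Y \<and> graph_of_genus g Y \<and> emb A Y m" for i
    proof -
      have "s i \<in> Arr (emb_cat g)" "fst (s i) = x"
        using s by (auto simp: emb_cat_def)
      then obtain A' Y m where *: "s i = arrow A' Y m" "canonical Y" "graph_of_genus g Y" "emb A' Y m"
        by (auto simp: emb_cat_def)
      moreover have "A' = A"
        using \<open>fst (s i) = x\<close> *(1) A(1) by simp
      ultimately show ?thesis
        by blast
    qed
    then obtain Y m where Ym: "\<And>i. s i = arrow A (Y i) (m i)" "\<And>i. canonical (Y i)"
      "\<And>i. graph_of_genus g (Y i)" "\<And>i. emb A (Y i) (m i)"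
      by metis
    obtain i j h where ij: "i < j" "emb (Y i) (Y j) h" and eq: "\<forall>x \<in> points (Y j).
        std_map (Y j) (retr A (Y j) (m j)) (emb_fe A (Y j) (m j)) (\<lambda>_. False) x =
        std_map (Y i) (retr A (Y i) (m i)) (emb_fe A (Y i) (m i)) (\<lambda>_. False)
          (std_map (Y j) (retr (Y i) (Y j) h) (emb_fe (Y i) (Y j) h) (\<lambda>_. False) x)"
      using contraction_wqo[of A Y, OF canonical_is_graph[OF A(2)] Ym(2) emb_contraction[OF A(2) Ym(2) Ym(4)]]
      by blast
    \<comment> \<open>Evaluation at vertices turns the equality of contractions into one of
      retractions, and a retraction determines its embedding.\<close>
    have "retr A (Y j) (m j) w = retr A (Y j) (h \<circ> m i) w" if w: "w < nv (Y j)" for w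
    proof -
      have "Vertex w \<in> points (Y j)"
        using w canonical_is_graph[OF Ym(2)] canonicalD(1)[OF Ym(2)] by simp
      from bspec[OF eq this] show ?thesis
        using retr_comp[OF A(2) Ym(2) Ym(2) Ym(4) ij(2) w] by simp
    qed
    then have "m j u = (h \<circ> m i) u" if "u < nv A" for u
      using that emb_eqI[OF A(2) Ym(2) Ym(4) emb_comp[OF A(2) Ym(2) Ym(2) Ym(4) ij(2)]] by blast
    then have "Cmp (emb_cat g) (arrow (Y i) (Y j) h) (s i) = s j"
      unfolding Ym(1) Cmp_arrow[OF A(2) Ym(2) Ym(4)] by (intro arrow_cong) simp
    moreover have "arrow (Y i) (Y j) h \<in> hom_set (emb_cat g) (Cod (emb_cat g) (s i)) (Cod (emb_cat g) (s j))"
      unfolding hom_set_emb_cat using Ym(2,3) ij(2) by (auto simp: Ym(1))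
    ultimately show "\<exists>i j. i < j \<and> (\<exists>h \<in> hom_set (emb_cat g) (Cod (emb_cat g) (s i)) (Cod (emb_cat g) (s j)).
        Cmp (emb_cat g) h (s i) = s j)"
      using ij(1) by blast
  qed
qed

text \<open>A strictly increasing map between initial segments of equal length is the identity, and
  with it the retraction. As canonical graphs carry no arbitrary data, all their structure is then
  equal. This excludes isomorphisms and endomorphisms other than identities.\<close>

lemma emb_same_size:
  assumes A: "canonical A" and Y: "canonical Y" and emb: "emb A Y m" and size: "nv Y \<le> nv A"
  shows "A = Y" "u < nv A \<Longrightarrow> m u = u"
proof -
  note m = tree_emb_mapD[OF emb_tree[OF A Y emb]]
  have shift: "m v + d \<le> m (v + d)" if "v + d < nv A" for v d
    using that
  proof (induction d)
    case (Suc d)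
    then have "m (v + d) < m (v + Suc d)"
      using m(4)[of "v + d" "v + Suc d"] by simp
    then show ?case
      using Suc by simp
  qed simp
  have mu: "m v = v" if "v < nv A" for v
  proof (rule order_antisym)
    show "v \<le> m v"
      using shift[of 0 v] m(2) that by simp
    \<comment> \<open>The number of vertices after \<open>v\<close>. They need as many different
      values above \<open>m v\<close>, so \<open>m v\<close> cannot exceed \<open>v\<close>.\<close>
    define d where "d = nv A - 1 - v"
    have d: "v + d = nv A - 1" "v + d < nv A"
      using that by (auto simp: d_def)
    have "m v + d \<le> m (v + d)" "m (v + d) < nv A"
      using shift[OF d(2)] m(1)[OF d(2)] size by linarith+
    then show "m v \<le> v"
      using d by linarith
  qed
  then show "u < nv A \<Longrightarrow> m u = u" .
  have nv: "nv A = nv Y"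
  proof -
    have "m (nv A - 1) < nv Y" "m (nv A - 1) = nv A - 1"
      using m(1)[of "nv A - 1"] mu[of "nv A - 1"] canonicalD(3)[OF A] by auto
    then show ?thesis
      using size by linarith
  qed
  have nx: "nx A = nx Y"
    by (rule emb_nx[OF A Y emb])
  have retr: "retr A Y m w = w" if "w < nv Y" for w
    using retr_image[OF A Y emb_tree[OF A Y emb], of w] mu[of w] that nv by simp
  have "att0 A i = att0 Y i \<and> att1 A i = att1 Y i" for i
  proof (cases "i = 0 \<or> nv Y + nx Y \<le> i")
    case True
    then show ?thesis
      using canonicalD(9)[OF A, of i] canonicalD(9)[OF Y, of i] nv nx by auto
  next
    case False
    then have i: "1 \<le> i" "i < nv Y + nx Y"
      by auto
    show ?thesis
    proof (cases "i < nv Y")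
      case True
      then have "att1 Y i < nv Y"
        using canonicalD(5)[OF Y i(1)] by simp
      then show ?thesis
        using retr_parent_in[OF A Y emb_tree[OF A Y emb] i(1)] retr mu[of i] canonicalD(4)[OF A i(1)] canonicalD(4)[OF Y i(1)] True nv
        by simp
    next
      case False
      define c where "c = i - nv Y"
      have c: "c < nx A" "c < nx Y" "i = nv Y + c"
        using False i nx by (auto simp: c_def)
      show ?thesis
        using emb_extra[OF A Y emb c(1)] retr canonicalD(7,8)[OF Y c(2)] nv c(3) by simp
    qed
  qed
  then have att: "att0 A = att0 Y" "att1 A = att1 Y"
    by auto
  have "e \<in> edges A \<longleftrightarrow> e \<in> edges Y" "v \<in> verts A \<longleftrightarrow> v \<in> verts Y" for e v
    unfolding canonicalD(1)[OF A] canonicalD(1)[OF Y] canonicalD(2)[OF A] canonicalD(2)[OF Y] using nv nx by simp_all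
  then have "edges A = edges Y" "verts A = verts Y"
    by blast+
  then show "A = Y"
    using att by (intro graph.equality) simp_all
qed

lemma groebner_emb_cat: "groebner (emb_cat g)"
proof (rule strict_groebner_imp_groebner[OF strict_groebner_emb_cat])
  have id: "A = Y \<and> arrow A Y m = arrow A A (\<lambda>u. u)"
    if "canonical A" "canonical Y" "emb A Y m" "nv Y \<le> nv A" for A Y m
    using emb_same_size[OF that] arrow_eq_iff by blast
  fix x \<alpha> assume "x \<in> Obj (emb_cat g)"
  {
    fix y assume "\<alpha> \<in> iso_set (emb_cat g) x y"
    then obtain \<beta> where "\<alpha> \<in> hom_set (emb_cat g) x y" "\<beta> \<in> hom_set (emb_cat g) y x"
      by (auto simp: iso_set_def)
    then obtain A Y m k where *: "x = (A, 0)" "y = (Y, 0)" "\<alpha> = arrow A Y m" "canonical A" "canonical Y" "emb A Y m" "emb Y A k"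
      unfolding hom_set_emb_cat by blast
    have "k ` {..<nv Y} \<subseteq> {..<nv A}" "inj_on k {..<nv Y}"
      using tree_emb_mapD(1,5)[OF emb_tree[OF *(5,4,7)]] by (auto simp: inj_on_def)
    then have "nv Y \<le> nv A"
      by (metis card_inj_on_le card_lessThan finite_lessThan)
    then show "x = y \<and> \<alpha> = Idn (emb_cat g) x"
    proof -
      have "A = Y" "arrow A Y m = arrow A A (\<lambda>u. u)"
        using id[OF *(4-6) \<open>nv Y \<le> nv A\<close>] by blast+
      moreover have "Idn (emb_cat g) x = arrow A A (\<lambda>u. u)"
        by (simp add: *(1))
      ultimately show ?thesis
        using *(1-3) by metis
    qed
  }
  assume "\<alpha> \<in> hom_set (emb_cat g) x x"
  then obtain A m where "x = (A, 0)" "\<alpha> = arrow A A m" "canonical A" "emb A A m"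
    unfolding hom_set_emb_cat by blast
  then show "\<alpha> = Idn (emb_cat g) x"
    using id[of A A m] by simp
qed

section \<open>The functor from embeddings to contractions\<close>

definition emb_class :: "graph \<Rightarrow> graph \<Rightarrow> (nat \<Rightarrow> nat) \<Rightarrow> (point \<Rightarrow> point) set" where
  "emb_class A Y m = morphism_class Y A (std_map Y (retr A Y m) (emb_fe A Y m) (\<lambda>_. False))"

definition emb_functor :: "emb_arrow \<Rightarrow> graph \<times> (point \<Rightarrow> point) set \<times> graph" where
  "emb_functor \<alpha> = (let A = fst (fst \<alpha>); Y = fst (fst (snd \<alpha>)) in (Y, emb_class A Y (arrow_map \<alpha>), A))"

lemma emb_functor_arrow: "emb_functor (arrow A Y m) = (Y, emb_class A Y m, A)"
proof -
  have "retr A Y (arrow_map (arrow A Y m)) = retr A Y m" "emb_fe A Y (arrow_map (arrow A Y m)) = emb_fe A Y m"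
    by (intro ext retr_cong emb_fe_cong arrow_map_arrow; assumption)+
  then show ?thesis
    by (simp add: emb_functor_def emb_class_def)
qed

lemma Cmp_contraction_cat: "Cmp (contraction_cat g) (H, K, L) (G, F, H') = (G, compose_classes G L K F, L)"
  by (simp add: contraction_cat_def)

lemma emb_class_id:
  assumes A: "canonical A"
  shows "emb_class A A (\<lambda>u. u) = morphism_class A A id"
  unfolding emb_class_def
proof (rule morphism_class_cong)
  note gA = canonical_is_graph[OF A]
  show "is_graph A"
    by (rule gA)
  show "very_cellular A A (std_map A (retr A A (\<lambda>u. u)) (emb_fe A A (\<lambda>u. u)) (\<lambda>_. False))"
    by (rule very_cellular_std_map[OF gA gA emb_graph_hom[OF A A emb_id[OF A]]])
  fix x assume "x \<in> points A"
  then show "std_map A (retr A A (\<lambda>u. u)) (emb_fe A A (\<lambda>u. u)) (\<lambda>_. False) x = id x"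
    using gA retr_id[OF A] emb_fe_id[OF A] canonicalD(1)[OF A] by (cases rule: points_cases) simp_all
qed

lemma emb_class_comp:
  assumes A: "canonical A" and Y: "canonical Y" and Z: "canonical Z" and m: "emb A Y m" and m': "emb Y Z m'"
  shows "compose_classes Z A (emb_class A Y m) (emb_class Y Z m') = emb_class A Z (m' \<circ> m)"
proof -
  note gr = canonical_is_graph[OF A] canonical_is_graph[OF Y] canonical_is_graph[OF Z]
  note D = emb_graph_hom[OF Y Z m'] emb_graph_hom[OF A Y m]
  let ?s = "std_map Z (retr A Y m \<circ> retr Y Z m') (comp_fe (emb_fe A Y m) (emb_fe Y Z m'))
    (comp_fl (\<lambda>_. False) (emb_fe Y Z m') (\<lambda>_. False))"
  have "compose_classes Z A (emb_class A Y m) (emb_class Y Z m') = morphism_class Z A ?s"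
    unfolding emb_class_def by (rule compose_classes_std_map[OF gr(3,2,1) D])
  also have "\<dots> = emb_class A Z (m' \<circ> m)"
    unfolding emb_class_def
  proof (rule morphism_class_cong[OF gr(3) very_cellular_std_map[OF gr(3,1) graph_hom_comp[OF D]]])
    fix x assume "x \<in> points Z"
    then show "?s x = std_map Z (retr A Z (m' \<circ> m)) (emb_fe A Z (m' \<circ> m)) (\<lambda>_. False) x"
      using gr(3)
    proof (cases rule: points_cases)
      case (Vertex v)
      then show ?thesis
        using retr_comp[OF A Y Z m m'] canonicalD(1)[OF Z] by simp
    next
      case (Interior e t)
      have "att0 Z e < nv Z"
        using att_in_verts(1)[OF gr(3) Interior(1)] canonicalD(1)[OF Z] by simp
      then show ?thesis
        using Interior retr_comp[OF A Y Z m m'] emb_fe_comp[OF A Y Z m m' Interior(1)]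
        by (simp add: comp_fl_def split: option.split)
    qed
  qed
  finally show ?thesis .
qed

lemma emb_class_contraction:
  assumes "canonical A" "canonical Y" "emb A Y m"
  shows "contraction Y A (emb_class A Y m)"
  unfolding emb_class_def
  by (rule contraction_std_map[OF canonical_is_graph[OF assms(2)] canonical_is_graph[OF assms(1)] emb_contraction[OF assms]])

lemma is_functor_emb_functor: "is_functor (emb_cat g) (op_cat (contraction_cat g)) fst emb_functor"
  unfolding is_functor_def
proof (intro conjI ballI)
  fix x assume "x \<in> Obj (emb_cat g)"
  then obtain A where A: "x = (A, 0)" "canonical A" "graph_of_genus g A"
    by auto
  then show "fst x \<in> Obj (op_cat (contraction_cat g))"
    by (simp add: contraction_cat_def)
  show "emb_functor (Idn (emb_cat g) x) = Idn (op_cat (contraction_cat g)) (fst x)"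
    using A emb_class_id[OF A(2)] by (simp add: emb_functor_arrow contraction_cat_def)
next
  fix x y \<alpha> assume "\<alpha> \<in> hom_set (emb_cat g) x y"
  then show "emb_functor \<alpha> \<in> hom_set (op_cat (contraction_cat g)) (fst x) (fst y)"
    unfolding hom_set_op_cat hom_set_contraction_cat hom_set_emb_cat
    using emb_class_contraction by (auto simp: emb_functor_arrow)
next
  fix x y z \<alpha> \<beta>
  assume h: "\<alpha> \<in> hom_set (emb_cat g) x y" "\<beta> \<in> hom_set (emb_cat g) y z"
  obtain A Y m where 1: "x = (A, 0)" "y = (Y, 0)" "\<alpha> = arrow A Y m" "canonical A" "canonical Y" "emb A Y m"
    using h(1) unfolding hom_set_emb_cat by blast
  obtain Z m' where 2: "\<beta> = arrow Y Z m'" "canonical Z" "emb Y Z m'"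
    using h(2) 1(2) unfolding hom_set_emb_cat by blast
  show "emb_functor (Cmp (emb_cat g) \<beta> \<alpha>) = Cmp (op_cat (contraction_cat g)) (emb_functor \<beta>) (emb_functor \<alpha>)"
    using emb_class_comp[OF 1(4,5) 2(2) 1(6) 2(3)]
    by (simp add: 1(3) 2(1) Cmp_arrow[OF 1(4-6)] emb_functor_arrow Cmp_contraction_cat)
qed

lemma essentially_surjective_emb_functor: "essentially_surjective (emb_cat g) (op_cat (contraction_cat g)) fst"
  unfolding essentially_surjective_def
proof
  fix G assume "G \<in> Obj (op_cat (contraction_cat g))"
  then have gen: "graph_of_genus g G"
    by (simp add: contraction_cat_def)
  then have G: "is_graph G" "verts G \<noteq> {}" "connected_space (graph_space G)"
    by (auto simp: graph_of_genus_def)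
  obtain Y fv en fl where Y: "canonical Y" and D: "graph_hom G Y fv (Some \<circ> en) fl"
    and bij: "bij_betw fv (verts G) (verts Y)" "bij_betw en (edges G) (edges Y)"
    using canonical_form_exists[OF G(1) connected_space_imp_connected_on[OF G(1,3)] G(2)] by (elim exE conjE)
  note gY = canonical_is_graph[OF Y]
  define f where "f = std_map G fv (Some \<circ> en) fl"
  define k where "k = std_map Y (inv_into (verts G) fv) (Some \<circ> inv_into (edges G) en) (fl \<circ> inv_into (edges G) en)"
  note inv = iso_inverse[OF G(1) gY D bij]
  have C: "graph_contraction G Y fv (Some \<circ> en) fl"
    by (rule iso_graph_contraction[OF G(1) gY D bij])
  have kf: "k (f x) = x" if "x \<in> points G" for x
    unfolding f_def k_def by (rule inv(2)[OF that])
  have fk: "f (k x) = x" if "x \<in> points Y" for x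
    unfolding f_def k_def by (rule inv(3)[OF that])
  have vf: "very_cellular G Y f"
    unfolding f_def by (rule very_cellular_std_map[OF G(1) gY D])
  have vk: "very_cellular Y G k"
    unfolding k_def using inv(1) by (intro very_cellular_std_map[OF gY G(1)]) (simp add: graph_contraction_def)
  have "homeomorphic_maps (graph_space G) (graph_space Y) f k"
    using vf vk kf fk by (simp add: homeomorphic_maps_def very_cellular_def topspace_graph_space)
  then have "graph_space G homeomorphic_space graph_space Y"
    unfolding homeomorphic_space_def by blast
  moreover have "verts Y \<noteq> {}"
    using canonicalD(1,3)[OF Y] by blast
  ultimately have genY: "graph_of_genus g Y"
    using graph_of_genus_homeomorphic[OF gen gY] by blast
  have cf: "contraction G Y (morphism_class G Y f)"
    unfolding f_def by (rule contraction_std_map[OF G(1) gY C])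
  have ck: "contraction Y G (morphism_class Y G k)"
    unfolding k_def by (rule contraction_std_map[OF gY G(1) inv(1)])
  have "morphism_class G G (k \<circ> f) = morphism_class G G id"
    using kf by (intro morphism_class_cong[OF G(1) very_cellular_comp[OF vf vk]]) simp
  moreover have "morphism_class Y Y (f \<circ> k) = morphism_class Y Y id"
    using fk by (intro morphism_class_cong[OF gY very_cellular_comp[OF vk vf]]) simp
  ultimately have comp: "compose_classes G G (morphism_class Y G k) (morphism_class G Y f) = morphism_class G G id"
    "compose_classes Y Y (morphism_class G Y f) (morphism_class Y G k) = morphism_class Y Y id"
    using compose_classes_morphism_class[OF vf vk] compose_classes_morphism_class[OF vk vf] by simp_all
  have "(Y, morphism_class Y G k, G) \<in> iso_set (op_cat (contraction_cat g)) G Y"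
    unfolding iso_set_def mem_Collect_eq hom_set_op_cat
  proof (intro conjI bexI[of _ "(G, morphism_class G Y f, Y)"])
    show "(Y, morphism_class Y G k, G) \<in> hom_set (contraction_cat g) Y G"
      "(G, morphism_class G Y f, Y) \<in> hom_set (contraction_cat g) G Y"
      using gen genY cf ck by (auto simp: hom_set_contraction_cat)
  qed (use comp in \<open>simp_all add: Cmp_contraction_cat, simp_all add: contraction_cat_def\<close>)
  then show "\<exists>y \<in> Obj (emb_cat g). iso_set (op_cat (contraction_cat g)) G (fst y) \<noteq> {}"
    using Y genY by (intro bexI[of _ "(Y, 0)"]) auto
qed

text \<open>The finitely many morphisms of (F) form a basis of all contractions from canonical
  graphs onto \<open>G\<close>, ordered by factorization through an embedding.\<close>

lemma property_F_emb_functor: "property_F (emb_cat g) (op_cat (contraction_cat g)) fst emb_functor"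
  unfolding property_F_def
proof
  fix G assume "G \<in> Obj (op_cat (contraction_cat g))"
  then have gen: "graph_of_genus g G"
    by (simp add: contraction_cat_def)
  then have G: "is_graph G"
    by (simp add: graph_of_genus_def)
  \<comment> \<open>The elements are combinatorial representatives, not classes, as the labels for
    Kruskal's theorem are read off from them. Each class has one by
    \<open>contraction_iff\<close>.\<close>
  define T where "T = {(Y, fv, fe, fl). canonical Y \<and> graph_of_genus g Y \<and> graph_contraction Y G fv fe fl}"
  define qle where "qle s t = (case s of (Y1, fv1, fe1, fl1) \<Rightarrow> case t of (Y2, fv2, fe2, fl2) \<Rightarrow>
    \<exists>m. emb Y1 Y2 m \<and> (\<forall>x \<in> points Y2. std_map Y2 fv2 fe2 fl2 x =
      std_map Y1 fv1 fe1 fl1 (std_map Y2 (retr Y1 Y2 m) (emb_fe Y1 Y2 m) (\<lambda>_. False) x)))" for s t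
  have "wqo_on qle T"
    unfolding wqo_on_def
  proof (intro allI impI)
    fix s :: "nat \<Rightarrow> graph \<times> (nat \<Rightarrow> nat) \<times> (nat \<Rightarrow> nat option) \<times> (nat \<Rightarrow> bool)"
    assume s: "\<forall>i. s i \<in> T"
    define Y fv fe fl where "Y i = fst (s i)" and "fv i = fst (snd (s i))" and "fe i = fst (snd (snd (s i)))"
      and "fl i = snd (snd (snd (s i)))" for i
    have si: "s i = (Y i, fv i, fe i, fl i)" for i
      by (simp add: Y_def fv_def fe_def fl_def)
    have "canonical (Y i)" "graph_contraction (Y i) G (fv i) (fe i) (fl i)" for i
      using s[THEN spec, of i] by (auto simp: si T_def)
    from contraction_wqo[OF G this] show "\<exists>i j. i < j \<and> qle (s i) (s j)"
      unfolding si qle_def prod.case by blast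
  qed
  from wqo_on_finite_basis[OF this]
  obtain B where B: "finite B \<and> B \<subseteq> T \<and> (\<forall>t \<in> T. \<exists>b \<in> B. qle b t)"
    by (rule exE)
  define F where "F b = (case b of (Y, fv, fe, fl) \<Rightarrow> ((Y, 0 :: nat), (Y, morphism_class Y G (std_map Y fv fe fl), G)))" for b
  show "\<exists>S. finite S \<and>
      (\<forall>(y, f) \<in> S. y \<in> Obj (emb_cat g) \<and> f \<in> hom_set (op_cat (contraction_cat g)) G (fst y)) \<and>
      (\<forall>y \<in> Obj (emb_cat g). \<forall>f \<in> hom_set (op_cat (contraction_cat g)) G (fst y).
        \<exists>(z, e) \<in> S. \<exists>h \<in> hom_set (emb_cat g) z y. f = Cmp (op_cat (contraction_cat g)) (emb_functor h) e)"
  proof (intro exI[of _ "F ` B"] conjI ballI)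
    show "finite (F ` B)"
      using B by blast
    show "case p of (y, f) \<Rightarrow> y \<in> Obj (emb_cat g) \<and> f \<in> hom_set (op_cat (contraction_cat g)) G (fst y)"
      if p: "p \<in> F ` B" for p
    proof -
      obtain b where "b \<in> T" "p = F b"
        using p B by blast
      moreover obtain Y fv fe fl where "b = (Y, fv, fe, fl)"
        by (cases b)
      ultimately have Y: "canonical Y" "graph_of_genus g Y" "graph_contraction Y G fv fe fl"
        and pF: "p = ((Y, 0), (Y, morphism_class Y G (std_map Y fv fe fl), G))"
        by (simp_all add: T_def F_def)
      have "contraction Y G (morphism_class Y G (std_map Y fv fe fl))"
        by (rule contraction_std_map[OF canonical_is_graph[OF Y(1)] G Y(3)])
      then show ?thesis
        using Y(1,2) gen by (simp add: pF hom_set_contraction_cat)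
    qed
    fix y f assume y: "y \<in> Obj (emb_cat g)" and f: "f \<in> hom_set (op_cat (contraction_cat g)) G (fst y)"
    obtain Y where Y: "y = (Y, 0)" "canonical Y" "graph_of_genus g Y"
      using y by auto
    note gY = canonical_is_graph[OF Y(2)]
    obtain K where K: "f = (Y, K, G)" "contraction Y G K"
      using f Y(1) by (auto simp: hom_set_contraction_cat)
    obtain fv fe fl where D: "graph_contraction Y G fv fe fl" "K = morphism_class Y G (std_map Y fv fe fl)"
      using K(2)[unfolded contraction_iff[OF gY G]] by (elim exE conjE)
    have "(Y, fv, fe, fl) \<in> T"
      using Y D by (simp add: T_def)
    then obtain b where b: "b \<in> B" "qle b (Y, fv, fe, fl)"
      using B by blast
    obtain Y1 fv1 fe1 fl1 where b_eq: "b = (Y1, fv1, fe1, fl1)"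
      by (cases b)
    have Y1: "canonical Y1" "graph_of_genus g Y1" "graph_contraction Y1 G fv1 fe1 fl1"
      using b(1) B by (auto simp: b_eq T_def)
    obtain m where m: "emb Y1 Y m" "\<forall>x \<in> points Y. std_map Y fv fe fl x =
        std_map Y1 fv1 fe1 fl1 (std_map Y (retr Y1 Y m) (emb_fe Y1 Y m) (\<lambda>_. False) x)"
      using b(2) unfolding b_eq qle_def prod.case by blast
    have v1: "very_cellular Y Y1 (std_map Y (retr Y1 Y m) (emb_fe Y1 Y m) (\<lambda>_. False))"
      by (rule very_cellular_std_map[OF gY canonical_is_graph[OF Y1(1)] emb_graph_hom[OF Y1(1) Y(2) m(1)]])
    have v2: "very_cellular Y1 G (std_map Y1 fv1 fe1 fl1)"
      using Y1(3) by (intro very_cellular_std_map[OF canonical_is_graph[OF Y1(1)] G]) (simp add: graph_contraction_def)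
    have "compose_classes Y G (morphism_class Y1 G (std_map Y1 fv1 fe1 fl1)) (emb_class Y1 Y m) = K"
      unfolding emb_class_def compose_classes_morphism_class[OF v1 v2] D(2)
      using m(2) by (intro morphism_class_cong[OF gY very_cellular_comp[OF v1 v2]]) simp
    then have "f = Cmp (op_cat (contraction_cat g)) (emb_functor (arrow Y1 Y m)) (Y1, morphism_class Y1 G (std_map Y1 fv1 fe1 fl1), G)"
      by (simp add: K(1) emb_functor_arrow Cmp_contraction_cat)
    moreover have "arrow Y1 Y m \<in> hom_set (emb_cat g) (Y1, 0) y"
      unfolding hom_set_emb_cat using Y Y1 m(1) by blast
    moreover have "((Y1, 0), (Y1, morphism_class Y1 G (std_map Y1 fv1 fe1 fl1), G)) \<in> F ` B"
    proof (rule image_eqI)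
      show "((Y1, 0), (Y1, morphism_class Y1 G (std_map Y1 fv1 fe1 fl1), G)) = F b"
        by (simp add: b_eq F_def)
    qed (rule b(1))
    ultimately show "\<exists>(z, e) \<in> F ` B. \<exists>h \<in> hom_set (emb_cat g) z y. f = Cmp (op_cat (contraction_cat g)) (emb_functor h) e"
      by blast
  qed
qed

theorem theorem1p1:
  fixes g :: nat
  shows "quasi_groebner (op_cat (contraction_cat g)) \<and>
    (\<forall>k :: 'a ring. cring k \<and> noetherian_ring k \<longrightarrow>
      locally_noetherian TYPE('b) k (op_cat (contraction_cat g)))"
proof (intro conjI allI impI)
  have C: "category (op_cat (contraction_cat g))"
    by (rule category_op_cat[OF category_contraction_cat])
  note F = is_functor_emb_functor[of g] essentially_surjective_emb_functor[of g] property_F_emb_functor[of g]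
  show "quasi_groebner (op_cat (contraction_cat g))"
    unfolding quasi_groebner_def using C groebner_emb_cat[of g] F by blast
  fix k :: "'a ring"
  assume "cring k \<and> noetherian_ring k"
  then show "locally_noetherian TYPE('b) k (op_cat (contraction_cat g))"
    by (intro locally_noetherian_transfer[OF strict_groebner_emb_cat F C]) auto
qed

end
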